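(* Let $\mathfrak{g}$ be a Lie $2$-algebra over a field $\mathbb{K}$ of characteristic $0$ with brackets $\pi^{(1,2)},\pi^{(1,3)}$. Via the identification $\pi\leftrightarrow\{\pi^{(m,l)}\}_{m\geq2,l\geq0}$ described in the context (with $n=2$), a $2$-shifted Poisson structure on the Chevalley–Eilenberg algebra $\mathrm{CE}(\mathfrak{g})$ is given by the datum of six maps $$\pi^{(2,0)}\in\underline{\mathrm{hom}}^-_+(\mathbb{K},\mathfrak{g}^{\otimes2})^{0},\quad \pi^{(2,1)}\in\underline{\mathrm{hom}}^-_+(\mathfrak{g},\mathfrak{g}^{\otimes2})^{-1},\quad \pi^{(2,2)}\in\underline{\mathrm{hom}}^-_+(\mathfrak{g}^{\otimes2},\mathfrak{g}^{\otimes2})^{-2},$$ $$\pi^{(3,0)}\in\underline{\mathrm{hom}}^-_+(\mathbb{K},\mathfrak{g}^{\otimes3})^{-2},\quad \pi^{(3,1)}\in\underline{\mathrm{hom}}^-_+(\mathfrak{g},\mathfrak{g}^{\otimes3})^{-3},\quad \pi^{(4,0)}\in\underline{\mathrm{hom}}^-_+(\mathbb{K},\mathfrak{g}^{\otimes4})^{-4}$$ (all other components $\pi^{(m,l)}$ with $m\geq2$, $l\geq0$ being zero), which satisfy the following nine identities: $$-\partial\pi^{(2,1)}=\pi^{(1,2)}\star\pi^{(2,0)},$$ $$-\partial\pi^{(2,2)}=\pi^{(2,1)}\star\pi^{(1,2)}-\pi^{(1,2)}\star\pi^{(2,1)}+\pi^{(1,3)}\star\pi^{(2,0)},$$ $$0=\pi^{(2,1)}\star\pi^{(1,3)}+\pi^{(1,2)}\star\pi^{(2,2)}+\pi^{(2,2)}\star\pi^{(1,2)}+\pi^{(1,3)}\star\pi^{(2,1)},$$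 $$-\partial\pi^{(3,0)}=\pi^{(2,1)}\star\pi^{(2,0)},$$ $$-\partial\pi^{(3,1)}=\pi^{(2,1)}\star\pi^{(2,1)}+\pi^{(1,2)}\star\pi^{(3,0)}+\pi^{(2,2)}\star\pi^{(2,0)},$$ $$0=\pi^{(3,1)}\star\pi^{(1,2)}+\pi^{(2,1)}\star\pi^{(2,2)}-\pi^{(1,2)}\star\pi^{(3,1)}-\pi^{(2,2)}\star\pi^{(2,1)}+\pi^{(1,3)}\star\pi^{(3,0)},$$ $$-\partial\pi^{(4,0)}=\pi^{(3,1)}\star\pi^{(2,0)}+\pi^{(2,1)}\star\pi^{(3,0)},$$ $$0=\pi^{(3,1)}\star\pi^{(2,1)}+\pi^{(2,1)}\star\pi^{(3,1)}+\pi^{(1,2)}\star\pi^{(4,0)}+\pi^{(2,2)}\star\pi^{(3,0)},$$ $$0=\pi^{(3,1)}\star\pi^{(3,0)}+\pi^{(2,1)}\star\pi^{(4,0)}.$$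
   Context: **Conventions.** $\mathbb{K}$ is a field of characteristic $0$. Cochain complexes $V=(V^i,\mathrm{d})_{i\in\mathbb{Z}}$ have differentials of degree $+1$; the tensor product carries $\mathrm{d}(v\otimes w)=\mathrm{d}v\otimes w+(-1)^{|v|}v\otimes\mathrm{d}w$ and the symmetric braiding $\gamma(v\otimes w)=(-1)^{|v||w|}w\otimes v$. $\underline{\mathrm{hom}}(V,W)^i=\prod_j\mathrm{Hom}(V^j,W^{j+i})$ with $\partial L=\mathrm{d}_WL-(-1)^{|L|}L\,\mathrm{d}_V$. The shift is $V[n]^i=V^{i+n}$, $\mathrm{d}_{V[n]}=(-1)^n\mathrm{d}_V$; elements of $V[n]$ are written $s^{-n}v$, where $s^{-n}$ has degree $-n$, and Koszul signs arise when moving $s$ past elements; in particular $Q\,(s^{-n-1}T)=(-1)^{|Q|(n+1)}s^{-n-1}(QT)$. Here $n$ is an integer (the shift). **Polyvectors and shifted Poisson structures.** For a commutative differential graded algebra (CDGA) $A$, $\mathbb{T}_A\subseteq\underline{\mathrm{hom}}(A,A)$ is the complex of derivations, $D(aa')=(Da)a'+(-1)^{|D||a|}a(Da')$, an $A$-dg-module via $(aD)(a')=a\,D(a')$, with Lie bracket $[D,D']=DD'-(-1)^{|D||D'|}D'D$. The CDGA of $n$-shifted polyvectors is $\mathrm{Pol}(A,n)=\mathrm{Sym}_A(\mathbb{T}_A[-n-1])=\bigoplus_{m\geq0}\mathrm{Sym}_A^m(\mathbb{T}_A[-n-1])$, where $m$ is called the weight; its completion is $\widehat{\mathrm{Pol}}(A,n)=\prod_{m\geq0}\mathrm{Sym}^m_A(\mathbb{T}_A[-n-1])$.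 The Schouten–Nijenhuis bracket $[\![\cdot,\cdot]\!]$ is the degree $0$ Lie bracket on $\mathrm{Pol}(A,n)[n+1]$ determined by $[\![s^{-n-1}a,s^{-n-1}a']\!]=0$, $[\![s^{-n-1}s^{n+1}D,s^{-n-1}a]\!]=(-1)^{|D|(n+1)}s^{-n-1}D(a)$, $[\![s^{-n-1}s^{n+1}D,s^{-n-1}s^{n+1}D']\!]=s^{-n-1}s^{n+1}[D,D']$, by (graded) antisymmetry, and by $[\![s^{-n-1}P,s^{-n-1}QR]\!]=[\![s^{-n-1}P,s^{-n-1}Q]\!]R+(-1)^{|P||Q|}Q[\![s^{-n-1}P,s^{-n-1}R]\!]$. It lowers total weight by $1$ and extends weight-wise to $\widehat{\mathrm{Pol}}(A,n)[n+1]$. An $n$-shifted Poisson structure on $A$ is an element $\pi=\sum_{m\geq2}\pi^{(m)}\in\widehat{\mathrm{Pol}}(A,n)^{n+2}$ of degree $n+2$ and weight $\geq2$ with $\partial(s^{-n-1}\pi)+\frac12[\![s^{-n-1}\pi,s^{-n-1}\pi]\!]=0$. **Polyvectors as maps.** Let $\mathfrak{g}$ be a bounded, degree-wise finite-dimensional cochain complex, $\mathfrak{g}^\ast=\underline{\mathrm{hom}}(\mathfrak{g},\mathbb{K})$, $A=\mathrm{Sym}(\mathfrak{g}^\ast[-1])$. Then $\mathbb{T}_A\cong A\otimes\mathfrak{g}[1]$, where $s^{-1}x$ is the derivation with $s^{-1}x(s\theta)=\langle\theta,x\rangle$; with $s^nx:=s^{n+1}s^{-1}x$ one gets $\mathrm{Pol}(A,n)\cong\mathrm{Sym}(\mathfrak{g}[-n])\otimes\mathrm{Sym}(\mathfrak{g}^\ast[-1])$.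 For $\sigma\in S_k$ let $\gamma_\sigma(y_1\otimes\cdots\otimes y_k)=\pm\,y_{\sigma(1)}\otimes\cdots\otimes y_{\sigma(k)}$ with Koszul sign and let $|\sigma|$ be the signature. $\underline{\mathrm{hom}}^-_\pm(\mathfrak{g}^{\otimes l},\mathfrak{g}^{\otimes m})$ is the complex of those $L\in\underline{\mathrm{hom}}(\mathfrak{g}^{\otimes l},\mathfrak{g}^{\otimes m})$ with $L\gamma_\sigma=(-1)^{|\sigma|}L$ for $\sigma\in S_l$ and $\gamma_\rho L=(-1)^{|\rho|n}L$ for $\rho\in S_m$ (subscript $+$ for $n$ even, $-$ for $n$ odd). There is a cochain isomorphism $\Phi:\mathrm{Pol}(A,n)\to\bigoplus_{m,l}\underline{\mathrm{hom}}^-_\pm(\mathfrak{g}^{\otimes l},\mathfrak{g}^{\otimes m})[-mn-l]$, extended weight-wise to completions ($\prod_m\bigoplus_l$), $$\Phi(s^nx_1\cdots s^nx_m\,s\theta_1\cdots s\theta_l)=(-1)^{\sum_k|x_k|((m-k)n+l)}(-1)^{\sum_j|\theta_j|(l-j)}\,s^{mn+l}L_B,$$ $$L_B(y_1,\dots,y_l)=\sum_{\sigma\in S_l}\sum_{\rho\in S_m}(-1)^{|x_1\cdots x_m|^\rho_\pm}(-1)^{|\theta_1\cdots\theta_l|^\sigma_-}(-1)^{|y_1\cdots y_l|^{\mathrm{rev}}_+}\,x_{\rho(1)}\otimes\cdots\otimes x_{\rho(m)}\prod_{j=1}^l\langle\theta_{\sigma(j)},y_j\rangle.$$ Here $(-1)^{|v_1\cdots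 v_k|^\rho_{\pm}}$ is the sign with $v_1\cdots v_k=(\text{sign})\,v_{\rho(1)}\cdots v_{\rho(k)}$ in the graded symmetric ($+$) or exterior ($-$) power (for the $x$'s: $+$ if $n$ even, $-$ if $n$ odd), and $\mathrm{rev}$ is the order-reversing permutation. **The operation $\star$.** $\mathrm{Sh}(p,q)$ is the set of $\sigma\in S_{p+q}$ increasing on $\{1,\dots,p\}$ and on $\{p+1,\dots,p+q\}$. For $\rho\in S_k$ let $\hat\gamma_\rho=\gamma_{\rho^{-1}}$, which moves the $i$-th tensor factor to position $\rho(i)$. For $L\in\underline{\mathrm{hom}}^-_\pm(\mathfrak{g}^{\otimes l},\mathfrak{g}^{\otimes m})$ and $L'\in\underline{\mathrm{hom}}^-_\pm(\mathfrak{g}^{\otimes l'},\mathfrak{g}^{\otimes m'})$ with $l,m'\geq 1$ set $$L\star L'=\sum_{\sigma\in\mathrm{Sh}(l-1,l')}\sum_{\rho\in\mathrm{Sh}(m,m'-1)}(-1)^{|\sigma|}(-1)^{|\rho|n}~\hat\gamma_\rho\circ\big(L\otimes\mathrm{id}^{\otimes(m'-1)}\big)\circ\big(\mathrm{id}^{\otimes(l-1)}\otimes L'\big)\circ\gamma_\sigma,$$ where the first output of $L'$ is fed into the last input of $L$ and Koszul signs are used for $\mathrm{id}^{\otimes(l-1)}\otimes L'$. **Lie $2$-algebras and $\mathrm{CE}(\mathfrak{g})$.** A Lie $2$-algebra is a $2$-term complex $\mathfrak{g}=(\mathfrak{g}^{-1}\xrightarrow{\mathrm{d}}\mathfrak{g}^0)$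 of finite-dimensional vector spaces (degrees $-1,0$) with totally graded antisymmetric maps $\pi^{(1,2)}:\mathfrak{g}^{\otimes2}\to\mathfrak{g}$ of degree $0$ and $\pi^{(1,3)}:\mathfrak{g}^{\otimes3}\to\mathfrak{g}$ of degree $-1$ satisfying $\partial\pi^{(1,2)}=0$, $-\partial\pi^{(1,3)}=\pi^{(1,2)}\star\pi^{(1,2)}$ and $0=-\pi^{(1,3)}\star\pi^{(1,2)}+\pi^{(1,2)}\star\pi^{(1,3)}$. (In terms of $L_\infty$-brackets, $\pi^{(1,l)}=(-1)^{l-1}\ell_l$.) $\mathrm{CE}(\mathfrak{g})$ is the CDGA with the underlying graded algebra of $A=\mathrm{Sym}(\mathfrak{g}^\ast[-1])$ and differential $\mathrm{d}+\alpha$, where $\alpha\in\mathbb{T}_A^1$ is the derivation (satisfying $\partial\alpha+\frac12[\alpha,\alpha]=0$, and independent of $n$) with $\Phi(s^{n+1}\alpha)=s^{n+2}\pi^{(1,2)}+s^{n+3}\pi^{(1,3)}$. As graded objects $\widehat{\mathrm{Pol}}(\mathrm{CE}(\mathfrak{g}),n)=\widehat{\mathrm{Pol}}(A,n)$, and an $n$-shifted Poisson structure $\pi$ on $\mathrm{CE}(\mathfrak{g})$ is identified with the family of maps $\pi^{(m,l)}\in\underline{\mathrm{hom}}^-_\pm(\mathfrak{g}^{\otimes l},\mathfrak{g}^{\otimes m})^{(1-m)n+2-l}$, $m\geq2$, $l\geq0$, defined by $\Phi(\pi)=\sum_{m,l}s^{mn+l}\pi^{(m,l)}$. *)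

theory Defs
  imports
    Complex_Main
    "HOL-Algebra.QuotRing"
    "HOL-Combinatorics.Permutations"
    "HOL-Library.Poly_Mapping"
    "HOL-Library.Function_Algebras"
begin

definition ksgn :: "int \<Rightarrow> 'k::field_char_0"
  where "ksgn i = (if even i then 1 else - 1)"

text \<open>
  For homogeneous v with degrees ds: the sign in
  v 0 * ... * v (k-1) = sign * v (s 0) * ... * v (s (k-1)) in the graded symmetric power;
  the exterior power has the additional factor \<^term>\<open>sign s\<close>.
\<close>

definition koszul :: "int list \<Rightarrow> (nat \<Rightarrow> nat) \<Rightarrow> 'k::field_char_0"
  where "koszul ds s = ksgn (\<Sum>(i, j) \<in> {(i, j). i < j \<and> j < length ds \<and> s j < s i}. ds ! s i * ds ! s j)"

definition permsgn :: "(nat \<Rightarrow> nat) \<Rightarrow> 'k::field_char_0"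
  where "permsgn s = of_int (sign s)"


section \<open>CDGAs, dg modules and derivations\<close>

text \<open>
  Degree pieces are subsets of one ambient type. In a dg module the operations that occur with
  Koszul signs are indexed by degrees: \<open>msmult M i\<close> is the action of scalars of degree i,
  \<open>mdiff M i\<close> is the differential on degree i.
\<close>

record ('k, 'a) cdga = "'a ring" +
  csmult :: "'k \<Rightarrow> 'a \<Rightarrow> 'a"
  cpart :: "int \<Rightarrow> 'a set"
  cdiff :: "'a \<Rightarrow> 'a"

record ('a, 'm) dgmod =
  mpart :: "int \<Rightarrow> 'm set"
  madd :: "'m \<Rightarrow> 'm \<Rightarrow> 'm"
  msmult :: "int \<Rightarrow> 'a \<Rightarrow> 'm \<Rightarrow> 'm"
  mdiff :: "int \<Rightarrow> 'm \<Rightarrow> 'm"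

definition base_cdga :: "('k::field_char_0, 'k) cdga"
  where "base_cdga = \<lparr>carrier = UNIV, monoid.mult = (*), one = 1, zero = 0, add = (+),
    csmult = (*), cpart = (\<lambda>i. if i = 0 then UNIV else {0}), cdiff = (\<lambda>_. 0)\<rparr>"

text \<open>
  An element \<open>s\<^sup>-\<^sup>n v\<close> of the shift \<open>M[n]\<close> is represented by v itself. Moving a scalar of degree i
  past \<open>s\<^sup>-\<^sup>n\<close> costs the sign \<open>(-1)\<^sup>i\<^sup>n\<close>.
\<close>

definition mshift :: "('k::field_char_0, 'a) cdga \<Rightarrow> int \<Rightarrow> ('a, 'm) dgmod \<Rightarrow> ('a, 'm) dgmod"
  where "mshift A n M = \<lparr>
    mpart = (\<lambda>i. mpart M (i + n)),
    madd = madd M,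
    msmult = (\<lambda>i a x. msmult M i (csmult A (ksgn (i * n)) a) x),
    mdiff = (\<lambda>i x. msmult M 0 (csmult A (ksgn n) \<one>\<^bsub>A\<^esub>) (mdiff M (i + n) x))\<rparr>"

definition der :: "('k::field_char_0, 'a) cdga \<Rightarrow> int \<Rightarrow> ('a \<Rightarrow> 'a) set"
  where "der A i = {D \<in> carrier A \<rightarrow>\<^sub>E carrier A.
    (\<forall>a \<in> carrier A. \<forall>b \<in> carrier A. D (a \<oplus>\<^bsub>A\<^esub> b) = D a \<oplus>\<^bsub>A\<^esub> D b) \<and>
    (\<forall>c. \<forall>a \<in> carrier A. D (csmult A c a) = csmult A c (D a)) \<and>
    (\<forall>j. \<forall>a \<in> cpart A j. D a \<in> cpart A (j + i)) \<and>
    (\<forall>j. \<forall>a \<in> cpart A j. \<forall>b \<in> carrier A.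
      D (a \<otimes>\<^bsub>A\<^esub> b) = D a \<otimes>\<^bsub>A\<^esub> b \<oplus>\<^bsub>A\<^esub> csmult A (ksgn (i * j)) (a \<otimes>\<^bsub>A\<^esub> D b))}"

definition der_bracket ::
    "('k::field_char_0, 'a) cdga \<Rightarrow> int \<Rightarrow> int \<Rightarrow> ('a \<Rightarrow> 'a) \<Rightarrow> ('a \<Rightarrow> 'a) \<Rightarrow> 'a \<Rightarrow> 'a"
  where "der_bracket A i j D E =
    (\<lambda>a \<in> carrier A. D (E a) \<ominus>\<^bsub>A\<^esub> csmult A (ksgn (i * j)) (E (D a)))"

definition tangent :: "('k::field_char_0, 'a) cdga \<Rightarrow> ('a, 'a \<Rightarrow> 'a) dgmod"
  where "tangent A = \<lparr>
    mpart = der A,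
    madd = (\<lambda>D E. \<lambda>a \<in> carrier A. D a \<oplus>\<^bsub>A\<^esub> E a),
    msmult = (\<lambda>_ a D. \<lambda>b \<in> carrier A. a \<otimes>\<^bsub>A\<^esub> D b),
    mdiff = (\<lambda>i D. \<lambda>a \<in> carrier A. cdiff A (D a) \<ominus>\<^bsub>A\<^esub> csmult A (ksgn i) (D (cdiff A a)))\<rparr>"


section \<open>The symmetric algebra of a dg module\<close>

text \<open>
  \<open>Sym\<^sub>A(M)\<close> is presented as the free associative K-algebra on the homogeneous elements of A and M,
  modulo the ideal which makes A a subalgebra, makes M an A-module, and imposes graded
  commutativity. Letters carry their degree, so that 0 is a letter once in every degree.
  The free algebra on a set of letters is the monoid algebra of the words in these letters.
\<close>

datatype 'x fword = FWord (letters: "'x list")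

instantiation fword :: (type) monoid_add
begin

definition "0 = FWord []"
definition "v + w = FWord (letters v @ letters w)"

instance
  by standard (simp_all add: zero_fword_def plus_fword_def)

end

datatype ('a, 'm) letter = Coef int 'a | Gen int 'm

primrec ldeg :: "('a, 'm) letter \<Rightarrow> int"
  where
    "ldeg (Coef i a) = i"
  | "ldeg (Gen i x) = i"

primrec lweight :: "('a, 'm) letter \<Rightarrow> nat"
  where
    "lweight (Coef i a) = 0"
  | "lweight (Gen i x) = 1"

definition wdeg :: "('a, 'm) letter fword \<Rightarrow> int"
  where "wdeg w = sum_list (map ldeg (letters w))"

definition wweight :: "('a, 'm) letter fword \<Rightarrow> nat"
  where "wweight w = sum_list (map lweight (letters w))"

type_synonym ('k, 'a, 'm) free = "('a, 'm) letter fword \<Rightarrow>\<^sub>0 'k"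

definition mon :: "('a, 'm) letter list \<Rightarrow> ('k::field_char_0, 'a, 'm) free"
  where "mon xs = Poly_Mapping.single (FWord xs) 1"

definition const :: "'k::field_char_0 \<Rightarrow> ('k, 'a, 'm) free"
  where "const c = Poly_Mapping.single 0 c"

definition sym_letters :: "('k::field_char_0, 'a) cdga \<Rightarrow> ('a, 'm) dgmod \<Rightarrow> ('a, 'm) letter set"
  where "sym_letters A M = {Coef i a |i a. a \<in> cpart A i} \<union> {Gen i x |i x. x \<in> mpart M i}"

definition sym_free :: "('k::field_char_0, 'a) cdga \<Rightarrow> ('a, 'm) dgmod \<Rightarrow> ('k, 'a, 'm) free ring"
  where "sym_free A M = \<lparr>
    carrier = {f. \<forall>w \<in> Poly_Mapping.keys f. set (letters w) \<subseteq> sym_letters A M},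
    monoid.mult = (*), one = 1, zero = 0, add = (+)\<rparr>"

definition sym_rels :: "('k::field_char_0, 'a) cdga \<Rightarrow> ('a, 'm) dgmod \<Rightarrow> ('k, 'a, 'm) free set"
  where "sym_rels A M =
      {mon [Coef i (a \<oplus>\<^bsub>A\<^esub> b)] - mon [Coef i a] - mon [Coef i b] |i a b. a \<in> cpart A i \<and> b \<in> cpart A i}
    \<union> {mon [Coef i (csmult A c a)] - const c * mon [Coef i a] |i c a. a \<in> cpart A i}
    \<union> {mon [Coef i a, Coef j b] - mon [Coef (i + j) (a \<otimes>\<^bsub>A\<^esub> b)] |i j a b. a \<in> cpart A i \<and> b \<in> cpart A j}
    \<union> {mon [Coef 0 \<one>\<^bsub>A\<^esub>] - mon []}
    \<union> {mon [Gen i (madd M x y)] - mon [Gen i x] - mon [Gen i y] |i x y. x \<in> mpart M i \<and> y \<in> mpart M i}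
    \<union> {mon [Coef i a, Gen j x] - mon [Gen (i + j) (msmult M i a x)] |i j a x. a \<in> cpart A i \<and> x \<in> mpart M j}
    \<union> {mon [u, v] - const (ksgn (ldeg u * ldeg v)) * mon [v, u] |u v.
        u \<in> sym_letters A M \<and> v \<in> sym_letters A M}"

definition sym_ideal :: "('k::field_char_0, 'a) cdga \<Rightarrow> ('a, 'm) dgmod \<Rightarrow> ('k, 'a, 'm) free set"
  where "sym_ideal A M = genideal (sym_free A M) (sym_rels A M)"

definition sym_cls ::
    "('k::field_char_0, 'a) cdga \<Rightarrow> ('a, 'm) dgmod \<Rightarrow> ('k, 'a, 'm) free \<Rightarrow> ('k, 'a, 'm) free set"
  where "sym_cls A M f = sym_ideal A M +>\<^bsub>sym_free A M\<^esub> f"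

text \<open>The derivation of the free algebra which extends the differentials of A and M.\<close>

primrec letter_diff :: "('k::field_char_0, 'a) cdga \<Rightarrow> ('a, 'm) dgmod \<Rightarrow> ('a, 'm) letter \<Rightarrow> ('a, 'm) letter"
  where
    "letter_diff A M (Coef i a) = Coef (i + 1) (cdiff A a)"
  | "letter_diff A M (Gen i x) = Gen (i + 1) (mdiff M i x)"

definition word_diff ::
    "('k::field_char_0, 'a) cdga \<Rightarrow> ('a, 'm) dgmod \<Rightarrow> ('a, 'm) letter list \<Rightarrow> ('k, 'a, 'm) free"
  where "word_diff A M xs = (\<Sum>p<length xs.
    const (ksgn (sum_list (map ldeg (take p xs)))) * mon (xs[p := letter_diff A M (xs ! p)]))"

definition free_diff ::
    "('k::field_char_0, 'a) cdga \<Rightarrow> ('a, 'm) dgmod \<Rightarrow> ('k, 'a, 'm) free \<Rightarrow> ('k, 'a, 'm) free"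
  where "free_diff A M f =
    (\<Sum>w \<in> Poly_Mapping.keys f. const (Poly_Mapping.lookup f w) * word_diff A M (letters w))"

text \<open>
  The differential is induced on cosets in the same style as the multiplication in
  \<^const>\<open>FactRing\<close>: the union is taken over equal cosets.
\<close>

definition sym_alg ::
    "('k::field_char_0, 'a) cdga \<Rightarrow> ('a, 'm) dgmod \<Rightarrow> ('k, ('k, 'a, 'm) free set) cdga"
  where "sym_alg A M = (let Q = sym_free A M Quot sym_ideal A M in \<lparr>
    carrier = carrier Q, monoid.mult = monoid.mult Q, one = one Q, zero = zero Q, add = add Q,
    csmult = (\<lambda>c X. sym_cls A M (const c) \<otimes>\<^bsub>Q\<^esub> X),
    cpart = (\<lambda>i. sym_cls A M ` {f \<in> carrier (sym_free A M). \<forall>w \<in> Poly_Mapping.keys f. wdeg w = i}),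
    cdiff = (\<lambda>X. \<Union>f \<in> X. sym_cls A M (free_diff A M f))\<rparr>)"

definition sym_wpart ::
    "('k::field_char_0, 'a) cdga \<Rightarrow> ('a, 'm) dgmod \<Rightarrow> nat \<Rightarrow> int \<Rightarrow> ('k, 'a, 'm) free set set"
  where "sym_wpart A M m i = sym_cls A M `
    {f \<in> carrier (sym_free A M). \<forall>w \<in> Poly_Mapping.keys f. wweight w = m \<and> wdeg w = i}"

definition sym_coef ::
    "('k::field_char_0, 'a) cdga \<Rightarrow> ('a, 'm) dgmod \<Rightarrow> int \<Rightarrow> 'a \<Rightarrow> ('k, 'a, 'm) free set"
  where "sym_coef A M i a = sym_cls A M (mon [Coef i a])"

definition sym_gen ::
    "('k::field_char_0, 'a) cdga \<Rightarrow> ('a, 'm) dgmod \<Rightarrow> int \<Rightarrow> 'm \<Rightarrow> ('k, 'a, 'm) free set"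
  where "sym_gen A M i x = sym_cls A M (mon [Gen i x])"


section \<open>Shifted polyvectors and shifted Poisson structures\<close>

definition pol_mod :: "('k::field_char_0, 'a) cdga \<Rightarrow> int \<Rightarrow> ('a, 'a \<Rightarrow> 'a) dgmod"
  where "pol_mod A n = mshift A (- n - 1) (tangent A)"

definition pol :: "('k::field_char_0, 'a) cdga \<Rightarrow> int \<Rightarrow> ('k, ('k, 'a, 'a \<Rightarrow> 'a) free set) cdga"
  where "pol A n = sym_alg A (pol_mod A n)"

text \<open>
  The bracket of \<open>s\<^sup>-\<^sup>n\<^sup>-\<^sup>1P\<close> and \<open>s\<^sup>-\<^sup>n\<^sup>-\<^sup>1Q\<close> is written \<open>s\<^sup>-\<^sup>n\<^sup>-\<^sup>1 b(P, Q)\<close>. Degrees i, j below are degrees in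
  \<open>Pol(A, n)\<close>, so that the shifted elements have degrees i - n - 1, j - n - 1; in the Leibniz rule,
  moving Q past \<open>s\<^sup>-\<^sup>n\<^sup>-\<^sup>1\<close> contributes the sign exponent j (n + 1). A derivation D of degree i
  gives the element \<open>s\<^sup>n\<^sup>+\<^sup>1D\<close> of degree i + n + 1. These properties determine b on the carrier;
  the Jacobi identity is a consequence.
\<close>

definition is_schouten ::
    "('k::field_char_0, 'a) cdga \<Rightarrow> int \<Rightarrow>
     (('k, 'a, 'a \<Rightarrow> 'a) free set \<Rightarrow> ('k, 'a, 'a \<Rightarrow> 'a) free set \<Rightarrow> ('k, 'a, 'a \<Rightarrow> 'a) free set) \<Rightarrow> bool"
  where "is_schouten A n b \<longleftrightarrow> (let P = pol A n; cf = sym_coef A (pol_mod A n); gn = sym_gen A (pol_mod A n) in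
    (\<forall>X \<in> carrier P. \<forall>Y \<in> carrier P. b X Y \<in> carrier P) \<and>
    (\<forall>X \<in> carrier P. \<forall>Y \<in> carrier P. \<forall>Z \<in> carrier P. b (X \<oplus>\<^bsub>P\<^esub> Y) Z = b X Z \<oplus>\<^bsub>P\<^esub> b Y Z \<and>
      b Z (X \<oplus>\<^bsub>P\<^esub> Y) = b Z X \<oplus>\<^bsub>P\<^esub> b Z Y) \<and>
    (\<forall>c. \<forall>X \<in> carrier P. \<forall>Y \<in> carrier P. b (csmult P c X) Y = csmult P c (b X Y) \<and>
      b X (csmult P c Y) = csmult P c (b X Y)) \<and>
    (\<forall>i j. \<forall>X \<in> cpart P i. \<forall>Y \<in> cpart P j. b X Y \<in> cpart P (i + j - n - 1)) \<and>
    (\<forall>i j. \<forall>X \<in> cpart P i. \<forall>Y \<in> cpart P j.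
      b X Y = csmult P (- ksgn ((i - n - 1) * (j - n - 1))) (b Y X)) \<and>
    (\<forall>i j. \<forall>X \<in> cpart P i. \<forall>Y \<in> cpart P j. \<forall>Z \<in> carrier P.
      b X (Y \<otimes>\<^bsub>P\<^esub> Z) = b X Y \<otimes>\<^bsub>P\<^esub> Z \<oplus>\<^bsub>P\<^esub> csmult P (ksgn (i * j + j * (n + 1))) (Y \<otimes>\<^bsub>P\<^esub> b X Z)) \<and>
    (\<forall>i j. \<forall>a \<in> cpart A i. \<forall>a' \<in> cpart A j. b (cf i a) (cf j a') = \<zero>\<^bsub>P\<^esub>) \<and>
    (\<forall>i j. \<forall>D \<in> der A i. \<forall>a \<in> cpart A j.
      b (gn (i + n + 1) D) (cf j a) = csmult P (ksgn (i * (n + 1))) (cf (i + j) (D a))) \<and>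
    (\<forall>i j. \<forall>D \<in> der A i. \<forall>E \<in> der A j.
      b (gn (i + n + 1) D) (gn (j + n + 1) E) = gn (i + j + n + 1) (der_bracket A i j D E)))"

definition schouten ::
    "('k::field_char_0, 'a) cdga \<Rightarrow> int \<Rightarrow>
     ('k, 'a, 'a \<Rightarrow> 'a) free set \<Rightarrow> ('k, 'a, 'a \<Rightarrow> 'a) free set \<Rightarrow> ('k, 'a, 'a \<Rightarrow> 'a) free set"
  where "schouten A n = (SOME b. is_schouten A n b)"

text \<open>
  An element of the completion is the family of its weight components. The Maurer-Cartan equation
  is imposed weight by weight; the differential of the shifted complex \<open>Pol(A, n)[n+1]\<close> contributes
  \<open>(-1)\<^sup>n\<^sup>+\<^sup>1\<close>, and the bracket lowers total weight by 1.
\<close>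

definition shifted_poisson :: "('k::field_char_0, 'a) cdga \<Rightarrow> int \<Rightarrow> (nat \<Rightarrow> ('k, 'a, 'a \<Rightarrow> 'a) free set) set"
  where "shifted_poisson A n = (let P = pol A n in {\<pi>.
    (\<forall>m. \<pi> m \<in> sym_wpart A (pol_mod A n) m (n + 2)) \<and>
    (\<forall>m<2. \<pi> m = \<zero>\<^bsub>P\<^esub>) \<and>
    (\<forall>w. csmult P (ksgn (n + 1)) (cdiff P (\<pi> w)) \<oplus>\<^bsub>P\<^esub>
      csmult P (1 / 2) (\<Oplus>\<^bsub>P\<^esub>m \<in> {..Suc w}. schouten A n (\<pi> m) (\<pi> (Suc w - m))) = \<zero>\<^bsub>P\<^esub>)})"


section \<open>Graded vector spaces, tensor powers and multilinear maps\<close>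

text \<open>The total space is the whole type 'v; the degree i piece is \<open>part g i\<close>.\<close>

record ('k, 'v) gvs =
  scl :: "'k \<Rightarrow> 'v \<Rightarrow> 'v"
  part :: "int \<Rightarrow> 'v set"
  dif :: "'v \<Rightarrow> 'v"

definition two_term_complex :: "('k::field_char_0, 'v::ab_group_add) gvs \<Rightarrow> bool"
  where "two_term_complex g \<longleftrightarrow>
    vector_space (scl g) \<and>
    (\<exists>B. finite B \<and> module.span (scl g) B = UNIV) \<and>
    (\<forall>i. module.subspace (scl g) (part g i)) \<and>
    (\<forall>i. i \<noteq> - 1 \<and> i \<noteq> 0 \<longrightarrow> part g i = {0}) \<and>
    part g (- 1) \<inter> part g 0 = {0} \<and>
    (\<forall>v. \<exists>x \<in> part g (- 1). \<exists>y \<in> part g 0. v = x + y) \<and>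
    Vector_Spaces.linear (scl g) (scl g) (dif g) \<and>
    (\<forall>i. \<forall>x \<in> part g i. dif g x \<in> part g (i + 1)) \<and>
    (\<forall>x. dif g (dif g x) = 0)"

text \<open>
  Tensor powers are realised inside the multilinear forms on the dual space, via the injective map
  which sends \<open>x\<^sub>1 \<otimes> ... \<otimes> x\<^sub>k\<close> to the form with value \<open>\<theta>\<^sub>1(x\<^sub>1) ... \<theta>\<^sub>k(x\<^sub>k)\<close> on \<open>\<theta>\<^sub>1, ..., \<theta>\<^sub>k\<close>.
\<close>

type_synonym ('k, 'v) tens = "('v \<Rightarrow> 'k) list \<Rightarrow> 'k"

type_synonym ('k, 'v) tmap = "('k, 'v) tens \<Rightarrow> ('k, 'v) tens"

definition tscale :: "'k::field_char_0 \<Rightarrow> ('k, 'v) tens \<Rightarrow> ('k, 'v) tens"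
  where "tscale c t = (\<lambda>\<theta>s. c * t \<theta>s)"

definition tpure :: "('k::field_char_0, 'v::ab_group_add) gvs \<Rightarrow> 'v list \<Rightarrow> ('k, 'v) tens"
  where "tpure g xs = (\<lambda>\<theta>s.
    if length \<theta>s = length xs \<and> (\<forall>\<theta> \<in> set \<theta>s. Vector_Spaces.linear (scl g) (*) \<theta>)
    then \<Prod>i<length xs. (\<theta>s ! i) (xs ! i) else 0)"

definition tpow :: "('k::field_char_0, 'v::ab_group_add) gvs \<Rightarrow> nat \<Rightarrow> ('k, 'v) tens set"
  where "tpow g k = module.span tscale {tpure g xs |xs. length xs = k}"

definition homog :: "('k::field_char_0, 'v::ab_group_add) gvs \<Rightarrow> int list \<Rightarrow> 'v list \<Rightarrow> bool"
  where "homog g ds xs \<longleftrightarrow> list_all2 (\<lambda>d x. x \<in> part g d) ds xs"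

definition tpart :: "('k::field_char_0, 'v::ab_group_add) gvs \<Rightarrow> nat \<Rightarrow> int \<Rightarrow> ('k, 'v) tens set"
  where "tpart g k i =
    module.span tscale {tpure g xs |xs ds. length xs = k \<and> homog g ds xs \<and> sum_list ds = i}"

text \<open>The tensor product of t in tensor power p with u.\<close>

definition tprod :: "nat \<Rightarrow> ('k::field_char_0, 'v) tens \<Rightarrow> ('k, 'v) tens \<Rightarrow> ('k, 'v) tens"
  where "tprod p t u = (\<lambda>\<theta>s. t (take p \<theta>s) * u (drop p \<theta>s))"

text \<open>Linear maps on a tensor power are extended by 0 to all multilinear forms.\<close>

definition tlinear :: "('k::field_char_0, 'v::ab_group_add) gvs \<Rightarrow> nat \<Rightarrow> ('k, 'v) tmap \<Rightarrow> bool"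
  where "tlinear g k L \<longleftrightarrow>
    (\<forall>t \<in> tpow g k. \<forall>u \<in> tpow g k. L (t + u) = L t + L u) \<and>
    (\<forall>c. \<forall>t \<in> tpow g k. L (tscale c t) = tscale c (L t)) \<and>
    (\<forall>t. t \<notin> tpow g k \<longrightarrow> L t = 0)"

text \<open>
  The universal property of the tensor power: the linear map with the value \<open>F ds xs\<close> on the
  tensor product of homogeneous elements xs of degrees ds, for F multilinear in xs.
\<close>

definition tlift ::
    "('k::field_char_0, 'v::ab_group_add) gvs \<Rightarrow> nat \<Rightarrow> (int list \<Rightarrow> 'v list \<Rightarrow> ('k, 'v) tens) \<Rightarrow> ('k, 'v) tmap"
  where "tlift g k F = (THE L. tlinear g k L \<and>
    (\<forall>ds xs. length xs = k \<and> homog g ds xs \<longrightarrow> L (tpure g xs) = F ds xs))"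

definition tdiff :: "('k::field_char_0, 'v::ab_group_add) gvs \<Rightarrow> nat \<Rightarrow> ('k, 'v) tmap"
  where "tdiff g k = tlift g k (\<lambda>ds xs.
    \<Sum>p<k. tscale (ksgn (sum_list (take p ds))) (tpure g (xs[p := dif g (xs ! p)])))"

text \<open>The action of s, called gamma with index s: position i of the result carries the factor x (s i).\<close>

definition tperm :: "('k::field_char_0, 'v::ab_group_add) gvs \<Rightarrow> nat \<Rightarrow> (nat \<Rightarrow> nat) \<Rightarrow> ('k, 'v) tmap"
  where "tperm g k s = tlift g k (\<lambda>ds xs. tscale (koszul ds s) (tpure g (permute_list s xs)))"

text \<open>
  Bidegrees (m, l) stand for maps from tensor power l to tensor power m, in this order as in the
  superscripts of \<open>\<pi>\<^sup>(\<^sup>m\<^sup>,\<^sup>l\<^sup>)\<close>; e is the degree of the map.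
\<close>

definition hom_part :: "('k::field_char_0, 'v::ab_group_add) gvs \<Rightarrow> nat \<times> nat \<Rightarrow> int \<Rightarrow> ('k, 'v) tmap set"
  where "hom_part g = (\<lambda>(m, l) e.
    {L. tlinear g l L \<and> (\<forall>i. \<forall>t \<in> tpart g l i. L t \<in> tpart g m (i + e))})"

definition hom_diff ::
    "('k::field_char_0, 'v::ab_group_add) gvs \<Rightarrow> nat \<times> nat \<Rightarrow> int \<Rightarrow> ('k, 'v) tmap \<Rightarrow> ('k, 'v) tmap"
  where "hom_diff g = (\<lambda>(m, l) e L t. tdiff g m (L t) - tscale (ksgn e) (L (tdiff g l t)))"

text \<open>The sign \<open>(-1)\<^bsup>|s|n\<^esup>\<close>.\<close>

definition permsgn_shift :: "int \<Rightarrow> (nat \<Rightarrow> nat) \<Rightarrow> 'k::field_char_0"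
  where "permsgn_shift n s = (if even n then 1 else permsgn s)"

definition sym_hom ::
    "('k::field_char_0, 'v::ab_group_add) gvs \<Rightarrow> int \<Rightarrow> nat \<times> nat \<Rightarrow> int \<Rightarrow> ('k, 'v) tmap set"
  where "sym_hom g n = (\<lambda>(m, l) e. {L \<in> hom_part g (m, l) e.
    (\<forall>s t. s permutes {..<l} \<and> t \<in> tpow g l \<longrightarrow> L (tperm g l s t) = tscale (permsgn s) (L t)) \<and>
    (\<forall>r t. r permutes {..<m} \<and> t \<in> tpow g l \<longrightarrow> tperm g m r (L t) = tscale (permsgn_shift n r) (L t))})"

text \<open>
  The tensor product of L, defined on tensor power l with values in tensor power m, and L' of
  degree e', defined on tensor power l'.
\<close>

definition tmap_prod ::
    "('k::field_char_0, 'v::ab_group_add) gvs \<Rightarrow> nat \<times> nat \<Rightarrow> ('k, 'v) tmap \<Rightarrow>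
     nat \<Rightarrow> int \<Rightarrow> ('k, 'v) tmap \<Rightarrow> ('k, 'v) tmap"
  where "tmap_prod g = (\<lambda>(m, l) L l' e' L'. tlift g (l + l') (\<lambda>ds xs.
    tscale (ksgn (e' * sum_list (take l ds)))
      (tprod m (L (tpure g (take l xs))) (L' (tpure g (drop l xs))))))"

definition shuffle_perms :: "nat \<Rightarrow> nat \<Rightarrow> (nat \<Rightarrow> nat) set"
  where "shuffle_perms p q =
    {s. s permutes {..<p + q} \<and> strict_mono_on {..<p} s \<and> strict_mono_on {p..<p + q} s}"

text \<open>
  For \<open>l \<ge> 1\<close> and \<open>m' \<ge> 1\<close>; e' is the degree of L'. The sum over r uses the action of the inverse of r,
  which moves factor i to position r i.
\<close>

definition star_deg ::
    "('k::field_char_0, 'v::ab_group_add) gvs \<Rightarrow> int \<Rightarrow> nat \<times> nat \<Rightarrow> ('k, 'v) tmap \<Rightarrow>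
     nat \<times> nat \<Rightarrow> int \<Rightarrow> ('k, 'v) tmap \<Rightarrow> ('k, 'v) tmap"
  where "star_deg g n = (\<lambda>(m, l) L (m', l') e' L' t.
    \<Sum>s \<in> shuffle_perms (l - 1) l'. \<Sum>r \<in> shuffle_perms m (m' - 1).
      tscale (permsgn s * permsgn_shift n r)
        (tperm g (m + m' - 1) (inv_into UNIV r)
          (tmap_prod g (m, l) L (m' - 1) 0 (\<lambda>u. u)
            (tmap_prod g (l - 1, l - 1) (\<lambda>u. u) l' e' L'
              (tperm g (l - 1 + l') s t)))))"

text \<open>
  The map of bidegree (m, l) in an n-shifted Poisson structure has degree (1 - m) n + 2 - l, as do
  the brackets of a Lie 2-algebra for m = 1.
\<close>

definition pdeg :: "int \<Rightarrow> nat \<times> nat \<Rightarrow> int"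
  where "pdeg n = (\<lambda>(m, l). (1 - int m) * n + 2 - int l)"

definition pdiff ::
    "('k::field_char_0, 'v::ab_group_add) gvs \<Rightarrow> int \<Rightarrow> nat \<times> nat \<Rightarrow> ('k, 'v) tmap \<Rightarrow> ('k, 'v) tmap"
  where "pdiff g n ml L = hom_diff g ml (pdeg n ml) L"

definition star ::
    "('k::field_char_0, 'v::ab_group_add) gvs \<Rightarrow> int \<Rightarrow> nat \<times> nat \<Rightarrow> ('k, 'v) tmap \<Rightarrow>
     nat \<times> nat \<Rightarrow> ('k, 'v) tmap \<Rightarrow> ('k, 'v) tmap"
  where "star g n ml L ml' L' = star_deg g n ml L ml' (pdeg n ml') L'"

text \<open>The shift n is irrelevant for maps with one output.\<close>

definition lie_2_algebra ::
    "('k::field_char_0, 'v::ab_group_add) gvs \<Rightarrow> ('k, 'v) tmap \<Rightarrow> ('k, 'v) tmap \<Rightarrow> bool"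
  where "lie_2_algebra g p12 p13 \<longleftrightarrow>
    two_term_complex g \<and>
    p12 \<in> sym_hom g 0 (1, 2) 0 \<and>
    p13 \<in> sym_hom g 0 (1, 3) (- 1) \<and>
    pdiff g 0 (1, 2) p12 = 0 \<and>
    - pdiff g 0 (1, 3) p13 = star g 0 (1, 2) p12 (1, 2) p12 \<and>
    0 = - star g 0 (1, 3) p13 (1, 2) p12 + star g 0 (1, 2) p12 (1, 3) p13"


section \<open>Polyvectors as maps\<close>

text \<open>
  The dual complex: the sign in the differential is that of \<open>\<partial>\<theta> = - (-1)\<^sup>i \<theta> \<circ> d\<close> for \<open>\<theta>\<close> of degree i.
\<close>

definition dual :: "('k::field_char_0, 'v::ab_group_add) gvs \<Rightarrow> ('k, 'v \<Rightarrow> 'k) dgmod"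
  where "dual g = \<lparr>
    mpart = (\<lambda>i. {\<theta>. Vector_Spaces.linear (scl g) (*) \<theta> \<and> (\<forall>j. j \<noteq> - i \<longrightarrow> (\<forall>x \<in> part g j. \<theta> x = 0))}),
    madd = (+),
    msmult = (\<lambda>_ c \<theta> x. c * \<theta> x),
    mdiff = (\<lambda>i \<theta> x. - ksgn i * \<theta> (dif g x))\<rparr>"

type_synonym ('k, 'v) sym_dual = "('k, 'k, 'v \<Rightarrow> 'k) free set"

definition dual_alg :: "('k::field_char_0, 'v::ab_group_add) gvs \<Rightarrow> ('k, ('k, 'v) sym_dual) cdga"
  where "dual_alg g = sym_alg base_cdga (mshift base_cdga (- 1) (dual g))"

text \<open>\<open>s\<theta>\<close> for \<open>\<theta>\<close> of degree j\<close>

definition sdual :: "('k::field_char_0, 'v::ab_group_add) gvs \<Rightarrow> int \<Rightarrow> ('v \<Rightarrow> 'k) \<Rightarrow> ('k, 'v) sym_dual"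
  where "sdual g j \<theta> = sym_gen base_cdga (mshift base_cdga (- 1) (dual g)) (j + 1) \<theta>"

text \<open>The derivation \<open>s\<^sup>-\<^sup>1x\<close> for x of degree i.\<close>

definition svec :: "('k::field_char_0, 'v::ab_group_add) gvs \<Rightarrow> int \<Rightarrow> 'v \<Rightarrow> ('k, 'v) sym_dual \<Rightarrow> ('k, 'v) sym_dual"
  where "svec g i x = (THE D. D \<in> der (dual_alg g) (i - 1) \<and>
    (\<forall>j. \<forall>\<theta> \<in> mpart (dual g) j. D (sdual g j \<theta>) = csmult (dual_alg g) (\<theta> x) \<one>\<^bsub>dual_alg g\<^esub>))"

type_synonym ('k, 'v) gpol = "('k, ('k, 'v) sym_dual, ('k, 'v) sym_dual \<Rightarrow> ('k, 'v) sym_dual) free set"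

text \<open>The element \<open>s\<^sup>nx\<^sub>1 ... s\<^sup>nx\<^sub>m s\<theta>\<^sub>1 ... s\<theta>\<^sub>l\<close>, for xs and \<open>\<theta>s\<close> of degrees ds and es.\<close>

definition pol_monomial ::
    "('k::field_char_0, 'v::ab_group_add) gvs \<Rightarrow> int \<Rightarrow> int list \<Rightarrow> 'v list \<Rightarrow>
     int list \<Rightarrow> ('v \<Rightarrow> 'k) list \<Rightarrow> ('k, 'v) gpol"
  where "pol_monomial g n ds xs es \<theta>s = (let A = dual_alg g; M = pol_mod A n in
    foldr (monoid.mult (pol A n))
      (map2 (\<lambda>i x. sym_gen A M (i + n) (svec g i x)) ds xs @
       map2 (\<lambda>j \<theta>. sym_coef A M (j + 1) (sdual g j \<theta>)) es \<theta>s)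
      \<one>\<^bsub>pol A n\<^esub>)"

definition monomial_map ::
    "('k::field_char_0, 'v::ab_group_add) gvs \<Rightarrow> int \<Rightarrow> int list \<Rightarrow> 'v list \<Rightarrow>
     int list \<Rightarrow> ('v \<Rightarrow> 'k) list \<Rightarrow> ('k, 'v) tmap"
  where "monomial_map g n ds xs es \<theta>s = (let m = length xs; l = length \<theta>s in
    tlift g l (\<lambda>fs ys. \<Sum>s | s permutes {..<l}. \<Sum>r | r permutes {..<m}.
      tscale (koszul ds r * permsgn_shift n r * (koszul es s * permsgn s) * koszul fs (\<lambda>i. l - 1 - i) *
          (\<Prod>j<l. (\<theta>s ! s j) (ys ! j)))
        (tpure g (permute_list r xs))))"

text \<open>Lists are indexed from 0, so k and j are replaced by k + 1 and j + 1 in the exponents.\<close>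

definition monomial_sgn :: "int \<Rightarrow> int list \<Rightarrow> int list \<Rightarrow> 'k::field_char_0"
  where "monomial_sgn n ds es = (let m = length ds; l = length es in
    ksgn (\<Sum>k<m. ds ! k * ((int m - (int k + 1)) * n + int l)) *
    ksgn (\<Sum>j<l. es ! j * (int l - (int j + 1))))"

text \<open>
  The value of \<open>\<Phi>\<close> is the family of the maps L in the components \<open>s\<^bsup>mn+l\<^esup>L\<close>, indexed by m and l.
\<close>

definition is_Phi ::
    "('k::field_char_0, 'v::ab_group_add) gvs \<Rightarrow> int \<Rightarrow> (('k, 'v) gpol \<Rightarrow> nat \<Rightarrow> nat \<Rightarrow> ('k, 'v) tmap) \<Rightarrow> bool"
  where "is_Phi g n F \<longleftrightarrow> (let P = pol (dual_alg g) n in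
    (\<forall>X \<in> carrier P. \<forall>Y \<in> carrier P. F (X \<oplus>\<^bsub>P\<^esub> Y) = F X + F Y) \<and>
    (\<forall>c. \<forall>X \<in> carrier P. F (csmult P c X) = (\<lambda>m l t. tscale c (F X m l t))) \<and>
    (\<forall>ds xs es \<theta>s. homog g ds xs \<and> list_all2 (\<lambda>j \<theta>. \<theta> \<in> mpart (dual g) j) es \<theta>s \<longrightarrow>
      F (pol_monomial g n ds xs es \<theta>s) = (\<lambda>m l t.
        if m = length xs \<and> l = length \<theta>s
        then tscale (monomial_sgn n ds es) (monomial_map g n ds xs es \<theta>s t) else 0)))"

definition Phi ::
    "('k::field_char_0, 'v::ab_group_add) gvs \<Rightarrow> int \<Rightarrow> ('k, 'v) gpol \<Rightarrow> nat \<Rightarrow> nat \<Rightarrow> ('k, 'v) tmap"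
  where "Phi g n = (SOME F. is_Phi g n F)"

text \<open>The derivation \<open>\<alpha>\<close> defined by the brackets does not depend on the auxiliary shift n.\<close>

definition ce_derivation ::
    "('k::field_char_0, 'v::ab_group_add) gvs \<Rightarrow> ('k, 'v) tmap \<Rightarrow> ('k, 'v) tmap \<Rightarrow> int \<Rightarrow>
     ('k, 'v) sym_dual \<Rightarrow> ('k, 'v) sym_dual"
  where "ce_derivation g p12 p13 n = (let A = dual_alg g in
    THE a. a \<in> der A 1 \<and> Phi g n (sym_gen A (pol_mod A n) (n + 2) a) =
      (\<lambda>m l. if m = 1 \<and> l = 2 then p12 else if m = 1 \<and> l = 3 then p13 else 0))"

definition CE ::
    "('k::field_char_0, 'v::ab_group_add) gvs \<Rightarrow> ('k, 'v) tmap \<Rightarrow> ('k, 'v) tmap \<Rightarrow> int \<Rightarrow>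
     ('k, ('k, 'v) sym_dual) cdga"
  where "CE g p12 p13 n = (let A = dual_alg g in
    A\<lparr>cdiff := (\<lambda>X. cdiff A X \<oplus>\<^bsub>A\<^esub> ce_derivation g p12 p13 n X)\<rparr>)"

text \<open>
  Polyvectors on the Chevalley-Eilenberg algebra and on \<^const>\<open>dual_alg\<close> are the same cosets, so
  that \<^const>\<open>Phi\<close> applies to both.
\<close>

lemma sym_free_CE:
  "sym_free (CE g p12 p13 n) (pol_mod (CE g p12 p13 n) k) = sym_free (dual_alg g) (pol_mod (dual_alg g) k)"
  by (simp add: sym_free_def sym_letters_def CE_def Let_def pol_mod_def mshift_def tangent_def der_def)

lemma sym_ideal_CE:
  "sym_ideal (CE g p12 p13 n) (pol_mod (CE g p12 p13 n) k) = sym_ideal (dual_alg g) (pol_mod (dual_alg g) k)"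
  by (simp add: sym_ideal_def sym_free_CE)
    (simp add: sym_rels_def sym_letters_def CE_def Let_def pol_mod_def mshift_def tangent_def der_def)

definition poisson_maps ::
    "('k::field_char_0, 'v::ab_group_add) gvs \<Rightarrow> int \<Rightarrow> (nat \<Rightarrow> ('k, 'v) gpol) \<Rightarrow> nat \<Rightarrow> nat \<Rightarrow> ('k, 'v) tmap"
  where "poisson_maps g n \<pi> = (\<lambda>m l. Phi g n (\<pi> m) m l)"

end

theory Submission
 imports Defs
begin

text \<open>In a basis of \<open>\<gg>\<close>, the algebra of 2-shifted polyvectors is free graded commutative on letters
 \<open>Pe e\<close> for \<open>s\<^sup>2e\<close> and \<open>Qe e\<close> for the shifted dual basis. It is modelled by the graded symmetric functions on
 words in these letters, with the signed shuffle product. The model is faithful: the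
 evaluation on functions has exactly the defining ideal as its kernel (\<open>ker_ev\<close>), since in characteristic
 0 the Euler field recovers an element from its values.

 In this model, all objects become explicit. The Schouten bracket is the canonical Poisson
 bracket in the conjugate letters (\<open>schouten_model\<close>), the differential of the Chevalley-Eilenberg
 algebra is the bracket with an element \<open>\<Delta>\<close> of weight 1, and the Maurer-Cartan equation says that
 \<open>\<Delta> + \<pi>\<close> has vanishing bracket with itself (\<open>shifted_poisson_model\<close>). The map \<open>\<Phi>\<close> sends a function
 to the multilinear maps whose matrix coefficients are, up to a sign, its values on sorted
 words (\<open>Phi_eq\<close>); it is a bijection onto families with the required symmetries
 (\<open>phi_sym_hom\<close>, \<open>phi_mkf\<close>, \<open>phi_inject\<close>).

 The key point is that one half of the bracket is transported by \<open>\<Phi>\<close> to the operation star, with the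
 sign \<open>(-1)\<^sup>l\<^sup>(\<^sup>l\<^sup>'\<^sup>+\<^sup>1\<^sup>)\<close> for maps with l and \<open>l'\<close> inputs (\<open>hM_star\<close>), and that the part of \<open>\<Delta>\<close>
 given by the differential of \<open>\<gg>\<close> yields the differential of multilinear maps (\<open>hM_differential\<close>).

 Finally, all letters have degree 1 or 2 because \<open>\<gg>\<close> lives in degrees -1 and 0. An element of degree 4
 therefore lives on words of length 2 to 4, which leaves the six components of weight at least 2.
 The Maurer-Cartan equation has degree 5, hence lives on words of length 3 to 5; in weight at least 2
 these are nine bidegrees, and the equations in these bidegrees are the nine identities.\<close>

section \<open>Signs\<close>

lemma ksgn_add: "(ksgn (i + j) :: 'k::field_char_0) = ksgn i * ksgn j"
 by (auto simp: ksgn_def)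

lemma ksgn_cong: "even (i + j) ==> ksgn i = ksgn j"
 by (auto simp: ksgn_def)

lemma ksgn_0 [simp]: "ksgn 0 = 1"
 by (simp add: ksgn_def)

lemma ksgn_square [simp]: "ksgn i * ksgn i = (1 :: 'k::field_char_0)"
 by (simp add: ksgn_def)

lemma ksgn_square_left [simp]: "ksgn i * (ksgn i * x) = (x :: 'k::field_char_0)"
 by (simp add: ksgn_def)

lemma ksgn_nonzero [simp]: "ksgn i ~= (0 :: 'k::field_char_0)"
 by (simp add: ksgn_def)

section \<open>The shuffle algebra of functions on words\<close>

text \<open>Letters carry their degree in the first component. Under the signed shuffle product, the graded symmetric functions on words are a model of the free graded commutative algebra in characteristic 0. In contrast to cosets of words, functions have coefficients, so that identities can be verified one word at a time.\<close>
typedef ('x, 'k) sfun = "UNIV :: ((int \<times> 'x) list => 'k) set"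
 morphisms co Sfun by simp

setup_lifting type_definition_sfun

lemma sfun_eqI: "(\<And>w. co f w = co g w) ==> f = g"
 by (simp add: co_inject[symmetric] ext)

abbreviation wd :: "(int \<times> 'x) list => int"
 where "wd w \<equiv> sum_list (map fst w)"

text \<open>The signed shuffle product: every letter of the word is given to one of the two factors. A letter given to the second factor passes the later letters that are given to the first factor, which explains the sign.\<close>
fun shp :: "((int \<times> 'x) list => 'k) => ((int \<times> 'x) list => 'k) => (int \<times> 'x) list => 'k::field_char_0"
 where
  "shp f g [] = f [] * g []"
 | "shp f g (z # w) = shp (%u. f (z # u)) g w + shp (%u. ksgn (fst z * wd u) * f u) (%u. g (z # u)) w"

lemma shp_add_left: "shp (%u. f u + f' u) g w = shp f g w + shp f' g w"
 by (induction w arbitrary: f f' g) (simp_all add: distrib_left distrib_right)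

lemma shp_add_right: "shp f (%u. g u + g' u) w = shp f g w + shp f g' w"
 by (induction w arbitrary: f g g') (simp_all add: distrib_left)

lemma shp_scale_left: "shp (%u. c * f u) g w = c * shp f g w"
proof (induction w arbitrary: f g)
 case (Cons z w)
 have "shp (%u. ksgn (fst z * wd u) * (c * f u)) h w = c * shp (%u. ksgn (fst z * wd u) * f u) h w" for h
  using Cons[of "%u. ksgn (fst z * wd u) * f u" h] by (simp add: mult.left_commute)
 then show ?case by (simp add: Cons distrib_left)
qed (simp add: mult.assoc)

lemma shp_scale_right: "shp f (%u. c * g u) w = c * shp f g w"
 by (induction w arbitrary: f g) (simp_all add: distrib_left mult.left_commute)

lemma shp_zero_left: "shp (%u. 0) g w = 0"
 using shp_scale_left[of 0 "%u. 0" g w] by simp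

lemma shp_zero_right: "shp f (%u. 0) w = 0"
 using shp_scale_right[of f 0 "%u. 0" w] by simp

lemma shp_twist:
 fixes f g :: "(int \<times> 'x) list => 'k::field_char_0"
 shows "ksgn (a * wd u) * shp f g u = shp (%v. ksgn (a * wd v) * f v) (%v. ksgn (a * wd v) * g v) u"
proof (induction u arbitrary: f g)
 case (Cons z w)
 have 1: "(%v. ksgn (a * (fst z + wd v)) * h v) = (%v. ksgn (a * fst z) * (ksgn (a * wd v) * h v))"
  for h :: "(int \<times> 'x) list => 'k"
  by (simp add: distrib_left ksgn_add mult.assoc)
 have 2: "(%v. ksgn (a * wd v) * (ksgn (fst z * wd v) * f v)) =
   (%v. ksgn (fst z * wd v) * (ksgn (a * wd v) * f v))"
  by (simp add: mult.left_commute)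
 show ?case
  by (simp add: 1 shp_scale_left shp_scale_right distrib_left ksgn_add mult.assoc Cons 2)
qed simp

lemma shp_assoc: "shp (shp f g) h w = shp f (shp g h) w"
proof (induction w arbitrary: f g h)
 case (Cons z w)
 have "(%u. ksgn (fst z * wd u) * shp f g u) =
   shp (%u. ksgn (fst z * wd u) * f u) (%u. ksgn (fst z * wd u) * g u)"
  by (rule ext) (rule shp_twist)
 then show ?case
  by (simp add: shp_add_left shp_add_right Cons add.assoc)
qed (simp add: mult.assoc)

lemma shp_one_left: "shp (%u. if u = [] then c else 0) g w = c * g w"
 by (induction w arbitrary: g c) (simp_all add: shp_zero_left if_distrib cong: if_cong)

lemma shp_one_right: "shp f (%u. if u = [] then c else 0) w = c * f w"
 by (induction w arbitrary: f c) (simp_all add: shp_zero_right mult.commute)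

instantiation sfun :: (type, field_char_0) ring_1
begin

lift_definition zero_sfun :: "('a, 'b) sfun" is "%_. 0" .
lift_definition one_sfun :: "('a, 'b) sfun" is "%w. if w = [] then 1 else 0" .
lift_definition plus_sfun :: "('a, 'b) sfun => ('a, 'b) sfun => ('a, 'b) sfun" is "%f g w. f w + g w" .
lift_definition minus_sfun :: "('a, 'b) sfun => ('a, 'b) sfun => ('a, 'b) sfun" is "%f g w. f w - g w" .
lift_definition uminus_sfun :: "('a, 'b) sfun => ('a, 'b) sfun" is "%f w. - f w" .
lift_definition times_sfun :: "('a, 'b) sfun => ('a, 'b) sfun => ('a, 'b) sfun" is shp .

instance
proof
 show "(0 :: ('a, 'b) sfun) ~= 1"
  by transfer (metis zero_neq_one)
qed (transfer; simp add: fun_eq_iff shp_assoc shp_add_left shp_add_right shp_one_left[where c = 1] shp_one_right[where c = 1])+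

end

text \<open>Deletion of the first letter is a graded derivation of the shuffle product, the analogue of a partial derivative. The twist by a degree supplies the Koszul sign in its Leibniz rule.\<close>
lift_definition Dl :: "int \<times> 'x => ('x, 'k) sfun => ('x, 'k) sfun" is "%z f w. f (z # w)" .
lift_definition tw :: "int => ('x, 'k::field_char_0) sfun => ('x, 'k) sfun" is "%a f w. ksgn (a * wd w) * f w" .
lift_definition cst :: "'k::field_char_0 => ('x, 'k) sfun" is "%c w. if w = [] then c else 0" .

text \<open>Functions that are supported on words of length one.\<close>
lift_definition lin :: "(int \<times> 'x => 'k::field_char_0) => ('x, 'k) sfun"
 is "%c w. case w of [z] => c z | _ => 0" .

abbreviation gen :: "int \<times> 'x => ('x, 'k::field_char_0) sfun"
 where "gen z \<equiv> lin (%y. if y = z then 1 else 0)"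

lemma co_zero [simp]: "co 0 w = 0" and co_add [simp]: "co (f + g) w = co f w + co g w"
 and co_minus [simp]: "co (f - g) w = co f w - co g w" and co_uminus [simp]: "co (- f) w = - co f w"
 and co_one: "co 1 w = (if w = [] then 1 else 0)"
 and co_Dl [simp]: "co (Dl z f) w = co f (z # w)"
 and co_tw [simp]: "co (tw a f) w = ksgn (a * wd w) * co f w"
 and co_cst: "co (cst c) w = (if w = [] then c else 0)"
 by (transfer; simp)+

lemma co_lin_Nil [simp]: "co (lin c) [] = 0" and co_lin_single [simp]: "co (lin c) [z] = c z"
 and co_lin_long [simp]: "co (lin c) (y # z # w) = 0"
 by (transfer; simp)+

lemma co_lin: "co (lin c) w = (if length w = 1 then c (hd w) else 0)"
 by transfer (auto split: list.split)

lemma co_sum [simp]: "co (sum f A) w = (\<Sum>x\<in>A. co (f x) w)"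
 by (induction A rule: infinite_finite_induct) simp_all

lemma co_mult_Nil [simp]: "co (f * g) [] = co f [] * co g []"
 by transfer simp

lemma co_cst_mult [simp]: "co (cst c * f) w = c * co f w"
 by transfer (simp add: shp_one_left)

lemma cst_central: "f * cst c = cst c * f"
 by (rule sfun_eqI, transfer) (simp add: shp_one_left shp_one_right)

lemma cst_left: "f * (cst c * g) = cst c * (f * g)"
 by (metis cst_central mult.assoc)

lemma cst_1 [simp]: "cst 1 = 1" and cst_0 [simp]: "cst 0 = 0"
 by (rule sfun_eqI; simp add: co_cst co_one)+

lemma cst_mult: "cst (a * b) = cst a * cst b" and cst_add: "cst (a + b) = cst a + cst b"
 and cst_uminus: "cst (- a) = - cst a"
 by (rule sfun_eqI; simp add: co_cst)+

lemma Dl_mult: "Dl z (f * g) = Dl z f * g + tw (fst z) f * Dl z g"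
 by (rule sfun_eqI, transfer) simp

lemma Dl_simps [simp]: "Dl z 0 = 0" "Dl z 1 = 0" "Dl z (f + g) = Dl z f + Dl z g" "Dl z (- f) = - Dl z f"
 "Dl z (f - g) = Dl z f - Dl z g" "Dl z (cst c * f) = cst c * Dl z f" "Dl z (cst c) = 0"
 "Dl z (lin h) = cst (h z)" "Dl z (sum k A) = (\<Sum>x\<in>A. Dl z (k x))"
 by (rule sfun_eqI; simp add: co_one co_cst co_lin)+

lemma tw_simps [simp]: "tw a 0 = 0" "tw a 1 = 1" "tw a (f + g) = tw a f + tw a g" "tw a (- f) = - tw a f"
 "tw a (f - g) = tw a f - tw a g" "tw a (cst c * f) = cst c * tw a f" "tw a (cst c) = cst c"
 "tw a (sum k A) = (\<Sum>x\<in>A. tw a (k x))" "tw a (tw a f) = f"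
 by (rule sfun_eqI; simp add: co_one co_cst sum_distrib_left algebra_simps)+

lemma Dl_tw: "Dl z (tw a f) = cst (ksgn (a * fst z)) * tw a (Dl z f)"
 by (rule sfun_eqI) (simp add: distrib_left ksgn_add)

lemma tw_commute: "tw a (tw b f) = tw b (tw a f)"
 by (rule sfun_eqI) (simp add: mult.left_commute)

text \<open>Homogeneity for an additive grading of the letters; the gradings in use are the cohomological degree and the weight.\<close>
definition homg :: "(int \<times> 'x => int) => int => ('x, 'k::field_char_0) sfun => bool"
 where "homg \<phi> i f \<longleftrightarrow> (\<forall>w. co f w ~= 0 --> sum_list (map \<phi> w) = i)"

abbreviation hom :: "int => ('x, 'k::field_char_0) sfun => bool"
 where "hom \<equiv> homg fst"

lemma homg_simps [simp]: "homg \<phi> i 0" "homg \<phi> 0 1" "homg \<phi> 0 (cst c)"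
 "homg \<phi> i f ==> homg \<phi> i (- f)"
 "homg \<phi> i f ==> homg \<phi> i (cst c * f)"
 "homg \<phi> i f ==> homg \<phi> i (tw a f)"
 unfolding homg_def by (simp_all add: co_one co_cst)

lemma homg_add [simp]: "homg \<phi> i f ==> homg \<phi> i g ==> homg \<phi> i (f + g)"
 unfolding homg_def by (metis add_cancel_right_left co_add)

lemma homg_diff [simp]: "homg \<phi> i f ==> homg \<phi> i g ==> homg \<phi> i (f - g)"
 using homg_add[of \<phi> i f "- g"] by simp

lemma homg_sum: "(\<And>x. x \<in> A ==> homg \<phi> i (f x)) ==> homg \<phi> i (sum f A)"
 by (induction A rule: infinite_finite_induct) simp_all

lemma homg_Dl: "homg \<phi> i f ==> homg \<phi> (i - \<phi> z) (Dl z f)"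
 by (fastforce simp: homg_def)

lemma homg_lin: "(\<And>z. c z ~= 0 ==> \<phi> z = i) ==> homg \<phi> i (lin c)"
 by (auto simp: homg_def co_lin length_Suc_conv split: if_splits)

lemma homg_mult:
 assumes "homg \<phi> i f" "homg \<phi> j g" shows "homg \<phi> (i + j) (f * g)"
proof -
 have "sum_list (map \<phi> w) = i + j" if "co (f * g) w ~= 0" "homg \<phi> i f" "homg \<phi> j g" for w i j f and g :: "('a, 'b) sfun"
  using that
 proof (induction w arbitrary: i j f g)
  case Nil
  then show ?case by (force simp: homg_def)
 next
  case (Cons z w)
  then have "co (Dl z f * g + tw (fst z) f * Dl z g) w ~= 0"
   by (simp flip: Dl_mult)
  then consider "co (Dl z f * g) w ~= 0" | "co (tw (fst z) f * Dl z g) w ~= 0" by fastforce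
  then show ?case
  proof cases
   case 1
   then show ?thesis using Cons.IH[OF 1 homg_Dl[OF Cons.prems(2)] Cons.prems(3)] by simp
  next
   case 2
   have "homg \<phi> i (tw (fst z) f)" using Cons.prems(2) by simp
   then show ?thesis using Cons.IH[OF 2 _ homg_Dl[OF Cons.prems(3)], of i] by simp
  qed
 qed
 then show ?thesis using assms by (auto simp: homg_def)
qed

lemma tw_hom: "hom i f ==> tw a f = cst (ksgn (a * i)) * f"
 by (rule sfun_eqI) (auto simp: homg_def)

lemma hom_commute:
 assumes "hom i f" "hom j g" shows "f * g = cst (ksgn (i * j)) * (g * f)"
proof (rule sfun_eqI)
 show "co (f * g) w = co (cst (ksgn (i * j)) * (g * f)) w" for w
  using assms
 proof (induction w arbitrary: i j f g)
  case Nil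
  then have "i = 0 & j = 0" if "co f [] ~= 0" "co g [] ~= 0"
   using that by (auto simp: homg_def dest: spec[of _ "[]"])
  then show ?case by (cases "co f [] = 0 \<or> co g [] = 0") auto
 next
  case (Cons z w)
  have f: "hom (i - fst z) (Dl z f)" and g: "hom (j - fst z) (Dl z g)"
   using Cons.prems by (simp_all add: homg_Dl)
  have "co (f * g) (z # w) = co (Dl z f * g) w + co (cst (ksgn (fst z * i)) * (f * Dl z g)) w"
   by (simp only: co_Dl[symmetric] Dl_mult co_add tw_hom[OF Cons.prems(1)] mult.assoc)
  also have "\<dots> = ksgn ((i - fst z) * j) * co (g * Dl z f) w + ksgn (fst z * i) * (ksgn (i * (j - fst z)) * co (Dl z g * f) w)"
   using Cons.IH[OF f Cons.prems(2)] Cons.IH[OF Cons.prems(1) g] by simp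
  also have "\<dots> = ksgn (i * j) * (ksgn (fst z * j) * co (g * Dl z f) w + co (Dl z g * f) w)"
   by (auto simp: ksgn_def algebra_simps)
  also have "\<dots> = co (cst (ksgn (i * j)) * (g * f)) (z # w)"
  proof -
   have "co (g * f) (z # w) = co (Dl z g * f) w + ksgn (fst z * j) * co (g * Dl z f) w"
    by (simp only: co_Dl[symmetric] Dl_mult co_add tw_hom[OF Cons.prems(2)] mult.assoc) simp
   then show ?thesis by simp
  qed
  finally show ?case .
 qed
qed

lemma co_lin_mult:
 assumes "\<And>z. c z ~= 0 ==> fst z = i"
 shows "co (lin c * h) w = (\<Sum>p<length w. ksgn (i * wd (take p w)) * c (w ! p) * co h (take p w @ drop (Suc p) w))"
proof (induction w arbitrary: h)
 case (Cons z w)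
 have t: "tw (fst z) (lin c) = cst (ksgn (fst z * i)) * (lin c :: ('a, 'b) sfun)"
  by (rule tw_hom, rule homg_lin, rule assms)
 have "co (lin c * h) (z # w) = c z * co h w + ksgn (fst z * i) * co (lin c * Dl z h) w"
  by (simp only: co_Dl[symmetric] Dl_mult co_add t mult.assoc) simp
 then show ?case
  by (simp add: Cons sum.lessThan_Suc_shift sum_distrib_left distrib_left ksgn_add algebra_simps
    del: sum.lessThan_Suc)
qed simp

section \<open>Symmetric functions\<close>

definition symf :: "('x, 'k::field_char_0) sfun => bool"
 where "symf f \<longleftrightarrow> (\<forall>u y z v. co f (u @ y # z # v) = ksgn (fst y * fst z) * co f (u @ z # y # v))"

text \<open>The bound on the length singles out polynomials among formal power series.\<close>
definition symset :: "(int \<times> 'x) set => ('x, 'k::field_char_0) sfun set"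
 where "symset L = {f. symf f & (\<exists>N. \<forall>w. co f w ~= 0 --> set w \<subseteq> L & length w \<le> N)}"

abbreviation lw :: "(int \<times> 'x) list => ('x, 'k::field_char_0) sfun"
 where "lw w \<equiv> prod_list (map gen w)"

lemma symf_swap: "symf f ==> co f (u @ y # z # v) = ksgn (fst y * fst z) * co f (u @ z # y # v)"
 unfolding symf_def by blast

lemma symf_front: "symf f ==> co f (u @ x # v) = ksgn (fst x * wd u) * co f (x # u @ v)"
proof (induction u arbitrary: v rule: rev_induct)
 case (snoc y u)
 then show ?case
  using symf_swap[OF snoc.prems, of u y x v]
  by (auto simp: ksgn_def)
qed simp

lemma symf_Dl: "symf f ==> symf (Dl z f)"
 unfolding symf_def by (metis append_Cons co_Dl)

lemma symf_simps: "symf 0" "symf (lin h)" "symf (cst c)"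
 by (simp_all add: symf_def co_lin co_cst)

lemma symf_add: "symf f ==> symf g ==> symf (f + g)"
 using symf_swap[of f] symf_swap[of g] unfolding symf_def co_add by (metis distrib_left)

lemma symf_tw: assumes "symf f" shows "symf (tw a f)"
 unfolding symf_def
proof (intro allI)
 show "co (tw a f) (u @ y # z # v) = ksgn (fst y * fst z) * co (tw a f) (u @ z # y # v)" for u y z v
  using symf_swap[OF assms, of u y z v] by (simp add: add.left_commute)
qed

lemma Dl_symf: "symf f ==> Dl z (Dl y f) = cst (ksgn (fst y * fst z)) * Dl y (Dl z f)"
proof (rule sfun_eqI)
 show "symf f ==> co (Dl z (Dl y f)) w = co (cst (ksgn (fst y * fst z)) * Dl y (Dl z f)) w" for w
  using symf_swap[of f "[]" y z w] by simp
qed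

lemma symf_mult:
 assumes "symf f" "symf g" shows "symf (f * g)"
proof -
 have "co (f * g) (u @ y # z # v) = ksgn (fst y * fst z) * co (f * g) (u @ z # y # v)"
  if "symf f" "symf g" for u y z v f and g :: "('a, 'b) sfun"
  using that
 proof (induction u arbitrary: f g)
  case Nil
  let ?s = "cst (ksgn (fst y * fst z)) :: ('a, 'b) sfun"
  have s: "?s * (?s * h) = h" for h
   by (simp flip: mult.assoc cst_mult)
  have s2: "cst (ksgn (fst z * fst y)) = ?s" by (simp add: mult.commute)
  have "Dl z (Dl y (f * g)) = ?s * Dl y (Dl z (f * g))"
   unfolding Dl_mult Dl_simps Dl_tw s2 Dl_symf[OF Nil(1), of z y] Dl_symf[OF Nil(2), of z y] tw_commute[of "fst z" "fst y"]
   by (simp add: distrib_left mult.assoc cst_left[of "tw _ _"] s add.assoc add.commute add.left_commute)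
  then have "co (Dl z (Dl y (f * g))) v = co (?s * Dl y (Dl z (f * g))) v" by simp
  then show ?case by simp
 next
  case (Cons x u)
  have "co (f * g) (x # w) = co (Dl x f * g) w + co (tw (fst x) f * Dl x g) w" for w
   by (simp flip: co_Dl co_add add: Dl_mult)
  then show ?case
   using Cons.IH[OF symf_Dl[OF Cons.prems(1)] Cons.prems(2), of x]
    Cons.IH[OF symf_tw[OF Cons.prems(1)] symf_Dl[OF Cons.prems(2)], of "fst x" x]
   by (simp only: append_Cons distrib_left)
 qed
 then show ?thesis using assms unfolding symf_def by blast
qed

lemma symset_symf: "f \<in> symset L ==> symf f"
 by (simp add: symset_def)

lemma symset_supp: "f \<in> symset L ==> co f w ~= 0 ==> set w \<subseteq> L"
 by (auto simp: symset_def)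

lemma symset_mono: "f \<in> symset L ==> L \<subseteq> L' ==> f \<in> symset L'"
 unfolding symset_def by (blast dest: subset_trans)

lemma symset_add: assumes "f \<in> symset L" "g \<in> symset L" shows "f + g \<in> symset L"
proof -
 from assms obtain N M where "\<forall>w. co f w ~= 0 --> set w \<subseteq> L & length w \<le> N"
  "\<forall>w. co g w ~= 0 --> set w \<subseteq> L & length w \<le> M" by (auto simp: symset_def)
 then have "\<forall>w. co (f + g) w ~= 0 --> set w \<subseteq> L & length w \<le> max N M"
  by (metis add_cancel_right_left co_add max.coboundedI1 max.coboundedI2)
 then show ?thesis using assms symf_add by (auto simp: symset_def)
qed

lemma mult_support:
 assumes "\<And>w. co f w ~= 0 ==> set w \<subseteq> L & length w \<le> N" "\<And>w. co g w ~= 0 ==> set w \<subseteq> L & length w \<le> M"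
  and "co (f * g) w ~= 0"
 shows "set w \<subseteq> L & length w \<le> N + M"
 using assms
proof (induction w arbitrary: f g N M)
 case (Cons z w)
 then have "co (Dl z f * g + tw (fst z) f * Dl z g) w ~= 0"
  by (simp flip: Dl_mult)
 then consider "co (Dl z f * g) w ~= 0" | "co (tw (fst z) f * Dl z g) w ~= 0" by fastforce
 then show ?case
 proof cases
  case 1
  then have "\<exists>u. co (Dl z f) u ~= 0"
   by (metis co_zero mult_zero_left sfun_eqI)
  then have "z \<in> L" "N \<ge> 1" using Cons.prems(1) by fastforce+
  moreover have "set w \<subseteq> L & length w \<le> (N - 1) + M"
   by (rule Cons.IH[OF _ _ 1]) (use Cons.prems in fastforce)+
  ultimately show ?thesis by auto
 next
  case 2
  then have "\<exists>u. co (Dl z g) u ~= 0"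
   by (metis co_zero mult_zero_right sfun_eqI)
  then have "z \<in> L" "M \<ge> 1" using Cons.prems(2) by fastforce+
  moreover have "set w \<subseteq> L & length w \<le> N + (M - 1)"
   by (rule Cons.IH[OF _ _ 2]) (use Cons.prems in fastforce)+
  ultimately show ?thesis by auto
 qed
qed auto

lemma symset_mult: assumes "f \<in> symset L" "g \<in> symset L" shows "f * g \<in> symset L"
proof -
 from assms obtain N M where "\<And>w. co f w ~= 0 ==> set w \<subseteq> L & length w \<le> N"
  "\<And>w. co g w ~= 0 ==> set w \<subseteq> L & length w \<le> M" by (auto simp: symset_def)
 then have "\<forall>w. co (f * g) w ~= 0 --> set w \<subseteq> L & length w \<le> N + M"
  using mult_support[of f L N g M] by blast
 then show ?thesis using assms symf_mult by (auto simp: symset_def)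
qed

lemma symset_lin: "(\<And>z. c z ~= 0 ==> z \<in> L) ==> lin c \<in> symset L"
 unfolding symset_def
 by (auto simp: symf_simps co_lin length_Suc_conv split: if_splits intro!: exI[of _ 1])

lemma symset_cst [simp]: "cst c \<in> symset L"
 unfolding symset_def by (auto simp: symf_simps co_cst split: if_splits)

lemma symset_0_1 [simp]: "0 \<in> symset L" "1 \<in> symset L"
 using symset_cst[of 0 L] symset_cst[of 1 L] by simp_all

lemma symset_scale: "f \<in> symset L ==> cst c * f \<in> symset L"
 by (simp add: symset_mult)

lemma symset_uminus: "f \<in> symset L ==> - f \<in> symset L"
 using symset_scale[of f L "- 1"] by (simp add: cst_uminus)

lemma symset_sum: "(\<And>x. x \<in> A ==> f x \<in> symset L) ==> sum f A \<in> symset L"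
 by (induction A rule: infinite_finite_induct) (simp_all add: symset_add)

lemma symset_tw: "f \<in> symset L ==> tw a f \<in> symset L"
 unfolding symset_def by (auto simp: symf_tw)

lemma symset_Dl: "f \<in> symset L ==> Dl z f \<in> symset L"
proof -
 assume f: "f \<in> symset L"
 then obtain N where N: "\<And>w. co f w ~= 0 ==> set w \<subseteq> L & length w \<le> N"
  by (auto simp: symset_def)
 have "\<forall>w. co (Dl z f) w ~= 0 --> set w \<subseteq> L & length w \<le> N"
  using N[of "z # _"] by fastforce
 then show ?thesis using symf_Dl[OF symset_symf[OF f]] by (auto simp: symset_def)
qed

lemma symset_lw: "set w \<subseteq> L ==> lw w \<in> symset L"
 by (induction w) (auto intro!: symset_mult symset_lin split: if_splits)

lemma homg_lw: "homg \<phi> (sum_list (map \<phi> w)) (lw w)"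
 by (induction w) (auto intro!: homg_mult homg_lin split: if_splits)

definition words :: "'z set => nat => 'z list set"
 where "words L k = {w. set w \<subseteq> L & length w = k}"

lemma words_0 [simp]: "words L 0 = {[]}"
 by (auto simp: words_def)

lemma finite_words [simp]: "finite L ==> finite (words L k)"
 by (simp add: words_def finite_lists_length_eq)

lemma sum_words_Suc: "(\<Sum>w\<in>words L (Suc k). h w) = (\<Sum>z\<in>L. \<Sum>w\<in>words L k. h (z # w))"
proof -
 have "words L (Suc k) = (%(z, w). z # w) ` (L \<times> words L k)"
  by (auto simp: words_def length_Suc_conv image_iff)
 moreover have "inj_on (%(z, w). z # w) (L \<times> words L k)" by (auto simp: inj_on_def)
 ultimately show ?thesis by (simp add: sum.reindex sum.cartesian_product case_prod_unfold)
qed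

text \<open>Every letter of a word can be brought to the front, so the Euler field multiplies the component of length k by k. In characteristic 0 this number is invertible for positive k.\<close>
lemma euler:
 assumes "finite L" "symf f" "\<And>w. co f w ~= 0 ==> set w \<subseteq> L"
 shows "co (\<Sum>z\<in>L. gen z * Dl z f) w = of_nat (length w) * co f w"
proof -
 have "co (\<Sum>z\<in>L. gen z * Dl z f) w =
   (\<Sum>z\<in>L. \<Sum>p<length w. if w ! p = z then ksgn (fst z * wd (take p w)) * co f (z # take p w @ drop (Suc p) w) else 0)"
  unfolding co_sum
  by (intro sum.cong refl, subst co_lin_mult[where i = "fst _"]) (auto split: if_splits intro!: sum.cong)
 also have "\<dots> = (\<Sum>p<length w. \<Sum>z\<in>L. if w ! p = z then ksgn (fst z * wd (take p w)) * co f (z # take p w @ drop (Suc p) w) else 0)"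
  by (rule sum.swap)
 also have "\<dots> = (\<Sum>p<length w. co f w)"
 proof (rule sum.cong[OF refl])
  fix p assume "p \<in> {..<length w}"
  then have p: "p < length w" by simp
  have w: "w = take p w @ w ! p # drop (Suc p) w" using p by (simp add: id_take_nth_drop)
  have "ksgn (fst (w ! p) * wd (take p w)) * co f (w ! p # take p w @ drop (Suc p) w) = co f w"
   using symf_front[OF assms(2), of "take p w" "w ! p" "drop (Suc p) w"] w by simp
  moreover have "co f w = 0" if "w ! p \<notin> L"
   using assms(3)[of w] that p by (metis nth_mem subsetD)
  ultimately show "(\<Sum>z\<in>L. if w ! p = z then ksgn (fst z * wd (take p w)) * co f (z # take p w @ drop (Suc p) w) else 0) = co f w"
   using assms(1) by simp
 qed
 finally show ?thesis by simp
qed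

text \<open>Iterating the Euler identity writes a graded symmetric function as a combination of products of letters.\<close>
lemma length_component_expansion:
 assumes "finite L" "symf f" "\<And>w. co f w ~= 0 ==> set w \<subseteq> L & length w = k"
 shows "cst (fact k) * f = (\<Sum>w\<in>words L k. cst (co f w) * lw w)"
 using assms(2,3)
proof (induction k arbitrary: f)
 case 0
 then show ?case by (intro sfun_eqI) (auto simp: co_cst co_one)
next
 case (Suc k)
 have "cst (of_nat (Suc k)) * f = (\<Sum>z\<in>L. gen z * Dl z f)"
  by (rule sfun_eqI) (use Suc.prems in \<open>subst euler[OF assms(1)]; force\<close>)
 moreover have "cst (fact (Suc k)) * f = cst (fact k) * (cst (of_nat (Suc k)) * f)"
  by (rule sfun_eqI) (simp add: algebra_simps)
 ultimately have "cst (fact (Suc k)) * f = (\<Sum>z\<in>L. gen z * (cst (fact k) * Dl z f))"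
  by (simp add: sum_distrib_left cst_left[of "lin _"])
 also have "\<dots> = (\<Sum>z\<in>L. gen z * (\<Sum>w\<in>words L k. cst (co f (z # w)) * lw w))"
 proof (rule sum.cong[OF refl])
  fix z assume "z \<in> L"
  show "gen z * (cst (fact k) * Dl z f) = gen z * (\<Sum>w\<in>words L k. cst (co f (z # w)) * lw w)"
   by (subst Suc.IH) (use Suc.prems(2)[of "z # _"] in \<open>auto simp: symf_Dl Suc.prems(1)\<close>)
 qed
 also have "\<dots> = (\<Sum>w\<in>words L (Suc k). cst (co f w) * lw w)"
  unfolding sum_words_Suc by (simp add: sum_distrib_left cst_left[of "lin _"])
 finally show ?case .
qed

lemma symset_induct:
 assumes "finite L" "f \<in> symset L"
  and "P 0" and add: "\<And>f g. P f ==> P g ==> P (f + g)" and scale: "\<And>c f. P f ==> P (cst c * f)"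
  and lw: "\<And>w. set w \<subseteq> L ==> P (lw w)"
 shows "P f"
proof -
 obtain N where f: "symf f" "\<And>w. co f w ~= 0 ==> set w \<subseteq> L & length w \<le> N"
  using assms(2) by (auto simp: symset_def)
 have sum: "P (sum h A)" if "finite A" "\<And>x. x \<in> A ==> P (h x)" for h and A :: "(int \<times> 'a) list set"
  using that(1,2)
 proof (induction A rule: finite_induct)
  case empty
  show ?case using assms(3) by simp
 next
  case (insert x A)
  have "P (h x)" "P (sum h A)" using insert.IH insert.prems by auto
  from add[OF this] show ?case by (simp only: sum.insert[OF insert.hyps])
 qed
 define part where "part k = Sfun (%w. if length w = k then co f w else 0)" for k
 have co_part: "co (part k) w = (if length w = k then co f w else 0)" for k w
  by (simp add: part_def Sfun_inverse)
 have P_part: "P (part k)" for k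
 proof -
  have "co (part k) (u @ y # z # v) = ksgn (fst y * fst z) * co (part k) (u @ z # y # v)" for u y z v
   using symf_swap[OF f(1), of u y z v] by (simp add: co_part)
  then have "symf (part k)" unfolding symf_def by blast
  then have "cst (fact k) * part k = (\<Sum>w\<in>words L k. cst (co (part k) w) * lw w)"
   by (intro length_component_expansion[OF assms(1)]) (auto simp: co_part f split: if_splits)
  moreover have "part k = cst (1 / fact k) * (cst (fact k) * part k)"
   by (rule sfun_eqI) simp
  moreover have "P (\<Sum>w\<in>words L k. cst (co (part k) w) * lw w)"
   by (intro sum scale lw finite_words assms(1)) (auto simp: words_def)
  ultimately show ?thesis by (metis scale)
 qed
 have "f = (\<Sum>k\<in>{..N}. part k)"
 proof (rule sfun_eqI)
  fix w
  have "co f w = 0" if "\<not> length w \<le> N" using f(2)[of w] that by blast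
  then show "co f w = co (\<Sum>k\<in>{..N}. part k) w" by (auto simp: co_part)
 qed
 moreover have "P (\<Sum>k\<in>{..n}. part k)" for n :: nat
 proof (induction n)
  case 0
  show ?case using P_part[of 0] by simp
 next
  case (Suc n)
  show ?case using add[OF Suc.IH P_part[of "Suc n"]] by simp
 qed
 ultimately show ?thesis by simp
qed

section \<open>Inversions, shuffles and products of linear forms\<close>

definition Inv :: "nat => (nat => nat) => (nat \<times> nat) set"
 where "Inv n s = {(i, j). i < j & j < n & s j < s i}"

lemma finite_Inv [simp]: "finite (Inv n s)"
 by (rule finite_subset[of _ "{..<n} \<times> {..<n}"]) (auto simp: Inv_def)

text \<open>A permutation of k + 1 letters is encoded by the position p that carries 0 and a permutation of k letters.\<close>
definition ins :: "nat => (nat => nat) => nat => nat"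
 where "ins p s i = (if i < p then Suc (s i) else if i = p then 0 else Suc (s (i - 1)))"

lemma ins_simps [simp]: "ins p s p = 0" "i < p ==> ins p s i = Suc (s i)" "p < i ==> ins p s i = Suc (s (i - 1))"
 by (simp_all add: ins_def)

lemma permutes_lt: "s permutes {..<k} ==> i < k ==> s i < k"
 using permutes_in_image[of s "{..<k}" i] by simp

lemma ins_permutes:
 assumes "s permutes {..<k}" "p \<le> k" shows "ins p s permutes {..<Suc k}"
proof (rule bij_imp_permutes)
 have inj: "s i = s j \<longleftrightarrow> i = j" for i j using assms(1) by (metis permutes_inj injD)
 have "inj_on (ins p s) {..<Suc k}"
  by (rule inj_onI) (auto simp: ins_def inj split: if_splits)
 moreover have "ins p s ` {..<Suc k} \<subseteq> {..<Suc k}"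
  using assms by (auto simp: ins_def permutes_lt)
 ultimately show "bij_betw (ins p s) {..<Suc k} {..<Suc k}"
  by (simp add: bij_betw_def endo_inj_surj)
 show "ins p s x = x" if "x \<notin> {..<Suc k}" for x
 proof -
  from that assms(2) have "p < x" "x - 1 \<notin> {..<k}" by auto
  then show ?thesis using permutes_not_in[OF assms(1), of "x - 1"] by simp
 qed
qed

lemma ins_inject:
 assumes "ins p s = ins p' s'" shows "p = p' & s = s'"
proof -
 have p: "p = p'"
  by (rule ccontr) (use fun_cong[OF assms, of p] in \<open>auto simp: ins_def split: if_splits\<close>)
 have "s i = s' i" for i
  using fun_cong[OF assms, of "if i < p then i else Suc i"] p by (cases "i < p") (simp_all add: ins_def)
 with p show ?thesis by auto
qed

lemma bij_betw_ins:
 "bij_betw (%(p, s). ins p s) ({..k} \<times> {s. s permutes {..<k}}) {s. s permutes {..<Suc k}}"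
 (is "bij_betw ?f ?A ?B")
proof -
 have inj: "inj_on ?f ?A" by (rule inj_onI) (auto dest: ins_inject)
 have sub: "?f ` ?A \<subseteq> ?B" by (auto intro: ins_permutes)
 have "card (?f ` ?A) = card ?B"
  by (simp add: card_image[OF inj] card_cartesian_product card_permutations)
 then have "?f ` ?A = ?B"
  using card_subset_eq[OF _ sub] by (simp add: finite_permutations)
 with inj show ?thesis by (simp add: bij_betw_def)
qed

lemma sum_permutations_Suc:
 "(\<Sum>s | s permutes {..<Suc k}. F s) = (\<Sum>p<Suc k. \<Sum>s | s permutes {..<k}. F (ins p s))"
 using sum.reindex_bij_betw[OF bij_betw_ins, of F k]
 by (simp add: sum.cartesian_product case_prod_unfold lessThan_Suc_atMost)

lemma permute_list_ins:
 assumes "length xs = k" "p \<le> k" "s permutes {..<k}"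
 shows "permute_list (ins p s) (x # xs) = take p (permute_list s xs) @ x # drop p (permute_list s xs)"
proof (rule nth_equalityI)
 show "length (permute_list (ins p s) (x # xs)) = length (take p (permute_list s xs) @ x # drop p (permute_list s xs))"
  using assms by simp
 fix i assume "i < length (permute_list (ins p s) (x # xs))"
 then have "i < Suc k" using assms by simp
 then show "permute_list (ins p s) (x # xs) ! i = (take p (permute_list s xs) @ x # drop p (permute_list s xs)) ! i"
  using assms by (auto simp: permute_list_def nth_append nth_Cons' min_def ins_def simp del: upt_Suc)
qed

lemma sum_Inv_ins:
 assumes "s permutes {..<k}" "p \<le> k"
 shows "(\<Sum>(i, j)\<in>Inv (Suc k) (ins p s). h (ins p s i) (ins p s j)) =
  (\<Sum>i<p. h (Suc (s i)) 0) + (\<Sum>(i, j)\<in>Inv k s. h (Suc (s i)) (Suc (s j)))"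
proof -
 define sk where "sk i = (if i < p then i else Suc i)" for i
 have sk: "ins p s (sk i) = Suc (s i)" for i by (simp add: sk_def ins_def)
 have inj: "inj sk" by (auto simp: inj_def sk_def)
 have eq: "Inv (Suc k) (ins p s) = (%i. (i, p)) ` {..<p} \<union> (%(i, j). (sk i, sk j)) ` Inv k s" (is "_ = ?A \<union> ?B")
 proof (intro equalityI subsetI)
  fix x assume "x \<in> Inv (Suc k) (ins p s)"
  then obtain i j where x: "x = (i, j)" "i < j" "j < Suc k" "ins p s j < ins p s i"
   by (auto simp: Inv_def)
  show "x \<in> ?A \<union> ?B"
  proof (cases "j = p")
   case True
   then show ?thesis using x by auto
  next
   case False
   have i: "i ~= p" using x by auto
   define i' j' where "i' = (if i < p then i else i - 1)" and "j' = (if j < p then j else j - 1)"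
   have "i = sk i'" "j = sk j'" "i' < j'" "j' < k"
    using i False x assms(2) by (auto simp: i'_def j'_def sk_def)
   with x sk show ?thesis by (auto simp: Inv_def image_iff intro!: bexI[of _ "(i', j')"])
  qed
 next
  fix x assume "x \<in> ?A \<union> ?B"
  then show "x \<in> Inv (Suc k) (ins p s)"
  proof
   assume "x \<in> ?A" then show ?thesis using assms(2) by (auto simp: Inv_def)
  next
   assume "x \<in> ?B"
   then obtain i j where x: "x = (sk i, sk j)" "i < j" "j < k" "s j < s i" by (auto simp: Inv_def)
   then have "sk i < sk j" "sk j < Suc k" by (auto simp: sk_def)
   with x show ?thesis by (simp add: Inv_def sk)
  qed
 qed
 have skp: "sk i ~= p" for i by (auto simp: sk_def)
 have "inj_on (%(i, j). (sk i, sk j)) (Inv k s)" using inj by (auto simp: inj_on_def inj_def)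
 moreover have "?A \<inter> ?B = {}" using skp by fastforce
 moreover have "inj_on (%i. (i, p)) {..<p}" by (simp add: inj_on_def)
 ultimately show ?thesis
  unfolding eq by (subst sum.union_disjoint) (simp_all add: sum.reindex case_prod_unfold sk)
qed

text \<open>The sum of q over the inversions of s. The product of degrees gives the exponent of the Koszul sign, and the constant 1 gives the exponent of the signature.\<close>
definition kap :: "('a => 'a => int) => 'a list => (nat => nat) => int"
 where "kap q ds s = (\<Sum>(i, j) \<in> Inv (length ds) s. q (ds ! s i) (ds ! s j))"

lemma koszul_kap: "koszul ds s = ksgn (kap (*) ds s)"
 by (simp add: koszul_def kap_def Inv_def)

lemma kap_add: "kap (%x y. q x y + q' x y) ds s = kap q ds s + kap q' ds s"
 by (simp add: kap_def sum.distrib case_prod_unfold)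

lemma kap_map: "s permutes {..<length ds} ==> kap q (map f ds) s = kap (%x y. q (f x) (f y)) ds s"
 unfolding kap_def by (rule sum.cong) (auto simp: Inv_def permutes_lt)

lemma kap_Nil [simp]: "kap q [] s = 0"
 by (simp add: kap_def Inv_def)

lemma kap_ins:
 assumes "s permutes {..<length xs}" "p \<le> length xs"
 shows "kap q (x # xs) (ins p s) = (\<Sum>y\<leftarrow>take p (permute_list s xs). q y x) + kap q xs s"
proof -
 have "(\<Sum>y\<leftarrow>take p (permute_list s xs). q y x) = (\<Sum>i<p. q (xs ! s i) x)"
  using assms(2) by (simp add: permute_list_def take_map take_upt sum_list_sum_nth atLeast0LessThan)
 then show ?thesis
  using sum_Inv_ins[OF assms, of "%i j. q ((x # xs) ! i) ((x # xs) ! j)"] by (simp add: kap_def)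
qed

lemma sign_ins:
 assumes "s permutes {..<k}" "p \<le> k" shows "sign (ins p s) = (- 1) ^ p * sign s"
 using assms(2)
proof (induction p)
 case 0
 have 1: "Suc ` {..<k} = {1..k}" by (simp add: image_Suc_lessThan)
 have "ins 0 s = map_permutation {..<k} Suc s"
 proof
  fix i
  show "ins 0 s i = map_permutation {..<k} Suc s i"
  proof (cases "i \<in> {1..k}")
   case True
   then have "inv_into {..<k} Suc i = i - 1" by (intro inv_into_f_eq) auto
   then show ?thesis using True by (simp add: map_permutation_def restrict_id_def 1 ins_def)
  next
   case False
   then have "i = 0 \<or> i > k" by auto
   then show ?thesis using False permutes_not_in[OF assms(1), of "i - 1"]
    by (auto simp: map_permutation_def restrict_id_def 1 ins_def)
  qed
 qed
 then show ?case using assms(1) by (simp add: sign_map_permutation)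
next
 case (Suc p)
 have "ins (Suc p) s = ins p s \<circ> transpose p (Suc p)"
  by (auto simp: fun_eq_iff ins_def transpose_def less_Suc_eq)
 moreover have "permutation (ins p s)"
  using ins_permutes[OF assms(1), of p] Suc.prems by (auto intro: permutes_imp_permutation[of "{..<Suc k}"])
 ultimately have "sign (ins (Suc p) s) = sign (ins p s) * sign (transpose p (Suc p))"
  by (simp only: sign_compose[OF _ permutation_swap_id])
 then show ?case
  using Suc by (simp add: sign_swap_id)
qed

lemma permutes_induct_ins [consumes 1, case_names Nil ins]:
 assumes "s permutes {..<length xs}"
  and "P [] id"
  and "\<And>x xs p s. s permutes {..<length xs} ==> p \<le> length xs ==> P xs s ==> P (x # xs) (ins p s)"
 shows "P xs s"
 using assms(1)
proof (induction xs arbitrary: s)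
 case (Cons x xs)
 then have "s \<in> (%(p, s). ins p s) ` ({..length xs} \<times> {s. s permutes {..<length xs}})"
  using bij_betw_ins[of "length xs"] by (simp add: bij_betw_def)
 then show ?case using Cons.IH assms(3) by auto
qed (simp add: assms(2))

lemma permsgn_kap:
 assumes "s permutes {..<length ds}" shows "permsgn s = ksgn (kap (%_ _. 1) ds s)"
 using assms
proof (induction rule: permutes_induct_ins)
 case Nil
 then show ?case by (simp add: permsgn_def)
next
 case (ins x xs p s)
 have "(ksgn (int p) :: 'b) = (- 1) ^ p" by (simp add: ksgn_def)
 moreover have "(\<Sum>y\<leftarrow>take p (permute_list s xs). (1::int)) = int p"
  using ins(2) by (simp add: sum_list_triv min_def)
 ultimately show ?case
  using ins by (simp add: kap_ins sign_ins permsgn_def ksgn_add)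
qed

lemma symf_permute:
 fixes f :: "('x, 'k::field_char_0) sfun"
 assumes "symf f" "s permutes {..<length w}"
 shows "co f (permute_list s w) = ksgn (kap (%x y. fst x * fst y) w s) * co f w"
proof -
 have "\<forall>f :: ('x, 'k) sfun. symf f --> co f (permute_list s w) = ksgn (kap (%x y. fst x * fst y) w s) * co f w"
  using assms(2)
 proof (induction rule: permutes_induct_ins)
  case (ins x xs p s)
  show ?case
  proof (intro allI impI)
   fix f :: "('x, 'k) sfun" assume f: "symf f"
   let ?c = "permute_list s xs"
   have "co f (permute_list (ins p s) (x # xs)) = ksgn (fst x * wd (take p ?c)) * co (Dl x f) ?c"
    using symf_front[OF f, of "take p ?c" x "drop p ?c"] ins by (simp add: permute_list_ins)
   moreover have "co (Dl x f) ?c = ksgn (kap (%x y. fst x * fst y) xs s) * co (Dl x f) xs"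
    using ins(3)[THEN spec, of "Dl x f"] symf_Dl[OF f, of x] by simp
   moreover have "(\<Sum>y\<leftarrow>take p ?c. fst y * fst x) = fst x * wd (take p ?c)"
    by (simp add: sum_list_mult_const mult.commute)
   ultimately show "co f (permute_list (ins p s) (x # xs)) = ksgn (kap (%x y. fst x * fst y) (x # xs) (ins p s)) * co f (x # xs)"
    using ins by (simp add: kap_ins ksgn_add)
  qed
 qed simp
 then show ?thesis using assms(1) by blast
qed

text \<open>The coefficients of a product of linear forms are signed sums over permutations, as in the formula for the image of a monomial under \<open>\<Phi>\<close>.\<close>
lemma co_prod_lin:
 assumes "list_all2 (%d c. \<forall>z. c z ~= 0 --> fst z = d) ds cs"
 shows "co (prod_list (map lin cs)) w =
  (if length w = length cs
   then \<Sum>s | s permutes {..<length cs}. ksgn (kap (*) ds s) * (\<Prod>j<length cs. (cs ! s j) (w ! j)) else 0)"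
 using assms
proof (induction ds cs arbitrary: w rule: list_all2_induct)
 case Nil
 then show ?case by (auto simp: co_one)
next
 case (Cons d ds c cs)
 have len: "length ds = length cs" using Cons.hyps(2) by (rule list_all2_lengthD)
 let ?r = "%p. take p w @ drop (Suc p) w"
 have e: "co (prod_list (map lin (c # cs))) w =
   (\<Sum>p<length w. ksgn (d * wd (take p w)) * c (w ! p) * co (prod_list (map lin cs)) (?r p))"
  by (simp, rule co_lin_mult) (use Cons.hyps(1) in blast)
 show ?case
 proof (cases "length w = Suc (length cs)")
  case False
  then show ?thesis unfolding e by (auto intro!: sum.neutral simp: Cons.IH)
 next
  case True
  have "ksgn (d * wd (take p w)) * c (w ! p) * co (prod_list (map lin cs)) (?r p) =
   (\<Sum>s | s permutes {..<length cs}. ksgn (kap (*) (d # ds) (ins p s)) *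
    (\<Prod>j<Suc (length cs). ((c # cs) ! ins p s j) (w ! j)))" if p: "p < length w" for p
  proof -
   have "ksgn (d * wd (take p w)) * c (w ! p) * (ksgn (kap (*) ds s) * (\<Prod>j<length cs. (cs ! s j) (?r p ! j))) =
    ksgn (kap (*) (d # ds) (ins p s)) * (\<Prod>j<Suc (length cs). ((c # cs) ! ins p s j) (w ! j))"
    if s: "s permutes {..<length cs}" for s
   proof -
    have p': "p \<le> length cs" using p True by simp
    have "{..<Suc (length cs)} = insert p ({..<p} \<union> Suc ` {p..<length cs})"
     using p' by (auto simp: image_iff)
    then have "(\<Prod>j<Suc (length cs). ((c # cs) ! ins p s j) (w ! j)) =
      c (w ! p) * (\<Prod>j\<in>{..<p} \<union> Suc ` {p..<length cs}. ((c # cs) ! ins p s j) (w ! j))"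
     by (simp only:) (subst prod.insert, auto)
    also have "(\<Prod>j\<in>{..<p} \<union> Suc ` {p..<length cs}. ((c # cs) ! ins p s j) (w ! j)) =
      (\<Prod>j<p. (cs ! s j) (w ! j)) * (\<Prod>j\<in>{p..<length cs}. (cs ! s j) (w ! Suc j))"
     by (subst prod.union_disjoint) (auto simp: prod.reindex simp del: image_Suc_atLeastLessThan intro!: arg_cong2[where f = "(*)"] prod.cong)
    also have "\<dots> = (\<Prod>j<p. (cs ! s j) (?r p ! j)) * (\<Prod>j\<in>{p..<length cs}. (cs ! s j) (?r p ! j))"
     using p True by (intro arg_cong2[where f = "(*)"] prod.cong) (auto simp: nth_append min_def)
    also have "\<dots> = (\<Prod>j<length cs. (cs ! s j) (?r p ! j))"
     using p' by (subst prod.union_disjoint[symmetric]) (auto intro!: prod.cong)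
    finally have prod: "(\<Prod>j<Suc (length cs). ((c # cs) ! ins p s j) (w ! j)) =
     c (w ! p) * (\<Prod>j<length cs. (cs ! s j) (?r p ! j))" .
    show ?thesis
    proof (cases "(\<Prod>j<length cs. (cs ! s j) (?r p ! j)) = 0")
     case False
     have "fst (w ! j) = ds ! s j" if "j < p" for j
     proof -
      have "(cs ! s j) (?r p ! j) ~= 0" using False that p' by auto
      moreover have "?r p ! j = w ! j" using that p by (simp add: nth_append)
      moreover have "\<forall>z. (cs ! s j) z ~= 0 --> fst z = ds ! s j"
       using Cons.hyps(2) permutes_lt[OF s, of j] that p' len
        list_all2_nthD[OF Cons.hyps(2), of "s j"] by simp
      ultimately show ?thesis by (metis (no_types))
     qed
     then have "take p (map fst w) = take p (permute_list s ds)"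
      using p' len True by (intro nth_equalityI) (auto simp: permute_list_def)
     then have "wd (take p w) = sum_list (take p (permute_list s ds))" by (simp add: take_map)
     then have "kap (*) (d # ds) (ins p s) = wd (take p w) * d + kap (*) ds s"
      using s p' len by (simp add: kap_ins sum_list_mult_const)
     then show ?thesis by (simp add: prod ksgn_add mult.commute mult.left_commute del: prod.lessThan_Suc)
    qed (simp only: prod mult_zero_right)
   qed
   moreover have "length (?r p) = length cs" using p True by simp
   ultimately show ?thesis
    by (simp only: Cons.IH refl if_True sum_distrib_left) (intro sum.cong refl, simp only: mem_Collect_eq)
  qed
  then show ?thesis
   using True unfolding e by (simp add: sum_permutations_Suc)
 qed
qed

text \<open>The sum over all decompositions of a word into a subword u and the complementary subword v, where q contributes to the sign for each pair of letters that changes its order.\<close>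
fun ssum :: "('a => 'a => int) => 'a list => ('a list => 'a list => 'k::field_char_0) => 'k"
 where
  "ssum q [] G = G [] []"
 | "ssum q (x # a) G = ssum q a (%u v. G (x # u) v) + ssum q a (%u v. ksgn (\<Sum>y\<leftarrow>u. q y x) * G u (x # v))"

lemma ssum_cong:
 assumes "\<And>u v. mset u + mset v = mset a ==> G u v = G' u v"
 shows "ssum q a G = ssum q a G'"
 using assms
proof (induction a arbitrary: G G')
 case (Cons x a)
 have "ssum q a (%u v. G (x # u) v) = ssum q a (%u v. G' (x # u) v)"
  by (intro Cons.IH Cons.prems) simp
 moreover have "ssum q a (%u v. ksgn (\<Sum>y\<leftarrow>u. q y x) * G u (x # v)) = ssum q a (%u v. ksgn (\<Sum>y\<leftarrow>u. q y x) * G' u (x # v))"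
  by (intro Cons.IH arg_cong2[where f = "(*)"] refl Cons.prems) simp
 ultimately show ?case by simp
qed simp

lemma ssum_add: "ssum q a (%u v. G u v + H u v) = ssum q a G + ssum q a H"
 by (induction a arbitrary: G H) (simp_all add: distrib_left)

lemma ssum_scale: "ssum q a (%u v. c * G u v) = c * ssum q a G"
 by (induction a arbitrary: G) (simp_all add: distrib_left mult.left_commute[of _ c])

lemma ssum_0 [simp]: "ssum q a (%u v. 0) = 0"
 using ssum_scale[of q a 0 "%_ _. 0"] by simp

lemma ssum_sum: "ssum q a (%u v. \<Sum>e\<in>A. G e u v) = (\<Sum>e\<in>A. ssum q a (G e))"
 by (induction A rule: infinite_finite_induct) (simp_all add: ssum_add)

lemma ssum_sign_cong:
 assumes "\<And>x y. even (q x y + q' x y)" shows "ssum q a G = ssum q' a G"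
proof (induction a arbitrary: G)
 case (Cons x a)
 have "even ((\<Sum>y\<leftarrow>u. q y x) + (\<Sum>y\<leftarrow>u. q' y x))" for u
 proof (induction u)
  case (Cons y u)
  then show ?case using assms[of y x] by (simp add: algebra_simps)
 qed simp
 then have "(ksgn (\<Sum>y\<leftarrow>u. q y x) :: 'b) = ksgn (\<Sum>y\<leftarrow>u. q' y x)" for u by (rule ksgn_cong)
 then show ?case by (simp add: Cons)
qed simp

lemma ssum_map: "ssum q (map f a) G = ssum (%x y. q (f x) (f y)) a (%u v. G (map f u) (map f v))"
 by (induction a arbitrary: G) (simp_all add: comp_def)

text \<open>A decomposition of a concatenation decomposes both parts. The additional sign moves the first subword of b past the second subword of a.\<close>
lemma ssum_append:
 "ssum q (a @ b) G = ssum q a (%u v. ssum q b (%u' v'. ksgn (\<Sum>x\<leftarrow>v. \<Sum>y\<leftarrow>u'. q y x) * G (u @ u') (v @ v')))"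
proof (induction a arbitrary: G)
 case (Cons x a)
 have "ssum q a (%u v. ssum q b (%u' v'. ksgn (\<Sum>x\<leftarrow>v. \<Sum>y\<leftarrow>u'. q y x) * (ksgn (\<Sum>y\<leftarrow>u @ u'. q y x) * G (u @ u') (x # v @ v')))) =
  ssum q a (%u v. ksgn (\<Sum>y\<leftarrow>u. q y x) * ssum q b (%u' v'. ksgn (\<Sum>x\<leftarrow>x # v. \<Sum>y\<leftarrow>u'. q y x) * G (u @ u') ((x # v) @ v')))"
  unfolding ssum_scale[symmetric] by (intro ssum_cong) (simp add: ksgn_add mult_ac)
 then show ?case by (simp add: Cons)
qed simp

lemma co_mult_ssum: "co (f * g) w = ssum (%x y. fst x * fst y) w (%u v. co f u * co g v)"
proof (induction w arbitrary: f g)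
 case (Cons z w)
 have "co (f * g) (z # w) = co (Dl z f * g) w + co (tw (fst z) f * Dl z g) w"
  by (simp flip: co_Dl co_add add: Dl_mult)
 then show ?case
  by (simp add: Cons sum_list_const_mult mult.assoc mult.commute[of _ "fst z"] mult.left_commute[of "co f _"])
qed simp

lemma shuffle_perms_Suc:
 assumes "P + Q = Suc k"
 shows "(\<Sum>s\<in>shuffle_perms P Q. F s) =
  (if P > 0 then \<Sum>s\<in>shuffle_perms (P - 1) Q. F (ins 0 s) else 0) +
  (if Q > 0 then \<Sum>s\<in>shuffle_perms P (Q - 1). F (ins P s) else 0)"
proof -
 let ?A = "if P > 0 then ins 0 ` shuffle_perms (P - 1) Q else {}"
 let ?B = "if Q > 0 then ins P ` shuffle_perms P (Q - 1) else {}"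
 have eq: "shuffle_perms P Q = ?A \<union> ?B"
 proof (intro equalityI subsetI)
  fix t assume "t \<in> shuffle_perms P Q"
  then have t: "t permutes {..<Suc k}" "strict_mono_on {..<P} t" "strict_mono_on {P..<Suc k} t"
   using assms by (auto simp: shuffle_perms_def)
  then obtain p s where ps: "t = ins p s" "p \<le> k" "s permutes {..<k}"
   using bij_betw_ins[of k] by (force simp: bij_betw_def)
  have p: "p = 0 \<or> p = P"
  proof (rule ccontr)
   assume *: "\<not> (p = 0 \<or> p = P)"
   then have "ins p s (p - 1) < ins p s p"
   proof (cases "p < P")
    case True
    then have "p - 1 \<in> {..<P}" "p \<in> {..<P}" "p - 1 < p" using * by auto
    then show ?thesis using strict_mono_onD[OF t(2)] ps(1) by blast
   next
    case False
    then have "p - 1 \<in> {P..<Suc k}" "p \<in> {P..<Suc k}" "p - 1 < p" using * ps(2) by auto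
    then show ?thesis using strict_mono_onD[OF t(3)] ps(1) by blast
   qed
   then show False by simp
  qed
  show "t \<in> ?A \<union> ?B"
  proof (cases "p = 0 & P > 0")
   case True
   have "strict_mono_on {..<P - 1} s"
   proof (rule strict_mono_onI)
    fix i j assume "i \<in> {..<P - 1}" "j \<in> {..<P - 1}" "i < j"
    then show "s i < s j" using strict_mono_onD[OF t(2), of "Suc i" "Suc j"] True ps by simp
   qed
   moreover have "strict_mono_on {P - 1..<k} s"
   proof (rule strict_mono_onI)
    fix i j assume "i \<in> {P - 1..<k}" "j \<in> {P - 1..<k}" "i < j"
    then show "s i < s j" using strict_mono_onD[OF t(3), of "Suc i" "Suc j"] True ps by auto
   qed
   moreover have "P - 1 + Q = k" using True assms by simp
   ultimately have "s \<in> shuffle_perms (P - 1) Q" using ps by (simp add: shuffle_perms_def)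
   then show ?thesis using True ps by auto
  next
   case False
   then have pP: "p = P" using p by auto
   then have Q: "Q > 0" "P + (Q - 1) = k" using ps assms by auto
   have "strict_mono_on {..<P} s"
   proof (rule strict_mono_onI)
    fix i j assume "i \<in> {..<P}" "j \<in> {..<P}" "i < j"
    then show "s i < s j" using strict_mono_onD[OF t(2), of i j] pP ps by simp
   qed
   moreover have "strict_mono_on {P..<k} s"
   proof (rule strict_mono_onI)
    fix i j assume "i \<in> {P..<k}" "j \<in> {P..<k}" "i < j"
    then show "s i < s j" using strict_mono_onD[OF t(3), of "Suc i" "Suc j"] pP ps by simp
   qed
   ultimately have "s \<in> shuffle_perms P (Q - 1)" using ps Q by (simp add: shuffle_perms_def)
   then show ?thesis using pP ps Q by auto
  qed
 next
  fix t assume "t \<in> ?A \<union> ?B"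
  then consider s where "P > 0" "t = ins 0 s" "s \<in> shuffle_perms (P - 1) Q"
   | s where "Q > 0" "t = ins P s" "s \<in> shuffle_perms P (Q - 1)" by (auto split: if_splits)
  then show "t \<in> shuffle_perms P Q"
  proof cases
   case 1
   then have k: "P - 1 + Q = k" using assms by simp
   then have s: "s permutes {..<k}" "strict_mono_on {..<P - 1} s" "strict_mono_on {P - 1..<k} s"
    using 1 by (auto simp: shuffle_perms_def)
   have "strict_mono_on {..<P} (ins 0 s)"
    by (rule strict_mono_onI) (auto simp: ins_def intro!: strict_mono_onD[OF s(2)])
   moreover have "strict_mono_on {P..<Suc k} (ins 0 s)"
    using 1 by (intro strict_mono_onI) (auto simp: ins_def intro!: strict_mono_onD[OF s(3)])
   ultimately show ?thesis using ins_permutes[OF s(1), of 0] 1 assms by (simp add: shuffle_perms_def)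
  next
   case 2
   then have k: "P + (Q - 1) = k" using assms by simp
   then have s: "s permutes {..<k}" "strict_mono_on {..<P} s" "strict_mono_on {P..<k} s"
    using 2 by (auto simp: shuffle_perms_def)
   have "strict_mono_on {..<P} (ins P s)"
    by (rule strict_mono_onI) (auto simp: ins_def intro!: strict_mono_onD[OF s(2)])
   moreover have "strict_mono_on {P..<Suc k} (ins P s)"
    by (intro strict_mono_onI) (auto simp: ins_def intro!: strict_mono_onD[OF s(3)])
   ultimately show ?thesis using ins_permutes[OF s(1), of P] 2 k assms by (simp add: shuffle_perms_def)
  qed
 qed
 have inj: "inj_on (ins p) A" for p A by (auto simp: inj_on_def dest: ins_inject)
 have fin: "finite (shuffle_perms a b)" for a b
  by (rule finite_subset[OF _ finite_permutations[of "{..<a + b}"]]) (auto simp: shuffle_perms_def)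
 have "?A \<inter> ?B = {}" by (auto dest: ins_inject)
 then show ?thesis
  unfolding eq by (subst sum.union_disjoint) (auto simp: sum.reindex[OF inj] fin)
qed

text \<open>Shuffle permutations correspond to decompositions of a word into subwords of prescribed lengths.\<close>
lemma sum_shuffle_perms:
 assumes "length a = P + Q"
 shows "(\<Sum>s\<in>shuffle_perms P Q. ksgn (kap q a s) * G (take P (permute_list s a)) (drop P (permute_list s a))) =
  ssum q a (%u v. if length u = P then G u v else 0)"
 using assms
proof (induction a arbitrary: P Q G)
 case Nil
 have "shuffle_perms 0 0 = {id}" by (auto simp: shuffle_perms_def)
 then show ?case using Nil by simp
next
 case (Cons x a)
 have perm: "s permutes {..<length a}" if "s \<in> shuffle_perms P' Q'" "P' + Q' = length a" for s P' Q'
  using that by (simp add: shuffle_perms_def)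
 have 1: "(\<Sum>s\<in>shuffle_perms (P - 1) Q. ksgn (kap q (x # a) (ins 0 s)) *
   G (take P (permute_list (ins 0 s) (x # a))) (drop P (permute_list (ins 0 s) (x # a)))) =
  ssum q a (%u v. if length (x # u) = P then G (x # u) v else 0)" if P: "P > 0"
 proof -
  have len: "P - 1 + Q = length a" using P Cons.prems by simp
  have "(\<Sum>s\<in>shuffle_perms (P - 1) Q. ksgn (kap q (x # a) (ins 0 s)) *
    G (take P (permute_list (ins 0 s) (x # a))) (drop P (permute_list (ins 0 s) (x # a)))) =
   (\<Sum>s\<in>shuffle_perms (P - 1) Q. ksgn (kap q a s) *
    G (x # take (P - 1) (permute_list s a)) (drop (P - 1) (permute_list s a)))"
   using P by (intro sum.cong) (simp_all add: perm[OF _ len] kap_ins permute_list_ins take_Cons' drop_Cons')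
  also have "\<dots> = ssum q a (%u v. if length u = P - 1 then G (x # u) v else 0)"
   using Cons.IH[of "P - 1" Q "%u. G (x # u)"] len by simp
  also have "\<dots> = ssum q a (%u v. if length (x # u) = P then G (x # u) v else 0)"
   using P by (intro ssum_cong) auto
  finally show ?thesis .
 qed
 have 2: "(\<Sum>s\<in>shuffle_perms P (Q - 1). ksgn (kap q (x # a) (ins P s)) *
   G (take P (permute_list (ins P s) (x # a))) (drop P (permute_list (ins P s) (x # a)))) =
  ssum q a (%u v. ksgn (\<Sum>y\<leftarrow>u. q y x) * (if length u = P then G u (x # v) else 0))" if Q: "Q > 0"
 proof -
  have len: "P + (Q - 1) = length a" using Q Cons.prems by simp
  have "(\<Sum>s\<in>shuffle_perms P (Q - 1). ksgn (kap q (x # a) (ins P s)) *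
    G (take P (permute_list (ins P s) (x # a))) (drop P (permute_list (ins P s) (x # a)))) =
   (\<Sum>s\<in>shuffle_perms P (Q - 1). ksgn (kap q a s) * (ksgn (\<Sum>y\<leftarrow>take P (permute_list s a). q y x) *
    G (take P (permute_list s a)) (x # drop P (permute_list s a))))"
  proof (rule sum.cong[OF refl])
   fix s assume s: "s \<in> shuffle_perms P (Q - 1)"
   have P: "P \<le> length a" using len by simp
   have "length (take P (permute_list s a)) = P" using P by simp
   then show "ksgn (kap q (x # a) (ins P s)) *
    G (take P (permute_list (ins P s) (x # a))) (drop P (permute_list (ins P s) (x # a))) =
    ksgn (kap q a s) * (ksgn (\<Sum>y\<leftarrow>take P (permute_list s a). q y x) *
    G (take P (permute_list s a)) (x # drop P (permute_list s a)))"
    using P by (simp add: perm[OF s len] kap_ins permute_list_ins ksgn_add mult_ac)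
  qed
  also have "\<dots> = ssum q a (%u v. if length u = P then ksgn (\<Sum>y\<leftarrow>u. q y x) * G u (x # v) else 0)"
   using Cons.IH[of P "Q - 1" "%u v. ksgn (\<Sum>y\<leftarrow>u. q y x) * G u (x # v)"] len by simp
  also have "\<dots> = ssum q a (%u v. ksgn (\<Sum>y\<leftarrow>u. q y x) * (if length u = P then G u (x # v) else 0))"
   by (intro ssum_cong) auto
  finally show ?thesis .
 qed
 have 3: "ssum q a (%u v. if length (x # u) = P then G (x # u) v else 0) = 0" if "\<not> P > 0"
  using that by simp
 have 4: "ssum q a (%u v. ksgn (\<Sum>y\<leftarrow>u. q y x) * (if length u = P then G u (x # v) else 0)) = 0" if "\<not> Q > 0"
 proof -
  have "ssum q a (%u v. ksgn (\<Sum>y\<leftarrow>u. q y x) * (if length u = P then G u (x # v) else 0)) = ssum q a (%u v. 0)"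
  proof (rule ssum_cong)
   fix u v assume "mset u + mset v = mset a"
   then have "length u \<le> length a" by (metis le_add1 size_mset size_union)
   then show "ksgn (\<Sum>y\<leftarrow>u. q y x) * (if length u = P then G u (x # v) else 0) = 0"
    using that Cons.prems by simp
  qed
  then show ?thesis by simp
 qed
 have if_eq: "(if c then x1 else 0) = y1" if "c ==> x1 = y1" "\<not> c ==> y1 = 0" for c and x1 y1 :: 'b
  using that by auto
 have "P + Q = Suc (length a)" using Cons.prems by simp
 then show ?case
  unfolding ssum.simps by (subst shuffle_perms_Suc) (intro arg_cong2[where f = "(+)"] if_eq 1 2 3 4 | assumption)+
qed

lemma koszul_inverse:
 assumes "r permutes {..<length ds}"
 shows "koszul (permute_list r ds) (inv_into UNIV r) = (koszul ds r :: 'k::field_char_0)"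
proof -
 let ?t = "inv_into UNIV r"
 have t: "?t permutes {..<length ds}" using assms by (rule permutes_inv)
 have tr: "?t (r i) = i" "r (?t i) = i" for i
  using permutes_inverses[OF assms] by simp_all
 have "(\<Sum>(i, j)\<in>Inv (length ds) ?t. permute_list r ds ! ?t i * permute_list r ds ! ?t j) =
  (\<Sum>(i, j)\<in>Inv (length ds) r. ds ! r i * ds ! r j)"
  by (rule sum.reindex_bij_witness[where i = "%(i, j). (r j, r i)" and j = "%(i, j). (?t j, ?t i)"])
   (auto simp: Inv_def tr permutes_lt[OF assms] permutes_lt[OF t] permute_list_nth[OF assms] mult.commute)
 then show ?thesis by (simp add: koszul_kap kap_def)
qed

section \<open>Symmetric algebras and their function models\<close>

lemma const_mon: "const c * mon xs = Poly_Mapping.single (FWord xs) c"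
 by (simp add: const_def mon_def mult_single)

lemma mon_append: "mon (xs @ ys) = mon xs * mon ys"
 by (simp add: mon_def mult_single plus_fword_def)

lemma mon_Nil [simp]: "mon [] = 1"
 by (simp add: mon_def flip: zero_fword_def)

lemma mon_Cons: "mon (x # xs) = mon [x] * mon xs"
 using mon_append[of "[x]" xs] by simp

lemma const_mult: "const (a * b) = const a * const b"
 and const_add: "const (a + b) = const a + const b"
 and const_1 [simp]: "const 1 = 1" and const_0 [simp]: "const 0 = 0"
 by (simp_all add: const_def mult_single single_add)

lemma free_expand: "f = (\<Sum>w\<in>Poly_Mapping.keys f. const (Poly_Mapping.lookup f w) * mon (letters w))"
 by (rule poly_mapping_eqI)
  (auto simp: const_mon lookup_sum lookup_single when_def in_keys_iff)

lemma free_induct [consumes 1, case_names zero add mon]: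
 assumes "\<And>w. w \<in> Poly_Mapping.keys f ==> set (letters w) \<subseteq> S"
  and zero: "P 0" and add: "\<And>f g. P f ==> P g ==> P (f + g)"
  and mon: "\<And>c xs. set xs \<subseteq> S ==> P (const c * mon xs)"
 shows "P f"
proof -
 have "P (\<Sum>w\<in>W. const (Poly_Mapping.lookup f w) * mon (letters w))"
  if "finite W" "W \<subseteq> Poly_Mapping.keys f" for W
  using that
 proof (induction W rule: finite_induct)
  case (insert w W)
  then show ?case using add[OF mon[OF assms(1)[of w]], of "\<Sum>w\<in>W. const (Poly_Mapping.lookup f w) * mon (letters w)"]
   by simp
 qed (simp add: zero)
 from this[OF finite_keys subset_refl] show ?thesis by (simp only: flip: free_expand)
qed

lemmas free_induct' [case_names zero add mon] = free_induct[where S = UNIV, OF subset_UNIV]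

lemma const_central: "f * const c = const c * f"
proof (induction f rule: free_induct')
 case (mon a xs)
 then show ?case by (simp add: const_mon) (simp add: const_def mult_single mult.commute)
qed (simp_all add: distrib_left distrib_right)

lemma const_left: "f * (const c * g) = const c * (f * g)"
 by (metis const_central mult.assoc)

lemma homg_gen: "homg \<phi> (\<phi> y) (gen y)"
 by (rule homg_lin) (simp split: if_splits)

lemma tw_gen: "tw a (gen y) = cst (ksgn (a * fst y)) * gen y"
 by (rule tw_hom, rule homg_gen)

definition wm :: "('l => ('x, 'k::field_char_0) sfun) => 'l list => ('x, 'k) sfun"
 where "wm lm xs = prod_list (map lm xs)"

definition ev :: "(('a, 'm) letter => ('x, 'k::field_char_0) sfun) => ('k, 'a, 'm) free => ('x, 'k) sfun"
 where "ev lm f = (\<Sum>w\<in>Poly_Mapping.keys f. cst (Poly_Mapping.lookup f w) * wm lm (letters w))"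

lemma ev_superset:
 assumes "finite W" "Poly_Mapping.keys f \<subseteq> W"
 shows "ev lm f = (\<Sum>w\<in>W. cst (Poly_Mapping.lookup f w) * wm lm (letters w))"
 unfolding ev_def using assms by (intro sum.mono_neutral_left) (auto simp: in_keys_iff)

lemma ev_add [simp]: "ev lm (f + g) = ev lm f + ev lm g"
proof -
 let ?W = "Poly_Mapping.keys f \<union> Poly_Mapping.keys g"
 have "ev lm f = (\<Sum>w\<in>?W. cst (Poly_Mapping.lookup f w) * wm lm (letters w))"
  "ev lm g = (\<Sum>w\<in>?W. cst (Poly_Mapping.lookup g w) * wm lm (letters w))"
  "ev lm (f + g) = (\<Sum>w\<in>?W. cst (Poly_Mapping.lookup (f + g) w) * wm lm (letters w))"
  by (rule ev_superset; simp add: Poly_Mapping.keys_add)+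
 then show ?thesis by (simp add: lookup_add cst_add distrib_right sum.distrib)
qed

lemma ev_0 [simp]: "ev lm 0 = 0"
 by (simp add: ev_def)

lemma ev_uminus [simp]: "ev lm (- f) = - ev lm f"
 using ev_add[of lm f "- f"] by (simp add: eq_neg_iff_add_eq_0 add.commute del: ev_add)

lemma ev_diff [simp]: "ev lm (f - g) = ev lm f - ev lm g"
 using ev_add[of lm f "- g"] by simp

lemma ev_sum [simp]: "ev lm (sum f A) = (\<Sum>x\<in>A. ev lm (f x))"
 by (induction A rule: infinite_finite_induct) simp_all

lemma ev_const_mon: "ev lm (const c * mon xs) = cst c * wm lm xs"
 unfolding const_mon ev_def by (cases "c = 0") simp_all

lemma wm_simps [simp]: "wm lm [] = 1" "wm lm (x # xs) = lm x * wm lm xs" "wm lm (xs @ ys) = wm lm xs * wm lm ys"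
 by (simp_all add: wm_def)

lemma ev_mon [simp]: "ev lm (mon xs) = wm lm xs" and ev_const [simp]: "ev lm (const c) = cst c"
 using ev_const_mon[of lm 1 xs] ev_const_mon[of lm c "[]"] by simp_all

lemma ev_1 [simp]: "ev lm 1 = 1"
 using ev_mon[of lm "[]"] by simp

lemma ev_mult [simp]: "ev lm (f * g) = ev lm f * ev lm g"
proof (induction f rule: free_induct')
 case (mon c xs)
 show ?case
 proof (induction g rule: free_induct')
  case (mon d ys)
  have "(const c * mon xs) * (const d * mon ys) = const (c * d) * mon (xs @ ys)"
   by (simp add: const_mult mon_append mult.assoc const_left[of "mon _"])
  then show ?case
   by (simp only: ev_const_mon wm_simps) (simp add: cst_mult mult.assoc cst_left[of "wm _ _"])
 qed (simp_all add: distrib_left)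
qed (simp_all add: distrib_right)

context
 fixes A :: "('k::field_char_0, 'a) cdga" and M :: "('a, 'm) dgmod"
begin

lemma carrier_sym_free: "f \<in> carrier (sym_free A M) \<longleftrightarrow> (\<forall>w\<in>Poly_Mapping.keys f. set (letters w) \<subseteq> sym_letters A M)"
 by (simp add: sym_free_def)

lemma sym_free_simps [simp]: "f \<otimes>\<^bsub>sym_free A M\<^esub> g = f * g" "f \<oplus>\<^bsub>sym_free A M\<^esub> g = f + g"
 "\<one>\<^bsub>sym_free A M\<^esub> = 1" "\<zero>\<^bsub>sym_free A M\<^esub> = 0"
 by (simp_all add: sym_free_def)

lemma carrier_closed [simp]:
 "f \<in> carrier (sym_free A M) ==> g \<in> carrier (sym_free A M) ==> f + g \<in> carrier (sym_free A M)"
 "f \<in> carrier (sym_free A M) ==> - f \<in> carrier (sym_free A M)"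
 "f \<in> carrier (sym_free A M) ==> g \<in> carrier (sym_free A M) ==> f * g \<in> carrier (sym_free A M)"
 "0 \<in> carrier (sym_free A M)" "1 \<in> carrier (sym_free A M)" "const c \<in> carrier (sym_free A M)"
proof goal_cases
 case 1
 then show ?case using Poly_Mapping.keys_add[of f g] by (auto simp: carrier_sym_free dest!: subsetD)
next
 case 2
 then show ?case by (simp add: carrier_sym_free in_keys_iff)
next
 case 3
 then show ?case using keys_mult[of f g] by (fastforce simp: carrier_sym_free plus_fword_def)
next
 case 4
 then show ?case by (simp add: carrier_sym_free)
next
 case 5
 then show ?case by (simp add: carrier_sym_free zero_fword_def)
next
 case 6
 then show ?case by (simp add: carrier_sym_free const_def zero_fword_def)
qed

lemma carrier_diff [simp]:
 "f \<in> carrier (sym_free A M) ==> g \<in> carrier (sym_free A M) ==> f - g \<in> carrier (sym_free A M)"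
 using carrier_closed(1)[of f "- g"] carrier_closed(2)[of g] by simp

lemma carrier_mon [simp]: "mon xs \<in> carrier (sym_free A M) \<longleftrightarrow> set xs \<subseteq> sym_letters A M"
 by (simp add: carrier_sym_free mon_def)

lemma carrier_sum: "(\<And>x. x \<in> S ==> f x \<in> carrier (sym_free A M)) ==> sum f S \<in> carrier (sym_free A M)"
 by (induction S rule: infinite_finite_induct) simp_all

lemma ring_sym_free: "ring (sym_free A M)"
proof (rule ringI)
 show "abelian_group (sym_free A M)"
 proof (rule abelian_groupI)
  fix x assume "x \<in> carrier (sym_free A M)"
  then show "\<exists>y\<in>carrier (sym_free A M). y \<oplus>\<^bsub>sym_free A M\<^esub> x = \<zero>\<^bsub>sym_free A M\<^esub>"
   by (intro bexI[of _ "- x"]) simp_all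
 qed (simp_all add: add.assoc add.commute)
 show "Group.monoid (sym_free A M)"
  by (rule Group.monoidI) (simp_all add: mult.assoc)
qed (simp_all add: distrib_left distrib_right)

lemma carrier_induct [consumes 1, case_names zero add mon]:
 assumes "f \<in> carrier (sym_free A M)"
  and "P 0" "\<And>f g. P f ==> P g ==> P (f + g)"
  and "\<And>c xs. set xs \<subseteq> sym_letters A M ==> P (const c * mon xs)"
 shows "P f"
proof (rule free_induct[where S = "sym_letters A M" and P = P])
 show "set (letters w) \<subseteq> sym_letters A M" if "w \<in> Poly_Mapping.keys f" for w
  using assms(1) that by (simp add: carrier_sym_free)
qed (fact assms)+

end

text \<open>Elements that are congruent, modulo the relations, to combinations of words in chosen generators.\<close>
inductive_set reducible :: "('k::field_char_0, 'a) cdga => ('a, 'm) dgmod => (int \<times> 'x => ('a, 'm) letter) =>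
  (int \<times> 'x) set => ('k, 'a, 'm) free set"
 for A M lz L
 where
  red_mon: "set w \<subseteq> L ==> mon (map lz w) \<in> reducible A M lz L"
 | red_add: "f \<in> reducible A M lz L ==> g \<in> reducible A M lz L ==> f + g \<in> reducible A M lz L"
 | red_scale: "f \<in> reducible A M lz L ==> const c * f \<in> reducible A M lz L"
 | red_cong: "f \<in> reducible A M lz L ==> g \<in> carrier (sym_free A M) ==> g - f \<in> sym_ideal A M ==> g \<in> reducible A M lz L"

locale sym_pres =
 fixes A :: "('k::field_char_0, 'a) cdga" and M :: "('a, 'm) dgmod"
 assumes rels_carrier: "sym_rels A M \<subseteq> carrier (sym_free A M)"
begin

abbreviation "F \<equiv> sym_free A M"
abbreviation "I \<equiv> sym_ideal A M"

lemma ideal_I: "ideal I F"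
 unfolding sym_ideal_def by (rule ring.genideal_ideal[OF ring_sym_free rels_carrier])

lemma rels_I: "r \<in> sym_rels A M ==> r \<in> I"
 unfolding sym_ideal_def using ring.genideal_self[OF ring_sym_free rels_carrier] by blast

lemma I_carrier: "f \<in> I ==> f \<in> carrier F"
 using ideal.Icarr[OF ideal_I] .

lemma I_closed: "0 \<in> I" "f \<in> I ==> g \<in> I ==> f + g \<in> I"
 "f \<in> I ==> h \<in> carrier F ==> h * f \<in> I" "f \<in> I ==> h \<in> carrier F ==> f * h \<in> I"
proof -
 interpret I: ideal I F by (rule ideal_I)
 show "0 \<in> I" using additive_subgroup.zero_closed[OF ideal.axioms(1)[OF ideal_I]] by simp
 show "f + g \<in> I" if "f \<in> I" "g \<in> I" using additive_subgroup.a_closed[OF ideal.axioms(1)[OF ideal_I] that] by simp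
 show "h * f \<in> I" if "f \<in> I" "h \<in> carrier F" using I.I_l_closed[OF that] by simp
 show "f * h \<in> I" if "f \<in> I" "h \<in> carrier F" using I.I_r_closed[OF that] by simp
qed

lemma I_uminus: "f \<in> I ==> - f \<in> I"
 using I_closed(3)[of f "- 1"] by simp

lemma I_diff: "f \<in> I ==> g \<in> I ==> f - g \<in> I"
 using I_closed(2)[of f "- g"] I_uminus[of g] by simp

lemma I_sum: "(\<And>x. x \<in> S ==> f x \<in> I) ==> sum f S \<in> I"
 by (induction S rule: infinite_finite_induct) (simp_all add: I_closed)

definition cong (infix "\<approx>" 50) where "f \<approx> g \<longleftrightarrow> f - g \<in> I"

lemma cong_refl [simp]: "f \<approx> f" by (simp add: cong_def I_closed)

lemma cong_trans [trans]: "f \<approx> g ==> g \<approx> h ==> f \<approx> h"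
 using I_closed(2)[of "f - g" "g - h"] by (simp add: cong_def)

lemma cong_sym: "f \<approx> g ==> g \<approx> f"
 using I_uminus[of "f - g"] by (simp add: cong_def)

lemma cong_add: "f \<approx> g ==> f' \<approx> g' ==> f + f' \<approx> g + g'"
 using I_closed(2)[of "f - g" "f' - g'"] by (simp add: cong_def algebra_simps)

lemma cong_mult_left: "f \<approx> g ==> h \<in> carrier F ==> h * f \<approx> h * g"
 using I_closed(3)[of "f - g" h] by (simp add: cong_def algebra_simps)

lemma cong_mult_right: "f \<approx> g ==> h \<in> carrier F ==> f * h \<approx> g * h"
 using I_closed(4)[of "f - g" h] by (simp add: cong_def algebra_simps)

lemma cong_sum: "(\<And>x. x \<in> S ==> f x \<approx> g x) ==> sum f S \<approx> sum g S"
 using I_sum[of S "%x. f x - g x"] by (simp add: cong_def sum_subtractf)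

lemma rel_Coef_add:
 assumes "a \<in> cpart A i" "b \<in> cpart A i"
 shows "mon [Coef i (a \<oplus>\<^bsub>A\<^esub> b)] \<approx> mon [Coef i a] + mon [Coef i b]"
 using rels_I[of "mon [Coef i (a \<oplus>\<^bsub>A\<^esub> b)] - mon [Coef i a] - mon [Coef i b]"] assms
 unfolding cong_def sym_rels_def diff_diff_eq by blast

lemma rel_Coef_scale: "a \<in> cpart A i ==> mon [Coef i (csmult A c a)] \<approx> const c * mon [Coef i a]"
 unfolding cong_def by (rule rels_I) (unfold sym_rels_def, blast)

lemma rel_Coef_mult:
 assumes "a \<in> cpart A i" "b \<in> cpart A j"
 shows "mon [Coef i a] * mon [Coef j b] \<approx> mon [Coef (i + j) (a \<otimes>\<^bsub>A\<^esub> b)]"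
 unfolding cong_def mon_Cons[of _ "[_]", symmetric] by (rule rels_I) (use assms in \<open>unfold sym_rels_def, blast\<close>)

lemma rel_Coef_one: "mon [Coef 0 \<one>\<^bsub>A\<^esub>] \<approx> 1"
 unfolding cong_def mon_Nil[symmetric] by (rule rels_I) (unfold sym_rels_def, blast)

lemma rel_Gen_add:
 assumes "x \<in> mpart M i" "y \<in> mpart M i"
 shows "mon [Gen i (madd M x y)] \<approx> mon [Gen i x] + mon [Gen i y]"
 using rels_I[of "mon [Gen i (madd M x y)] - mon [Gen i x] - mon [Gen i y]"] assms
 unfolding cong_def sym_rels_def diff_diff_eq by blast

lemma rel_Gen_smult:
 assumes "a \<in> cpart A i" "x \<in> mpart M j"
 shows "mon [Coef i a] * mon [Gen j x] \<approx> mon [Gen (i + j) (msmult M i a x)]"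
 unfolding cong_def mon_Cons[of _ "[_]", symmetric] by (rule rels_I) (use assms in \<open>unfold sym_rels_def, blast\<close>)

lemma double_zero: "f \<approx> f + f ==> f \<approx> 0"
 using I_uminus[of "f - (f + f)"] by (simp add: cong_def)

lemma letter_commute:
 assumes "u \<in> sym_letters A M" "v \<in> sym_letters A M"
 shows "mon [u, v] \<approx> const (ksgn (ldeg u * ldeg v)) * mon [v, u]"
 unfolding cong_def by (rule rels_I, unfold sym_rels_def, rule UnI2) (use assms in blast)

end

locale sym_gens = sym_pres A M for A :: "('k::field_char_0, 'a) cdga" and M :: "('a, 'm) dgmod" +
 fixes L :: "(int \<times> 'x) set" and lz :: "int \<times> 'x => ('a, 'm) letter"
 assumes lz_letter: "z \<in> L ==> lz z \<in> sym_letters A M"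
begin

abbreviation "R \<equiv> reducible A M lz L"

lemma reducible_carrier: "f \<in> reducible A M lz L ==> f \<in> carrier F"
 by (induction rule: reducible.induct) (auto simp: lz_letter)

lemma reducible_cong: "f \<approx> h ==> f \<in> carrier F ==> h \<in> R ==> f \<in> R"
 unfolding cong_def by (rule red_cong)

lemma reducible_0 [simp]: "0 \<in> R"
 using red_scale[OF red_mon[of "[]"], where c = 0] by simp

lemma reducible_1 [simp]: "1 \<in> R"
 using red_mon[of "[]"] by simp

lemma reducible_mult:
 assumes "f \<in> reducible A M lz L" "g \<in> reducible A M lz L" shows "f * g \<in> reducible A M lz L"
 using assms(1)
proof (induction rule: reducible.induct)
 case (red_mon w)
 show ?case using assms(2)
 proof (induction rule: reducible.induct)
  case (red_mon w')
  then show ?case using \<open>set w \<subseteq> L\<close> reducible.red_mon[where w = "w @ w'" and L = L and A = A and M = M and lz = lz] by (simp add: mon_append)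
 next
  case (red_add f g)
  then show ?case by (simp add: distrib_left reducible.red_add)
 next
  case (red_scale f c)
  then show ?case by (simp add: const_left[of "mon _"] reducible.red_scale)
 next
  case (red_cong f g)
  have "mon (map lz w) \<in> carrier F" using \<open>set w \<subseteq> L\<close> lz_letter by auto
  then show ?case
   using red_cong cong_mult_left[OF red_cong(3)[folded cong_def], unfolded cong_def] by (blast intro: reducible.red_cong carrier_closed(3))
 qed
next
 case (red_add f g)
 then show ?case by (simp add: distrib_right reducible.red_add)
next
 case (red_scale f c)
 then show ?case by (simp add: mult.assoc reducible.red_scale)
next
 case (red_cong f g')
 then show ?case
  using cong_mult_right[OF red_cong(3)[folded cong_def], unfolded cong_def] reducible_carrier[OF assms(2)]
  by (blast intro: reducible.red_cong carrier_closed(3))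
qed

end

text \<open>These data identify a symmetric algebra with the graded symmetric functions on words in finitely many generators: the relations hold for the functions assigned to the letters, and modulo the relations every letter is a combination of words in the generators.\<close>
locale sym_model = sym_gens A M L lz
 for A :: "('k::field_char_0, 'a) cdga" and M :: "('a, 'm) dgmod"
  and L :: "(int \<times> 'x) set" and lz :: "int \<times> 'x => ('a, 'm) letter" +
 fixes lm :: "('a, 'm) letter => ('x, 'k) sfun" and wt :: "int \<times> 'x => int"
 assumes finite_L: "finite L"
  and ev_rels: "r \<in> sym_rels A M ==> ev lm r = 0"
  and lm_symset: "u \<in> sym_letters A M ==> lm u \<in> symset L"
  and lm_hom: "u \<in> sym_letters A M ==> hom (ldeg u) (lm u)"
  and lm_wt: "u \<in> sym_letters A M ==> homg wt (int (lweight u)) (lm u)"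
  and lm_lz: "z \<in> L ==> lm (lz z) = gen z"
  and letter_reducible: "u \<in> sym_letters A M ==> mon [u] \<in> reducible A M lz L"
begin

abbreviation "P \<equiv> sym_alg A M"
abbreviation "cls \<equiv> sym_cls A M"

lemma wm_symset: "set xs \<subseteq> sym_letters A M ==> wm lm xs \<in> symset L"
 by (induction xs) (auto intro!: symset_mult lm_symset)

lemma ev_symset: "f \<in> carrier F ==> ev lm f \<in> symset L"
 by (induction rule: carrier_induct) (simp_all add: symset_add ev_const_mon symset_scale wm_symset)

lemma I_ker: assumes "f \<in> I" shows "ev lm f = 0"
proof -
 let ?K = "{f \<in> carrier F. ev lm f = 0}"
 interpret F: ring F by (rule ring_sym_free)
 have "ideal ?K F"
 proof (rule idealI[OF ring_sym_free])
  show "subgroup ?K (add_monoid F)"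
  proof
   fix x assume "x \<in> ?K"
   then have "\<ominus>\<^bsub>F\<^esub> x = - x" "- x \<in> ?K"
    using F.minus_equality[of "- x" x] by simp_all
   then show "inv\<^bsub>add_monoid F\<^esub> x \<in> ?K" by (simp add: a_inv_def)
  qed auto
 qed auto
 moreover have "sym_rels A M \<subseteq> ?K" using rels_carrier ev_rels by auto
 ultimately have "I \<subseteq> ?K"
  unfolding sym_ideal_def by (rule F.genideal_minimal)
 with assms show ?thesis by auto
qed

lemma ldeg_lz: "z \<in> L ==> ldeg (lz z) = fst z"
 using lm_hom[OF lz_letter, of z] by (force simp: lm_lz homg_def dest: spec[of _ "[z]"])

lemma lz_commute:
 assumes "y \<in> L" "z \<in> L"
 shows "mon [lz z] * mon [lz y] \<approx> const (ksgn (fst z * fst y)) * (mon [lz y] * mon [lz z])"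
 using letter_commute[OF lz_letter[OF assms(2)] lz_letter[OF assms(1)]] assms
 by (simp add: ldeg_lz mon_Cons[of _ "[_]"])

text \<open>A candidate for the inverse of the evaluation, on the component of length k and up to the factor k!: first letters are split off one after the other and replaced by generators.\<close>
fun Xi :: "nat => ('x, 'k) sfun => ('k, 'a, 'm) free"
 where
  "Xi 0 f = const (co f [])"
 | "Xi (Suc k) f = (\<Sum>z\<in>L. mon [lz z] * Xi k (Dl z f))"

lemma Xi_add: "Xi k (f + g) = Xi k f + Xi k g"
 by (induction k arbitrary: f g) (simp_all add: const_add distrib_left sum.distrib)

lemma Xi_scale: "Xi k (cst c * f) = const c * Xi k f"
 by (induction k arbitrary: f) (simp_all add: const_mult sum_distrib_left const_left[of "mon _"] co_cst)

lemma Xi_zero [simp]: "Xi k 0 = 0"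
 using Xi_scale[of k 0 0] by simp

lemma Xi_carrier: "Xi k f \<in> carrier F"
 by (induction k arbitrary: f) (auto intro!: carrier_sum carrier_closed(3) simp: lz_letter)

lemma Xi_gen:
 assumes y: "y \<in> L" shows "Xi (Suc k) (gen y * h) \<approx> const (of_nat (Suc k)) * (mon [lz y] * Xi k h)"
proof (induction k arbitrary: h)
 have D: "Dl z (gen y * h) = cst (if z = y then 1 else 0) * h + cst (ksgn (fst z * fst y)) * (gen y * Dl z h)" for z and h :: "('x, 'k) sfun"
  by (simp add: Dl_mult tw_gen mult.assoc)
 have X: "Xi (Suc k) (gen y * h) = mon [lz y] * Xi k h + (\<Sum>z\<in>L. const (ksgn (fst z * fst y)) * (mon [lz z] * Xi k (gen y * Dl z h)))" for k h
 proof -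
  have "(\<Sum>z\<in>L. mon [lz z] * (const (if z = y then 1 else 0) * Xi k h)) = (\<Sum>z\<in>L. if z = y then mon [lz z] * Xi k h else 0)"
   by (intro sum.cong) auto
  then show ?thesis
   using y finite_L by (simp add: D Xi_add Xi_scale distrib_left sum.distrib const_left[of "mon _"] del: if_cancel)
 qed
 case 0
 show ?case unfolding X by simp
 case (Suc k)
 have "(\<Sum>z\<in>L. const (ksgn (fst z * fst y)) * (mon [lz z] * Xi (Suc k) (gen y * Dl z h)))
  \<approx> (\<Sum>z\<in>L. const (of_nat (Suc k)) * (mon [lz y] * (mon [lz z] * Xi k (Dl z h))))"
 proof (rule cong_sum)
  fix z assume z: "z \<in> L"
  let ?s = "const (ksgn (fst z * fst y))"
  have "?s * (mon [lz z] * Xi (Suc k) (gen y * Dl z h)) \<approx>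
    ?s * (mon [lz z] * (const (of_nat (Suc k)) * (mon [lz y] * Xi k (Dl z h))))"
   using z by (intro cong_mult_left Suc.IH) (simp_all add: lz_letter)
  also have "?s * (mon [lz z] * (const (of_nat (Suc k)) * (mon [lz y] * Xi k (Dl z h)))) =
    (?s * const (of_nat (Suc k))) * ((mon [lz z] * mon [lz y]) * Xi k (Dl z h))"
   by (simp add: mult.assoc const_left[of "mon _"])
  also have "\<dots> \<approx> (?s * const (of_nat (Suc k))) * ((?s * (mon [lz y] * mon [lz z])) * Xi k (Dl z h))"
   by (intro cong_mult_left cong_mult_right lz_commute y z) (simp_all add: Xi_carrier)
  also have "\<dots> = const (of_nat (Suc k)) * ((?s * ?s) * (mon [lz y] * (mon [lz z] * Xi k (Dl z h))))"
   by (simp only: mult.assoc const_left[of ?s "of_nat (Suc k)"])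
  also have "?s * ?s = 1" by (simp flip: const_mult)
  finally show "?s * (mon [lz z] * Xi (Suc k) (gen y * Dl z h)) \<approx>
    const (of_nat (Suc k)) * (mon [lz y] * (mon [lz z] * Xi k (Dl z h)))" by simp
 qed
 also have "(\<Sum>z\<in>L. const (of_nat (Suc k)) * (mon [lz y] * (mon [lz z] * Xi k (Dl z h)))) =
   const (of_nat (Suc k)) * (mon [lz y] * Xi (Suc k) h)"
  by (simp add: sum_distrib_left)
 finally have "Xi (Suc (Suc k)) (gen y * h) \<approx> mon [lz y] * Xi (Suc k) h + const (of_nat (Suc k)) * (mon [lz y] * Xi (Suc k) h)"
  unfolding X[of "Suc k"] by (intro cong_add) simp_all
 then show ?case
  by (simp only: of_nat_Suc[of "Suc k"] const_add const_1 distrib_right mult_1)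
qed

lemma Xi_lw:
 "set w \<subseteq> L ==> Xi k (lw w) \<approx> (if k = length w then const (fact k) * mon (map lz w) else 0)"
proof (induction w arbitrary: k)
 case Nil
 then show ?case by (cases k) (simp_all add: co_one I_closed)
next
 case (Cons y w)
 show ?case
 proof (cases k)
  case 0
  then show ?thesis by (simp add: I_closed)
 next
  case (Suc k')
  have w: "set (map lz (y # w)) \<subseteq> sym_letters A M" using Cons.prems lz_letter by auto
  have "Xi (Suc k') (gen y * lw w) \<approx> const (of_nat (Suc k')) * (mon [lz y] * Xi k' (lw w))"
   using Cons.prems by (intro Xi_gen) simp
  also have "\<dots> \<approx> const (of_nat (Suc k')) * (mon [lz y] * (if k' = length w then const (fact k') * mon (map lz w) else 0))"
   using Cons.prems w by (intro cong_mult_left Cons.IH) auto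
  also have "\<dots> = (if k = length (y # w) then const (fact k) * mon (map lz (y # w)) else 0)"
   using Suc by (simp add: const_left[of "mon _"] mon_Cons[of _ "map lz w"] const_mult mult.assoc del: of_nat_Suc)
  finally show ?thesis by (simp add: Suc)
 qed
qed

lemma reducible_recover:
 assumes "f \<in> reducible A M lz L"
 shows "\<exists>N0. \<forall>N\<ge>N0. (\<Sum>k\<le>N. const (1 / fact k) * Xi k (ev lm f)) \<approx> f"
 using assms
proof (induction rule: reducible.induct)
 case (red_mon w)
 have ev: "ev lm (mon (map lz w)) = lw w"
  using red_mon by (induction w) (auto simp: lm_lz)
 have "(\<Sum>k\<le>N. const (1 / fact k) * Xi k (lw w)) \<approx> mon (map lz w)" if "N \<ge> length w" for N
 proof -
  have "(\<Sum>k\<le>N. const (1 / fact k) * Xi k (lw w)) \<approx>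
   (\<Sum>k\<le>N. const (1 / fact k) * (if k = length w then const (fact k) * mon (map lz w) else 0))"
   by (intro cong_sum cong_mult_left Xi_lw red_mon) simp
  also have "(\<Sum>k\<le>N. const (1 / fact k) * (if k = length w then const (fact k) * mon (map lz w) else 0)) =
   (\<Sum>k\<le>N. if k = length w then mon (map lz w) else 0)"
   by (intro sum.cong) (simp_all flip: mult.assoc const_mult)
  also have "\<dots> = mon (map lz w)" using that by simp
  finally show ?thesis .
 qed
 then show ?case unfolding ev by blast
next
 case (red_add f g)
 then obtain N1 N2 where N: "\<And>N. N \<ge> N1 ==> (\<Sum>k\<le>N. const (1 / fact k) * Xi k (ev lm f)) \<approx> f"
  "\<And>N. N \<ge> N2 ==> (\<Sum>k\<le>N. const (1 / fact k) * Xi k (ev lm g)) \<approx> g" by blast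
 show ?case
  using cong_add[OF N] by (intro exI[of _ "max N1 N2"]) (simp add: Xi_add distrib_left sum.distrib)
next
 case (red_scale f c)
 then obtain N1 where N: "\<And>N. N \<ge> N1 ==> (\<Sum>k\<le>N. const (1 / fact k) * Xi k (ev lm f)) \<approx> f" by blast
 have "(\<Sum>k\<le>N. const (1 / fact k) * Xi k (ev lm (const c * f))) = const c * (\<Sum>k\<le>N. const (1 / fact k) * Xi k (ev lm f))" for N
  by (simp add: Xi_scale sum_distrib_left const_left[of "const (inverse (fact _))"] inverse_eq_divide[symmetric])
 then show ?case using cong_mult_left[OF N] by (intro exI[of _ N1]) simp
next
 case (red_cong f g)
 then have "ev lm g = ev lm f" using I_ker[of "g - f"] by simp
 moreover obtain N1 where N: "\<And>N. N \<ge> N1 ==> (\<Sum>k\<le>N. const (1 / fact k) * Xi k (ev lm f)) \<approx> f"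
  using red_cong by blast
 ultimately show ?case using cong_trans[OF N cong_sym[OF red_cong(3)[folded cong_def]]] by auto
qed

lemma carrier_reducible: "f \<in> carrier F ==> f \<in> reducible A M lz L"
proof (induction rule: carrier_induct)
 case zero
 show ?case by simp
next
 case (mon c xs)
 then have "mon xs \<in> reducible A M lz L"
 proof (induction xs)
  case Nil
  show ?case using red_mon[of "[]"] by simp
 next
  case (Cons x xs)
  then show ?case by (subst mon_Cons) (auto intro!: reducible_mult letter_reducible)
 qed
 then show ?case by (rule red_scale)
qed (rule red_add)

text \<open>The relations evaluate to 0. Conversely, a combination of words in the generators is recovered from its value by \<open>Xi\<close> modulo the relations, because generators commute up to Koszul signs there.\<close>
theorem ker_ev: "f \<in> carrier F ==> ev lm f = 0 \<longleftrightarrow> f \<in> I"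
proof
 assume f: "f \<in> carrier F" "ev lm f = 0"
 obtain N0 where "(\<Sum>k\<le>N0. const (1 / fact k) * Xi k (ev lm f)) \<approx> f"
  using reducible_recover[OF carrier_reducible[OF f(1)]] by blast
 then show "f \<in> I" using f(2) I_uminus by (fastforce simp: cong_def)
qed (rule I_ker)

text \<open>Cosets are evaluated on an arbitrary representative, which is legitimate because the evaluation kills the ideal.\<close>
definition Psi :: "('k, 'a, 'm) free set => ('x, 'k) sfun"
 where "Psi X = ev lm (SOME f. f \<in> X)"

lemma cls_eq: "cls f = {h + f |h. h \<in> I}"
 by (auto simp: sym_cls_def a_r_coset_def r_coset_def)

lemma in_cls: "f \<in> cls f"
 unfolding cls_eq using I_closed(1) by fastforce

lemma Psi_mem: "g \<in> cls f ==> ev lm g = ev lm f"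
 by (auto simp: cls_eq I_ker)

lemma Psi_cls [simp]: "Psi (cls f) = ev lm f"
 unfolding Psi_def by (rule Psi_mem, rule someI[of "%x. x \<in> cls f", OF in_cls])

lemma cls_eq_iff:
 assumes "f \<in> carrier F" "g \<in> carrier F" shows "cls f = cls g \<longleftrightarrow> ev lm f = ev lm g"
proof
 assume "ev lm f = ev lm g"
 then have fg: "f - g \<in> I" using assms by (simp flip: ker_ev)
 have "h + f = (h + (f - g)) + g" "h + g = (h - (f - g)) + f" for h by simp_all
 then show "cls f = cls g"
  unfolding cls_eq using I_closed(2)[OF _ fg] I_diff[OF _ fg] by blast
qed (metis Psi_cls)

lemma carrier_P: "carrier P = cls ` carrier F"
 by (auto simp: sym_alg_def Let_def FactRing_def A_RCOSETS_def' sym_cls_def)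

lemma P_ops:
 assumes "f \<in> carrier F" "g \<in> carrier F"
 shows "cls f \<oplus>\<^bsub>P\<^esub> cls g = cls (f + g)" "cls f \<otimes>\<^bsub>P\<^esub> cls g = cls (f * g)"
  "csmult P c (cls g) = cls (const c * g)"
 using ideal.rcoset_mult_add[OF ideal_I, of f g] ideal.rcoset_mult_add[OF ideal_I, of "const c" g]
  abelian_subgroup.a_rcos_sum[OF abelian_subgroupI3[OF ideal.axioms(1)[OF ideal_I] ring.is_abelian_group[OF ring_sym_free]], of f g] assms
 by (simp_all add: sym_alg_def Let_def FactRing_def sym_cls_def)

lemma P_01: "\<zero>\<^bsub>P\<^esub> = cls 0" "\<one>\<^bsub>P\<^esub> = cls 1"
 by (simp_all add: sym_alg_def Let_def FactRing_def sym_cls_def cls_eq[unfolded sym_cls_def])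

lemma P_cases: assumes "X \<in> carrier P" obtains f where "f \<in> carrier F" "X = cls f"
 using assms by (auto simp: carrier_P)

lemma cls_carrier: "f \<in> carrier F ==> cls f \<in> carrier P"
 by (simp add: carrier_P)

lemma Psi_inj: "X \<in> carrier P ==> Y \<in> carrier P ==> Psi X = Psi Y ==> X = Y"
 by (metis P_cases Psi_cls cls_eq_iff)

lemma Psi_symset: "X \<in> carrier P ==> Psi X \<in> symset L"
 by (metis P_cases Psi_cls ev_symset)

lemma Psi_surj: assumes "f \<in> symset L" obtains X where "X \<in> carrier P" "Psi X = f"
proof -
 have "\<exists>X\<in>carrier F. ev lm X = f"
 proof (rule symset_induct[OF finite_L assms])
  show "\<exists>X\<in>carrier F. ev lm X = 0" by (intro bexI[of _ 0]) simp_all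
  show "\<exists>X\<in>carrier F. ev lm X = f + g" if "\<exists>X\<in>carrier F. ev lm X = f" "\<exists>X\<in>carrier F. ev lm X = g" for f g
   using that carrier_closed(1)[of _ A M] ev_add by metis
  show "\<exists>X\<in>carrier F. ev lm X = cst c * f" if "\<exists>X\<in>carrier F. ev lm X = f" for c f
   using that carrier_closed(3)[OF carrier_closed(6)] ev_mult ev_const by metis
  show "\<exists>X\<in>carrier F. ev lm X = lw w" if "set w \<subseteq> L" for w
  proof -
   have "ev lm (mon (map lz w)) = lw w" using that by (induction w) (auto simp: lm_lz)
   moreover have "mon (map lz w) \<in> carrier F" using that lz_letter by auto
   ultimately show ?thesis by blast
  qed
 qed
 then show ?thesis using that cls_carrier Psi_cls by blast
qed

lemma P_closed [simp]:
 "X \<in> carrier P ==> Y \<in> carrier P ==> X \<oplus>\<^bsub>P\<^esub> Y \<in> carrier P"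
 "X \<in> carrier P ==> Y \<in> carrier P ==> X \<otimes>\<^bsub>P\<^esub> Y \<in> carrier P"
 "X \<in> carrier P ==> csmult P c X \<in> carrier P" "\<zero>\<^bsub>P\<^esub> \<in> carrier P" "\<one>\<^bsub>P\<^esub> \<in> carrier P"
 by (auto elim!: P_cases simp: P_ops P_01 intro!: cls_carrier)

lemma Psi_ops [simp]:
 "X \<in> carrier P ==> Y \<in> carrier P ==> Psi (X \<oplus>\<^bsub>P\<^esub> Y) = Psi X + Psi Y"
 "X \<in> carrier P ==> Y \<in> carrier P ==> Psi (X \<otimes>\<^bsub>P\<^esub> Y) = Psi X * Psi Y"
 "X \<in> carrier P ==> Psi (csmult P c X) = cst c * Psi X" "Psi \<zero>\<^bsub>P\<^esub> = 0" "Psi \<one>\<^bsub>P\<^esub> = 1"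
 by (auto elim!: P_cases simp: P_ops P_01)

lemma abelian_group_P: "abelian_group P"
proof (rule abelian_groupI)
 fix X assume X: "X \<in> carrier P"
 show "\<exists>Y\<in>carrier P. Y \<oplus>\<^bsub>P\<^esub> X = \<zero>\<^bsub>P\<^esub>"
  using X by (intro bexI[of _ "csmult P (- 1) X"] Psi_inj) (simp_all add: cst_uminus)
qed (rule Psi_inj; simp add: add_ac | simp)+

lemma Psi_minus [simp]:
 assumes "X \<in> carrier P" "Y \<in> carrier P"
 shows "X \<ominus>\<^bsub>P\<^esub> Y \<in> carrier P" "Psi (X \<ominus>\<^bsub>P\<^esub> Y) = Psi X - Psi Y"
proof -
 interpret abelian_group P by (rule abelian_group_P)
 have "\<ominus>\<^bsub>P\<^esub> Y \<in> carrier P" using assms by simp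
 moreover have "Psi (\<ominus>\<^bsub>P\<^esub> Y \<oplus>\<^bsub>P\<^esub> Y) = 0" using assms by (simp add: l_neg)
 ultimately show "X \<ominus>\<^bsub>P\<^esub> Y \<in> carrier P" "Psi (X \<ominus>\<^bsub>P\<^esub> Y) = Psi X - Psi Y"
  using assms by (simp_all add: a_minus_def eq_neg_iff_add_eq_0)
qed

lemma Psi_finsum:
 assumes "finite S" "\<And>i. i \<in> S ==> X i \<in> carrier P"
 shows "finsum P X S \<in> carrier P & Psi (finsum P X S) = (\<Sum>i\<in>S. Psi (X i))"
 using assms
proof (induction S rule: finite_induct)
 interpret abelian_group P by (rule abelian_group_P)
 {
  case empty
  show ?case by simp
 next
  case (insert i S)
  then show ?case by (simp add: finsum_insert Pi_def)
 }
qed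

lemma graded_part:
 assumes "\<And>xs u. set xs \<subseteq> sym_letters A M ==> co (wm lm xs) u ~= 0 ==> grade (FWord xs) = gr u"
 shows "cls ` {f \<in> carrier F. \<forall>w\<in>Poly_Mapping.keys f. grade w = d} = {X \<in> carrier P. \<forall>u. co (Psi X) u ~= 0 --> gr u = d}"
  (is "?A = ?B")
proof (intro equalityI subsetI)
 fix X assume "X \<in> ?A"
 then obtain f where f: "X = cls f" "f \<in> carrier F" "\<forall>w\<in>Poly_Mapping.keys f. grade w = d" by auto
 have "gr u = d" if "co (ev lm f) u ~= 0" for u
 proof -
  from that obtain w where "w \<in> Poly_Mapping.keys f" "co (wm lm (letters w)) u ~= 0"
   by (force simp: ev_def elim: sum.not_neutral_contains_not_neutral)
  then show ?thesis using f assms[of "letters w" u] by (simp add: carrier_sym_free)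
 qed
 then show "X \<in> ?B" using f by (simp add: cls_carrier)
next
 fix X assume "X \<in> ?B"
 then obtain f where f: "X = cls f" "f \<in> carrier F" and gr: "\<And>u. co (ev lm f) u ~= 0 ==> gr u = d"
  by (auto elim!: P_cases)
 let ?K = "{w \<in> Poly_Mapping.keys f. grade w = d}"
 define h where "h = (\<Sum>w\<in>?K. const (Poly_Mapping.lookup f w) * mon (letters w))"
 have lookup: "Poly_Mapping.lookup h w = (if w \<in> ?K then Poly_Mapping.lookup f w else 0)" for w
  by (auto simp: h_def const_mon lookup_sum lookup_single when_def in_keys_iff)
 then have keys: "Poly_Mapping.keys h = ?K" by (auto simp: in_keys_iff split: if_splits)
 then have h: "h \<in> carrier F" using f(2) by (simp add: carrier_sym_free)
 have "ev lm h = ev lm f"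
 proof (rule sfun_eqI)
  fix u
  have nz: "co (wm lm (letters w)) u = 0" if "w \<in> Poly_Mapping.keys f" "grade w ~= gr u" for w
   using assms[of "letters w" u] that f(2) by (auto simp: carrier_sym_free)
  show "co (ev lm h) u = co (ev lm f) u"
  proof (cases "gr u = d")
   case True
   have "co (ev lm h) u = (\<Sum>w\<in>?K. Poly_Mapping.lookup f w * co (wm lm (letters w)) u)"
    by (simp add: ev_def keys lookup)
   also have "\<dots> = (\<Sum>w\<in>Poly_Mapping.keys f. Poly_Mapping.lookup f w * co (wm lm (letters w)) u)"
    using nz True by (intro sum.mono_neutral_left) auto
   finally show ?thesis by (simp add: ev_def)
  next
   case False
   then have "co (ev lm f) u = 0" using gr by blast
   moreover have "co (ev lm h) u = 0"
    using nz False by (auto simp: ev_def keys intro!: sum.neutral)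
   ultimately show ?thesis by simp
  qed
 qed
 then have "X = cls h" using f h cls_eq_iff by simp
 then show "X \<in> ?A" using h keys by auto
qed

lemma wm_homg:
 assumes "\<And>u. u \<in> sym_letters A M ==> homg \<phi> (d u) (lm u)" "set xs \<subseteq> sym_letters A M"
 shows "homg \<phi> (sum_list (map d xs)) (wm lm xs)"
 using assms(2) by (induction xs) (auto intro!: homg_mult assms(1))

lemma cpart_P: "X \<in> cpart P i \<longleftrightarrow> X \<in> carrier P & hom i (Psi X)"
 using graded_part[of wdeg wd i] wm_homg[of fst ldeg, OF lm_hom]
 by (auto simp: sym_alg_def Let_def wdeg_def homg_def)

lemma sym_wpart_P:
 "X \<in> sym_wpart A M m i \<longleftrightarrow> X \<in> carrier P & hom i (Psi X) & homg wt (int m) (Psi X)"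
proof -
 have "sum_list (map (%u. int (lweight u)) xs) = int (sum_list (map lweight xs))" for xs :: "('a, 'm) letter list"
  by (induction xs) simp_all
 then have "sum_list (map wt u) = int (sum_list (map lweight xs))"
  if "set xs \<subseteq> sym_letters A M" "co (wm lm xs) u ~= 0" for xs u
  using wm_homg[of wt "%u. int (lweight u)", OF lm_wt that(1)] that(2) by (simp add: homg_def)
 then show ?thesis
  using graded_part[of "%w. (int (wweight w), wdeg w)" "%u. (sum_list (map wt u), wd u)" "(int m, i)"]
   wm_homg[of fst ldeg, OF lm_hom]
  by (auto simp: sym_wpart_def wdeg_def wweight_def homg_def)
qed

text \<open>The differential of a symmetric algebra is determined by its values on letters and the Leibniz rule.\<close>
lemma diff_model:
 fixes A' :: "('k, 'a) cdga" and M' :: "('a, 'm) dgmod"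
 assumes add: "\<And>f g. \<delta> (f + g) = \<delta> f + \<delta> g" and scale: "\<And>c f. \<delta> (cst c * f) = cst c * \<delta> f"
  and leibniz: "\<And>i f g. hom i f ==> \<delta> (f * g) = \<delta> f * g + cst (ksgn i) * (f * \<delta> g)"
  and letter: "\<And>u. u \<in> sym_letters A M ==> letter_diff A' M' u \<in> sym_letters A M & lm (letter_diff A' M' u) = \<delta> (lm u)"
  and X: "X \<in> carrier P"
 shows "(\<Union>f\<in>X. cls (free_diff A' M' f)) \<in> carrier P" "Psi (\<Union>f\<in>X. cls (free_diff A' M' f)) = \<delta> (Psi X)"
proof -
 let ?fd = "free_diff A' M'"
 have d1: "\<delta> 1 = 0" using leibniz[of 0 1 1] by simp
 have d0: "\<delta> 0 = 0" using scale[of 0 0] by simp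
 have wd_Cons: "word_diff A' M' (x # xs) =
   mon [letter_diff A' M' x] * mon xs + const (ksgn (ldeg x)) * (mon [x] * word_diff A' M' xs)" for x xs
  unfolding word_diff_def
  by (simp add: sum.lessThan_Suc_shift sum_distrib_left ksgn_add const_mult mult.assoc const_left[of "mon _"]
   mon_Cons[of _ "_[_ := _]"] mon_Cons[of _ xs] del: sum.lessThan_Suc)
 have word: "word_diff A' M' xs \<in> carrier F & ev lm (word_diff A' M' xs) = \<delta> (wm lm xs)"
  if "set xs \<subseteq> sym_letters A M" for xs
  using that
 proof (induction xs)
  case Nil
  then show ?case by (simp add: word_diff_def d1)
 next
  case (Cons x xs)
  then show ?case
   using letter[of x] leibniz[OF lm_hom, of x "wm lm xs"] by (simp add: wd_Cons mult.assoc)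
 qed
 have fd_sup: "?fd f = (\<Sum>w\<in>W. const (Poly_Mapping.lookup f w) * word_diff A' M' (letters w))"
  if "finite W" "Poly_Mapping.keys f \<subseteq> W" for f W
  unfolding free_diff_def using that by (intro sum.mono_neutral_left) (auto simp: in_keys_iff)
 have fd: "?fd f \<in> carrier F & ev lm (?fd f) = \<delta> (ev lm f)" if "f \<in> carrier F" for f
  using that
 proof (induction rule: carrier_induct)
  case zero
  then show ?case by (simp add: free_diff_def d0)
 next
  case (add f g)
  let ?W = "Poly_Mapping.keys f \<union> Poly_Mapping.keys g"
  have "?fd (f + g) = ?fd f + ?fd g"
   by (subst (1 2 3) fd_sup[of ?W]) (simp_all add: Poly_Mapping.keys_add lookup_add const_add distrib_right sum.distrib)
  then show ?case using add assms(1) by simp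
 next
  case (mon c xs)
  have "?fd (const c * mon xs) = const c * word_diff A' M' xs"
   unfolding const_mon by (subst fd_sup[of "{FWord xs}"]) simp_all
  then show ?case using word[OF mon] scale by (simp add: ev_const_mon)
 qed
 obtain f where f: "f \<in> carrier F" "X = cls f" using X by (rule P_cases)
 have "cls (?fd g) = cls (?fd f)" if "g \<in> X" for g
 proof -
  have "g \<in> carrier F" "ev lm g = ev lm f"
   using that f I_carrier by (auto simp: cls_eq I_ker)
  then show ?thesis using fd[of g] fd[OF f(1)] cls_eq_iff by simp
 qed
 then have "(\<Union>f\<in>X. cls (?fd f)) = cls (?fd f)"
  using in_cls[of f] f(2) by blast
 then show "(\<Union>f\<in>X. cls (free_diff A' M' f)) \<in> carrier P" "Psi (\<Union>f\<in>X. cls (free_diff A' M' f)) = \<delta> (Psi X)"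
  using fd[OF f(1)] f cls_carrier by simp_all
qed

end

definition hcomp :: "int => ('x, 'k::field_char_0) sfun => ('x, 'k) sfun"
 where "hcomp i f = Sfun (%w. if wd w = i then co f w else 0)"

lemma co_hcomp [simp]: "co (hcomp i f) w = (if wd w = i then co f w else 0)"
 by (simp add: hcomp_def Sfun_inverse)

lemma hcomp_hom: "hom j f ==> hcomp i f = (if i = j then f else 0)"
 by (rule sfun_eqI) (auto simp: homg_def)

lemma hom_hcomp: "hom i (hcomp i f)"
 by (simp add: homg_def)

lemma symset_hcomp: assumes "f \<in> symset L" shows "hcomp i f \<in> symset L"
proof -
 have "co (hcomp i f) (u @ y # z # v) = ksgn (fst y * fst z) * co (hcomp i f) (u @ z # y # v)" for u y z v
  using symf_swap[OF symset_symf[OF assms], of u y z v] by simp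
 then have "symf (hcomp i f)" unfolding symf_def by blast
 then show ?thesis using assms by (auto simp: symset_def split: if_splits)
qed

lemma sym_rels_carrierI:
 assumes "\<And>i a b. a \<in> cpart A i ==> b \<in> cpart A i ==> a \<oplus>\<^bsub>A\<^esub> b \<in> cpart A i"
  and "\<And>i c a. a \<in> cpart A i ==> csmult A c a \<in> cpart A i"
  and "\<And>i j a b. a \<in> cpart A i ==> b \<in> cpart A j ==> a \<otimes>\<^bsub>A\<^esub> b \<in> cpart A (i + j)"
  and "\<one>\<^bsub>A\<^esub> \<in> cpart A 0"
  and "\<And>i x y. x \<in> mpart M i ==> y \<in> mpart M i ==> madd M x y \<in> mpart M i"
  and "\<And>i j a x. a \<in> cpart A i ==> x \<in> mpart M j ==> msmult M i a x \<in> mpart M (i + j)"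
 shows "sym_rels A M \<subseteq> carrier (sym_free A M)"
proof -
 have C: "mon [Coef i a] \<in> carrier (sym_free A M)" if "a \<in> cpart A i" for i a
  using that by (simp add: sym_letters_def)
 have G: "mon [Gen i x] \<in> carrier (sym_free A M)" if "x \<in> mpart M i" for i x
  using that by (simp add: sym_letters_def)
 have W: "mon [u, v] \<in> carrier (sym_free A M)" if "u \<in> sym_letters A M" "v \<in> sym_letters A M" for u v
  using that by simp
 have L: "Coef i a \<in> sym_letters A M" if "a \<in> cpart A i" for i a using that by (simp add: sym_letters_def)
 have L': "Gen i x \<in> sym_letters A M" if "x \<in> mpart M i" for i x using that by (simp add: sym_letters_def)
 show ?thesis
  unfolding sym_rels_def Un_subset_iff mon_Nil
  by (intro conjI subsetI) (elim CollectE exE conjE singletonE; hypsubst;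
   intro carrier_diff carrier_closed C G W L L' assms; assumption)+
qed

lemma ev_relsI:
 assumes "\<And>i a b. a \<in> cpart A i ==> b \<in> cpart A i ==> lm (Coef i (a \<oplus>\<^bsub>A\<^esub> b)) = lm (Coef i a) + lm (Coef i b)"
  and "\<And>i c a. a \<in> cpart A i ==> lm (Coef i (csmult A c a)) = cst c * lm (Coef i a)"
  and "\<And>i j a b. a \<in> cpart A i ==> b \<in> cpart A j ==> lm (Coef (i + j) (a \<otimes>\<^bsub>A\<^esub> b)) = lm (Coef i a) * lm (Coef j b)"
  and "lm (Coef 0 \<one>\<^bsub>A\<^esub>) = 1"
  and "\<And>i x y. x \<in> mpart M i ==> y \<in> mpart M i ==> lm (Gen i (madd M x y)) = lm (Gen i x) + lm (Gen i y)"
  and "\<And>i j a x. a \<in> cpart A i ==> x \<in> mpart M j ==> lm (Gen (i + j) (msmult M i a x)) = lm (Coef i a) * lm (Gen j x)"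
  and hom: "\<And>u. u \<in> sym_letters A M ==> hom (ldeg u) (lm u)"
  and "r \<in> sym_rels A M"
 shows "ev lm r = 0"
proof -
 have comm: "(lm u * lm v = cst (ksgn (ldeg u * ldeg v)) * (lm v * lm u)) = True"
  if "u \<in> sym_letters A M" "v \<in> sym_letters A M" for u v
  using hom_commute[OF hom hom, OF that] by simp
 show ?thesis
  using assms(8) unfolding sym_rels_def
  by (elim UnE CollectE exE conjE singletonE) (hypsubst, simp add: assms(1-6) comm)+
qed

lemma linear_form_iff:
 fixes scale :: "'k::field_char_0 => 'v::ab_group_add => 'v"
 assumes "vector_space scale"
 shows "Vector_Spaces.linear scale (*) \<theta> \<longleftrightarrow> (\<forall>x y. \<theta> (x + y) = \<theta> x + \<theta> y) & (\<forall>c x. \<theta> (scale c x) = c * \<theta> x)"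
proof -
 have "vector_space ((*) :: 'k => 'k => 'k)" by unfold_locales (simp_all add: algebra_simps)
 then show ?thesis using assms by (simp add: Vector_Spaces.linear_iff)
qed

lemma linear_form_sum:
 assumes "Vector_Spaces.linear scale (*) \<theta>"
 shows "\<theta> (\<Sum>x\<in>S. scale (c x) (h x)) = (\<Sum>x\<in>S. c x * \<theta> (h x))"
proof -
 interpret Vector_Spaces.linear scale "(*)" \<theta> by (rule assms)
 show ?thesis by (simp add: sum scale)
qed

section \<open>Homogeneous bases of a two-term complex\<close>

type_synonym ('v, 'k) pqfun = "(bool \<times> 'v, 'k) sfun"

locale two_term_basis =
 fixes g :: "('k::field_char_0, 'v::ab_group_add) gvs" and B :: "'v set" and dg :: "'v => int"
  and crd :: "'v => 'v => 'k"
 assumes two_term: "two_term_complex g"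
  and finite_B: "finite B"
  and B_part: "e \<in> B ==> e \<in> part g (dg e)"
  and crd_linear: "e \<in> B ==> Vector_Spaces.linear (scl g) (*) (crd e)"
  and crd_expand: "v = (\<Sum>e\<in>B. scl g (crd e v) e)"
  and crd_basis: "e \<in> B ==> e' \<in> B ==> crd e e' = (if e = e' then 1 else 0)"
  and crd_part: "x \<in> part g d ==> e \<in> B ==> crd e x ~= 0 ==> dg e = d"
  and dg_range: "e \<in> B ==> dg e = - 1 \<or> dg e = 0"

lemma two_term_basis_exists:
 fixes g :: "('k::field_char_0, 'v::ab_group_add) gvs"
 assumes "two_term_complex g"
 shows "\<exists>B dg crd. two_term_basis g B dg crd"
proof -
 interpret vector_space "scl g" using assms by (simp add: two_term_complex_def)
 from assms obtain T where T: "finite T" "span T = UNIV" by (auto simp: two_term_complex_def)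
 let ?V = "part g (- 1) \<union> part g 0"
 obtain B where B: "B \<subseteq> ?V" "independent B" "?V \<subseteq> span B" by (rule maximal_independent_subset)
 have subsp: "subspace (part g i)" for i using assms by (simp add: two_term_complex_def)
 have inter: "part g (- 1) \<inter> part g 0 = {0}" and out: "i ~= - 1 ==> i ~= 0 ==> part g i = {0}" for i
  using assms by (auto simp: two_term_complex_def)
 have inter': "y = 0" if "y \<in> part g d \<inter> part g (- 1 - d)" "d = - 1 \<or> d = 0" for y d
  using that(2)
 proof
  assume "d = - 1" then show ?thesis using that(1) inter by auto
 next
  assume "d = 0" then show ?thesis using that(1) inter by auto
 qed
 have "v \<in> span B" for v
 proof -
  obtain x y where "x \<in> part g (- 1)" "y \<in> part g 0" "v = x + y"
   using assms unfolding two_term_complex_def by blast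
  then show ?thesis using B(3) by (auto intro: span_add)
 qed
 then have span: "span B = UNIV" by auto
 have fin: "finite B" using independent_span_bound[OF T(1) B(2)] T(2) by simp
 define dg where "dg e = (if e \<in> part g (- 1) then - 1 else 0 :: int)" for e
 define crd where "crd e v = representation B v e" for e v
 have lin: "Vector_Spaces.linear (scl g) (*) (crd e)" for e
  unfolding crd_def using linear_representation[OF B(2) span] .
 have expand: "v = (\<Sum>e\<in>B. scl g (crd e v) e)" for v
  unfolding crd_def using sum_representation_eq[OF B(2) _ fin] span by simp
 have basis: "crd e e' = (if e = e' then 1 else 0)" if "e' \<in> B" for e e'
  unfolding crd_def using representation_basis[OF B(2) that] by auto
 have part: "e \<in> part g (dg e)" if "e \<in> B" for e using that B(1) by (auto simp: dg_def)
 have crd_sum: "crd e (\<Sum>x\<in>S. scl g (c x) x) = (\<Sum>x\<in>S. c x * crd e x)" for e c and S :: "'v set"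
  by (rule linear_form_sum[OF lin])
 have "dg e = d" if x: "x \<in> part g d" and e: "e \<in> B" "crd e x ~= 0" for x d e
 proof (rule ccontr)
  assume "dg e ~= d"
  have "d = - 1 \<or> d = 0"
  proof (rule ccontr)
   assume "\<not> (d = - 1 \<or> d = 0)"
   then have "x = 0" using out[of d] x by auto
   then show False using e by (simp add: crd_def representation_zero)
  qed
  let ?S = "{e \<in> B. dg e = d}" and ?T = "{e \<in> B. dg e ~= d}"
  have "(\<Sum>e\<in>B. scl g (crd e x) e) = (\<Sum>e\<in>?S. scl g (crd e x) e) + (\<Sum>e\<in>?T. scl g (crd e x) e)"
   by (subst sum.union_disjoint[symmetric]) (use fin in \<open>auto intro!: sum.cong\<close>)
  then have "x = (\<Sum>e\<in>?S. scl g (crd e x) e) + (\<Sum>e\<in>?T. scl g (crd e x) e)"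
   by (simp flip: expand)
  moreover have "(\<Sum>e\<in>?S. scl g (crd e x) e) \<in> part g d"
   by (intro subspace_sum[OF subsp] subspace_scale[OF subsp]) (use part in auto)
  moreover have "(\<Sum>e\<in>?T. scl g (crd e x) e) \<in> part g (- 1 - d)"
  proof (intro subspace_sum[OF subsp] subspace_scale[OF subsp])
   show "e \<in> part g (- 1 - d)" if "e \<in> ?T" for e
    using part[of e] that \<open>d = - 1 \<or> d = 0\<close> by (auto simp: dg_def split: if_splits)
  qed
  ultimately have "(\<Sum>e\<in>?T. scl g (crd e x) e) \<in> part g d \<inter> part g (- 1 - d)"
   using subspace_diff[OF subsp x, of "\<Sum>e\<in>?S. scl g (crd e x) e"] by (metis (no_types, lifting) Int_iff add_diff_cancel_left')
  then have "(\<Sum>e\<in>?T. scl g (crd e x) e) = 0" using inter' \<open>d = - 1 \<or> d = 0\<close> by blast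
  then have "(\<Sum>e'\<in>?T. crd e' x * crd e e') = 0"
   using crd_sum[of e "%e. crd e x" ?T] by (simp add: crd_def representation_zero)
  moreover have "(\<Sum>e'\<in>?T. crd e' x * crd e e') = (\<Sum>e'\<in>?T. if e' = e then crd e x else 0)"
   by (intro sum.cong) (auto simp: basis)
  ultimately show False using \<open>dg e ~= d\<close> e fin by simp
 qed
 note coord_part = this
 have "two_term_basis g B dg crd"
  by (rule two_term_basis.intro; (rule lin | fact assms fin part expand | rule basis coord_part; assumption | simp add: dg_def)?)
 then show ?thesis by blast
qed

context two_term_basis
begin

lemma vector_space_g: "vector_space (scl g)"
 using two_term by (simp add: two_term_complex_def)

lemmas form_iff = linear_form_iff[OF vector_space_g]

lemma linear_expand:
 assumes "Vector_Spaces.linear (scl g) (*) \<theta>" shows "\<theta> x = (\<Sum>e\<in>B. \<theta> e * crd e x)"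
proof -
 have "\<theta> x = \<theta> (\<Sum>e\<in>B. scl g (crd e x) e)" by (simp flip: crd_expand)
 also have "\<dots> = (\<Sum>e\<in>B. crd e x * \<theta> e)"
  by (rule linear_form_sum[OF assms])
 finally show ?thesis by (simp add: mult.commute)
qed

text \<open>The letters for the generators \<open>s\<^sup>2e\<close> and \<open>s\<theta>\<close>, where \<open>\<theta>\<close> is the element of the dual basis that belongs to e. The first component is the degree as a 2-shifted polyvector; it is 1 or 2 in all cases.\<close>
definition Pe :: "'v => int \<times> bool \<times> 'v" where "Pe e = (dg e + 2, True, e)"
definition Qe :: "'v => int \<times> bool \<times> 'v" where "Qe e = (1 - dg e, False, e)"
definition LQ :: "(int \<times> bool \<times> 'v) set" where "LQ = Qe ` B"
definition LPQ :: "(int \<times> bool \<times> 'v) set" where "LPQ = Pe ` B \<union> Qe ` B"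

abbreviation wt :: "int \<times> bool \<times> 'v => int" where "wt z \<equiv> if fst (snd z) then 1 else 0"

lemma PQ_simps [simp]: "fst (Pe e) = dg e + 2" "fst (Qe e) = 1 - dg e" "snd (Pe e) = (True, e)" "snd (Qe e) = (False, e)"
 "Pe e = Pe e' \<longleftrightarrow> e = e'" "Qe e = Qe e' \<longleftrightarrow> e = e'" "Pe e ~= Qe e'" "Qe e ~= Pe e'"
 by (auto simp: Pe_def Qe_def)

lemma finite_LQ [simp]: "finite LQ" and finite_LPQ [simp]: "finite LPQ"
 by (simp_all add: LQ_def LPQ_def finite_B)

abbreviation "DA \<equiv> dual_alg g"
abbreviation "DM \<equiv> mshift base_cdga (- 1) (dual g)"

lemma base_simps [simp]: "carrier base_cdga = UNIV" "a \<otimes>\<^bsub>base_cdga\<^esub> b = a * b" "\<one>\<^bsub>base_cdga\<^esub> = 1" "\<zero>\<^bsub>base_cdga\<^esub> = 0"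
 "a \<oplus>\<^bsub>base_cdga\<^esub> b = a + b" "csmult base_cdga c a = c * a"
 "cpart base_cdga i = (if i = 0 then UNIV else {0})" "cdiff base_cdga a = 0"
 by (simp_all add: base_cdga_def)

lemma dual_part: "\<theta> \<in> mpart (dual g) i \<longleftrightarrow>
  Vector_Spaces.linear (scl g) (*) \<theta> & (\<forall>j. j ~= - i --> (\<forall>x \<in> part g j. \<theta> x = 0))"
 by (simp add: dual_def)

lemma DM_simps: "mpart DM i = mpart (dual g) (i - 1)" "madd DM \<theta> \<eta> = \<theta> + \<eta>"
 "msmult DM i c \<theta> = (%x. ksgn i * c * \<theta> x)"
 "mdiff DM i \<theta> = (%x. - ksgn i * \<theta> (dif g x))"
 by (simp_all add: mshift_def dual_def fun_eq_iff ksgn_def)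

lemma dual_degree: "\<theta> \<in> mpart (dual g) i ==> e \<in> B ==> \<theta> e ~= 0 ==> dg e = - i"
 using B_part dual_part by blast

lemma crd_dual: "e \<in> B ==> crd e \<in> mpart (dual g) (- dg e)"
 using crd_linear crd_part by (fastforce simp: dual_part)

lemma dual_closed:
 "\<theta> \<in> mpart (dual g) i ==> \<eta> \<in> mpart (dual g) i ==> \<theta> + \<eta> \<in> mpart (dual g) i"
 "\<theta> \<in> mpart (dual g) i ==> (%x. c * \<theta> x) \<in> mpart (dual g) i"
 "0 \<in> mpart (dual g) i"
 unfolding dual_part form_iff by (auto simp: algebra_simps)

text \<open>The function that represents the generator \<open>s\<theta>\<close>.\<close>
definition lQ :: "('v => 'k) => ('v, 'k) pqfun"
 where "lQ \<theta> = lin (%z. if z \<in> LQ then \<theta> (snd (snd z)) else 0)"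

lemma lQ_simps: "lQ (\<theta> + \<eta>) = lQ \<theta> + lQ \<eta>" "lQ (%x. c * \<theta> x) = cst c * lQ \<theta>" "lQ 0 = 0"
 by (rule sfun_eqI; simp add: lQ_def co_lin)+

lemma lQ_crd: "e \<in> B ==> lQ (crd e) = gen (Qe e)"
 unfolding lQ_def by (rule arg_cong[where f = lin]) (auto simp: fun_eq_iff LQ_def crd_basis Qe_def)

lemma lQ_symset: "lQ \<theta> \<in> symset LQ"
 unfolding lQ_def by (rule symset_lin) (simp split: if_splits)

lemma lQ_hom: "\<theta> \<in> mpart (dual g) i ==> hom (i + 1) (lQ \<theta>)"
 unfolding lQ_def by (rule homg_lin) (auto simp: LQ_def split: if_splits dest: dual_degree)

lemma Dl_lQ: "e \<in> B ==> Dl (Qe e) (lQ \<theta>) = cst (\<theta> e)"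
 by (simp add: lQ_def LQ_def)

definition lmA :: "('k, 'v => 'k) letter => ('v, 'k) pqfun"
 where "lmA u = (case u of Coef i c => cst c | Gen i \<theta> => lQ \<theta>)"

definition lzA :: "int \<times> bool \<times> 'v => ('k, 'v => 'k) letter"
 where "lzA z = Gen (fst z) (crd (snd (snd z)))"

lemma letters_A: "u \<in> sym_letters base_cdga DM \<longleftrightarrow>
 (case u of Coef i c => i = 0 \<or> c = 0 | Gen i \<theta> => \<theta> \<in> mpart (dual g) (i - 1))"
 by (cases u) (auto simp: sym_letters_def DM_simps)

lemma lmA_hom: "u \<in> sym_letters base_cdga DM ==> hom (ldeg u) (lmA u)"
 using lQ_hom by (cases u) (fastforce simp: letters_A lmA_def)+

lemma DA_gens: "sym_gens base_cdga DM LQ lzA"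
proof
 show "lzA z \<in> sym_letters base_cdga DM" if "z \<in> LQ" for z
  using that crd_dual by (auto simp: lzA_def letters_A LQ_def)
 show "sym_rels base_cdga DM \<subseteq> carrier (sym_free base_cdga DM)"
  by (rule sym_rels_carrierI) (auto simp: DM_simps dual_closed dual_closed(3)[unfolded zero_fun_def] mult.assoc split: if_splits)
qed

end

sublocale two_term_basis \<subseteq> G: sym_gens base_cdga DM LQ lzA
 by (rule DA_gens)

context two_term_basis
begin

lemma reducible_A_Coef: "mon [Coef 0 c] \<in> G.R"
proof -
 have "G.cong (mon [Coef 0 c]) (const c * mon [Coef 0 1])"
  using G.rel_Coef_scale[of 1 0 c] by simp
 also have "G.cong \<dots> (const c * 1)" using G.rel_Coef_one by (intro G.cong_mult_left) simp_all
 finally have c: "G.cong (mon [Coef 0 c]) (const c * 1)" .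
 show ?thesis by (rule G.reducible_cong[OF c _ red_scale[OF G.reducible_1]]) (simp add: letters_A)
qed

lemma reducible_A_Gen:
 assumes \<theta>: "\<theta> \<in> mpart (dual g) (i - 1)" shows "mon [Gen i \<theta>] \<in> G.R"
proof -
 have 0: "mon [Gen i 0] \<in> G.R"
 proof -
  have "G.cong (mon [Gen i 0]) 0"
   using G.rel_Gen_add[of 0 i 0] by (intro G.double_zero) (simp add: DM_simps dual_closed)
  then show ?thesis by (rule G.reducible_cong) (simp_all add: letters_A dual_closed)
 qed
 have "(%x. \<Sum>e\<in>S. \<theta> e * crd e x) \<in> mpart (dual g) (i - 1) & mon [Gen i (%x. \<Sum>e\<in>S. \<theta> e * crd e x)] \<in> G.R"
  if "S \<subseteq> B" for S
  using finite_subset[OF that finite_B] that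
 proof (induction S rule: finite_induct)
  case empty
  then show ?case using 0 dual_closed(3) by (simp add: zero_fun_def)
 next
  case (insert e S)
  let ?s = "%x. \<Sum>e\<in>S. \<theta> e * crd e x"
  have eq: "(%x. \<Sum>e\<in>insert e S. \<theta> e * crd e x) = madd DM (%x. \<theta> e * crd e x) ?s"
   using insert.hyps by (simp add: fun_eq_iff DM_simps)
  show ?case
  proof (cases "\<theta> e = 0")
   case True
   then show ?thesis using insert by simp
  next
   case False
   then have d: "1 - dg e = i" using dual_degree[OF \<theta>] insert by fastforce
   have e: "crd e \<in> mpart (dual g) (i - 1)" using crd_dual[of e] insert.prems d by auto
   have "G.cong (mon [Gen i (%x. \<theta> e * crd e x)]) (mon [Coef 0 (\<theta> e)] * mon [Gen i (crd e)])"
    using G.rel_Gen_smult[of "\<theta> e" 0 "crd e" i] e by (simp add: DM_simps G.cong_sym)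
   note c1 = this
   have "mon [Gen i (crd e)] \<in> G.R"
    using red_mon[of "[Qe e]" LQ lzA base_cdga DM] insert.prems d by (simp add: lzA_def LQ_def)
   then have "mon [Coef 0 (\<theta> e)] * mon [Gen i (crd e)] \<in> G.R"
    by (rule G.reducible_mult[OF reducible_A_Coef])
   moreover have "mon [Gen i (%x. \<theta> e * crd e x)] \<in> carrier (sym_free base_cdga DM)"
    using dual_closed(2)[OF e, of "\<theta> e"] by (simp add: letters_A)
   ultimately have R: "mon [Gen i (%x. \<theta> e * crd e x)] \<in> G.R"
    by (rule G.reducible_cong[OF c1, rotated])
   have c: "G.cong (mon [Gen i (madd DM (%x. \<theta> e * crd e x) ?s)]) (mon [Gen i (%x. \<theta> e * crd e x)] + mon [Gen i ?s])"
    using insert dual_closed(2)[OF e] by (intro G.rel_Gen_add) (auto simp: DM_simps)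
   have m: "(%x. \<theta> e * crd e x) + ?s \<in> mpart (dual g) (i - 1)"
    using insert dual_closed(2)[OF e] by (intro dual_closed(1)) auto
   then have "mon [Gen i (madd DM (%x. \<theta> e * crd e x) ?s)] \<in> carrier (sym_free base_cdga DM)"
    by (simp add: letters_A DM_simps)
   moreover have "mon [Gen i ?s] \<in> G.R" using insert by simp
   ultimately have "mon [Gen i (madd DM (%x. \<theta> e * crd e x) ?s)] \<in> G.R"
    by (intro G.reducible_cong[OF c] red_add R)
   with m show ?thesis unfolding eq by (simp add: DM_simps)
  qed
 qed
 from this[OF subset_refl] show ?thesis
  using \<theta> linear_expand[of \<theta>] by (simp add: dual_part flip: linear_expand)
qed

lemma DA_model: "sym_model base_cdga DM LQ lzA lmA (%_. 1)"
proof
 show "homg (%_. 1) (int (lweight u)) (lmA u)" for u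
  by (cases u) (auto simp: lmA_def lQ_def intro: homg_lin)
 show "ev lmA r = 0" if r: "r \<in> sym_rels base_cdga DM" for r
  by (rule ev_relsI[OF _ _ _ _ _ _ lmA_hom r])
   (auto simp: lmA_def DM_simps lQ_simps cst_add cst_mult split: if_splits)
 show "lmA u \<in> symset LQ" for u by (cases u) (simp_all add: lmA_def lQ_symset)
 show "hom (ldeg u) (lmA u)" if "u \<in> sym_letters base_cdga DM" for u using that by (rule lmA_hom)
 show "lmA (lzA z) = gen z" if "z \<in> LQ" for z
  using that by (auto simp: lmA_def lzA_def LQ_def lQ_crd)
 show "mon [u] \<in> G.R" if "u \<in> sym_letters base_cdga DM" for u
 proof (cases u)
  case (Coef i c)
  show ?thesis
  proof (cases "i = 0")
   case True
   then show ?thesis using Coef reducible_A_Coef by simp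
  next
   case False
   then have u: "u = Coef i 0" using that Coef by (simp add: letters_A)
   have "G.cong (mon [Coef i 0]) 0"
    using G.rel_Coef_add[of 0 i 0] by (intro G.double_zero) simp
   then show ?thesis unfolding u by (rule G.reducible_cong) (simp_all add: letters_A)
  qed
 next
  case (Gen i \<theta>)
  then show ?thesis using that reducible_A_Gen by (simp add: letters_A)
 qed
qed simp

end

sublocale two_term_basis \<subseteq> A: sym_model base_cdga DM LQ lzA lmA "%_. 1"
 by (rule DA_model)

context two_term_basis
begin

section \<open>Derivations of the free graded commutative algebra\<close>

abbreviation "PA \<equiv> A.Psi"

lemmas DA_closed [simp] = A.P_closed[folded dual_alg_def]
lemmas PA_ops [simp] = A.Psi_ops[folded dual_alg_def]
lemmas PA_inj = A.Psi_inj[folded dual_alg_def]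
lemmas PA_symset [simp] = A.Psi_symset[folded dual_alg_def]
lemmas PA_surj = A.Psi_surj[folded dual_alg_def]
lemmas PA_minus [simp] = A.Psi_minus[folded dual_alg_def]
lemmas cpart_DA = A.cpart_P[folded dual_alg_def]

definition iA :: "('v, 'k) pqfun => ('k, 'v) sym_dual"
 where "iA f = (SOME X. X \<in> carrier DA & PA X = f)"

lemma iA: assumes "f \<in> symset LQ" shows iA_carrier: "iA f \<in> carrier DA" and PA_iA: "PA (iA f) = f"
 using someI_ex[of "%X. X \<in> carrier DA & PA X = f"] PA_surj[OF assms] unfolding iA_def by blast+

lemma iA_PA: "X \<in> carrier DA ==> iA (PA X) = X"
 by (intro PA_inj) (simp_all add: iA)

lemma sdual_model:
 assumes "\<theta> \<in> mpart (dual g) j"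
 shows "sdual g j \<theta> \<in> cpart DA (j + 1)" "sdual g j \<theta> \<in> carrier DA" "PA (sdual g j \<theta>) = lQ \<theta>"
proof -
 have l: "Gen (j + 1) \<theta> \<in> sym_letters base_cdga DM" using assms by (simp add: letters_A)
 then have "sdual g j \<theta> \<in> carrier A.P" unfolding sdual_def sym_gen_def by (intro A.cls_carrier) simp
 moreover show "PA (sdual g j \<theta>) = lQ \<theta>"
  unfolding sdual_def sym_gen_def by (simp add: lmA_def)
 ultimately show "sdual g j \<theta> \<in> carrier DA" "sdual g j \<theta> \<in> cpart DA (j + 1)"
  using lQ_hom[OF assms] by (simp_all add: dual_alg_def A.cpart_P)
qed

definition Qh :: "'v => ('k, 'v) sym_dual"
 where "Qh e = sdual g (- dg e) (crd e)"

lemma Qh: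
 assumes "e \<in> B" shows "Qh e \<in> carrier DA" "PA (Qh e) = gen (Qe e)" "Qh e \<in> cpart DA (1 - dg e)"
 using sdual_model[OF crd_dual[OF assms]] assms by (simp_all add: Qh_def lQ_crd)

text \<open>A derivation of the free graded commutative algebra is determined by its values c on the generators \<open>Qe\<close>.\<close>
definition dact :: "('v => ('v, 'k) pqfun) => ('v, 'k) pqfun => ('v, 'k) pqfun"
 where "dact c f = (\<Sum>e\<in>B. c e * Dl (Qe e) f)"

lemma dact_add: "dact c (f + h) = dact c f + dact c h"
 by (simp add: dact_def distrib_left sum.distrib)

lemma dact_scale: "dact c (cst a * f) = cst a * dact c f"
proof -
 have "c e * (cst a * Dl (Qe e) f) = cst a * (c e * Dl (Qe e) f)" for e by (rule cst_left)
 then show ?thesis by (simp add: dact_def sum_distrib_left)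
qed

lemma dact_mult:
 assumes c: "\<And>e. e \<in> B ==> hom (i + 1 - dg e) (c e)" and f: "hom j f"
 shows "dact c (f * h) = dact c f * h + cst (ksgn (i * j)) * (f * dact c h)"
proof -
 have "c e * Dl (Qe e) (f * h) = c e * Dl (Qe e) f * h + cst (ksgn (i * j)) * (f * (c e * Dl (Qe e) h))" if "e \<in> B" for e
 proof -
  have "c e * (tw (1 - dg e) f * Dl (Qe e) h) = cst (ksgn ((1 - dg e) * j)) * (c e * f * Dl (Qe e) h)"
   by (simp add: tw_hom[OF f] mult.assoc cst_left[of "c e"])
  also have "\<dots> = cst (ksgn ((1 - dg e) * j)) * (cst (ksgn ((i + 1 - dg e) * j)) * (f * c e) * Dl (Qe e) h)"
   by (simp only: hom_commute[OF c[OF that] f])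
  also have "\<dots> = cst (ksgn ((1 - dg e) * j) * ksgn ((i + 1 - dg e) * j)) * (f * (c e * Dl (Qe e) h))"
   by (simp add: cst_mult mult.assoc)
  also have "(ksgn ((1 - dg e) * j) * ksgn ((i + 1 - dg e) * j) :: 'k) = ksgn (i * j)"
   by (simp flip: ksgn_add) (rule ksgn_cong, simp add: algebra_simps)
  finally show ?thesis by (simp add: Dl_mult distrib_left mult.assoc)
 qed
 then show ?thesis by (simp add: dact_def sum.distrib sum_distrib_left sum_distrib_right)
qed

lemma dact_symset: "(\<And>e. e \<in> B ==> c e \<in> symset L) ==> f \<in> symset L ==> dact c f \<in> symset L"
 unfolding dact_def by (intro symset_sum symset_mult symset_Dl)

lemma dact_hom:
 assumes "\<And>e. e \<in> B ==> hom (i + 1 - dg e) (c e)" "hom j f" shows "hom (i + j) (dact c f)"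
 unfolding dact_def
proof (rule homg_sum)
 fix e assume "e \<in> B"
 then show "hom (i + j) (c e * Dl (Qe e) f)"
  using homg_mult[OF assms(1) homg_Dl[OF assms(2)], of e "Qe e"] by (simp add: algebra_simps)
qed

lemma dact_lQ: "dact c (lQ \<theta>) = (\<Sum>e\<in>B. cst (\<theta> e) * c e)"
 unfolding dact_def by (intro sum.cong refl) (simp add: Dl_lQ cst_central)

lemma dact_gen: "e \<in> B ==> dact c (gen (Qe e)) = c e"
proof -
 assume e: "e \<in> B"
 have "dact c (gen (Qe e)) = (\<Sum>e'\<in>B. if e' = e then c e' else 0)"
  unfolding dact_def by (intro sum.cong) auto
 then show ?thesis using e finite_B by simp
qed

definition der_coeffs :: "int => ('v => ('v, 'k) pqfun) => bool"
 where "der_coeffs i c \<longleftrightarrow> (\<forall>e\<in>B. c e \<in> symset LQ & hom (i + 1 - dg e) (c e))"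

definition mkder :: "('v => ('v, 'k) pqfun) => ('k, 'v) sym_dual => ('k, 'v) sym_dual"
 where "mkder c = (\<lambda>X\<in>carrier DA. iA (dact c (PA X)))"

lemma mkder_apply:
 assumes "der_coeffs i c" "X \<in> carrier DA"
 shows "mkder c X \<in> carrier DA" "PA (mkder c X) = dact c (PA X)"
 using assms by (simp_all add: mkder_def iA dact_symset der_coeffs_def)

lemma mkder_der: assumes c: "der_coeffs i c" shows "mkder c \<in> der DA i"
 unfolding der_def
proof (intro CollectI conjI ballI allI)
 note [simp] = mkder_apply[OF c]
 have h: "\<And>e. e \<in> B ==> hom (i + 1 - dg e) (c e)" using c by (simp add: der_coeffs_def)
 show "mkder c \<in> carrier DA \<rightarrow>\<^sub>E carrier DA"
  by (intro PiE_I) (simp_all, simp add: mkder_def)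
 show "mkder c (a \<oplus>\<^bsub>DA\<^esub> b) = mkder c a \<oplus>\<^bsub>DA\<^esub> mkder c b" if "a \<in> carrier DA" "b \<in> carrier DA" for a b
  using that by (intro PA_inj) (simp_all add: dact_add)
 show "mkder c (csmult DA k a) = csmult DA k (mkder c a)" if "a \<in> carrier DA" for a k
  using that by (intro PA_inj) (simp_all add: dact_scale)
 show "mkder c a \<in> cpart DA (j + i)" if "a \<in> cpart DA j" for a j
  using that dact_hom[of i c j "PA a"] h by (simp add: cpart_DA add.commute)
 show "mkder c (a \<otimes>\<^bsub>DA\<^esub> b) = mkder c a \<otimes>\<^bsub>DA\<^esub> b \<oplus>\<^bsub>DA\<^esub> csmult DA (ksgn (i * j)) (a \<otimes>\<^bsub>DA\<^esub> mkder c b)"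
  if "a \<in> cpart DA j" "b \<in> carrier DA" for a b j
  using that by (intro PA_inj) (simp_all add: dact_mult[OF h] cpart_DA)
qed

definition cof :: "(('k, 'v) sym_dual => ('k, 'v) sym_dual) => 'v => ('v, 'k) pqfun"
 where "cof D e = PA (D (Qh e))"

lemma der_closed: "D \<in> der DA i ==> X \<in> carrier DA ==> D X \<in> carrier DA"
 by (auto simp: der_def)

lemma der_coeffs_cof: assumes "D \<in> der DA i" shows "der_coeffs i (cof D)"
 unfolding der_coeffs_def
proof (intro ballI conjI)
 fix e assume e: "e \<in> B"
 show "cof D e \<in> symset LQ" using der_closed[OF assms] Qh[OF e] by (simp add: cof_def)
 have "D (Qh e) \<in> cpart DA (1 - dg e + i)" using assms Qh(3)[OF e] by (auto simp: der_def)
 then show "hom (i + 1 - dg e) (cof D e)" by (simp add: cpart_DA cof_def algebra_simps)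
qed

lemma der_PA:
 assumes D: "D \<in> der DA i" and X: "X \<in> carrier DA"
 shows "PA (D X) = dact (cof D) (PA X)"
proof -
 have cl: "D a \<in> carrier DA" if "a \<in> carrier DA" for a using der_closed[OF D that] .
 have add: "D (a \<oplus>\<^bsub>DA\<^esub> b) = D a \<oplus>\<^bsub>DA\<^esub> D b" if "a \<in> carrier DA" "b \<in> carrier DA" for a b
  using D that by (auto simp: der_def)
 have scale: "D (csmult DA k a) = csmult DA k (D a)" if "a \<in> carrier DA" for a k
  using D that by (auto simp: der_def)
 have leib: "D (a \<otimes>\<^bsub>DA\<^esub> b) = D a \<otimes>\<^bsub>DA\<^esub> b \<oplus>\<^bsub>DA\<^esub> csmult DA (ksgn (i * j)) (a \<otimes>\<^bsub>DA\<^esub> D b)"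
  if "a \<in> cpart DA j" "b \<in> carrier DA" for a b j
  using D that by (auto simp: der_def)
 have coef: "\<And>e. e \<in> B ==> hom (i + 1 - dg e) (cof D e)"
  using der_coeffs_cof[OF D] by (simp add: der_coeffs_def)
 have word: "\<exists>X\<in>carrier DA. PA X = lw w & PA (D X) = dact (cof D) (lw w)" if "set w \<subseteq> LQ" for w
  using that
 proof (induction w)
  case Nil
  have "PA (D (\<one>\<^bsub>DA\<^esub> \<otimes>\<^bsub>DA\<^esub> \<one>\<^bsub>DA\<^esub>)) = PA (D \<one>\<^bsub>DA\<^esub>) + PA (D \<one>\<^bsub>DA\<^esub>)"
   using leib[of "\<one>\<^bsub>DA\<^esub>" 0 "\<one>\<^bsub>DA\<^esub>"] by (simp add: cpart_DA cl)
  moreover have "\<one>\<^bsub>DA\<^esub> \<otimes>\<^bsub>DA\<^esub> \<one>\<^bsub>DA\<^esub> = \<one>\<^bsub>DA\<^esub>" by (rule PA_inj) simp_all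
  ultimately have "PA (D \<one>\<^bsub>DA\<^esub>) = 0" by simp
  then show ?case by (intro bexI[of _ "\<one>\<^bsub>DA\<^esub>"]) (simp_all add: dact_def)
 next
  case (Cons z w)
  then obtain X where X: "X \<in> carrier DA" "PA X = lw w" "PA (D X) = dact (cof D) (lw w)" by auto
  from Cons.prems obtain e where e: "e \<in> B" "z = Qe e" by (auto simp: LQ_def)
  have "PA (D (Qh e \<otimes>\<^bsub>DA\<^esub> X)) = dact (cof D) (lw (z # w))"
   using leib[OF Qh(3)[OF e(1)] X(1)] e X Qh[OF e(1)] dact_mult[OF coef homg_gen[of fst "Qe e"]]
   by (simp add: cl dact_gen) (simp add: cof_def)
  then show ?case using X e Qh by (intro bexI[of _ "Qh e \<otimes>\<^bsub>DA\<^esub> X"]) simp_all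
 qed
 have "\<exists>X\<in>carrier DA. PA X = f & PA (D X) = dact (cof D) f" if "f \<in> symset LQ" for f
 proof (rule symset_induct[OF finite_LQ that])
  have "PA (D (csmult DA 0 \<one>\<^bsub>DA\<^esub>)) = 0" by (subst scale) (simp_all add: cl)
  then show "\<exists>X\<in>carrier DA. PA X = 0 & PA (D X) = dact (cof D) 0"
   by (intro bexI[of _ "csmult DA 0 \<one>\<^bsub>DA\<^esub>"]) (simp_all add: dact_def)
  show "\<exists>X\<in>carrier DA. PA X = f + h & PA (D X) = dact (cof D) (f + h)"
   if fh: "\<exists>X\<in>carrier DA. PA X = f & PA (D X) = dact (cof D) f" "\<exists>X\<in>carrier DA. PA X = h & PA (D X) = dact (cof D) h" for f h
  proof -
   obtain X Y where "X \<in> carrier DA" "PA X = f" "PA (D X) = dact (cof D) f"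
    "Y \<in> carrier DA" "PA Y = h" "PA (D Y) = dact (cof D) h" using fh by blast
   then show ?thesis by (intro bexI[of _ "X \<oplus>\<^bsub>DA\<^esub> Y"]) (simp_all add: add cl dact_add)
  qed
  show "\<exists>X\<in>carrier DA. PA X = cst k * f & PA (D X) = dact (cof D) (cst k * f)"
   if f: "\<exists>X\<in>carrier DA. PA X = f & PA (D X) = dact (cof D) f" for f k
  proof -
   obtain X where "X \<in> carrier DA" "PA X = f" "PA (D X) = dact (cof D) f" using f by blast
   then show ?thesis by (intro bexI[of _ "csmult DA k X"]) (simp_all add: scale cl dact_scale)
  qed
 qed (rule word)
 then show ?thesis using PA_inj X PA_symset by metis
qed

lemma der_eq_mkder:
 assumes "D \<in> extensional (carrier DA)" "der_coeffs i c"
  and "\<And>X. X \<in> carrier DA ==> D X \<in> carrier DA & PA (D X) = dact c (PA X)"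
 shows "D = mkder c"
proof (rule extensionalityI[of _ "carrier DA"])
 show "mkder c \<in> extensional (carrier DA)" by (simp add: mkder_def)
 show "D X = mkder c X" if "X \<in> carrier DA" for X
  using assms(3)[OF that] mkder_apply[OF assms(2) that] by (intro PA_inj) simp_all
qed (fact assms)

lemma mkder_cof: assumes "D \<in> der DA i" shows "mkder (cof D) = D"
proof (rule der_eq_mkder[symmetric, OF _ der_coeffs_cof[OF assms]])
 show "D \<in> extensional (carrier DA)" using assms by (simp add: der_def PiE_def)
 show "D X \<in> carrier DA & PA (D X) = dact (cof D) (PA X)" if "X \<in> carrier DA" for X
  using der_closed[OF assms that] der_PA[OF assms that] by simp
qed

lemma cof_mkder: "der_coeffs i c ==> e \<in> B ==> cof (mkder c) e = c e"
 by (simp add: cof_def mkder_apply Qh dact_gen)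

lemma mkder_cong: "(\<And>e. e \<in> B ==> c e = c' e) ==> mkder c = mkder c'"
 unfolding mkder_def dact_def by (intro restrict_ext arg_cong[where f = iA] sum.cong) simp_all

lemma der_eqI:
 assumes "D \<in> der DA i" "E \<in> der DA i" "\<And>e. e \<in> B ==> cof D e = cof E e" shows "D = E"
 using mkder_cong[of "cof D" "cof E"] mkder_cof assms by metis

lemma svec_model:
 assumes "x \<in> part g i"
 shows "svec g i x = mkder (%e. cst (crd e x))" "svec g i x \<in> der DA (i - 1)"
  and "e \<in> B ==> cof (svec g i x) e = cst (crd e x)"
proof -
 have c: "der_coeffs (i - 1) (%e. cst (crd e x))"
  unfolding der_coeffs_def
 proof (intro ballI conjI)
  fix e assume "e \<in> B"
  then show "hom (i - 1 + 1 - dg e) (cst (crd e x))"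
   using crd_part[OF assms, of e] by (cases "crd e x = 0") auto
 qed simp
 have sd: "mkder (%e. cst (crd e x)) (sdual g j \<theta>) = csmult DA (\<theta> x) \<one>\<^bsub>DA\<^esub>" if t: "\<theta> \<in> mpart (dual g) j" for j \<theta>
 proof (rule PA_inj)
  have "PA (mkder (%e. cst (crd e x)) (sdual g j \<theta>)) = (\<Sum>e\<in>B. cst (\<theta> e * crd e x))"
   using sdual_model[OF t] by (simp add: mkder_apply[OF c] dact_lQ cst_mult)
  also have "\<dots> = cst (\<Sum>e\<in>B. \<theta> e * crd e x)"
   by (rule sfun_eqI) (simp add: co_cst)
  also have "(\<Sum>e\<in>B. \<theta> e * crd e x) = \<theta> x" using linear_expand[of \<theta> x] t by (simp add: dual_part)
  finally show "PA (mkder (%e. cst (crd e x)) (sdual g j \<theta>)) = PA (csmult DA (\<theta> x) \<one>\<^bsub>DA\<^esub>)" by simp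
 qed (simp_all add: mkder_apply[OF c] sdual_model[OF t])
 have D: "D = mkder (%e. cst (crd e x))"
  if D: "D \<in> der DA (i - 1)" "\<forall>j. \<forall>\<theta>\<in>mpart (dual g) j. D (sdual g j \<theta>) = csmult DA (\<theta> x) \<one>\<^bsub>DA\<^esub>" for D
 proof (rule der_eqI[OF D(1) mkder_der[OF c]])
  fix e assume e: "e \<in> B"
  have "D (Qh e) = csmult DA (crd e x) \<one>\<^bsub>DA\<^esub>"
   unfolding Qh_def using D(2) crd_dual[OF e] by blast
  then show "cof D e = cof (mkder (%e. cst (crd e x))) e"
   by (simp add: cof_mkder[OF c e]) (simp add: cof_def)
 qed
 show eq: "svec g i x = mkder (%e. cst (crd e x))"
  unfolding svec_def
 proof (rule the_equality)
  show "mkder (%e. cst (crd e x)) \<in> der DA (i - 1) &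
   (\<forall>j. \<forall>\<theta>\<in>mpart (dual g) j. mkder (%e. cst (crd e x)) (sdual g j \<theta>) = csmult DA (\<theta> x) \<one>\<^bsub>DA\<^esub>)"
   using mkder_der[OF c] sd by blast
 qed (rule D; blast)
 show "svec g i x \<in> der DA (i - 1)" unfolding eq by (rule mkder_der[OF c])
 show "e \<in> B ==> cof (svec g i x) e = cst (crd e x)" unfolding eq by (rule cof_mkder[OF c])
qed

section \<open>Two-shifted polyvectors as symmetric functions\<close>

abbreviation "PM \<equiv> pol_mod DA 2"

lemma PM_simps:
 "mpart PM i = der DA (i - 3)"
 "madd PM D E = (\<lambda>a\<in>carrier DA. D a \<oplus>\<^bsub>DA\<^esub> E a)"
 "msmult PM i a D = (\<lambda>b\<in>carrier DA. csmult DA (ksgn i) a \<otimes>\<^bsub>DA\<^esub> D b)"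
proof -
 have "(ksgn (i * (- 2 - 1)) :: 'k) = ksgn i" by (rule ksgn_cong) simp
 then show "msmult PM i a D = (\<lambda>b\<in>carrier DA. csmult DA (ksgn i) a \<otimes>\<^bsub>DA\<^esub> D b)"
  by (simp add: pol_mod_def mshift_def tangent_def)
qed (simp_all add: pol_mod_def mshift_def tangent_def)

lemma madd_model:
 assumes "D \<in> der DA i" "E \<in> der DA i"
 shows "madd PM D E \<in> der DA i" "e \<in> B ==> cof (madd PM D E) e = cof D e + cof E e"
proof -
 have c: "der_coeffs i (%e. cof D e + cof E e)"
  using der_coeffs_cof[OF assms(1)] der_coeffs_cof[OF assms(2)] by (simp add: der_coeffs_def symset_add)
 have eq: "madd PM D E = mkder (%e. cof D e + cof E e)"
  unfolding PM_simps
  by (rule der_eq_mkder[OF _ c])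
   (use assms in \<open>simp_all add: der_closed[OF assms(1)] der_closed[OF assms(2)] der_PA[OF assms(1)] der_PA[OF assms(2)] dact_def distrib_right sum.distrib\<close>)
 show "madd PM D E \<in> der DA i" unfolding eq by (rule mkder_der[OF c])
 show "e \<in> B ==> cof (madd PM D E) e = cof D e + cof E e" unfolding eq by (rule cof_mkder[OF c])
qed

lemma msmult_model:
 assumes "a \<in> cpart DA i" "D \<in> der DA j"
 shows "msmult PM i a D \<in> der DA (i + j)" "e \<in> B ==> cof (msmult PM i a D) e = cst (ksgn i) * (PA a * cof D e)"
proof -
 have a: "a \<in> carrier DA" "hom i (PA a)" using assms(1) by (simp_all add: cpart_DA)
 let ?c = "%e. cst (ksgn i) * (PA a * cof D e)"
 have c: "der_coeffs (i + j) ?c"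
  unfolding der_coeffs_def
 proof (intro ballI conjI)
  fix e assume "e \<in> B"
  then have "cof D e \<in> symset LQ" "hom (j + 1 - dg e) (cof D e)"
   using der_coeffs_cof[OF assms(2)] by (simp_all add: der_coeffs_def)
  then show "?c e \<in> symset LQ" "hom (i + j + 1 - dg e) (?c e)"
   using homg_mult[OF a(2), of "j + 1 - dg e" "cof D e"] a
   by (simp_all add: symset_scale symset_mult algebra_simps)
 qed
 have eq: "msmult PM i a D = mkder ?c"
  unfolding PM_simps
  by (rule der_eq_mkder[OF _ c])
   (use a in \<open>simp_all add: der_closed[OF assms(2)] der_PA[OF assms(2)] dact_def sum_distrib_left mult.assoc\<close>)
 show "msmult PM i a D \<in> der DA (i + j)" unfolding eq by (rule mkder_der[OF c])
 show "e \<in> B ==> cof (msmult PM i a D) e = ?c e" unfolding eq by (rule cof_mkder[OF c])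
qed

text \<open>The function that represents \<open>s\<^sup>3D\<close>. The coefficients of D are multiplied by the letters \<open>Pe\<close>, and the sign comes from moving the shift past these coefficients.\<close>
definition emb :: "int => (('k, 'v) sym_dual => ('k, 'v) sym_dual) => ('v, 'k) pqfun"
 where "emb j D = (\<Sum>e\<in>B. cst (ksgn (j + dg e)) * (cof D e * gen (Pe e)))"

definition lmP :: "(('k, 'v) sym_dual, ('k, 'v) sym_dual => ('k, 'v) sym_dual) letter => ('v, 'k) pqfun"
 where "lmP u = (case u of Coef i a => PA a | Gen j D => emb j D)"

definition lzP :: "int \<times> bool \<times> 'v => (('k, 'v) sym_dual, ('k, 'v) sym_dual => ('k, 'v) sym_dual) letter"
 where "lzP z = (let e = snd (snd z) in if fst (snd z) then Gen (dg e + 2) (svec g (dg e) e) else Coef (1 - dg e) (Qh e))"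

lemma lzP_simps: "lzP (Pe e) = Gen (dg e + 2) (svec g (dg e) e)" "lzP (Qe e) = Coef (1 - dg e) (Qh e)"
 by (simp_all add: lzP_def)

lemma letters_P: "u \<in> sym_letters DA PM \<longleftrightarrow>
 (case u of Coef i a => a \<in> cpart DA i | Gen j D => D \<in> der DA (j - 3))"
 by (cases u) (auto simp: sym_letters_def PM_simps)

lemma LQ_LPQ: "LQ \<subseteq> LPQ"
 by (auto simp: LQ_def LPQ_def)

lemma symset_LQ_LPQ: "f \<in> symset LQ ==> f \<in> symset LPQ"
 using symset_mono LQ_LPQ by blast

lemma Pe_LPQ: "e \<in> B ==> Pe e \<in> LPQ" and Qe_LPQ: "e \<in> B ==> Qe e \<in> LPQ"
 by (simp_all add: LPQ_def)

lemma emb_symset: "D \<in> der DA i ==> emb j D \<in> symset LPQ"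
 unfolding emb_def using der_coeffs_cof[of D i]
 by (intro symset_sum symset_scale symset_mult symset_lin)
  (auto simp: der_coeffs_def split: if_splits intro: symset_mono[OF _ LQ_LPQ] Pe_LPQ)

lemma emb_hom: assumes "D \<in> der DA (j - 3)" shows "hom j (emb j D)"
 unfolding emb_def
proof (intro homg_sum homg_simps)
 fix e assume "e \<in> B"
 then have "hom (j - 3 + 1 - dg e) (cof D e)" using der_coeffs_cof[OF assms] by (simp add: der_coeffs_def)
 from homg_mult[OF this homg_gen[of fst "Pe e"]] show "hom j (cof D e * gen (Pe e))" by (simp add: algebra_simps)
qed

lemma homg_wt_LQ: "f \<in> symset LQ ==> homg wt 0 f"
 unfolding homg_def
proof (intro allI impI)
 fix w assume "f \<in> symset LQ" "co f w ~= 0"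
 then have "set w \<subseteq> LQ" by (rule symset_supp)
 then show "sum_list (map wt w) = 0" by (induction w) (auto simp: LQ_def)
qed

lemma lmP_hom: "u \<in> sym_letters DA PM ==> hom (ldeg u) (lmP u)"
 by (cases u) (simp_all add: letters_P lmP_def cpart_DA emb_hom)

lemma DP_gens: "sym_gens DA PM LPQ lzP"
proof
 show "lzP z \<in> sym_letters DA PM" if "z \<in> LPQ" for z
  using that svec_model(2)[OF B_part] Qh(3) by (auto simp: LPQ_def lzP_simps letters_P)
 show "sym_rels DA PM \<subseteq> carrier (sym_free DA PM)"
 proof (rule sym_rels_carrierI)
  show "a \<otimes>\<^bsub>DA\<^esub> b \<in> cpart DA (i + j)" if "a \<in> cpart DA i" "b \<in> cpart DA j" for i j a b
   using that by (auto simp: cpart_DA intro: homg_mult)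
  show "msmult PM i a x \<in> mpart PM (i + j)" if "a \<in> cpart DA i" "x \<in> mpart PM j" for i j a x
   using msmult_model(1)[of a i x "j - 3"] that by (simp add: PM_simps(1) add_diff_eq)
  show "madd PM x y \<in> mpart PM i" if "x \<in> mpart PM i" "y \<in> mpart PM i" for x y i
   using that madd_model(1) by (simp add: PM_simps(1))
 qed (auto simp: cpart_DA)
qed

end

sublocale two_term_basis \<subseteq> H: sym_gens DA PM LPQ lzP
 by (rule DP_gens)

context two_term_basis
begin

lemma reducible_P_zero: "mon [Coef i \<zero>\<^bsub>DA\<^esub>] \<in> H.R"
proof -
 have 0: "\<zero>\<^bsub>DA\<^esub> \<in> cpart DA i" "\<zero>\<^bsub>DA\<^esub> \<oplus>\<^bsub>DA\<^esub> \<zero>\<^bsub>DA\<^esub> = \<zero>\<^bsub>DA\<^esub>" by (simp add: cpart_DA, rule PA_inj) simp_all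
 then have "H.cong (mon [Coef i \<zero>\<^bsub>DA\<^esub>]) 0"
  using H.rel_Coef_add[of "\<zero>\<^bsub>DA\<^esub>" i "\<zero>\<^bsub>DA\<^esub>"] by (intro H.double_zero) simp
 then show ?thesis by (rule H.reducible_cong) (simp_all add: letters_P 0)
qed

lemma reducible_P_Coef:
 assumes "a \<in> cpart DA i" shows "mon [Coef i a] \<in> H.R"
proof -
 have cpart: "iA f \<in> cpart DA i" if "f \<in> symset LQ" "hom i f" for f i
  using that by (simp add: cpart_DA iA)
 have C: "mon [Coef i (iA f)] \<in> carrier (sym_free DA PM)" if "f \<in> symset LQ" "hom i f" for f i
  using cpart[OF that] by (simp add: letters_P)
 have iA0: "iA 0 = \<zero>\<^bsub>DA\<^esub>" by (rule PA_inj) (simp_all add: iA)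
 have word: "mon [Coef (wd w) (iA (lw w))] \<in> H.R" if "set w \<subseteq> LQ" for w
  using that
 proof (induction w)
  case Nil
  have "iA 1 = \<one>\<^bsub>DA\<^esub>" by (rule PA_inj) (simp_all add: iA)
  then show ?case
   using H.reducible_cong[OF H.rel_Coef_one] by (simp add: letters_P cpart_DA)
 next
  case (Cons z w)
  then obtain e where e: "e \<in> B" "z = Qe e" by (auto simp: LQ_def)
  have s: "(lw w :: ('v, 'k) pqfun) \<in> symset LQ" "(lw (z # w) :: ('v, 'k) pqfun) \<in> symset LQ" using Cons.prems by (auto intro!: symset_lw simp del: list.map prod_list.Cons)
  have iz: "iA (lw (z # w)) = Qh e \<otimes>\<^bsub>DA\<^esub> iA (lw w)"
   using s e Qh[OF e(1)] by (intro PA_inj) (simp_all add: iA)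
  have c1: "H.cong (mon [Coef (1 - dg e) (Qh e)] * mon [Coef (wd w) (iA (lw w))]) (mon [Coef (wd (z # w)) (iA (lw (z # w)))])"
   using H.rel_Coef_mult[OF Qh(3)[OF e(1)] cpart[OF s(1) homg_lw]] e iz by simp
  have "mon [Coef (1 - dg e) (Qh e)] \<in> H.R"
   using red_mon[of "[Qe e]" LPQ lzP DA PM] e by (simp add: lzP_simps LPQ_def)
  moreover have "mon [Coef (wd w) (iA (lw w))] \<in> H.R" using Cons by simp
  ultimately have "mon [Coef (1 - dg e) (Qh e)] * mon [Coef (wd w) (iA (lw w))] \<in> H.R"
   by (rule H.reducible_mult)
  then show ?case
   by (rule H.reducible_cong[OF H.cong_sym[OF c1] C[OF s(2) homg_lw]])
 qed
 have "PA a \<in> symset LQ & (\<forall>i. mon [Coef i (iA (hcomp i (PA a)))] \<in> H.R)"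
 proof (rule symset_induct[OF finite_LQ])
  show "PA a \<in> symset LQ" using assms by (simp add: cpart_DA)
  show "0 \<in> symset LQ & (\<forall>i. mon [Coef i (iA (hcomp i 0))] \<in> H.R)"
   using reducible_P_zero by (simp add: hcomp_hom[of 0] iA0)
  show "f + h \<in> symset LQ & (\<forall>i. mon [Coef i (iA (hcomp i (f + h)))] \<in> H.R)"
   if "f \<in> symset LQ & (\<forall>i. mon [Coef i (iA (hcomp i f))] \<in> H.R)" "h \<in> symset LQ & (\<forall>i. mon [Coef i (iA (hcomp i h))] \<in> H.R)" for f h
  proof (intro conjI allI)
   show "f + h \<in> symset LQ" using that by (simp add: symset_add)
   fix i
   have s: "hcomp i f \<in> symset LQ" "hcomp i h \<in> symset LQ" using that by (auto intro: symset_hcomp)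
   have eq: "hcomp i (f + h) = hcomp i f + hcomp i h" by (rule sfun_eqI) simp
   have i: "iA (hcomp i (f + h)) = iA (hcomp i f) \<oplus>\<^bsub>DA\<^esub> iA (hcomp i h)"
    unfolding eq using s by (intro PA_inj) (simp_all add: iA symset_add)
   have "H.cong (mon [Coef i (iA (hcomp i (f + h)))]) (mon [Coef i (iA (hcomp i f))] + mon [Coef i (iA (hcomp i h))])"
    unfolding i by (intro H.rel_Coef_add cpart s hom_hcomp)
   moreover have "mon [Coef i (iA (hcomp i (f + h)))] \<in> carrier (sym_free DA PM)"
    by (intro C hom_hcomp) (simp add: eq s symset_add)
   moreover have "mon [Coef i (iA (hcomp i f))] + mon [Coef i (iA (hcomp i h))] \<in> H.R"
    using that by (intro red_add) auto
   ultimately show "mon [Coef i (iA (hcomp i (f + h)))] \<in> H.R" by (rule H.reducible_cong)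
  qed
  show "cst k * f \<in> symset LQ & (\<forall>i. mon [Coef i (iA (hcomp i (cst k * f)))] \<in> H.R)"
   if "f \<in> symset LQ & (\<forall>i. mon [Coef i (iA (hcomp i f))] \<in> H.R)" for f k
  proof (intro conjI allI)
   show "cst k * f \<in> symset LQ" using that by (simp add: symset_scale)
   fix i
   have s: "hcomp i f \<in> symset LQ" using that by (auto intro: symset_hcomp)
   have eq: "hcomp i (cst k * f) = cst k * hcomp i f" by (rule sfun_eqI) simp
   have i: "iA (hcomp i (cst k * f)) = csmult DA k (iA (hcomp i f))"
    unfolding eq using s by (intro PA_inj) (simp_all add: iA symset_scale)
   have "H.cong (mon [Coef i (iA (hcomp i (cst k * f)))]) (const k * mon [Coef i (iA (hcomp i f))])"
    unfolding i by (intro H.rel_Coef_scale cpart s hom_hcomp)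
   moreover have "mon [Coef i (iA (hcomp i (cst k * f)))] \<in> carrier (sym_free DA PM)"
    by (intro C hom_hcomp) (simp add: eq s symset_scale)
   moreover have "const k * mon [Coef i (iA (hcomp i f))] \<in> H.R"
    using that by (intro red_scale) auto
   ultimately show "mon [Coef i (iA (hcomp i (cst k * f)))] \<in> H.R" by (rule H.reducible_cong)
  qed
  show "lw w \<in> symset LQ & (\<forall>i. mon [Coef i (iA (hcomp i (lw w)))] \<in> H.R)" if "set w \<subseteq> LQ" for w
   using symset_lw[OF that] word[OF that] reducible_P_zero by (simp add: hcomp_hom[OF homg_lw] iA0)
 qed
 then have "mon [Coef i (iA (hcomp i (PA a)))] \<in> H.R" by blast
 then show ?thesis using assms hcomp_hom[of i "PA a" i] by (simp add: cpart_DA iA_PA)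
qed

lemma reducible_P_Gen:
 assumes D: "D \<in> der DA (j - 3)" shows "mon [Gen j D] \<in> H.R"
proof -
 have dc: "der_coeffs (j - 3) (%e. if e \<in> S then cof D e else 0)" for S
  using der_coeffs_cof[OF D] by (simp add: der_coeffs_def)
 let ?D = "%S. mkder (%e. if e \<in> S then cof D e else 0)"
 have DS: "?D S \<in> der DA (j - 3)" for S using mkder_der[OF dc] .
 have C: "mon [Gen j E] \<in> carrier (sym_free DA PM)" if "E \<in> der DA (j - 3)" for E
  using that by (simp add: letters_P)
 have "mon [Gen j (?D S)] \<in> H.R" if "S \<subseteq> B" for S
  using finite_subset[OF that finite_B] that
 proof (induction S rule: finite_induct)
  case empty
  have "madd PM (?D {}) (?D {}) = ?D {}"
   by (rule der_eqI[OF madd_model(1)[OF DS DS] DS]) (simp only: madd_model(2)[OF DS DS] cof_mkder[OF dc], simp)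
  then have "H.cong (mon [Gen j (?D {})]) 0"
   using H.rel_Gen_add[of "?D {}" j "?D {}"] DS[of "{}"] by (intro H.double_zero) (simp add: PM_simps(1))
  then show ?case by (rule H.reducible_cong) (rule C[OF DS], simp)
 next
  case (insert e S)
  have e: "e \<in> B" using insert.prems by simp
  let ?a = "iA (cst (ksgn (j - 3 + 1 - dg e)) * cof D e)"
  have ce: "cof D e \<in> symset LQ" "hom (j - 3 + 1 - dg e) (cof D e)"
   using der_coeffs_cof[OF D] e by (simp_all add: der_coeffs_def)
  then have a: "?a \<in> cpart DA (j - 3 + 1 - dg e)" by (simp add: cpart_DA iA symset_scale)
  note sv = svec_model[OF B_part[OF e]]
  have j: "j - 3 + 1 - dg e + (dg e - 1) = j - 3" "j - 3 + 1 - dg e + (dg e + 2) = j" by simp_all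
  note ms = msmult_model[OF a sv(2), unfolded j]
  let ?E = "msmult PM (j - 3 + 1 - dg e) ?a (svec g (dg e) e)"
  have cofE: "cof ?E e' = (if e' = e then cof D e else 0)" if "e' \<in> B" for e'
   using ms(2)[OF that] sv(3)[OF that] ce crd_basis[OF that e]
   by (simp add: iA symset_scale flip: mult.assoc cst_mult)
  have eq: "?D (insert e S) = madd PM ?E (?D S)"
  proof (rule der_eqI[OF DS])
   show "madd PM ?E (?D S) \<in> der DA (j - 3)" by (rule madd_model(1)[OF ms(1) DS])
   show "cof (?D (insert e S)) e' = cof (madd PM ?E (?D S)) e'" if "e' \<in> B" for e'
    unfolding madd_model(2)[OF ms(1) DS that] cof_mkder[OF dc that] cofE[OF that] using insert.hyps by auto
  qed
  have "H.cong (mon [Coef (j - 3 + 1 - dg e) ?a] * mon [Gen (dg e + 2) (svec g (dg e) e)]) (mon [Gen j ?E])"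
   using H.rel_Gen_smult[OF a, of "svec g (dg e) e" "dg e + 2"] sv(2) j by (simp add: PM_simps(1))
  note c1 = H.cong_sym[OF this]
  have "mon [Gen (dg e + 2) (svec g (dg e) e)] \<in> H.R"
   using red_mon[of "[Pe e]" LPQ lzP DA PM] e by (simp add: lzP_simps LPQ_def)
  then have "mon [Gen j ?E] \<in> H.R"
   by (intro H.reducible_cong[OF c1 C[OF ms(1)]] H.reducible_mult reducible_P_Coef a)
  moreover have "mon [Gen j (?D S)] \<in> H.R" using insert by simp
  moreover have c2: "H.cong (mon [Gen j (?D (insert e S))]) (mon [Gen j ?E] + mon [Gen j (?D S)])"
   unfolding eq by (rule H.rel_Gen_add) (simp_all only: PM_simps(1) ms(1) DS)
  ultimately show ?case by (intro H.reducible_cong[OF c2 C[OF DS]] red_add)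
 qed
 from this[OF subset_refl] mkder_cong[of "%e. if e \<in> B then cof D e else 0" "cof D"] mkder_cof[OF D]
 show ?thesis by simp
qed

lemma DP_model: "sym_model DA PM LPQ lzP lmP wt"
proof
 show "finite LPQ" by simp
 show "ev lmP r = 0" if r: "r \<in> sym_rels DA PM" for r
 proof (rule ev_relsI[OF _ _ _ _ _ _ lmP_hom r])
  show "lmP (Gen i (madd PM x y)) = lmP (Gen i x) + lmP (Gen i y)" if "x \<in> mpart PM i" "y \<in> mpart PM i" for i x y
   using that by (simp add: lmP_def PM_simps(1) emb_def madd_model distrib_left distrib_right sum.distrib)
  show "lmP (Gen (i + j) (msmult PM i a x)) = lmP (Coef i a) * lmP (Gen j x)" if "a \<in> cpart DA i" "x \<in> mpart PM j" for i j a x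
  proof -
   have "cst (ksgn (i + j + dg e)) * (cof (msmult PM i a x) e * gen (Pe e)) =
     PA a * (cst (ksgn (j + dg e)) * (cof x e * gen (Pe e)))" if e: "e \<in> B" for e
   proof -
    have s: "(ksgn (i + j + dg e) * ksgn i :: 'k) = ksgn (j + dg e)"
     unfolding ksgn_add[symmetric] by (rule ksgn_cong) simp
    have "PA a * (cst (ksgn (j + dg e)) * (cof x e * gen (Pe e))) = cst (ksgn (j + dg e)) * (PA a * (cof x e * gen (Pe e)))"
     by (rule cst_left)
    then show ?thesis
     using msmult_model(2)[of a i x "j - 3" e] that \<open>a \<in> cpart DA i\<close> \<open>x \<in> mpart PM j\<close> e
     by (simp add: PM_simps(1) mult.assoc flip: s) (simp add: cst_mult mult.assoc)
   qed
   then show ?thesis by (simp add: lmP_def emb_def sum_distrib_left)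
  qed
 qed (auto simp: lmP_def cpart_DA)
 show "lmP u \<in> symset LPQ" if "u \<in> sym_letters DA PM" for u
  using that emb_symset by (cases u) (auto simp: lmP_def letters_P cpart_DA intro: symset_LQ_LPQ)
 show "hom (ldeg u) (lmP u)" if "u \<in> sym_letters DA PM" for u using that by (rule lmP_hom)
 show "homg wt (int (lweight u)) (lmP u)" if "u \<in> sym_letters DA PM" for u
 proof (cases u)
  case (Coef i a)
  then show ?thesis using that by (simp add: lmP_def letters_P cpart_DA homg_wt_LQ)
 next
  case (Gen j D)
  have "homg wt 1 (cof D e * gen (Pe e))" if "e \<in> B" for e
  proof -
   have "cof D e \<in> symset LQ" using der_coeffs_cof[of D "j - 3"] that \<open>u \<in> sym_letters DA PM\<close> Gen by (simp add: letters_P der_coeffs_def)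
   from homg_mult[OF homg_wt_LQ[OF this] homg_gen[of wt "Pe e"]] show ?thesis by simp
  qed
  then show ?thesis using Gen by (simp add: lmP_def emb_def homg_sum)
 qed
 show "lmP (lzP z) = gen z" if "z \<in> LPQ" for z
 proof -
  from that consider e where "e \<in> B" "z = Qe e" | e where "e \<in> B" "z = Pe e" by (auto simp: LPQ_def)
  then show ?thesis
  proof cases
   case 1
   then show ?thesis by (simp add: lzP_simps lmP_def Qh)
  next
   case 2
   have "emb (dg e + 2) (svec g (dg e) e) = (\<Sum>e'\<in>B. if e' = e then gen (Pe e) else 0)"
    unfolding emb_def
    by (intro sum.cong refl) (use 2 svec_model(3)[OF B_part] in \<open>auto simp: crd_basis ksgn_def\<close>)
   then show ?thesis using 2 finite_B by (simp add: lzP_simps lmP_def)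
  qed
 qed
 show "mon [u] \<in> H.R" if "u \<in> sym_letters DA PM" for u
  using that reducible_P_Coef reducible_P_Gen by (cases u) (simp_all add: letters_P)
qed

end

sublocale two_term_basis \<subseteq> W: sym_model DA PM LPQ lzP lmP wt
 by (rule DP_model)

context two_term_basis
begin

section \<open>The Schouten bracket in the function model\<close>

abbreviation "DP \<equiv> pol DA 2"
abbreviation "Ps \<equiv> W.Psi"

lemmas DP_closed [simp] = W.P_closed[folded pol_def]
lemmas Ps_ops [simp] = W.Psi_ops[folded pol_def]
lemmas Ps_inj = W.Psi_inj[folded pol_def]
lemmas Ps_symset [simp] = W.Psi_symset[folded pol_def]
lemmas Ps_surj = W.Psi_surj[folded pol_def]
lemmas cpart_DP = W.cpart_P[folded pol_def]
lemmas wpart_DP = W.sym_wpart_P[folded pol_def]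

definition iP :: "('v, 'k) pqfun => ('k, 'v) gpol"
 where "iP f = (SOME X. X \<in> carrier DP & Ps X = f)"

lemma iP: assumes "f \<in> symset LPQ" shows iP_carrier: "iP f \<in> carrier DP" and Ps_iP: "Ps (iP f) = f"
 using someI_ex[of "%X. X \<in> carrier DP & Ps X = f"] Ps_surj[OF assms] unfolding iP_def by blast+

lemma Ps_coef: "Ps (sym_coef DA PM i a) = PA a"
 by (simp add: sym_coef_def lmP_def)

lemma Ps_gen: "Ps (sym_gen DA PM j D) = emb j D"
 by (simp add: sym_gen_def lmP_def)

lemma coef_carrier: "a \<in> cpart DA i ==> sym_coef DA PM i a \<in> carrier DP"
 unfolding sym_coef_def pol_def by (rule W.cls_carrier) (simp add: letters_P)

lemma gen_carrier: "D \<in> der DA (j - 3) ==> sym_gen DA PM j D \<in> carrier DP"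
 unfolding sym_gen_def pol_def by (rule W.cls_carrier) (simp add: letters_P)

definition hf :: "int \<times> bool \<times> 'v => int \<times> bool \<times> 'v => ('v, 'k) pqfun => ('v, 'k) pqfun => ('v, 'k) pqfun"
 where "hf z y f h = Dl z (tw (fst z) f) * Dl y h"

definition hfs :: "'v => ('v, 'k) pqfun => ('v, 'k) pqfun => ('v, 'k) pqfun"
 where "hfs e f h = hf (Pe e) (Qe e) f h + hf (Qe e) (Pe e) f h"

text \<open>The canonical Poisson bracket, for which \<open>Pe\<close> and \<open>Qe\<close> are conjugate. The degree shift by 3 is responsible for the twists.\<close>
definition bM :: "('v, 'k) pqfun => ('v, 'k) pqfun => ('v, 'k) pqfun"
 where "bM f h = - (\<Sum>e\<in>B. hfs e f h)"

lemma hf_linear: "hf z y (f + f') h = hf z y f h + hf z y f' h" "hf z y f (h + h') = hf z y f h + hf z y f h'"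
 "hf z y (cst c * f) h = cst c * hf z y f h" "hf z y f (cst c * h) = cst c * hf z y f h"
 by (simp_all add: hf_def distrib_left distrib_right mult.assoc cst_left[of "Dl _ _"])

lemma hfs_linear: "hfs e (f + f') h = hfs e f h + hfs e f' h" "hfs e f (h + h') = hfs e f h + hfs e f h'"
 "hfs e (cst c * f) h = cst c * hfs e f h" "hfs e f (cst c * h) = cst c * hfs e f h"
 by (simp_all add: hfs_def hf_linear distrib_left add_ac)

lemma bM_linear: "bM (f + f') h = bM f h + bM f' h" "bM f (h + h') = bM f h + bM f h'"
 "bM (cst c * f) h = cst c * bM f h" "bM f (cst c * h) = cst c * bM f h"
 by (simp_all add: bM_def hfs_linear sum.distrib sum_distrib_left)

lemma bM_zero [simp]: "bM 0 h = 0" "bM f 0 = 0"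
 using bM_linear(3)[of 0 0 h] bM_linear(4)[of f 0 0] by simp_all

lemma hf_mult:
 assumes "fst z + fst y = 3" "hom i f" "hom j k"
 shows "hf z y f (k * h) = hf z y f k * h + cst (ksgn (i * j + j * 3)) * (k * hf z y f h)"
proof -
 let ?u = "Dl z (tw (fst z) f)"
 have u: "hom (i - fst z) ?u" using assms(2) by (intro homg_Dl) simp
 have "?u * (tw (fst y) k * Dl y h) = cst (ksgn (fst y * j)) * (?u * k * Dl y h)"
  by (simp add: tw_hom[OF assms(3)] mult.assoc cst_left[of "Dl _ _"])
 also have "\<dots> = cst (ksgn (fst y * j)) * (cst (ksgn ((i - fst z) * j)) * (k * ?u) * Dl y h)"
  by (simp only: hom_commute[OF u assms(3)])
 also have "\<dots> = cst (ksgn (fst y * j) * ksgn ((i - fst z) * j)) * (k * (?u * Dl y h))"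
  by (simp add: cst_mult mult.assoc)
 also have "(ksgn (fst y * j) * ksgn ((i - fst z) * j) :: 'k) = ksgn (i * j + j * 3)"
 proof -
  have y: "fst y = 3 - fst z" using assms(1) by simp
  show ?thesis unfolding y by (cases "even i"; cases "even j"; cases "even (fst z)") (simp_all add: ksgn_def)
 qed
 finally show ?thesis by (simp add: hf_def Dl_mult distrib_left mult.assoc)
qed

lemma hf_swap:
 assumes "fst z + fst y = 3" "hom i f" "hom j h"
 shows "hf z y f h = cst (- ksgn ((i - 3) * (j - 3))) * hf y z h f"
proof -
 have y: "fst y = 3 - fst z" using assms(1) by simp
 have "hf z y f h = cst (ksgn (fst z * i)) * (Dl z f * Dl y h)"
  by (simp add: hf_def tw_hom[OF assms(2)] mult.assoc)
 also have "Dl z f * Dl y h = cst (ksgn ((i - fst z) * (j - fst y))) * (Dl y h * Dl z f)"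
  by (intro hom_commute homg_Dl assms)
 also have "cst (ksgn (fst z * i)) * (cst (ksgn ((i - fst z) * (j - fst y))) * (Dl y h * Dl z f)) =
   cst (ksgn (fst z * i) * ksgn ((i - fst z) * (j - fst y))) * (Dl y h * Dl z f)"
  by (simp add: cst_mult mult.assoc)
 also have "(ksgn (fst z * i) * ksgn ((i - fst z) * (j - fst y)) :: 'k) = - ksgn ((i - 3) * (j - 3)) * ksgn (fst y * j)"
  unfolding y by (cases "even i"; cases "even j"; cases "even (fst z)") (simp_all add: ksgn_def)
 also have "cst (- ksgn ((i - 3) * (j - 3)) * ksgn (fst y * j)) * (Dl y h * Dl z f) = cst (- ksgn ((i - 3) * (j - 3))) * hf y z h f"
  by (simp add: hf_def tw_hom[OF assms(3)] mult.assoc cst_mult cst_uminus)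
 finally show ?thesis .
qed

lemma bM_mult:
 assumes "hom i f" "hom j k"
 shows "bM f (k * h) = bM f k * h + cst (ksgn (i * j + j * 3)) * (k * bM f h)"
proof -
 have "hfs e f (k * h) = hfs e f k * h + cst (ksgn (i * j + j * 3)) * (k * hfs e f h)" for e
  using hf_mult[of "Pe e" "Qe e", OF _ assms] hf_mult[of "Qe e" "Pe e", OF _ assms]
  by (simp add: hfs_def distrib_left distrib_right)
 then show ?thesis
  by (simp add: bM_def sum.distrib sum_distrib_left sum_distrib_right)
qed

lemma bM_swap:
 assumes "hom i f" "hom j h" shows "bM f h = cst (- ksgn ((i - 3) * (j - 3))) * bM h f"
proof -
 have "hfs e f h = cst (- ksgn ((i - 3) * (j - 3))) * hfs e h f" for e
  using hf_swap[of "Pe e" "Qe e", OF _ assms] hf_swap[of "Qe e" "Pe e", OF _ assms]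
  by (simp add: hfs_def distrib_left add.commute)
 then show ?thesis by (simp add: bM_def sum_distrib_left)
qed

lemma bM_hom: assumes "hom i f" "hom j h" shows "hom (i + j - 3) (bM f h)"
proof -
 have "hom (i + j - 3) (hf z y f h)" if "fst z + fst y = 3" for z y
 proof -
  have "hom (i - fst z) (Dl z (tw (fst z) f))" using assms by (intro homg_Dl homg_simps)
  from homg_mult[OF this homg_Dl[OF assms(2), of y]] show ?thesis
   using that by (simp add: hf_def algebra_simps)
 qed
 then show ?thesis unfolding bM_def hfs_def by (intro homg_simps homg_sum homg_add) simp_all
qed

lemma bM_symset: "f \<in> symset L ==> h \<in> symset L ==> bM f h \<in> symset L"
 unfolding bM_def hfs_def hf_def by (intro symset_uminus symset_sum symset_add symset_mult symset_Dl symset_tw)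

lemma Dl_Pe_LQ: assumes "f \<in> symset LQ" shows "Dl (Pe e) f = 0"
proof (rule sfun_eqI)
 show "co (Dl (Pe e) f) w = co 0 w" for w
  using symset_supp[OF assms, of "Pe e # w"] by (cases "co f (Pe e # w) = 0") (auto simp: LQ_def)
qed

lemma DlP_emb:
 assumes D: "D \<in> der DA i" and e: "e \<in> B"
 shows "Dl (Pe e) (tw (dg e + 2) (emb (i + 3) D)) = - (cst (ksgn i) * cof D e)"
proof -
 have c: "cof D e' \<in> symset LQ" "hom (i + 1 - dg e') (cof D e')" if "e' \<in> B" for e'
  using der_coeffs_cof[OF D] that by (simp_all add: der_coeffs_def)
 have "Dl (Pe e) (emb (i + 3) D) = (\<Sum>e'\<in>B. if e' = e then cst (ksgn (i + 3 + dg e)) * tw (dg e + 2) (cof D e) else 0)"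
  unfolding emb_def Dl_simps by (intro sum.cong refl) (simp add: Dl_mult Dl_Pe_LQ c cst_central)
 also have "\<dots> = cst (ksgn (i + 3 + dg e)) * (cst (ksgn ((dg e + 2) * (i + 1 - dg e))) * cof D e)"
  using e finite_B by (simp add: tw_hom[OF c(2)])
 finally have "Dl (Pe e) (tw (dg e + 2) (emb (i + 3) D)) =
   cst (ksgn ((dg e + 2) * (i + 3)) * (ksgn (i + 3 + dg e) * ksgn ((dg e + 2) * (i + 1 - dg e)))) * cof D e"
  using emb_hom[of D "i + 3"] D by (simp add: tw_hom[of "i + 3"] cst_mult mult.assoc)
 also have "(ksgn ((dg e + 2) * (i + 3)) * (ksgn (i + 3 + dg e) * ksgn ((dg e + 2) * (i + 1 - dg e))) :: 'k) = - ksgn i"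
  by (cases "even i"; cases "even (dg e)") (simp_all add: ksgn_def)
 finally show ?thesis by (simp add: cst_uminus)
qed

lemma DlQ_emb: "Dl (Qe e) (emb j D) = (\<Sum>f\<in>B. cst (ksgn (j + dg f)) * (Dl (Qe e) (cof D f) * gen (Pe f)))"
 by (simp add: emb_def Dl_mult)

lemma half_bracket:
 assumes D: "D \<in> der DA i" and E: "E \<in> der DA j"
 shows "- (\<Sum>e\<in>B. hf (Pe e) (Qe e) (emb (i + 3) D) (emb (j + 3) E)) =
  (\<Sum>f\<in>B. cst (ksgn (i + j + 3 + dg f)) * (PA (D (E (Qh f))) * gen (Pe f)))"
proof -
 have "- (\<Sum>e\<in>B. hf (Pe e) (Qe e) (emb (i + 3) D) (emb (j + 3) E)) =
  (\<Sum>e\<in>B. \<Sum>f\<in>B. cst (ksgn i) * (cof D e * (cst (ksgn (j + 3 + dg f)) * (Dl (Qe e) (cof E f) * gen (Pe f)))))"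
  by (simp add: hf_def DlP_emb[OF D] DlQ_emb sum_negf[symmetric] sum_distrib_left mult.assoc)
 also have "\<dots> = (\<Sum>f\<in>B. \<Sum>e\<in>B. cst (ksgn (i + j + 3 + dg f)) * (cof D e * Dl (Qe e) (cof E f) * gen (Pe f)))"
  by (subst sum.swap) (simp add: cst_left[of "cof _ _"] ksgn_add cst_mult mult.assoc)
 also have "\<dots> = (\<Sum>f\<in>B. cst (ksgn (i + j + 3 + dg f)) * (PA (D (E (Qh f))) * gen (Pe f)))"
  by (intro sum.cong refl)
   (simp add: der_PA[OF D der_closed[OF E]] Qh dact_def cof_def sum_distrib_left sum_distrib_right)
 finally show ?thesis .
qed

lemma bracket_model:
 assumes D: "D \<in> der DA i" and E: "E \<in> der DA j"
 shows "der_bracket DA i j D E \<in> der DA (i + j)"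
  and "emb (i + j + 3) (der_bracket DA i j D E) = bM (emb (i + 3) D) (emb (j + 3) E)"
proof -
 have DE: "D X \<in> carrier DA" "E X \<in> carrier DA" if "X \<in> carrier DA" for X
  using der_closed[OF D that] der_closed[OF E that] by simp_all
 have br: "der_bracket DA i j D E X \<in> carrier DA"
   "PA (der_bracket DA i j D E X) = PA (D (E X)) - cst (ksgn (i * j)) * PA (E (D X))" if "X \<in> carrier DA" for X
  using that DE by (simp_all add: der_bracket_def)
 have hD: "\<And>e. e \<in> B ==> hom (i + 1 - dg e) (cof D e)" and hE: "\<And>e. e \<in> B ==> hom (j + 1 - dg e) (cof E e)"
  using der_coeffs_cof[OF D] der_coeffs_cof[OF E] by (simp_all add: der_coeffs_def)
 have mD: "dact (cof D) (f * h) = dact (cof D) f * h + cst (ksgn (i * l)) * (f * dact (cof D) h)"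
  and mE: "dact (cof E) (f * h) = dact (cof E) f * h + cst (ksgn (j * l)) * (f * dact (cof E) h)"
  and homD: "hom (i + l) (dact (cof D) f)" and homE: "hom (j + l) (dact (cof E) f)" if "hom l f" for f h l
  using hD hE that by (auto intro: dact_mult dact_hom)
 let ?h = "%f. dact (cof D) (dact (cof E) f) - cst (ksgn (i * j)) * dact (cof E) (dact (cof D) f)"
 have PAbr: "PA (der_bracket DA i j D E X) = ?h (PA X)" if "X \<in> carrier DA" for X
  using br[OF that] DE that by (simp add: der_PA[OF D] der_PA[OF E])
 have hmult: "?h (f * h) = ?h f * h + cst (ksgn ((i + j) * l)) * (f * ?h h)" if f: "hom l f" for f h l
 proof -
  note hDf = homD[OF f] and hEf = homE[OF f]
  have 1: "dact (cof D) (dact (cof E) (f * h)) = dact (cof D) (dact (cof E) f) * h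
    + cst (ksgn (i * (j + l))) * (dact (cof E) f * dact (cof D) h)
    + cst (ksgn (j * l)) * (dact (cof D) f * dact (cof E) h)
    + cst (ksgn (j * l) * ksgn (i * l)) * (f * dact (cof D) (dact (cof E) h))"
   unfolding mE[OF f] dact_add dact_scale mD[OF f] mD[OF hEf]
   by (simp add: distrib_left cst_mult mult.assoc add.assoc)
  have 2: "dact (cof E) (dact (cof D) (f * h)) = dact (cof E) (dact (cof D) f) * h
    + cst (ksgn (j * (i + l))) * (dact (cof D) f * dact (cof E) h)
    + cst (ksgn (i * l)) * (dact (cof E) f * dact (cof D) h)
    + cst (ksgn (i * l) * ksgn (j * l)) * (f * dact (cof E) (dact (cof D) h))"
   unfolding mD[OF f] dact_add dact_scale mE[OF f] mE[OF hDf]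
   by (simp add: distrib_left cst_mult mult.assoc add.assoc)
  have s: "ksgn (i * j) * ksgn (j * (i + l)) = (ksgn (j * l) :: 'k)" "ksgn (i * j) * ksgn (i * l) = (ksgn (i * (j + l)) :: 'k)"
   "ksgn (j * l) * ksgn (i * l) = (ksgn ((i + j) * l) :: 'k)" "ksgn (i * l) * ksgn (j * l) = (ksgn ((i + j) * l) :: 'k)"
   unfolding ksgn_add[symmetric] by (rule ksgn_cong, simp add: algebra_simps)+
  have 3: "cst (ksgn (i * j)) * dact (cof E) (dact (cof D) (f * h)) = cst (ksgn (i * j)) * dact (cof E) (dact (cof D) f) * h
    + cst (ksgn (j * l)) * (dact (cof D) f * dact (cof E) h)
    + cst (ksgn (i * (j + l))) * (dact (cof E) f * dact (cof D) h)
    + cst (ksgn ((i + j) * l)) * (f * (cst (ksgn (i * j)) * dact (cof E) (dact (cof D) h)))"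
  proof -
   have t: "cst (ksgn (i * j)) * (cst (ksgn (j * (i + l))) * X) = cst (ksgn (j * l)) * X"
    "cst (ksgn (i * j)) * (cst (ksgn (i * l)) * X) = cst (ksgn (i * (j + l))) * X"
    "cst (ksgn (i * j)) * (cst (ksgn ((i + j) * l)) * (f * X)) = cst (ksgn ((i + j) * l)) * (f * (cst (ksgn (i * j)) * X))" for X
    by (metis s(1) cst_mult mult.assoc, metis s(2) cst_mult mult.assoc, metis cst_left)
   show ?thesis
    unfolding 2 s(4) by (simp only: distrib_left[of "cst _"] mult.assoc[of "cst _"] t)
  qed
  show ?thesis unfolding 3 unfolding 1 s by (simp add: algebra_simps)
 qed
 have der: "der_bracket DA i j D E \<in> der DA (i + j)"
  unfolding der_def
 proof (intro CollectI conjI ballI allI)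
  let ?b = "der_bracket DA i j D E"
  show "?b \<in> carrier DA \<rightarrow>\<^sub>E carrier DA"
   by (intro PiE_I) (simp_all add: br(1), simp add: der_bracket_def)
  show "?b (a \<oplus>\<^bsub>DA\<^esub> b) = ?b a \<oplus>\<^bsub>DA\<^esub> ?b b" if "a \<in> carrier DA" "b \<in> carrier DA" for a b
   using that by (intro PA_inj) (simp_all add: br(1) PAbr dact_add algebra_simps)
  show "?b (csmult DA k a) = csmult DA k (?b a)" if "a \<in> carrier DA" for a k
  proof (rule PA_inj)
   have "cst (ksgn (i * j)) * (cst k * X) = cst k * (cst (ksgn (i * j)) * X)" for X :: "('v, 'k) pqfun"
    by (rule cst_left)
   then show "PA (?b (csmult DA k a)) = PA (csmult DA k (?b a))"
    using that by (simp add: br(1) PAbr dact_scale right_diff_distrib)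
  qed (simp_all add: that br(1))
  show "?b a \<in> cpart DA (l + (i + j))" if "a \<in> cpart DA l" for a l
  proof -
   have a: "a \<in> carrier DA" "hom l (PA a)" using that by (simp_all add: cpart_DA)
   have "hom (l + (i + j)) (?h (PA a))"
    using homD[OF homE[OF a(2)]] homE[OF homD[OF a(2)]]
    by (intro homg_diff homg_simps) (simp_all add: algebra_simps)
   then show ?thesis using a by (simp add: cpart_DA br(1) PAbr)
  qed
  show "?b (a \<otimes>\<^bsub>DA\<^esub> b) = ?b a \<otimes>\<^bsub>DA\<^esub> b \<oplus>\<^bsub>DA\<^esub> csmult DA (ksgn ((i + j) * l)) (a \<otimes>\<^bsub>DA\<^esub> ?b b)"
   if "a \<in> cpart DA l" "b \<in> carrier DA" for a b l
   using that hmult[of l "PA a" "PA b"] by (intro PA_inj) (simp_all add: br(1) PAbr cpart_DA)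
 qed
 then show "der_bracket DA i j D E \<in> der DA (i + j)" .
 have "bM (emb (i + 3) D) (emb (j + 3) E) = - (\<Sum>e\<in>B. hf (Pe e) (Qe e) (emb (i + 3) D) (emb (j + 3) E))
   - (\<Sum>e\<in>B. hf (Qe e) (Pe e) (emb (i + 3) D) (emb (j + 3) E))"
  by (simp add: bM_def hfs_def sum.distrib)
 also have "(\<Sum>e\<in>B. hf (Qe e) (Pe e) (emb (i + 3) D) (emb (j + 3) E)) =
   cst (ksgn (i * j)) * (- (\<Sum>e\<in>B. hf (Pe e) (Qe e) (emb (j + 3) E) (emb (i + 3) D)))"
  using hf_swap[of "Qe _" "Pe _" "i + 3" "emb (i + 3) D" "j + 3" "emb (j + 3) E"] D E emb_hom[of D "i + 3"] emb_hom[of E "j + 3"]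
  by (simp add: sum_distrib_left cst_uminus sum_negf)
 also have "- (\<Sum>e\<in>B. hf (Pe e) (Qe e) (emb (i + 3) D) (emb (j + 3) E)) -
   cst (ksgn (i * j)) * (- (\<Sum>e\<in>B. hf (Pe e) (Qe e) (emb (j + 3) E) (emb (i + 3) D))) =
   emb (i + j + 3) (der_bracket DA i j D E)"
  unfolding half_bracket[OF D E] half_bracket[OF E D]
  unfolding emb_def sum_distrib_left sum_subtractf[symmetric]
 proof (intro sum.cong refl)
  fix f assume f: "f \<in> B"
  have ij: "j + i + 3 + dg f = i + j + 3 + dg f" by simp
  have "cst (ksgn (i * j)) * (cst (ksgn (i + j + 3 + dg f)) * X) = cst (ksgn (i + j + 3 + dg f)) * (cst (ksgn (i * j)) * X)"
   for X :: "('v, 'k) pqfun" by (rule cst_left)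
  then show "cst (ksgn (i + j + 3 + dg f)) * (PA (D (E (Qh f))) * gen (Pe f)) -
   cst (ksgn (i * j)) * (cst (ksgn (j + i + 3 + dg f)) * (PA (E (D (Qh f))) * gen (Pe f))) =
   cst (ksgn (i + j + 3 + dg f)) * (cof (der_bracket DA i j D E) f * gen (Pe f))"
   unfolding ij cof_def br(2)[OF Qh(1)[OF f]] by (simp add: right_diff_distrib left_diff_distrib mult.assoc)
 qed
 finally show "emb (i + j + 3) (der_bracket DA i j D E) = bM (emb (i + 3) D) (emb (j + 3) E)" ..
qed

lemma bM_coef:
 assumes D: "D \<in> der DA i" and a: "a \<in> carrier DA"
 shows "bM (emb (i + 3) D) (PA a) = cst (ksgn i) * PA (D a)"
proof -
 have "hfs e (emb (i + 3) D) (PA a) = - (cst (ksgn i) * (cof D e * Dl (Qe e) (PA a)))"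
  if "e \<in> B" for e
  using that a by (simp add: hfs_def hf_def DlP_emb[OF D] Dl_Pe_LQ mult.assoc)
 then show ?thesis
  by (simp add: bM_def der_PA[OF D a] dact_def sum_distrib_left sum_negf)
qed

lemma bM_coef_coef: "a \<in> carrier DA ==> b \<in> carrier DA ==> bM (PA a) (PA b) = 0"
 unfolding bM_def hfs_def hf_def Dl_tw by (simp add: Dl_Pe_LQ)

lemma der_degree: "D \<in> der DA i ==> a \<in> cpart DA j ==> D a \<in> cpart DA (i + j)"
 unfolding der_def add.commute[of i j] by blast

text \<open>The canonical bracket satisfies the Leibniz rule and antisymmetry; what remains is its value on coefficients and on derivations, which is the evaluation of a derivation and the commutator.\<close>
lemma is_schouten_bM: "is_schouten DA 2 (%X Y. iP (bM (Ps X) (Ps Y)))"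
proof -
 have c: "iP (bM (Ps X) (Ps Y)) \<in> carrier DP" "Ps (iP (bM (Ps X) (Ps Y))) = bM (Ps X) (Ps Y)"
  if "X \<in> carrier DP" "Y \<in> carrier DP" for X Y
  using that by (simp_all add: iP bM_symset)
 have k3: "(ksgn (i * 3) :: 'k) = ksgn i" for i by (rule ksgn_cong) simp
 show ?thesis
  unfolding is_schouten_def Let_def
 proof (intro conjI ballI allI)
  fix i j D a assume D: "D \<in> der DA i" and a: "a \<in> cpart DA j"
  have g: "sym_gen DA PM (i + 2 + 1) D \<in> carrier DP" using D by (intro gen_carrier) simp
  have i3: "i + 2 + 1 = i + 3" by simp
  have Da: "D a \<in> cpart DA (i + j)" using D a by (rule der_degree)
  show "iP (bM (Ps (sym_gen DA PM (i + 2 + 1) D)) (Ps (sym_coef DA PM j a))) =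
    csmult DP (ksgn (i * (2 + 1))) (sym_coef DA PM (i + j) (D a))"
   using bM_coef[OF D, of a] a g c[OF g coef_carrier[OF a]] coef_carrier[OF Da]
   by (intro Ps_inj) (simp_all add: Ps_gen Ps_coef cpart_DA i3 k3)
 next
  fix i j D E assume D: "D \<in> der DA i" and E: "E \<in> der DA j"
  have g: "sym_gen DA PM (i + 2 + 1) D \<in> carrier DP" "sym_gen DA PM (j + 2 + 1) E \<in> carrier DP"
   using D E by (auto intro!: gen_carrier)
  have b: "sym_gen DA PM (i + j + 2 + 1) (der_bracket DA i j D E) \<in> carrier DP"
   using bracket_model(1)[OF D E] by (intro gen_carrier) simp
  have i3: "i + 2 + 1 = i + 3" "j + 2 + 1 = j + 3" "i + j + 2 + 1 = i + j + 3" by simp_all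
  show "iP (bM (Ps (sym_gen DA PM (i + 2 + 1) D)) (Ps (sym_gen DA PM (j + 2 + 1) E))) =
    sym_gen DA PM (i + j + 2 + 1) (der_bracket DA i j D E)"
   using c[OF g] b bracket_model(2)[OF D E] by (intro Ps_inj) (simp_all only: Ps_gen i3)
 next
  fix i j X Y Z assume "X \<in> cpart DP i" "Y \<in> cpart DP j" "Z \<in> carrier DP"
  then show "iP (bM (Ps X) (Ps (Y \<otimes>\<^bsub>DP\<^esub> Z))) = iP (bM (Ps X) (Ps Y)) \<otimes>\<^bsub>DP\<^esub> Z \<oplus>\<^bsub>DP\<^esub>
    csmult DP (ksgn (i * j + j * (2 + 1))) (Y \<otimes>\<^bsub>DP\<^esub> iP (bM (Ps X) (Ps Z)))"
   using bM_mult[of i "Ps X" j "Ps Y" "Ps Z"] c[of X "Y \<otimes>\<^bsub>DP\<^esub> Z"] by (intro Ps_inj) (simp_all add: cpart_DP c)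
 next
  fix i j X Y assume "X \<in> cpart DP i" "Y \<in> cpart DP j"
  then have X: "X \<in> carrier DP" "hom i (Ps X)" and Y: "Y \<in> carrier DP" "hom j (Ps Y)" by (simp_all add: cpart_DP)
  have i3: "i - 2 - 1 = i - 3" "j - 2 - 1 = j - 3" by simp_all
  show "iP (bM (Ps X) (Ps Y)) = csmult DP (- ksgn ((i - 2 - 1) * (j - 2 - 1))) (iP (bM (Ps Y) (Ps X)))"
   unfolding i3
  proof (rule Ps_inj)
   show "Ps (iP (bM (Ps X) (Ps Y))) = Ps (csmult DP (- ksgn ((i - 3) * (j - 3))) (iP (bM (Ps Y) (Ps X))))"
    unfolding Ps_ops(3)[OF c(1)[OF Y(1) X(1)]] c(2)[OF X(1) Y(1)] c(2)[OF Y(1) X(1)] by (rule bM_swap[OF X(2) Y(2)])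
  qed (simp_all add: c X Y)
 next
  fix i j X Y assume "X \<in> cpart DP i" "Y \<in> cpart DP j"
  then show "iP (bM (Ps X) (Ps Y)) \<in> cpart DP (i + j - 2 - 1)"
   using bM_hom[of i "Ps X" j "Ps Y"] by (simp add: cpart_DP c algebra_simps)
 next
  fix i j a b assume a: "a \<in> cpart DA i" "b \<in> cpart DA j"
  then show "iP (bM (Ps (sym_coef DA PM i a)) (Ps (sym_coef DA PM j b))) = \<zero>\<^bsub>DP\<^esub>"
   using c[OF coef_carrier[OF a(1)] coef_carrier[OF a(2)]]
   by (intro Ps_inj) (simp_all add: Ps_coef bM_coef_coef cpart_DA)
 qed (rule Ps_inj; simp add: iP bM_symset symset_add symset_scale bM_linear; fail | simp add: c; fail)+
qed

text \<open>Generators span, so that the defining properties determine the Schouten bracket on polyvectors.\<close>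
lemma schouten_model:
 assumes b: "is_schouten DA 2 b" and X: "X \<in> carrier DP" and Y: "Y \<in> carrier DP"
 shows "b X Y \<in> carrier DP" "Ps (b X Y) = bM (Ps X) (Ps Y)"
proof -
 note b1 = b[unfolded is_schouten_def Let_def]
 note b2 = b1[THEN conjunct2] note b3 = b2[THEN conjunct2] note b4 = b3[THEN conjunct2]
 note b5 = b4[THEN conjunct2] note b6 = b5[THEN conjunct2] note b7 = b6[THEN conjunct2]
 note b8 = b7[THEN conjunct2]
 have cl: "b X Y \<in> carrier DP" if "X \<in> carrier DP" "Y \<in> carrier DP" for X Y using b1[THEN conjunct1] that by blast
 have add: "b (X \<oplus>\<^bsub>DP\<^esub> Y) Z = b X Z \<oplus>\<^bsub>DP\<^esub> b Y Z" "b Z (X \<oplus>\<^bsub>DP\<^esub> Y) = b Z X \<oplus>\<^bsub>DP\<^esub> b Z Y"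
  if "X \<in> carrier DP" "Y \<in> carrier DP" "Z \<in> carrier DP" for X Y Z using b2[THEN conjunct1] that by blast+
 have scale: "b (csmult DP c X) Y = csmult DP c (b X Y)" "b X (csmult DP c Y) = csmult DP c (b X Y)"
  if "X \<in> carrier DP" "Y \<in> carrier DP" for X Y c using b3[THEN conjunct1] that by blast+
 have swap: "b X Y = csmult DP (- ksgn ((i - 2 - 1) * (j - 2 - 1))) (b Y X)"
  if "X \<in> cpart DP i" "Y \<in> cpart DP j" for X Y i j using b5[THEN conjunct1] that by blast
 have leib: "b X (Y \<otimes>\<^bsub>DP\<^esub> Z) = b X Y \<otimes>\<^bsub>DP\<^esub> Z \<oplus>\<^bsub>DP\<^esub> csmult DP (ksgn (i * j + j * (2 + 1))) (Y \<otimes>\<^bsub>DP\<^esub> b X Z)"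
  if "X \<in> cpart DP i" "Y \<in> cpart DP j" "Z \<in> carrier DP" for X Y Z i j using b6[THEN conjunct1] that by blast
 have cc: "b (sym_coef DA PM i a) (sym_coef DA PM j a') = \<zero>\<^bsub>DP\<^esub>"
  if "a \<in> cpart DA i" "a' \<in> cpart DA j" for a a' i j using b7[THEN conjunct1] that by blast
 have gc: "b (sym_gen DA PM (i + 2 + 1) D) (sym_coef DA PM j a) = csmult DP (ksgn (i * (2 + 1))) (sym_coef DA PM (i + j) (D a))"
  if "D \<in> der DA i" "a \<in> cpart DA j" for a D i j using b8[THEN conjunct1] that by blast
 have gg: "b (sym_gen DA PM (i + 2 + 1) D) (sym_gen DA PM (j + 2 + 1) E) = sym_gen DA PM (i + j + 2 + 1) (der_bracket DA i j D E)"
  if "D \<in> der DA i" "E \<in> der DA j" for D E i j using b8[THEN conjunct2] that by blast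
 have k3: "(ksgn (i * 3) :: 'k) = ksgn i" for i by (rule ksgn_cong) simp
 let ?N = "%X Y. Ps (b X Y) = bM (Ps X) (Ps Y)"
 define zh where "zh z = sym_cls DA PM (mon [lzP z])" for z
 have zh: "zh z \<in> carrier DP" "Ps (zh z) = gen z" "zh z \<in> cpart DP (fst z)" if "z \<in> LPQ" for z
 proof -
  show "zh z \<in> carrier DP" unfolding zh_def pol_def by (rule W.cls_carrier) (simp add: H.lz_letter that)
  moreover show "Ps (zh z) = gen z" by (simp add: zh_def W.lm_lz that)
  ultimately show "zh z \<in> cpart DP (fst z)" by (simp add: cpart_DP homg_gen)
 qed
 have zQ: "zh (Qe e) = sym_coef DA PM (1 - dg e) (Qh e)" for e by (simp add: zh_def lzP_simps sym_coef_def)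
 have zP: "zh (Pe e) = sym_gen DA PM (dg e - 1 + 2 + 1) (svec g (dg e) e)" for e
 proof -
  have i: "dg e - 1 + 2 + 1 = dg e + 2" by simp
  show ?thesis by (simp only: i zh_def lzP_simps sym_gen_def)
 qed
 have emb3: "dg e - 1 + 2 + 1 = dg e - 1 + 3" for e by simp
 have gens: "?N (zh z) (zh y)" if zy: "z \<in> LPQ" "y \<in> LPQ" for z y
 proof -
  have QQ: "?N (zh (Qe e)) (zh (Qe e'))" if "e \<in> B" "e' \<in> B" for e e'
   using cc[OF Qh(3) Qh(3), OF that] bM_coef_coef[OF Qh(1) Qh(1), OF that] by (simp add: zQ Ps_coef)
  have PQ: "?N (zh (Pe e)) (zh (Qe e'))" if e: "e \<in> B" "e' \<in> B" for e e'
  proof -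
   note sv = svec_model(2)[OF B_part[OF e(1)]]
   have "svec g (dg e) e (Qh e') \<in> cpart DA (dg e - 1 + (1 - dg e'))"
    using sv Qh(3)[OF e(2)] by (rule der_degree)
   moreover have k: "(ksgn ((dg e - 1) * (2 + 1)) :: 'k) = ksgn (dg e - 1)" by (rule ksgn_cong) simp
   ultimately show ?thesis
    using coef_carrier unfolding zP zQ gc[OF sv Qh(3)[OF e(2)]] k
    using bM_coef[OF sv Qh(1)[OF e(2)]] by (simp add: Ps_gen Ps_coef emb3 k3)
  qed
  have QP: "?N (zh (Qe e)) (zh (Pe e'))" if e: "e \<in> B" "e' \<in> B" for e e'
   using swap[OF zh(3)[OF Qe_LPQ[OF e(1)]] zh(3)[OF Pe_LPQ[OF e(2)]]] PQ[OF e(2,1)]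
    bM_swap[of _ "Ps (zh (Qe e))" _ "Ps (zh (Pe e'))", OF zh(3)[OF Qe_LPQ[OF e(1)], unfolded cpart_DP, THEN conjunct2]
     zh(3)[OF Pe_LPQ[OF e(2)], unfolded cpart_DP, THEN conjunct2]]
    cl[OF zh(1)[OF Pe_LPQ[OF e(2)]] zh(1)[OF Qe_LPQ[OF e(1)]]] by simp
  have PP: "?N (zh (Pe e)) (zh (Pe e'))" if e: "e \<in> B" "e' \<in> B" for e e'
  proof -
   note sv = svec_model(2)[OF B_part[OF e(1)]] svec_model(2)[OF B_part[OF e(2)]]
   have ij: "dg e - 1 + (dg e' - 1) + 2 + 1 = dg e - 1 + (dg e' - 1) + 3" by simp
   show ?thesis unfolding zP gg[OF sv] Ps_gen unfolding emb3 ij by (rule bracket_model(2)[OF sv])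
  qed
  show ?thesis using zy QQ PQ QP PP unfolding LPQ_def by blast
 qed
 have one: "Ps (b X \<one>\<^bsub>DP\<^esub>) = 0" "bM (Ps X) 1 = 0" if "X \<in> cpart DP i" for X i
 proof -
  have X: "X \<in> carrier DP" "hom i (Ps X)" using that by (simp_all add: cpart_DP)
  have 1: "\<one>\<^bsub>DP\<^esub> \<otimes>\<^bsub>DP\<^esub> \<one>\<^bsub>DP\<^esub> = \<one>\<^bsub>DP\<^esub>" by (rule Ps_inj) simp_all
  have "Ps (b X (\<one>\<^bsub>DP\<^esub> \<otimes>\<^bsub>DP\<^esub> \<one>\<^bsub>DP\<^esub>)) = Ps (b X \<one>\<^bsub>DP\<^esub>) + Ps (b X \<one>\<^bsub>DP\<^esub>)"
   using leib[OF that, of "\<one>\<^bsub>DP\<^esub>" 0 "\<one>\<^bsub>DP\<^esub>"] X by (simp add: cpart_DP cl)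
  then show "Ps (b X \<one>\<^bsub>DP\<^esub>) = 0" unfolding 1 by simp
  show "bM (Ps X) 1 = 0" using bM_mult[OF X(2), of 0 1 1] by simp
 qed
 have right: "?N X Y" if X: "X \<in> cpart DP i" and hyp: "\<And>z. z \<in> LPQ ==> ?N X (zh z)" and Y: "Y \<in> carrier DP" for X Y i
 proof -
  have Xc: "X \<in> carrier DP" "hom i (Ps X)" using X by (simp_all add: cpart_DP)
  have "\<exists>Y\<in>carrier DP. Ps Y = f & ?N X Y" if "f \<in> symset LPQ" for f
  proof (rule symset_induct[OF finite_LPQ that])
   show "\<exists>Y\<in>carrier DP. Ps Y = 0 & ?N X Y"
    using scale(2)[OF Xc(1), of "\<one>\<^bsub>DP\<^esub>" 0] Xc cl by (intro bexI[of _ "csmult DP 0 \<one>\<^bsub>DP\<^esub>"]) simp_all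
   show "\<exists>Y\<in>carrier DP. Ps Y = f + h & ?N X Y"
    if fh: "\<exists>Y\<in>carrier DP. Ps Y = f & ?N X Y" "\<exists>Y\<in>carrier DP. Ps Y = h & ?N X Y" for f h
   proof -
    obtain Y Z where "Y \<in> carrier DP" "Ps Y = f" "?N X Y" "Z \<in> carrier DP" "Ps Z = h" "?N X Z" using fh by blast
    then show ?thesis using Xc by (intro bexI[of _ "Y \<oplus>\<^bsub>DP\<^esub> Z"]) (simp_all add: add cl bM_linear)
   qed
   show "\<exists>Y\<in>carrier DP. Ps Y = cst c * f & ?N X Y" if f: "\<exists>Y\<in>carrier DP. Ps Y = f & ?N X Y" for f c
   proof -
    obtain Y where "Y \<in> carrier DP" "Ps Y = f" "?N X Y" using f by blast
    then show ?thesis using Xc by (intro bexI[of _ "csmult DP c Y"]) (simp_all add: scale cl bM_linear)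
   qed
   show "\<exists>Y\<in>carrier DP. Ps Y = lw w & ?N X Y" if "set w \<subseteq> LPQ" for w
    using that
   proof (induction w)
    case Nil
    then show ?case using one[OF X] by (intro bexI[of _ "\<one>\<^bsub>DP\<^esub>"]) simp_all
   next
    case (Cons z w)
    then obtain Y where Y: "Y \<in> carrier DP" "Ps Y = lw w" "?N X Y" by auto
    have z: "z \<in> LPQ" using Cons.prems by simp
    then show ?case
     using leib[OF X zh(3)[OF z] Y(1)] Y Xc zh[OF z] hyp[OF z] bM_mult[OF Xc(2) homg_gen[of fst z], of "lw w"]
     by (intro bexI[of _ "zh z \<otimes>\<^bsub>DP\<^esub> Y"]) (simp_all add: cl)
   qed
  qed
  then show ?thesis using Y Ps_symset Ps_inj by metis
 qed
 have rightz: "?N (zh z) Y" if "z \<in> LPQ" "Y \<in> carrier DP" for z Y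
  by (rule right[OF zh(3) gens]) (use that in auto)
 have homs: "?N X Y" if X: "X \<in> cpart DP i" and Y: "Y \<in> carrier DP" for X Y i
 proof (rule right[OF X _ Y])
  fix z assume z: "z \<in> LPQ"
  have Xc: "X \<in> carrier DP" "hom i (Ps X)" using X by (simp_all add: cpart_DP)
  show "?N X (zh z)"
   using swap[OF X zh(3)[OF z]] rightz[OF z Xc(1)] bM_swap[OF Xc(2) homg_gen[of fst z]] zh[OF z] cl[OF zh(1)[OF z] Xc(1)] by simp
 qed
 have "\<exists>X\<in>carrier DP. Ps X = f & ?N X Y" if "f \<in> symset LPQ" for f
 proof (rule symset_induct[OF finite_LPQ that])
  show "\<exists>X\<in>carrier DP. Ps X = 0 & ?N X Y"
   using scale(1)[OF _ Y, of "\<one>\<^bsub>DP\<^esub>" 0] Y cl by (intro bexI[of _ "csmult DP 0 \<one>\<^bsub>DP\<^esub>"]) simp_all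
  show "\<exists>X\<in>carrier DP. Ps X = f + h & ?N X Y"
   if fh: "\<exists>X\<in>carrier DP. Ps X = f & ?N X Y" "\<exists>X\<in>carrier DP. Ps X = h & ?N X Y" for f h
  proof -
   obtain X Z where "X \<in> carrier DP" "Ps X = f" "?N X Y" "Z \<in> carrier DP" "Ps Z = h" "?N Z Y" using fh by blast
   then show ?thesis using Y by (intro bexI[of _ "X \<oplus>\<^bsub>DP\<^esub> Z"]) (simp_all add: add cl bM_linear)
  qed
  show "\<exists>X\<in>carrier DP. Ps X = cst c * f & ?N X Y" if f: "\<exists>X\<in>carrier DP. Ps X = f & ?N X Y" for f c
  proof -
   obtain X where "X \<in> carrier DP" "Ps X = f" "?N X Y" using f by blast
   then show ?thesis using Y by (intro bexI[of _ "csmult DP c X"]) (simp_all add: scale cl bM_linear)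
  qed
  show "\<exists>X\<in>carrier DP. Ps X = lw w & ?N X Y" if w: "set w \<subseteq> LPQ" for w
  proof -
   obtain X where "X \<in> carrier DP" "Ps X = lw w" using Ps_surj[OF symset_lw[OF w]] by blast
   then show ?thesis using homs[of X "wd w"] Y by (auto simp: cpart_DP homg_lw)
  qed
 qed
 then show "Ps (b X Y) = bM (Ps X) (Ps Y)" using X Ps_symset Ps_inj by metis
 show "b X Y \<in> carrier DP" using cl X Y .
qed

end

context two_term_basis
begin

section \<open>The Maurer-Cartan equation in the function model\<close>

definition cd :: "'v => ('v, 'k) pqfun"
 where "cd e = lQ (%x. ksgn (dg e) * crd e (dif g x))"

lemma dif_linear: "dif g (x + y) = dif g x + dif g y" "dif g (scl g c x) = scl g c (dif g x)"
 using two_term unfolding two_term_complex_def Vector_Spaces.linear_iff by blast+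

lemma dif_part: "x \<in> part g i ==> dif g x \<in> part g (i + 1)"
 using two_term unfolding two_term_complex_def by blast

lemma dual_dif:
 assumes "\<theta> \<in> mpart (dual g) i" shows "(%x. c * \<theta> (dif g x)) \<in> mpart (dual g) (i + 1)"
 unfolding dual_part form_iff
proof (intro conjI allI impI ballI)
 have l: "\<theta> (x + y) = \<theta> x + \<theta> y" "\<theta> (scl g k x) = k * \<theta> x" for x y k
  using assms unfolding dual_part form_iff by blast+
 show "c * \<theta> (dif g (x + y)) = c * \<theta> (dif g x) + c * \<theta> (dif g y)" for x y
  by (simp add: dif_linear l distrib_left)
 show "c * \<theta> (dif g (scl g k x)) = k * (c * \<theta> (dif g x))" for k x
  by (simp add: dif_linear l)
 fix j x assume "j ~= - (i + 1)" "x \<in> part g j"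
 then have "dif g x \<in> part g (j + 1)" "j + 1 ~= - i" using dif_part by auto
 then show "c * \<theta> (dif g x) = 0" using assms unfolding dual_part by auto
qed

lemma cd_coeffs: "der_coeffs 1 cd"
 unfolding der_coeffs_def
proof (intro ballI conjI)
 fix e assume e: "e \<in> B"
 show "cd e \<in> symset LQ" unfolding cd_def by (rule lQ_symset)
 show "hom (1 + 1 - dg e) (cd e)"
  using lQ_hom[OF dual_dif[OF crd_dual[OF e]], of "ksgn (dg e)"] unfolding cd_def by (simp add: algebra_simps)
qed

lemma cdiff_DA:
 assumes X: "X \<in> carrier DA" shows "cdiff DA X = mkder cd X"
proof -
 have h: "\<And>e. e \<in> B ==> hom (1 + 1 - dg e) (cd e)" using cd_coeffs by (simp add: der_coeffs_def)
 have letter: "letter_diff base_cdga DM u \<in> sym_letters base_cdga DM & lmA (letter_diff base_cdga DM u) = dact cd (lmA u)"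
  if u: "u \<in> sym_letters base_cdga DM" for u
 proof (cases u)
  case (Coef i c)
  then show ?thesis by (simp add: letters_A lmA_def dact_def)
 next
  case (Gen i \<theta>)
  then have \<theta>: "\<theta> \<in> mpart (dual g) (i - 1)" using u by (simp add: letters_A)
  have d: "mdiff DM i \<theta> = (%x. - ksgn i * \<theta> (dif g x))" by (simp add: DM_simps)
  have "dact cd (lQ \<theta>) = lQ (%x. - ksgn i * \<theta> (dif g x))"
  proof (rule sfun_eqI)
   fix w
   have "(\<Sum>e\<in>B. \<theta> e * (ksgn (dg e) * crd e (dif g x))) = - ksgn i * \<theta> (dif g x)" for x
   proof -
    have "(\<Sum>e\<in>B. \<theta> e * (ksgn (dg e) * crd e (dif g x))) = (\<Sum>e\<in>B. - ksgn i * (\<theta> e * crd e (dif g x)))"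
    proof (rule sum.cong[OF refl])
     fix e assume e: "e \<in> B"
     have "ksgn (dg e) = - (ksgn i :: 'k)" if "\<theta> e ~= 0"
      using dual_degree[OF \<theta> e that] by (simp add: ksgn_def)
     then show "\<theta> e * (ksgn (dg e) * crd e (dif g x)) = - ksgn i * (\<theta> e * crd e (dif g x))"
      by (cases "\<theta> e = 0") simp_all
    qed
    also have "\<dots> = - ksgn i * \<theta> (dif g x)"
     using linear_expand[of \<theta> "dif g x"] \<theta> by (simp add: dual_part sum_distrib_left)
    finally show ?thesis .
   qed
   then show "co (dact cd (lQ \<theta>)) w = co (lQ (%x. - ksgn i * \<theta> (dif g x))) w"
    unfolding dact_lQ by (simp add: cd_def) (simp add: lQ_def co_lin)
  qed
  then show ?thesis using Gen dual_dif[OF \<theta>, of "- ksgn i"] by (simp add: letters_A lmA_def d)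
 qed
 have X': "X \<in> carrier A.P" using X by (simp add: dual_alg_def)
 have D: "cdiff DA X = (\<Union>f\<in>X. A.cls (free_diff base_cdga DM f))"
  by (simp add: dual_alg_def sym_alg_def Let_def)
 have leib: "dact cd (f * h) = dact cd f * h + cst (ksgn i) * (f * dact cd h)" if "hom i f" for i f h
  using dact_mult[OF h that] by simp
 note dm = A.diff_model[where \<delta> = "dact cd", OF dact_add dact_scale leib letter X']
 show ?thesis
  unfolding D by (rule PA_inj) (use dm mkder_apply[OF cd_coeffs X] in \<open>auto simp: dual_alg_def\<close>)
qed

text \<open>For arguments of degree 4, the two halves of the canonical bracket agree up to the exchange of the arguments.\<close>
definition hM :: "('v, 'k) pqfun => ('v, 'k) pqfun => ('v, 'k) pqfun"
 where "hM f h = (\<Sum>e\<in>B. Dl (Qe e) f * Dl (Pe e) h)"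

lemma bM_hM:
 assumes f: "hom 4 f" and h: "hom 4 h" shows "bM f h = - (hM f h + hM h f)"
proof -
 have "hfs e f h = Dl (Qe e) f * Dl (Pe e) h + Dl (Qe e) h * Dl (Pe e) f" for e
 proof -
  have "tw a f = f" for a
  proof -
   have "(ksgn (a * 4) :: 'k) = 1" by (simp add: ksgn_def)
   then show ?thesis using tw_hom[OF f, of a] by simp
  qed
  moreover have "Dl (Pe e) f * Dl (Qe e) h = Dl (Qe e) h * Dl (Pe e) f"
  proof -
   have "even ((4 - (dg e + 2)) * (4 - (1 - dg e)))" by simp
   then have "(ksgn ((4 - fst (Pe e)) * (4 - fst (Qe e))) :: 'k) = 1" by (simp add: ksgn_def)
   then show ?thesis using hom_commute[OF homg_Dl[OF f, of "Pe e"] homg_Dl[OF h, of "Qe e"]] by simp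
  qed
  ultimately show ?thesis by (simp add: hfs_def hf_def add.commute)
 qed
 then show ?thesis by (simp add: bM_def hM_def sum.distrib)
qed

end

locale ce_algebra = two_term_basis g B dg crd
 for g :: "('k::field_char_0, 'v::ab_group_add) gvs" and B dg crd +
 fixes p12 p13 :: "('k, 'v) tmap"
 assumes ce_der: "ce_derivation g p12 p13 2 \<in> der (dual_alg g) 1"
begin

abbreviation "\<alpha> \<equiv> ce_derivation g p12 p13 2"
abbreviation "CA \<equiv> CE g p12 p13 2"
abbreviation "CM \<equiv> pol_mod CA 2"

definition \<delta> :: "('k, 'v) sym_dual => ('k, 'v) sym_dual"
 where "\<delta> = mkder (%e. cd e + cof \<alpha> e)"

definition \<Delta> :: "('v, 'k) pqfun"
 where "\<Delta> = emb 4 (mkder cd) + emb 4 \<alpha>"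

lemma \<delta>_coeffs: "der_coeffs 1 (%e. cd e + cof \<alpha> e)"
 using cd_coeffs der_coeffs_cof[OF ce_der] by (simp add: der_coeffs_def symset_add)

lemma \<delta>_der: "\<delta> \<in> der DA 1"
 unfolding \<delta>_def by (rule mkder_der[OF \<delta>_coeffs])

lemma \<Delta>_eq: "\<Delta> = emb 4 \<delta>"
 unfolding \<Delta>_def emb_def \<delta>_def sum.distrib[symmetric]
 by (intro sum.cong refl) (simp add: cof_mkder[OF cd_coeffs] cof_mkder[OF \<delta>_coeffs] distrib_left distrib_right)

lemma \<Delta>_hom: "hom 4 \<Delta>" and \<Delta>_symset: "\<Delta> \<in> symset LPQ"
 unfolding \<Delta>_eq using emb_hom[of \<delta> 4] emb_symset[OF \<delta>_der] \<delta>_der by simp_all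

lemma cdiff_CA: assumes "X \<in> carrier DA" shows "cdiff CA X = \<delta> X"
proof -
 have "cdiff CA X = mkder cd X \<oplus>\<^bsub>DA\<^esub> \<alpha> X" using assms by (simp add: CE_def Let_def cdiff_DA)
 also have "\<dots> = \<delta> X"
  unfolding \<delta>_def using assms
  by (intro PA_inj) (simp_all add: mkder_apply[OF cd_coeffs] mkder_apply[OF \<delta>_coeffs] der_closed[OF ce_der]
    der_PA[OF ce_der] dact_def distrib_right sum.distrib)
 finally show ?thesis .
qed

lemma CA_simps: "carrier CA = carrier DA" "a \<oplus>\<^bsub>CA\<^esub> b = a \<oplus>\<^bsub>DA\<^esub> b" "a \<otimes>\<^bsub>CA\<^esub> b = a \<otimes>\<^bsub>DA\<^esub> b" "\<one>\<^bsub>CA\<^esub> = \<one>\<^bsub>DA\<^esub>"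
 "csmult CA = csmult DA" "a \<ominus>\<^bsub>CA\<^esub> b = a \<ominus>\<^bsub>DA\<^esub> b" "cpart CA = cpart DA"
 by (simp_all add: CE_def Let_def a_minus_def a_inv_def m_inv_def)

lemma der_CA: "der CA = der DA" and bracket_CA: "der_bracket CA = der_bracket DA"
 by (simp_all add: fun_eq_iff der_def der_bracket_def CA_simps)

lemma cls_CA: "sym_cls CA CM = sym_cls DA PM"
 by (simp add: fun_eq_iff sym_cls_def sym_free_CE sym_ideal_CE)

lemma pol_CA: "pol CA 2 = DP\<lparr>cdiff := %X. \<Union>f\<in>X. W.cls (free_diff CA CM f)\<rparr>"
 by (simp add: pol_def sym_alg_def Let_def cls_CA sym_free_CE sym_ideal_CE)

lemma is_schouten_CA: "is_schouten CA 2 = is_schouten DA 2"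
 by (simp add: fun_eq_iff is_schouten_def Let_def pol_CA CA_simps der_CA bracket_CA sym_coef_def sym_gen_def cls_CA)

lemma schouten_CA:
 assumes "X \<in> carrier DP" "Y \<in> carrier DP"
 shows "schouten CA 2 X Y \<in> carrier DP" "Ps (schouten CA 2 X Y) = bM (Ps X) (Ps Y)"
proof -
 have "is_schouten DA 2 (schouten CA 2)"
  unfolding schouten_def is_schouten_CA using is_schouten_bM by (rule someI[of "is_schouten DA 2"])
 from schouten_model[OF this assms] show "schouten CA 2 X Y \<in> carrier DP" "Ps (schouten CA 2 X Y) = bM (Ps X) (Ps Y)" .
qed

lemma mdiff_CM:
 assumes D: "D \<in> der DA (i - 3)"
 shows "mdiff CM i D = msmult PM 0 (csmult DA (- 1) \<one>\<^bsub>DA\<^esub>) (der_bracket DA 1 (i - 3) \<delta> D)"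
proof (rule ext)
 fix a
 have k: "(ksgn (- 3) :: 'k) = - 1" by (simp add: ksgn_def)
 show "mdiff CM i D a = msmult PM 0 (csmult DA (- 1) \<one>\<^bsub>DA\<^esub>) (der_bracket DA 1 (i - 3) \<delta> D) a"
 proof (cases "a \<in> carrier DA")
  case True
  have c: "\<delta> (D a) \<in> carrier DA" "D (\<delta> a) \<in> carrier DA" "D a \<in> carrier DA" "\<delta> a \<in> carrier DA"
   using True der_closed[OF D] der_closed[OF \<delta>_der] by simp_all
  have i: "i + (- 2 - 1) = i - 3" by simp
  show ?thesis
   using True c by (intro PA_inj)
    (simp_all add: PM_simps pol_mod_def mshift_def tangent_def CA_simps cdiff_CA der_bracket_def k)
 next
  case False
  then show ?thesis by (simp add: PM_simps pol_mod_def mshift_def tangent_def CA_simps)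
 qed
qed

lemma cdiff_pol:
 assumes X: "X \<in> carrier DP"
 shows "cdiff (pol CA 2) X \<in> carrier DP" "Ps (cdiff (pol CA 2) X) = - bM \<Delta> (Ps X)"
proof -
 have leib: "- bM \<Delta> (f * h) = - bM \<Delta> f * h + cst (ksgn i) * (f * - bM \<Delta> h)" if "hom i f" for i f h
 proof -
  have "(ksgn (4 * i + i * 3) :: 'k) = ksgn i" by (rule ksgn_cong) simp
  then show ?thesis using bM_mult[OF \<Delta>_hom that, of h] by simp
 qed
 have letter: "letter_diff CA CM u \<in> sym_letters DA PM & lmP (letter_diff CA CM u) = - bM \<Delta> (lmP u)"
  if u: "u \<in> sym_letters DA PM" for u
 proof (cases u)
  case (Coef i a)
  then have a: "a \<in> cpart DA i" "a \<in> carrier DA" using u by (simp_all add: letters_P cpart_DA)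
  have "bM (emb (1 + 3) \<delta>) (PA a) = - PA (\<delta> a)"
   using bM_coef[OF \<delta>_der a(2)] by (simp add: ksgn_def cst_uminus)
  then show ?thesis
   using Coef a der_degree[OF \<delta>_der a(1)] by (simp add: letters_P lmP_def cdiff_CA \<Delta>_eq add.commute)
 next
  case (Gen i D)
  then have D: "D \<in> der DA (i - 3)" using u by (simp add: letters_P)
  note br = bracket_model[OF \<delta>_der D]
  have one: "csmult DA (- 1) \<one>\<^bsub>DA\<^esub> \<in> cpart DA 0" by (simp add: cpart_DA)
  note ms = msmult_model[OF one br(1)]
  have "emb (i + 1) (mdiff CM i D) = - emb (i + 1) (der_bracket DA 1 (i - 3) \<delta> D)"
   unfolding emb_def mdiff_CM[OF D] sum_negf[symmetric]
   by (intro sum.cong refl) (simp add: ms(2) cst_uminus)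
  moreover have "1 + (i - 3) + 3 = i + 1" "1 + 3 = (4::int)" "i - 3 + 3 = i" by simp_all
  ultimately have "emb (i + 1) (mdiff CM i D) = - bM \<Delta> (emb i D)"
   using br(2) by (simp add: \<Delta>_eq add.commute[of 1 i])
  moreover have "mdiff CM i D \<in> der DA (i + 1 - 3)"
   using ms(1) unfolding mdiff_CM[OF D] by (simp add: algebra_simps)
  ultimately show ?thesis using Gen by (simp add: letters_P lmP_def)
 qed
 have X': "X \<in> carrier W.P" using X by (simp add: pol_def)
 have add: "- bM \<Delta> (f + h) = - bM \<Delta> f + - bM \<Delta> h" and scale: "- bM \<Delta> (cst c * f) = cst c * - bM \<Delta> f" for f h c
  by (simp_all add: bM_linear)
 note dm = W.diff_model[where \<delta> = "%f. - bM \<Delta> f", OF add scale leib letter X']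
 show "cdiff (pol CA 2) X \<in> carrier DP" "Ps (cdiff (pol CA 2) X) = - bM \<Delta> (Ps X)"
  using dm by (simp_all add: pol_CA) (simp_all add: pol_def)
qed

text \<open>The differential of the Chevalley-Eilenberg algebra is the bracket with the element \<open>\<Delta>\<close> of weight 1. Hence the Maurer-Cartan equation is the vanishing of the bracket of \<open>\<Delta> + \<pi>\<close> with itself, in all weights but the lowest.\<close>
lemma shifted_poisson_model:
 "\<pi> \<in> shifted_poisson CA 2 \<longleftrightarrow>
  (\<forall>m. \<pi> m \<in> carrier DP & hom 4 (Ps (\<pi> m)) & homg wt (int m) (Ps (\<pi> m))) & (\<forall>m<2. \<pi> m = \<zero>\<^bsub>DP\<^esub>) &
  (\<forall>w. hM \<Delta> (Ps (\<pi> w)) + hM (Ps (\<pi> w)) \<Delta> + (\<Sum>m\<le>Suc w. hM (Ps (\<pi> m)) (Ps (\<pi> (Suc w - m)))) = 0)"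
proof -
 have wp: "sym_wpart CA CM m i = sym_wpart DA PM m i" for m i
  by (simp add: sym_wpart_def cls_CA sym_free_CE)
 have ops: "\<zero>\<^bsub>pol CA 2\<^esub> = \<zero>\<^bsub>DP\<^esub>" "csmult (pol CA 2) = csmult DP" "X \<oplus>\<^bsub>pol CA 2\<^esub> Y = X \<oplus>\<^bsub>DP\<^esub> Y"
  "finsum (pol CA 2) = (finsum DP :: (nat => _) => _)" for X Y
  by (simp_all add: pol_CA finsum_def fun_eq_iff finprod_def)
 have k3: "(ksgn 3 :: 'k) = - 1" by (simp add: ksgn_def)
 have mc: "csmult DP (ksgn (2 + 1)) (cdiff (pol CA 2) (\<pi> w)) \<oplus>\<^bsub>DP\<^esub>
   csmult DP (1 / 2) (\<Oplus>\<^bsub>DP\<^esub>m\<in>{..Suc w}. schouten CA 2 (\<pi> m) (\<pi> (Suc w - m))) = \<zero>\<^bsub>DP\<^esub> \<longleftrightarrow>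
   hM \<Delta> (Ps (\<pi> w)) + hM (Ps (\<pi> w)) \<Delta> + (\<Sum>m\<le>Suc w. hM (Ps (\<pi> m)) (Ps (\<pi> (Suc w - m)))) = 0"
  (is "?l \<oplus>\<^bsub>DP\<^esub> ?r = _ \<longleftrightarrow> ?R") if \<pi>: "\<And>m. \<pi> m \<in> carrier DP & hom 4 (Ps (\<pi> m))" for w
 proof -
  have c: "\<pi> m \<in> carrier DP" "hom 4 (Ps (\<pi> m))" for m using \<pi> by simp_all
  let ?s = "\<Oplus>\<^bsub>DP\<^esub>m\<in>{..Suc w}. schouten CA 2 (\<pi> m) (\<pi> (Suc w - m))"
  have fs: "?s \<in> carrier DP & Ps ?s = (\<Sum>m\<in>{..Suc w}. Ps (schouten CA 2 (\<pi> m) (\<pi> (Suc w - m))))"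
   by (rule W.Psi_finsum[folded pol_def]) (simp_all add: schouten_CA c)
  have "(\<Sum>m\<le>Suc w. hM (Ps (\<pi> (Suc w - m))) (Ps (\<pi> m))) = (\<Sum>m\<le>Suc w. hM (Ps (\<pi> m)) (Ps (\<pi> (Suc w - m))))"
   by (rule sum.reindex_bij_witness[of _ "%m. Suc w - m" "%m. Suc w - m"]) auto
  note re = this
  have "Ps ?s = (\<Sum>m\<le>Suc w. - hM (Ps (\<pi> m)) (Ps (\<pi> (Suc w - m))) - hM (Ps (\<pi> (Suc w - m))) (Ps (\<pi> m)))"
   using fs by (simp add: schouten_CA c bM_hM del: sum.atMost_Suc)
  also have "\<dots> = - (\<Sum>m\<le>Suc w. hM (Ps (\<pi> m)) (Ps (\<pi> (Suc w - m)))) - (\<Sum>m\<le>Suc w. hM (Ps (\<pi> m)) (Ps (\<pi> (Suc w - m))))"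
   unfolding sum_subtractf sum_negf re ..
  finally have "Ps ?s = cst (- 2) * (\<Sum>m\<le>Suc w. hM (Ps (\<pi> m)) (Ps (\<pi> (Suc w - m))))"
   by (intro sfun_eqI) (simp del: sum.atMost_Suc)
  then have "Ps (?l \<oplus>\<^bsub>DP\<^esub> ?r) = bM \<Delta> (Ps (\<pi> w)) - (\<Sum>m\<le>Suc w. hM (Ps (\<pi> m)) (Ps (\<pi> (Suc w - m))))"
   using fs cdiff_pol[OF c(1)] by (intro sfun_eqI) (simp add: k3 cst_uminus del: sum.atMost_Suc)
  also have "\<dots> = - (hM \<Delta> (Ps (\<pi> w)) + hM (Ps (\<pi> w)) \<Delta> + (\<Sum>m\<le>Suc w. hM (Ps (\<pi> m)) (Ps (\<pi> (Suc w - m)))))"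
   by (simp add: bM_hM \<Delta>_hom c del: sum.atMost_Suc)
  finally have eq: "Ps (?l \<oplus>\<^bsub>DP\<^esub> ?r) = - (hM \<Delta> (Ps (\<pi> w)) + hM (Ps (\<pi> w)) \<Delta> + (\<Sum>m\<le>Suc w. hM (Ps (\<pi> m)) (Ps (\<pi> (Suc w - m)))))" .
  have "?l \<oplus>\<^bsub>DP\<^esub> ?r \<in> carrier DP" using fs cdiff_pol[OF c(1)] by simp
  moreover have "Z = \<zero>\<^bsub>DP\<^esub> \<longleftrightarrow> Ps Z = 0" if "Z \<in> carrier DP" for Z
   using Ps_inj[OF that DP_closed(4)] by auto
  ultimately have "?l \<oplus>\<^bsub>DP\<^esub> ?r = \<zero>\<^bsub>DP\<^esub> \<longleftrightarrow> Ps (?l \<oplus>\<^bsub>DP\<^esub> ?r) = 0"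
   by blast
  then show ?thesis by (simp only: eq neg_equal_0_iff_equal)
 qed
 have e: "2 + 2 = (4::int)" by simp
 show ?thesis
  unfolding shifted_poisson_def Let_def mem_Collect_eq wp ops wpart_DP e
  using mc by blast
qed

end

section \<open>Matrix coefficients of multilinear maps\<close>

interpretation tens: vector_space "tscale :: 'k::field_char_0 => ('k, 'v) tens => ('k, 'v) tens"
 by unfold_locales (simp_all add: tscale_def fun_eq_iff algebra_simps)

lemma tscale_apply [simp]: "tscale c t x = c * t x"
 by (simp add: tscale_def)

lemma fun_sum_apply: "(\<Sum>i\<in>A. f i) x = (\<Sum>i\<in>A. f i x)" for f :: "_ => _ => _::comm_monoid_add"
 by (induction A rule: infinite_finite_induct) simp_all

abbreviation pairing :: "('v => 'k::field_char_0) list => 'v list => 'k"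
 where "pairing \<theta>s xs \<equiv> \<Prod>i<length xs. (\<theta>s ! i) (xs ! i)"

lemma prod_lessThan_add: "(\<Prod>i<p + q. h i) = (\<Prod>i<p. h i) * (\<Prod>i<q. h (p + i))" for h :: "nat => 'k::comm_monoid_mult"
 by (induction q) (simp_all add: mult.assoc)

lemma pairing_Cons: "pairing (\<theta> # \<theta>s) (x # xs) = \<theta> x * pairing \<theta>s xs"
 by (simp add: prod.lessThan_Suc_shift del: prod.lessThan_Suc)

context two_term_basis
begin

abbreviation lin_form :: "('v => 'k) => bool" where "lin_form \<equiv> Vector_Spaces.linear (scl g) (*)"

abbreviation tp :: "'v list => ('k, 'v) tens" where "tp \<equiv> tpure g"

abbreviation crds :: "'v list => ('v => 'k) list" where "crds a \<equiv> map crd a"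

lemma pairing_expand:
 assumes "length \<theta>s = length xs" "\<And>\<theta>. \<theta> \<in> set \<theta>s ==> lin_form \<theta>"
 shows "pairing \<theta>s xs = (\<Sum>b\<in>words B (length xs). pairing (crds b) xs * pairing \<theta>s b)"
 using assms
proof (induction \<theta>s xs rule: list_induct2)
 case (Cons \<theta> \<theta>s x xs)
 have "pairing (\<theta> # \<theta>s) (x # xs) = (\<Sum>e\<in>B. crd e x * \<theta> e) * pairing \<theta>s xs"
  using linear_expand[of \<theta> x] Cons.prems unfolding pairing_Cons by (simp add: mult.commute)
 also have "\<dots> = (\<Sum>e\<in>B. \<Sum>b\<in>words B (length xs). (crd e x * pairing (crds b) xs) * (\<theta> e * pairing \<theta>s b))"
  using Cons by (simp add: sum_product mult_ac)
 also have "\<dots> = (\<Sum>b\<in>words B (length (x # xs)). pairing (crds b) (x # xs) * pairing (\<theta> # \<theta>s) b)"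
  unfolding length_Cons sum_words_Suc
  by (intro sum.cong refl) (simp add: pairing_Cons[simplified] words_def prod.lessThan_Suc_shift del: prod.lessThan_Suc)
 finally show ?case .
qed simp

lemma tp_apply: "length \<theta>s = length xs ==> (\<And>\<theta>. \<theta> \<in> set \<theta>s ==> lin_form \<theta>) ==> tp xs \<theta>s = pairing \<theta>s xs"
 by (simp add: tpure_def)

lemma tp_outside: "\<not> (length \<theta>s = length xs & (\<forall>\<theta>\<in>set \<theta>s. lin_form \<theta>)) ==> tp xs \<theta>s = 0"
 by (auto simp: tpure_def)

text \<open>Pure tensors are linear in each entry and therefore expand in the basis. The map h on entries covers permutations as well as the application of the differential to one entry.\<close>
lemma tens_expand_gen:
 fixes h :: "'v list => 'v list"
 assumes len: "\<And>xs. length (h xs) = length xs"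
  and pair: "\<And>\<theta>s. length \<theta>s = k ==> (\<forall>\<theta>\<in>set \<theta>s. lin_form \<theta>) ==>
   \<exists>\<eta>s. length \<eta>s = k & (\<forall>\<theta>\<in>set \<eta>s. lin_form \<theta>) & (\<forall>ys. length ys = k --> pairing \<theta>s (h ys) = pairing \<eta>s ys)"
  and xs: "length xs = k"
 shows "tp (h xs) = (\<Sum>b\<in>words B k. tscale (pairing (crds b) xs) (tp (h b)))"
proof (rule ext)
 fix \<theta>s :: "('v => 'k) list"
 show "tp (h xs) \<theta>s = (\<Sum>b\<in>words B k. tscale (pairing (crds b) xs) (tp (h b))) \<theta>s"
 proof (cases "length \<theta>s = k & (\<forall>\<theta>\<in>set \<theta>s. lin_form \<theta>)")
  case True
  then obtain \<eta>s where \<eta>: "length \<eta>s = k" "\<And>\<theta>. \<theta> \<in> set \<eta>s ==> lin_form \<theta>" "\<And>ys. length ys = k ==> pairing \<theta>s (h ys) = pairing \<eta>s ys"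
   using pair[of \<theta>s] by blast
  have tph: "tp (h ys) \<theta>s = pairing \<eta>s ys" if "length ys = k" for ys
  proof -
   have "tp (h ys) \<theta>s = pairing \<theta>s (h ys)" using True len that by (intro tp_apply) auto
   then show ?thesis using \<eta>(3)[OF that] by simp
  qed
  have "tp (h xs) \<theta>s = pairing \<eta>s xs" by (rule tph[OF xs])
  also have "\<dots> = (\<Sum>b\<in>words B k. pairing (crds b) xs * pairing \<eta>s b)"
   using pairing_expand[of \<eta>s xs] \<eta> xs by simp
  also have "\<dots> = (\<Sum>b\<in>words B k. pairing (crds b) xs * tp (h b) \<theta>s)"
   by (intro sum.cong refl) (simp add: tph words_def)
  finally show ?thesis by (simp add: fun_sum_apply)
 next
  case False
  have "tp (h b) \<theta>s = 0" if "length b = k" for b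
   using False len[of b] that by (intro tp_outside) auto
  then show ?thesis using xs by (simp add: fun_sum_apply words_def)
 qed
qed

lemma tp_expand: "length xs = k ==> tp xs = (\<Sum>b\<in>words B k. tscale (pairing (crds b) xs) (tp b))"
 using tens_expand_gen[of "%xs. xs" k xs] by blast

lemma tp_permute_expand:
 assumes "s permutes {..<k}" "length xs = k"
 shows "tp (permute_list s xs) = (\<Sum>b\<in>words B k. tscale (pairing (crds b) xs) (tp (permute_list s b)))"
proof (rule tens_expand_gen[OF length_permute_list _ assms(2)])
 fix \<theta>s :: "('v => 'k) list"
 assume len: "length \<theta>s = k" and lin: "\<forall>\<theta>\<in>set \<theta>s. lin_form \<theta>"
 have inv: "inv_into UNIV s permutes {..<k}" using assms(1) by (rule permutes_inv)
 have "pairing \<theta>s (permute_list s ys) = pairing (permute_list (inv_into UNIV s) \<theta>s) ys" if "length ys = k" for ys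
 proof -
  have "pairing \<theta>s (permute_list s ys) = (\<Prod>i<k. (\<theta>s ! i) (ys ! s i))"
   using that assms(1) by (auto intro!: prod.cong simp: permute_list_nth)
  also have "\<dots> = (\<Prod>j<k. (\<theta>s ! inv_into UNIV s j) (ys ! j))"
   using assms(1) inv
   by (intro prod.reindex_bij_witness[of _ "inv_into UNIV s" s]) (auto simp: permutes_inverses permutes_lt)
  also have "\<dots> = pairing (permute_list (inv_into UNIV s) \<theta>s) ys"
   using that inv len by (auto intro!: prod.cong simp: permute_list_nth)
  finally show ?thesis .
 qed
 then show "\<exists>\<eta>s. length \<eta>s = k & (\<forall>\<theta>\<in>set \<eta>s. lin_form \<theta>) & (\<forall>ys. length ys = k --> pairing \<theta>s (permute_list s ys) = pairing \<eta>s ys)"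
  using len lin inv by (intro exI[of _ "permute_list (inv_into UNIV s) \<theta>s"]) auto
qed

lemma tp_dif_expand:
 assumes "p < k" "length xs = k"
 shows "tp (xs[p := dif g (xs ! p)]) = (\<Sum>b\<in>words B k. tscale (pairing (crds b) xs) (tp (b[p := dif g (b ! p)])))"
proof (rule tens_expand_gen[of "%xs. xs[p := dif g (xs ! p)]", OF length_list_update _ assms(2)])
 fix \<theta>s :: "('v => 'k) list"
 assume len: "length \<theta>s = k" and lin: "\<forall>\<theta>\<in>set \<theta>s. lin_form \<theta>"
 let ?\<eta> = "\<theta>s[p := (%x. (\<theta>s ! p) (dif g x))]"
 have "lin_form (\<theta>s ! p)" using len assms(1) lin by auto
 then have "lin_form (%x. (\<theta>s ! p) (dif g x))" unfolding form_iff by (simp add: dif_linear)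
 moreover have "pairing \<theta>s (ys[p := dif g (ys ! p)]) = pairing ?\<eta> ys" if "length ys = k" for ys
  using that len assms(1) by (auto intro!: prod.cong simp: nth_list_update)
 ultimately show "\<exists>\<eta>s. length \<eta>s = k & (\<forall>\<theta>\<in>set \<eta>s. lin_form \<theta>) &
   (\<forall>ys. length ys = k --> pairing \<theta>s (ys[p := dif g (ys ! p)]) = pairing \<eta>s ys)"
  using len lin by (intro exI[of _ ?\<eta>]) (auto dest!: subsetD[OF set_update_subset_insert])
qed

lemma tp_crds:
 assumes "a \<in> words B k" "b \<in> words B k" shows "tp b (crds a) = (if a = b then 1 else 0)"
proof -
 have "tp b (crds a) = (\<Prod>i<k. crd (a ! i) (b ! i))"
  using assms crd_linear by (subst tp_apply) (auto simp: words_def intro!: prod.cong)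
 also have "\<dots> = (\<Prod>i<k. if a ! i = b ! i then 1 else 0)"
  using assms by (intro prod.cong refl) (auto simp: words_def crd_basis subset_iff)
 also have "\<dots> = (if a = b then 1 else 0)"
 proof (cases "a = b")
  case False
  then obtain i where "i < k" "a ! i ~= b ! i" using assms by (auto simp: words_def list_eq_iff_nth_eq)
  then show ?thesis using False by (auto intro!: prod_zero)
 qed simp
 finally show ?thesis .
qed

lemma tpow_tp: "length xs = k ==> tp xs \<in> tpow g k"
 unfolding tpow_def by (rule tens.span_base) auto

lemma tpow_closed: "0 \<in> tpow g k" "t \<in> tpow g k ==> u \<in> tpow g k ==> t + u \<in> tpow g k" "t \<in> tpow g k ==> tscale c t \<in> tpow g k"
 unfolding tpow_def by (rule tens.span_zero tens.span_add tens.span_scale; assumption?)+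

lemma tpow_sum: "(\<And>i. i \<in> A ==> f i \<in> tpow g k) ==> sum f A \<in> tpow g k"
 unfolding tpow_def by (rule tens.span_sum)

lemma tpow_expand: assumes "t \<in> tpow g k" shows "t = (\<Sum>b\<in>words B k. tscale (t (crds b)) (tp b))"
proof -
 have "tpow g k \<subseteq> {t. t = (\<Sum>b\<in>words B k. tscale (t (crds b)) (tp b))}"
  unfolding tpow_def
 proof (rule tens.span_minimal)
  show "tens.subspace {t. t = (\<Sum>b\<in>words B k. tscale (t (crds b)) (tp b))}"
  proof (rule tens.subspaceI)
   show "0 \<in> {t. t = (\<Sum>b\<in>words B k. tscale (t (crds b)) (tp b))}"
    by (simp add: zero_fun_def fun_eq_iff fun_sum_apply)
  next
   fix t u assume "t \<in> {t. t = (\<Sum>b\<in>words B k. tscale (t (crds b)) (tp b))}" "u \<in> {t. t = (\<Sum>b\<in>words B k. tscale (t (crds b)) (tp b))}"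
   then have tu: "(\<Sum>b\<in>words B k. tscale (t (crds b)) (tp b)) = t" "(\<Sum>b\<in>words B k. tscale (u (crds b)) (tp b)) = u" by simp_all
   show "t + u \<in> {t. t = (\<Sum>b\<in>words B k. tscale (t (crds b)) (tp b))}"
    by (simp only: mem_Collect_eq plus_fun_apply tens.scale_left_distrib sum.distrib tu)
  next
   fix c t assume "t \<in> {t. t = (\<Sum>b\<in>words B k. tscale (t (crds b)) (tp b))}"
   then have t: "(\<Sum>b\<in>words B k. tscale (t (crds b)) (tp b)) = t" by simp
   show "tscale c t \<in> {t. t = (\<Sum>b\<in>words B k. tscale (t (crds b)) (tp b))}"
    by (simp only: mem_Collect_eq tscale_apply tens.scale_scale[symmetric] tens.scale_sum_right[symmetric] t)
  qed
  show "{tp xs |xs. length xs = k} \<subseteq> {t. t = (\<Sum>b\<in>words B k. tscale (t (crds b)) (tp b))}"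
  proof clarify
   fix xs :: "'v list" assume k: "k = length xs"
   have "tp xs (crds b) = pairing (crds b) xs" if "b \<in> words B k" for b
    using that k crd_linear by (intro tp_apply) (auto simp: words_def)
   then show "tp xs = (\<Sum>b\<in>words B (length xs). tscale (tp xs (crds b)) (tp b))"
    unfolding k using tp_expand[OF refl, of xs] by (simp cong: sum.cong)
  qed
 qed
 then show ?thesis using assms by blast
qed

definition tl :: "nat => nat => ('k, 'v) tmap => bool"
 where "tl l m L \<longleftrightarrow> tlinear g l L & (\<forall>t\<in>tpow g l. L t \<in> tpow g m)"

definition mc :: "('k, 'v) tmap => 'v list => 'v list => 'k"
 where "mc L a b = L (tp b) (crds a)"

lemma tlinear_simps:
 assumes "tlinear g l L"
 shows "t \<in> tpow g l ==> u \<in> tpow g l ==> L (t + u) = L t + L u"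
  "t \<in> tpow g l ==> L (tscale c t) = tscale c (L t)" "t \<notin> tpow g l ==> L t = 0"
 using assms by (simp_all add: tlinear_def)

lemma plin_sum:
 assumes add: "\<And>t u. t \<in> tpow g l ==> u \<in> tpow g l ==> L (t + u) = L t + L u"
  and scale: "\<And>c t. t \<in> tpow g l ==> L (tscale c t) = tscale c (L t)"
  and "\<And>i. i \<in> A ==> f i \<in> tpow g l"
 shows "L (\<Sum>i\<in>A. tscale (c i) (f i)) = (\<Sum>i\<in>A. tscale (c i) (L (f i)))"
proof -
 have "tscale 0 (0 :: ('k, 'v) tens) = 0" "tscale 0 (L 0) = 0" by (simp_all add: fun_eq_iff)
 then have L0: "L 0 = 0" using scale[OF tpow_closed(1), of 0] by simp
 have sum: "L (sum h A) = (\<Sum>i\<in>A. L (h i))" if "\<And>i. i \<in> A ==> h i \<in> tpow g l" for h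
  using that by (induction A rule: infinite_finite_induct) (simp_all add: L0 add tpow_sum)
 show ?thesis
  using sum[of "%i. tscale (c i) (f i)"] assms(3) scale tpow_closed(3) by (simp cong: sum.cong)
qed

lemma tlinear_expand:
 assumes "tlinear g l L" "t \<in> tpow g l"
 shows "L t = (\<Sum>b\<in>words B l. tscale (t (crds b)) (L (tp b)))"
proof -
 have "L t = L (\<Sum>b\<in>words B l. tscale (t (crds b)) (tp b))"
  using tpow_expand[OF assms(2)] by (rule arg_cong)
 also have "\<dots> = (\<Sum>b\<in>words B l. tscale (t (crds b)) (L (tp b)))"
  by (rule plin_sum[where L = L and l = l, OF tlinear_simps(1,2)[OF assms(1)]]) (auto simp: words_def intro!: tpow_tp)
 finally show ?thesis .
qed

lemma tl_apply:
 assumes "tl l m L" "t \<in> tpow g l"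
 shows "L t (crds a) = (\<Sum>b\<in>words B l. t (crds b) * mc L a b)"
 using tlinear_expand[of l L t] assms by (simp add: tl_def fun_sum_apply mc_def)

lemma tl_eqI:
 assumes "tl l m L" "tl l m L'" "\<And>a b. a \<in> words B m ==> b \<in> words B l ==> mc L a b = mc L' a b"
 shows "L = L'"
proof (rule ext)
 fix t
 show "L t = L' t"
 proof (cases "t \<in> tpow g l")
  case True
  have "L (tp b) = L' (tp b)" if "b \<in> words B l" for b
  proof -
   have "tp b \<in> tpow g l" using that by (auto simp: words_def intro: tpow_tp)
   then have "L (tp b) \<in> tpow g m" "L' (tp b) \<in> tpow g m" using assms(1,2) by (simp_all add: tl_def)
   then show ?thesis
    using tpow_expand assms(3)[OF _ that] unfolding mc_def by (metis (no_types, lifting) sum.cong)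
  qed
  then show ?thesis using tlinear_expand[OF _ True] assms(1,2) by (simp add: tl_def cong: sum.cong)
 next
  case False
  then show ?thesis using assms(1,2) by (simp add: tl_def tlinear_def)
 qed
qed

definition mkT :: "nat => nat => ('v list => 'v list => 'k) => ('k, 'v) tmap"
 where "mkT m l c t = (if t \<in> tpow g l then \<Sum>a\<in>words B m. tscale (\<Sum>b\<in>words B l. t (crds b) * c a b) (tp a) else 0)"

lemma tl_mkT: "tl l m (mkT m l c)"
 unfolding tl_def tlinear_def
 by (auto simp: mkT_def tpow_closed distrib_right sum.distrib tens.scale_left_distrib tens.scale_sum_right
   sum_distrib_left mult.assoc words_def intro!: tpow_sum tpow_closed tpow_tp)

lemma mc_mkT:
 assumes "a \<in> words B m" "b \<in> words B l" shows "mc (mkT m l c) a b = c a b"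
proof -
 have "tp b \<in> tpow g l" using assms(2) by (auto simp: words_def intro: tpow_tp)
 then have "mc (mkT m l c) a b = (\<Sum>a'\<in>words B m. (\<Sum>b'\<in>words B l. tp b (crds b') * c a' b') * tp a' (crds a))"
  by (simp add: mc_def mkT_def fun_sum_apply)
 also have "\<dots> = (\<Sum>a'\<in>words B m. if a' = a then \<Sum>b'\<in>words B l. if b' = b then c a b else 0 else 0)"
  using assms by (intro sum.cong refl) (auto simp: tp_crds intro!: sum.cong)
 also have "\<dots> = c a b" using assms finite_B by simp
 finally show ?thesis .
qed

lemma tl_comp:
 assumes "tl l m L" "tl m n K"
 shows "tl l n (%t. K (L t))"
  "b \<in> words B l ==> mc (%t. K (L t)) a b = (\<Sum>c\<in>words B m. mc L c b * mc K a c)"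
proof -
 have lin: "tlinear g l L" "tlinear g m K" and "\<And>t. t \<in> tpow g l ==> L t \<in> tpow g m" "\<And>t. t \<in> tpow g m ==> K t \<in> tpow g n"
  using assms by (simp_all add: tl_def)
 note pow = this(3,4)
 have K0: "K 0 = 0" using tlinear_simps(2)[OF lin(2) tpow_closed(1), of 0] by (simp add: zero_fun_def tscale_def)
 show "tl l n (%t. K (L t))"
  unfolding tl_def tlinear_def
  by (auto simp: tlinear_simps[OF lin(1)] tlinear_simps[OF lin(2)] pow K0)
 show "mc (%t. K (L t)) a b = (\<Sum>c\<in>words B m. mc L c b * mc K a c)" if "b \<in> words B l"
 proof -
  have "tp b \<in> tpow g l" using that by (auto simp: words_def intro: tpow_tp)
  then show ?thesis using tl_apply[OF assms(2) pow(1)] by (simp add: mc_def)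
 qed
qed

lemma tl_sum: "finite A ==> (\<And>i. i \<in> A ==> tl l m (f i)) ==> tl l m (%t. \<Sum>i\<in>A. f i t)"
 unfolding tl_def tlinear_def by (auto simp: sum.distrib tens.scale_sum_right intro!: tpow_sum)

lemma tl_scale: "tl l m L ==> tl l m (%t. tscale c (L t))"
 unfolding tl_def tlinear_def by (auto simp: tens.scale_right_distrib mult.commute intro!: tpow_closed)

lemma mc_sum: "mc (%t. \<Sum>i\<in>A. f i t) a b = (\<Sum>i\<in>A. mc (f i) a b)"
 and mc_scale: "mc (%t. tscale c (L t)) a b = c * mc L a b"
 by (simp_all add: mc_def fun_sum_apply)

lemma homog_pairing:
 assumes "homog g ds xs" "b \<in> words B (length xs)" "pairing (crds b) xs ~= 0" shows "map dg b = ds"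
proof (rule nth_equalityI)
 have len: "length ds = length xs" "length b = length xs" using assms by (auto simp: homog_def words_def dest: list_all2_lengthD)
 then show "length (map dg b) = length ds" by simp
 fix i assume "i < length (map dg b)"
 then have i: "i < length xs" using len by simp
 then have "xs ! i \<in> part g (ds ! i)" "b ! i \<in> B" "crd (b ! i) (xs ! i) ~= 0"
  using assms len by (auto simp: homog_def words_def list_all2_conv_all_nth)
 then show "map dg b ! i = ds ! i" using crd_part i len by simp
qed

lemma homog_basis: "b \<in> words B k ==> homog g (map dg b) b"
 using B_part nth_mem by (fastforce simp: homog_def words_def list_all2_conv_all_nth)

lemma tlift_tl:
 assumes F: "\<And>ds xs. length xs = l ==> homog g ds xs ==> F ds xs = (\<Sum>b\<in>words B l. tscale (pairing (crds b) xs) (F ds b))"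
  and pow: "\<And>b. b \<in> words B l ==> F (map dg b) b \<in> tpow g m"
 shows "tl l m (tlift g l F)" "b \<in> words B l ==> tlift g l F (tp b) = F (map dg b) b"
proof -
 let ?L = "mkT m l (%a b. F (map dg b) b (crds a))"
 let ?P = "%L. tlinear g l L & (\<forall>ds xs. length xs = l & homog g ds xs --> L (tp xs) = F ds xs)"
 have basis: "?L (tp b) = F (map dg b) b" if "b \<in> words B l" for b
 proof -
  have "?L (tp b) \<in> tpow g m" using tl_mkT[of l m] that by (auto simp: tl_def words_def intro!: tpow_tp)
  then have "?L (tp b) = (\<Sum>a\<in>words B m. tscale (mc ?L a b) (tp a))" unfolding mc_def by (rule tpow_expand)
  also have "\<dots> = (\<Sum>a\<in>words B m. tscale (F (map dg b) b (crds a)) (tp a))"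
   by (intro sum.cong refl) (simp add: mc_mkT that)
  also have "\<dots> = F (map dg b) b" using tpow_expand[OF pow[OF that]] by simp
  finally show ?thesis .
 qed
 have P: "?P ?L"
 proof (intro conjI allI impI)
  show lin: "tlinear g l ?L" using tl_mkT by (simp add: tl_def)
  fix ds xs assume "length xs = l & homog g ds xs"
  then have xs: "length xs = l" "homog g ds xs" by auto
  have "?L (tp xs) = ?L (\<Sum>b\<in>words B l. tscale (pairing (crds b) xs) (tp b))"
   using tp_expand[OF xs(1)] by (rule arg_cong)
  also have "\<dots> = (\<Sum>b\<in>words B l. tscale (pairing (crds b) xs) (?L (tp b)))"
   by (rule plin_sum[where L = "?L" and l = l, OF tlinear_simps(1,2)[OF lin]]) (auto simp: words_def intro!: tpow_tp)
  also have "\<dots> = (\<Sum>b\<in>words B l. tscale (pairing (crds b) xs) (F ds b))"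
  proof (rule sum.cong[OF refl])
   fix b assume b: "b \<in> words B l"
   show "tscale (pairing (crds b) xs) (?L (tp b)) = tscale (pairing (crds b) xs) (F ds b)"
    using homog_pairing[OF xs(2), of b] b xs(1) basis[OF b] by (cases "pairing (crds b) xs = 0") auto
  qed
  also have "\<dots> = F ds xs" using F[OF xs] by simp
  finally show "?L (tp xs) = F ds xs" .
 qed
 have "tlift g l F = ?L"
  unfolding tlift_def
 proof (rule the_equality[where P = ?P, OF P])
  fix L assume L: "?P L"
  show "L = ?L"
  proof (rule ext)
   fix t
   show "L t = ?L t"
   proof (cases "t \<in> tpow g l")
    case True
    have "L (tp b) = ?L (tp b)" if "b \<in> words B l" for b
     using L homog_basis[OF that] basis[OF that] that by (auto simp: words_def)
    then show ?thesis
     using tlinear_expand[of l L t] tlinear_expand[of l ?L t] L P True by (simp cong: sum.cong)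
   next
    case False
    then show ?thesis using L P by (simp add: tlinear_def)
   qed
  qed
 qed
 then show "tl l m (tlift g l F)" "b \<in> words B l ==> tlift g l F (tp b) = F (map dg b) b"
  using tl_mkT basis by simp_all
qed

lemma perm_words: "s permutes {..<k} ==> b \<in> words B k ==> permute_list s b \<in> words B k"
 by (auto simp: words_def)

lemma tperm_tl:
 assumes s: "s permutes {..<k}"
 shows "tl k k (tperm g k s)"
  "b \<in> words B k ==> tperm g k s (tp b) = tscale (koszul (map dg b) s) (tp (permute_list s b))"
proof -
 have F: "tscale (koszul ds s) (tp (permute_list s xs)) =
  (\<Sum>b\<in>words B k. tscale (pairing (crds b) xs) (tscale (koszul ds s) (tp (permute_list s b))))"
  if "length xs = k" for ds xs
  by (subst tp_permute_expand[OF s that]) (simp add: tens.scale_sum_right mult.commute)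
 have pow: "tscale (koszul (map dg b) s) (tp (permute_list s b)) \<in> tpow g k" if "b \<in> words B k" for b
  using that by (auto simp: words_def intro!: tpow_closed tpow_tp)
 show "tl k k (tperm g k s)"
  unfolding tperm_def by (rule tlift_tl(1)) (erule F pow)+
 show "b \<in> words B k ==> tperm g k s (tp b) = tscale (koszul (map dg b) s) (tp (permute_list s b))"
  unfolding tperm_def by (rule tlift_tl(2)) (erule F pow | assumption)+
qed

lemma mc_tperm:
 assumes "s permutes {..<k}" "a \<in> words B k" "b \<in> words B k"
 shows "mc (tperm g k s) a b = (if a = permute_list s b then koszul (map dg b) s else 0)"
 using assms by (simp add: mc_def tperm_tl(2) tp_crds perm_words)

lemma tdiff_tl:
 shows "tl k k (tdiff g k)"
  "b \<in> words B k ==> tdiff g k (tp b) = (\<Sum>p<k. tscale (ksgn (sum_list (take p (map dg b)))) (tp (b[p := dif g (b ! p)])))"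
proof -
 let ?F = "%ds xs. \<Sum>p<k. tscale (ksgn (sum_list (take p ds))) (tp (xs[p := dif g (xs ! p)]))"
 have F: "?F ds xs = (\<Sum>b\<in>words B k. tscale (pairing (crds b) xs) (?F ds b))" if "length xs = k" for ds xs
 proof -
  have "?F ds xs = (\<Sum>p<k. \<Sum>b\<in>words B k. tscale (pairing (crds b) xs) (tscale (ksgn (sum_list (take p ds))) (tp (b[p := dif g (b ! p)]))))"
   by (intro sum.cong refl, subst tp_dif_expand[OF _ that]) (auto simp: tens.scale_sum_right mult.commute)
  then show ?thesis by (subst (asm) sum.swap) (simp add: tens.scale_sum_right)
 qed
 have pow: "?F (map dg b) b \<in> tpow g k" if "b \<in> words B k" for b
  using that by (auto simp: words_def intro!: tpow_sum tpow_closed tpow_tp)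
 show "tl k k (tdiff g k)"
  unfolding tdiff_def by (rule tlift_tl(1)) (erule F pow)+
 show "b \<in> words B k ==> tdiff g k (tp b) = ?F (map dg b) b"
  unfolding tdiff_def by (rule tlift_tl(2)) (erule F pow | assumption)+
qed

lemma sum_words_append:
 "(\<Sum>w\<in>words X (k + l). h w) = (\<Sum>u\<in>words X k. \<Sum>v\<in>words X l. h (u @ v))"
 by (induction k arbitrary: h) (simp_all add: sum_words_Suc)

lemma tprod_tp: "length xs = p ==> tprod p (tp xs) (tp ys) = tp (xs @ ys)"
proof (rule ext)
 fix \<theta>s :: "('v => 'k) list" assume p: "length xs = p"
 show "tprod p (tp xs) (tp ys) \<theta>s = tp (xs @ ys) \<theta>s"
 proof (cases "length \<theta>s = length (xs @ ys) & (\<forall>\<theta>\<in>set \<theta>s. lin_form \<theta>)")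
  case True
  have "lin_form \<theta>" if "\<theta> \<in> set (take p \<theta>s)" for \<theta> using True that by (auto dest: in_set_takeD)
  moreover have "lin_form \<theta>" if "\<theta> \<in> set (drop p \<theta>s)" for \<theta> using True that by (auto dest: in_set_dropD)
  ultimately have "tprod p (tp xs) (tp ys) \<theta>s = pairing (take p \<theta>s) xs * pairing (drop p \<theta>s) ys"
   using p True by (simp add: tprod_def tp_apply)
  moreover have "tp (xs @ ys) \<theta>s = (\<Prod>i<p + length ys. (\<theta>s ! i) ((xs @ ys) ! i))"
   using True p by (subst tp_apply) auto
  moreover have "(\<Prod>i<p + length ys. (\<theta>s ! i) ((xs @ ys) ! i)) =
    (\<Prod>i<p. (\<theta>s ! i) ((xs @ ys) ! i)) * (\<Prod>i<length ys. (\<theta>s ! (p + i)) ((xs @ ys) ! (p + i)))"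
   by (rule prod_lessThan_add)
  ultimately show ?thesis using p True by (auto intro!: arg_cong2[where f = "(*)"] prod.cong simp: nth_append)
 next
  case False
  have "tp xs (take p \<theta>s) = 0 \<or> tp ys (drop p \<theta>s) = 0"
  proof (rule ccontr)
   assume "\<not> ?thesis"
   then have nz: "tp xs (take p \<theta>s) ~= 0" "tp ys (drop p \<theta>s) ~= 0" by simp_all
   have "length (take p \<theta>s) = length xs & (\<forall>\<theta>\<in>set (take p \<theta>s). lin_form \<theta>)"
    by (rule ccontr) (use tp_outside[of "take p \<theta>s" xs] nz in blast)
   moreover have "length (drop p \<theta>s) = length ys & (\<forall>\<theta>\<in>set (drop p \<theta>s). lin_form \<theta>)"
    by (rule ccontr) (use tp_outside[of "drop p \<theta>s" ys] nz in blast)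
   moreover have "set \<theta>s = set (take p \<theta>s) \<union> set (drop p \<theta>s)" by (metis append_take_drop_id set_append)
   moreover have "length \<theta>s = length (take p \<theta>s) + length (drop p \<theta>s)" by (metis append_take_drop_id length_append)
   ultimately have "length \<theta>s = length (xs @ ys) & (\<forall>\<theta>\<in>set \<theta>s. lin_form \<theta>)"
    by (metis Un_iff length_append)
   with False show False by blast
  qed
  then have "tprod p (tp xs) (tp ys) \<theta>s = 0" by (auto simp only: tprod_def mult_zero_left mult_zero_right)
  then show ?thesis using tp_outside[OF False] by simp
 qed
qed

lemma tprod_linear:
 "tprod p (\<Sum>i\<in>A. tscale (c i) (f i)) u = (\<Sum>i\<in>A. tscale (c i) (tprod p (f i) u))"
 "tprod p t (\<Sum>i\<in>A. tscale (c i) (f i)) = (\<Sum>i\<in>A. tscale (c i) (tprod p t (f i)))"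
 by (auto simp: fun_eq_iff tprod_def fun_sum_apply sum_distrib_left sum_distrib_right mult_ac intro!: sum.cong)

lemma tprod_tpow: assumes "t \<in> tpow g p" "u \<in> tpow g q" shows "tprod p t u \<in> tpow g (p + q)"
proof -
 have "tprod p t u = tprod p (\<Sum>a\<in>words B p. tscale (t (crds a)) (tp a)) (\<Sum>b\<in>words B q. tscale (u (crds b)) (tp b))"
  using tpow_expand[OF assms(1)] tpow_expand[OF assms(2)] by (rule arg_cong2)
 also have "\<dots> \<in> tpow g (p + q)"
  unfolding tprod_linear by (intro tpow_sum tpow_closed) (auto simp: words_def tprod_tp intro: tpow_tp)
 finally show ?thesis .
qed

lemma tmap_prod_tl:
 assumes add: "\<And>t u. t \<in> tpow g l ==> u \<in> tpow g l ==> L (t + u) = L t + L u"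
   "\<And>c t. t \<in> tpow g l ==> L (tscale c t) = tscale c (L t)" "\<And>t. t \<in> tpow g l ==> L t \<in> tpow g m"
  and add': "\<And>t u. t \<in> tpow g l' ==> u \<in> tpow g l' ==> L' (t + u) = L' t + L' u"
   "\<And>c t. t \<in> tpow g l' ==> L' (tscale c t) = tscale c (L' t)" "\<And>t. t \<in> tpow g l' ==> L' t \<in> tpow g m'"
 shows "tl (l + l') (m + m') (tmap_prod g (m, l) L l' e' L')"
  "a \<in> words B (m + m') ==> b \<in> words B (l + l') ==> mc (tmap_prod g (m, l) L l' e' L') a b =
   ksgn (e' * sum_list (take l (map dg b))) * mc L (take m a) (take l b) * mc L' (drop m a) (drop l b)"
proof -
 let ?F = "%ds xs. tscale (ksgn (e' * sum_list (take l ds))) (tprod m (L (tp (take l xs))) (L' (tp (drop l xs))))"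
 have split: "pairing (crds (u @ v)) xs = pairing (crds u) (take l xs) * pairing (crds v) (drop l xs)"
  if "length xs = l + l'" "length u = l" for xs u v
 proof -
  have "(\<Prod>i<l + l'. (crds (u @ v) ! i) (xs ! i)) = (\<Prod>i<l. (crds (u @ v) ! i) (xs ! i)) * (\<Prod>i<l'. (crds (u @ v) ! (l + i)) (xs ! (l + i)))"
   by (rule prod_lessThan_add)
  then show ?thesis using that by (auto intro!: arg_cong2[where f = "(*)"] prod.cong simp: nth_append)
 qed
 have F: "?F ds xs = (\<Sum>b\<in>words B (l + l'). tscale (pairing (crds b) xs) (?F ds b))" if xs: "length xs = l + l'" for ds xs
 proof -
  have 1: "L (tp (take l xs)) = (\<Sum>u\<in>words B l. tscale (pairing (crds u) (take l xs)) (L (tp u)))"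
   using xs by (subst tp_expand[of "take l xs" l], simp) (rule plin_sum[where L = L and l = l, OF add(1,2)], auto simp: words_def intro: tpow_tp)
  have 2: "L' (tp (drop l xs)) = (\<Sum>v\<in>words B l'. tscale (pairing (crds v) (drop l xs)) (L' (tp v)))"
   using xs by (subst tp_expand[of "drop l xs" l'], simp) (rule plin_sum[where L = L' and l = l', OF add'(1,2)], auto simp: words_def intro: tpow_tp)
  have "?F ds xs = (\<Sum>u\<in>words B l. \<Sum>v\<in>words B l'.
    tscale (pairing (crds u) (take l xs) * pairing (crds v) (drop l xs)) (tscale (ksgn (e' * sum_list (take l ds))) (tprod m (L (tp u)) (L' (tp v)))))"
   unfolding 1 2 tprod_linear by (simp add: tens.scale_sum_right mult_ac) (rule sum.swap)
  also have "\<dots> = (\<Sum>u\<in>words B l. \<Sum>v\<in>words B l'. tscale (pairing (crds (u @ v)) xs) (?F ds (u @ v)))"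
   by (intro sum.cong refl, subst split[OF xs]) (auto simp: words_def)
  also have "\<dots> = (\<Sum>b\<in>words B (l + l'). tscale (pairing (crds b) xs) (?F ds b))"
   by (rule sum_words_append[symmetric])
  finally show ?thesis .
 qed
 have pow: "?F (map dg b) b \<in> tpow g (m + m')" if "b \<in> words B (l + l')" for b
  using that by (auto simp: words_def intro!: tpow_closed tprod_tpow add(3) add'(3) tpow_tp)
 have def: "tmap_prod g (m, l) L l' e' L' = tlift g (l + l') ?F" by (simp add: tmap_prod_def)
 show "tl (l + l') (m + m') (tmap_prod g (m, l) L l' e' L')"
  unfolding def by (rule tlift_tl(1)) (erule F pow)+
 show "mc (tmap_prod g (m, l) L l' e' L') a b =
   ksgn (e' * sum_list (take l (map dg b))) * mc L (take m a) (take l b) * mc L' (drop m a) (drop l b)"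
  if "a \<in> words B (m + m')" "b \<in> words B (l + l')"
 proof -
  have "tmap_prod g (m, l) L l' e' L' (tp b) = ?F (map dg b) b"
   unfolding def by (rule tlift_tl(2)[OF _ _ that(2)]) (erule F pow)+
  then show ?thesis using that by (simp add: mc_def tprod_def take_map drop_map)
 qed
qed

end

context two_term_basis
begin

abbreviation sdg :: "'v list => int" where "sdg b \<equiv> sum_list (map dg b)"

lemma mc_id: "a \<in> words B k ==> b \<in> words B k ==> mc (%u. u) a b = (if a = b then 1 else 0)"
 by (simp add: mc_def tp_crds)

lemma words_take_drop: "b \<in> words X (k + l) ==> take k b \<in> words X k" "b \<in> words X (k + l) ==> drop k b \<in> words X l"
 by (auto simp: words_def dest: in_set_takeD in_set_dropD)

section \<open>The operation star in coordinates\<close>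

text \<open>The contraction of the first output of \<open>L'\<close> with the last input of L.\<close>

lemma contraction_mc:
 fixes p q l' m :: nat and e' :: int
 assumes L: "tl (Suc p) m L" and L': "tl l' (Suc q) L'"
 defines "T \<equiv> %t. tmap_prod g (m, Suc p) L q 0 (%u. u) (tmap_prod g (p, p) (%u. u) l' e' L' t)"
 shows "tl (p + l') (m + q) T"
  "a \<in> words B (m + q) ==> d \<in> words B (p + l') ==> mc T a d = ksgn (e' * sdg (take p d)) *
   (\<Sum>e\<in>B. mc L (take m a) (take p d @ [e]) * mc L' (e # drop m a) (drop p d))"
proof -
 have lin: "tlinear g (Suc p) L" "tlinear g l' L'" "\<And>t. t \<in> tpow g (Suc p) ==> L t \<in> tpow g m" "\<And>t. t \<in> tpow g l' ==> L' t \<in> tpow g (Suc q)"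
  using L L' by (simp_all add: tl_def)
 let ?P1 = "tmap_prod g (m, Suc p) L q 0 (%u. u)" and ?P2 = "tmap_prod g (p, p) (%u. u) l' e' L'"
 have P1: "tl (Suc p + q) (m + q) ?P1"
  by (rule tmap_prod_tl(1); simp add: lin tlinear_simps[OF lin(1)] tlinear_simps[OF lin(2)])
 have P1c: "mc ?P1 a b = ksgn (0 * sum_list (take (Suc p) (map dg b))) * mc L (take m a) (take (Suc p) b) * mc (%u. u) (drop m a) (drop (Suc p) b)"
  if "a \<in> words B (m + q)" "b \<in> words B (Suc p + q)" for a b
  by (rule tmap_prod_tl(2)[OF _ _ _ _ _ _ that]; simp add: lin tlinear_simps[OF lin(1)] tlinear_simps[OF lin(2)])
 have P2: "tl (p + l') (p + Suc q) ?P2"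
  by (rule tmap_prod_tl(1); simp add: lin tlinear_simps[OF lin(1)] tlinear_simps[OF lin(2)])
 have P2c: "mc ?P2 a b = ksgn (e' * sum_list (take p (map dg b))) * mc (%u. u) (take p a) (take p b) * mc L' (drop p a) (drop p b)"
  if "a \<in> words B (p + Suc q)" "b \<in> words B (p + l')" for a b
  by (rule tmap_prod_tl(2)[OF _ _ _ _ _ _ that]; simp add: lin tlinear_simps[OF lin(1)] tlinear_simps[OF lin(2)])
 have k: "Suc p + q = p + Suc q" by simp
 note comp = tl_comp[OF P2 P1[unfolded k]]
 show "tl (p + l') (m + q) T" unfolding T_def by (rule comp(1))
 assume a: "a \<in> words B (m + q)" and d: "d \<in> words B (p + l')"
 have td: "take p d \<in> words B p" "drop p d \<in> words B l'" "drop m a \<in> words B q" using words_take_drop a d by blast+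
 have "mc T a d = (\<Sum>c\<in>words B (p + Suc q). mc ?P2 c d * mc ?P1 a c)"
  unfolding T_def by (rule comp(2)[OF d])
 also have "\<dots> = (\<Sum>u\<in>words B p. \<Sum>e\<in>B. \<Sum>v\<in>words B q. mc ?P2 (u @ e # v) d * mc ?P1 a (u @ e # v))"
  unfolding sum_words_append sum_words_Suc ..
 also have "\<dots> = (\<Sum>u\<in>words B p. \<Sum>e\<in>B. \<Sum>v\<in>words B q. if u = take p d then if v = drop m a then
   ksgn (e' * sdg (take p d)) * (mc L (take m a) (take p d @ [e]) * mc L' (e # drop m a) (drop p d)) else 0 else 0)"
 proof (intro sum.cong refl)
  fix u e v assume u: "u \<in> words B p" and e: "e \<in> B" and v: "v \<in> words B q"
  have w: "u @ e # v \<in> words B (p + Suc q)" using u e v by (auto simp: words_def)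
  then have w': "u @ e # v \<in> words B (Suc p + q)" by (simp only: k)
  have "take p (u @ e # v) = u" "drop p (u @ e # v) = e # v" "take (Suc p) (u @ e # v) = u @ [e]" "drop (Suc p) (u @ e # v) = v"
   using u by (auto simp: words_def)
  then show "mc ?P2 (u @ e # v) d * mc ?P1 a (u @ e # v) = (if u = take p d then if v = drop m a then
   ksgn (e' * sdg (take p d)) * (mc L (take m a) (take p d @ [e]) * mc L' (e # drop m a) (drop p d)) else 0 else 0)"
   using P1c[OF a w'] P2c[OF w d] mc_id[OF u td(1)] mc_id[OF td(3) v] by (auto simp: take_map mult_ac)
 qed
 also have "\<dots> = (\<Sum>u\<in>words B p. if u = take p d then \<Sum>e\<in>B.
   ksgn (e' * sdg (take p d)) * (mc L (take m a) (take p d @ [e]) * mc L' (e # drop m a) (drop p d)) else 0)"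
 proof (intro sum.cong refl)
  fix u
  show "(\<Sum>e\<in>B. \<Sum>v\<in>words B q. if u = take p d then if v = drop m a then
    ksgn (e' * sdg (take p d)) * (mc L (take m a) (take p d @ [e]) * mc L' (e # drop m a) (drop p d)) else 0 else 0) =
   (if u = take p d then \<Sum>e\<in>B. ksgn (e' * sdg (take p d)) * (mc L (take m a) (take p d @ [e]) * mc L' (e # drop m a) (drop p d)) else 0)"
   using td(3) finite_B by (cases "u = take p d") simp_all
 qed
 also have "\<dots> = ksgn (e' * sdg (take p d)) * (\<Sum>e\<in>B. mc L (take m a) (take p d @ [e]) * mc L' (e # drop m a) (drop p d))"
  using td(1) finite_B by (simp add: sum_distrib_left)
 finally show "mc T a d = ksgn (e' * sdg (take p d)) * (\<Sum>e\<in>B. mc L (take m a) (take p d @ [e]) * mc L' (e # drop m a) (drop p d))" .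
qed

text \<open>In coordinates, the two shuffle sums of the operation star run over the decompositions of the words of outputs and of inputs.\<close>
lemma star_mc:
 assumes L: "tl (Suc p) m L" and L': "tl l' (Suc q) L'"
 shows "tl (p + l') (m + q) (star_deg g 2 (m, Suc p) L (Suc q, l') e' L')"
  "a \<in> words B (m + q) ==> b \<in> words B (p + l') ==> mc (star_deg g 2 (m, Suc p) L (Suc q, l') e' L') a b =
   ssum (%x y. dg x * dg y) a (%a1 a2. if length a1 = m then
    ssum (%x y. dg x * dg y + 1) b (%b1 b2. if length b1 = p then ksgn (e' * sdg b1) *
     (\<Sum>e\<in>B. mc L a1 (b1 @ [e]) * mc L' (e # a2) b2) else 0) else 0)"
proof -
 define T where "T = (%t. tmap_prod g (m, Suc p) L q 0 (%u. u) (tmap_prod g (p, p) (%u. u) l' e' L' t))"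
 note T = contraction_mc[OF L L', where e' = e', folded T_def]
 have perms: "s permutes {..<p + l'}" if "s \<in> shuffle_perms p l'" for s p l'
  using that by (simp add: shuffle_perms_def)
 have fin: "finite (shuffle_perms p l')" for p l'
  by (rule finite_subset[OF _ finite_permutations[of "{..<p + l'}"]]) (auto simp: perms)
 let ?U = "%s r t. tperm g (m + q) (inv_into UNIV r) (T (tperm g (p + l') s t))"
 have star: "star_deg g 2 (m, Suc p) L (Suc q, l') e' L' =
   (%t. \<Sum>s\<in>shuffle_perms p l'. \<Sum>r\<in>shuffle_perms m q. tscale (permsgn s) (?U s r t))"
  by (simp add: star_deg_def T_def fun_eq_iff permsgn_shift_def)
 have U: "tl (p + l') (m + q) (?U s r)" if "s \<in> shuffle_perms p l'" "r \<in> shuffle_perms m q" for s r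
  by (rule tl_comp(1)[OF tl_comp(1)[OF tperm_tl(1)[OF perms[OF that(1)]] T(1)] tperm_tl(1)[OF permutes_inv[OF perms[OF that(2)]]]])
 show "tl (p + l') (m + q) (star_deg g 2 (m, Suc p) L (Suc q, l') e' L')"
  unfolding star by (intro tl_sum fin tl_scale U)
 assume a: "a \<in> words B (m + q)" and b: "b \<in> words B (p + l')"
 let ?H = "%a1 a2 b1 b2. ksgn (e' * sdg b1) * (\<Sum>e\<in>B. mc L a1 (b1 @ [e]) * mc L' (e # a2) b2)"
 have mcU: "mc (?U s r) a b = koszul (map dg b) s * (koszul (map dg a) r *
   ?H (take m (permute_list r a)) (drop m (permute_list r a)) (take p (permute_list s b)) (drop p (permute_list s b)))"
  if s: "s \<in> shuffle_perms p l'" and r: "r \<in> shuffle_perms m q" for s r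
 proof -
  note s' = perms[OF s] and r' = perms[OF r] and ri = permutes_inv[OF perms[OF r]]
  have la: "length a = m + q" using a by (simp add: words_def)
  have ca: "permute_list r a \<in> words B (m + q)" and db: "permute_list s b \<in> words B (p + l')"
   using perm_words r' s' a b by blast+
  have inv1: "permute_list (inv_into UNIV r) (permute_list r a) = a"
  proof -
   have "permute_list (inv_into UNIV r) (permute_list r a) = permute_list (r \<circ> inv_into UNIV r) a"
    using ri la by (simp add: permute_list_compose)
   then show ?thesis using r' by (simp add: permutes_inv_o(1))
  qed
  have inv2: "c = permute_list r a" if "c \<in> words B (m + q)" "a = permute_list (inv_into UNIV r) c" for c
  proof -
   have "permute_list r (permute_list (inv_into UNIV r) c) = permute_list (inv_into UNIV r \<circ> r) c"
    using r' that(1) by (simp add: permute_list_compose words_def)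
   then show ?thesis using r' that(2) by (simp add: permutes_inv_o(2))
  qed
  have kos: "koszul (map dg (permute_list r a)) (inv_into UNIV r) = koszul (map dg a) r"
   using koszul_inverse[of r "map dg a"] r' la by (simp add: permute_list_map)
  have "mc (?U s r) a b = (\<Sum>c\<in>words B (m + q). mc (%t. T (tperm g (p + l') s t)) c b * mc (tperm g (m + q) (inv_into UNIV r)) a c)"
   using tl_comp(2)[OF tl_comp(1)[OF tperm_tl(1)[OF s'] T(1)] tperm_tl(1)[OF ri] b] .
  also have "\<dots> = (\<Sum>c\<in>words B (m + q). if c = permute_list r a then mc (%t. T (tperm g (p + l') s t)) c b * koszul (map dg a) r else 0)"
   using inv1 inv2 by (intro sum.cong refl) (auto simp: mc_tperm[OF ri a] kos)
  also have "\<dots> = mc (%t. T (tperm g (p + l') s t)) (permute_list r a) b * koszul (map dg a) r"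
   using ca finite_B by simp
  also have "mc (%t. T (tperm g (p + l') s t)) (permute_list r a) b =
    (\<Sum>d\<in>words B (p + l'). mc (tperm g (p + l') s) d b * mc T (permute_list r a) d)"
   using tl_comp(2)[OF tperm_tl(1)[OF s'] T(1) b] .
  also have "\<dots> = (\<Sum>d\<in>words B (p + l'). if d = permute_list s b then koszul (map dg b) s * mc T (permute_list r a) d else 0)"
   by (intro sum.cong refl) (simp add: mc_tperm[OF s' _ b])
  also have "\<dots> = koszul (map dg b) s * mc T (permute_list r a) (permute_list s b)"
   using db finite_B by simp
  finally show ?thesis using T(2)[OF ca db] by (simp add: mult_ac)
 qed
 have ks: "permsgn s * koszul (map dg b) s = (ksgn (kap (%x y. dg x * dg y + 1) b s) :: 'k)" if "s \<in> shuffle_perms p l'" for s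
  using perms[OF that] b permsgn_kap[of s b] by (simp add: koszul_kap kap_map kap_add ksgn_add words_def mult.commute)
 have kr: "koszul (map dg a) r = (ksgn (kap (%x y. dg x * dg y) a r) :: 'k)" if "r \<in> shuffle_perms m q" for r
  using perms[OF that] a by (simp add: koszul_kap kap_map words_def)
 have "mc (star_deg g 2 (m, Suc p) L (Suc q, l') e' L') a b =
  (\<Sum>s\<in>shuffle_perms p l'. \<Sum>r\<in>shuffle_perms m q. permsgn s * (koszul (map dg b) s * (koszul (map dg a) r *
   ?H (take m (permute_list r a)) (drop m (permute_list r a)) (take p (permute_list s b)) (drop p (permute_list s b)))))"
  unfolding star mc_sum mc_scale by (intro sum.cong refl) (simp add: mcU)
 also have "\<dots> = (\<Sum>r\<in>shuffle_perms m q. ksgn (kap (%x y. dg x * dg y) a r) *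
   (\<Sum>s\<in>shuffle_perms p l'. ksgn (kap (%x y. dg x * dg y + 1) b s) *
   ?H (take m (permute_list r a)) (drop m (permute_list r a)) (take p (permute_list s b)) (drop p (permute_list s b))))"
  by (subst sum.swap) (auto intro!: sum.cong simp: sum_distrib_left ks[symmetric] kr[symmetric] mult_ac)
 also have "\<dots> = ssum (%x y. dg x * dg y) a (%a1 a2. if length a1 = m then
   (\<Sum>s\<in>shuffle_perms p l'. ksgn (kap (%x y. dg x * dg y + 1) b s) * ?H a1 a2 (take p (permute_list s b)) (drop p (permute_list s b))) else 0)"
  using a by (intro sum_shuffle_perms[where G = "%a1 a2. \<Sum>s\<in>shuffle_perms p l'. ksgn (kap (%x y. dg x * dg y + 1) b s) * ?H a1 a2 (take p (permute_list s b)) (drop p (permute_list s b))"])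
   (simp add: words_def)
 also have "\<dots> = ssum (%x y. dg x * dg y) a (%a1 a2. if length a1 = m then
    ssum (%x y. dg x * dg y + 1) b (%b1 b2. if length b1 = p then ?H a1 a2 b1 b2 else 0) else 0)"
  using b by (subst sum_shuffle_perms) (simp_all add: words_def)
 finally show "mc (star_deg g 2 (m, Suc p) L (Suc q, l') e' L') a b =
   ssum (%x y. dg x * dg y) a (%a1 a2. if length a1 = m then
    ssum (%x y. dg x * dg y + 1) b (%b1 b2. if length b1 = p then ?H a1 a2 b1 b2 else 0) else 0)" .
qed

section \<open>Symmetry conditions in coordinates\<close>

lemma tpart_tpow: "t \<in> tpart g k i ==> t \<in> tpow g k"
 unfolding tpart_def tpow_def by (rule subsetD[OF tens.span_mono]) auto

lemma tpart_coord:
 assumes "t \<in> tpart g k i" "a \<in> words B k" "sdg a ~= i" shows "t (crds a) = 0"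
proof -
 have "tpart g k i \<subseteq> {t. t (crds a) = 0}"
  unfolding tpart_def
 proof (rule tens.span_minimal)
  show "tens.subspace {t. t (crds a) = 0}" by (rule tens.subspaceI) auto
  show "{tp xs |xs ds. length xs = k & homog g ds xs & sum_list ds = i} \<subseteq> {t. t (crds a) = 0}"
  proof clarify
   fix xs ds assume xs: "k = length xs" "homog g ds xs" "i = sum_list ds"
   have "tp xs (crds a) = pairing (crds a) xs"
    using assms(2) xs crd_linear by (intro tp_apply) (auto simp: words_def)
   then show "tp xs (crds a) = 0"
    using homog_pairing[OF xs(2), of a] assms(2,3) xs by auto
  qed
 qed
 then show ?thesis using assms by blast
qed

lemma tpart_basis: "b \<in> words B k ==> tp b \<in> tpart g k (sdg b)"
 unfolding tpart_def by (rule tens.span_base) (use homog_basis in \<open>auto simp: words_def\<close>)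

definition homdeg :: "nat => nat => int => ('v list => 'v list => 'k) => bool"
 where "homdeg m l e c \<longleftrightarrow> (\<forall>a\<in>words B m. \<forall>b\<in>words B l. c a b ~= 0 --> sdg a = sdg b + e)"

lemma hom_part_iff: "L \<in> hom_part g (m, l) e \<longleftrightarrow> tl l m L & homdeg m l e (mc L)"
proof
 assume L: "L \<in> hom_part g (m, l) e"
 then have lin: "tlinear g l L" and deg: "\<And>i t. t \<in> tpart g l i ==> L t \<in> tpart g m (i + e)"
  by (auto simp: hom_part_def)
 have Lb: "L (tp b) \<in> tpart g m (sdg b + e)" if "b \<in> words B l" for b
  by (rule deg[OF tpart_basis[OF that]])
 have "L t \<in> tpow g m" if "t \<in> tpow g l" for t
  unfolding tlinear_expand[OF lin that] by (intro tpow_sum tpow_closed tpart_tpow[OF Lb])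
 then show "tl l m L & homdeg m l e (mc L)"
  using lin tpart_coord[OF Lb] by (force simp: tl_def homdeg_def mc_def)
next
 assume L: "tl l m L & homdeg m l e (mc L)"
 have sub: "tens.subspace (tpart g m i)" for i unfolding tpart_def by (rule tens.subspace_span)
 have "L t \<in> tpart g m (i + e)" if t: "t \<in> tpart g l i" for i t
 proof -
  have tl: "t \<in> tpow g l" by (rule tpart_tpow[OF t])
  then have "L t \<in> tpow g m" using L by (simp add: tl_def)
  then have expand: "L t = (\<Sum>a\<in>words B m. tscale (L t (crds a)) (tp a))" by (rule tpow_expand)
  have "tscale (L t (crds a)) (tp a) \<in> tpart g m (i + e)" if a: "a \<in> words B m" for a
  proof (cases "sdg a = i + e")
   case True
   then show ?thesis using tpart_basis[OF a] by (auto intro: tens.subspace_scale[OF sub])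
  next
   case False
   have "t (crds b) * mc L a b = 0" if b: "b \<in> words B l" for b
    using tpart_coord[OF t b] L a b False by (cases "sdg b = i") (auto simp: homdeg_def)
   then have "(\<Sum>b\<in>words B l. t (crds b) * mc L a b) = 0" by (intro sum.neutral) blast
   then have "L t (crds a) = 0" using tl_apply[of l m L t a] L tl by metis
   moreover have "tscale 0 (tp a) = 0" by (simp add: fun_eq_iff)
   ultimately show ?thesis using tens.subspace_0[OF sub] by (simp only:)
  qed
  then have "(\<Sum>a\<in>words B m. tscale (L t (crds a)) (tp a)) \<in> tpart g m (i + e)" by (rule tens.subspace_sum[OF sub])
  then show ?thesis unfolding expand[symmetric] .
 qed
 then show "L \<in> hom_part g (m, l) e" using L by (simp add: hom_part_def tl_def)
qed

text \<open>Degree and symmetry of a multilinear map are visible on its matrix coefficients, because the basis is homogeneous.\<close>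
lemma sym_hom_iff:
 "L \<in> sym_hom g 2 (m, l) e \<longleftrightarrow> tl l m L & homdeg m l e (mc L) &
  (\<forall>s a b. s permutes {..<l} --> a \<in> words B m --> b \<in> words B l -->
   mc L a (permute_list s b) = permsgn s * koszul (map dg b) s * mc L a b) &
  (\<forall>r a b. r permutes {..<m} --> a \<in> words B m --> b \<in> words B l -->
   mc L (permute_list r a) b = koszul (map dg a) r * mc L a b)"
 (is "_ \<longleftrightarrow> ?tl & ?deg & ?in & ?out")
proof (cases "tl l m L")
 case True
 have restrict: "(\<forall>t\<in>tpow g l. K t = K' t) \<longleftrightarrow> (\<forall>a\<in>words B m. \<forall>b\<in>words B l. mc K a b = mc K' a b)"
  if "tl l m K" "tl l m K'" for K K'
 proof
  assume "\<forall>t\<in>tpow g l. K t = K' t"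
  then show "\<forall>a\<in>words B m. \<forall>b\<in>words B l. mc K a b = mc K' a b"
   by (auto simp: mc_def words_def tpow_tp)
 next
  assume "\<forall>a\<in>words B m. \<forall>b\<in>words B l. mc K a b = mc K' a b"
  then have "K = K'" using tl_eqI[OF that] by blast
  then show "\<forall>t\<in>tpow g l. K t = K' t" by simp
 qed
 have ks: "koszul ds s * (koszul ds s * x) = (x :: 'k)" for ds s x by (simp add: koszul_def)
 have ps: "permsgn s * (permsgn s * x) = (x :: 'k)" for s x
  by (cases s rule: sign_cases) (simp_all add: permsgn_def)
 have 1: "(\<forall>t\<in>tpow g l. L (tperm g l s t) = tscale (permsgn s) (L t)) \<longleftrightarrow>
   (\<forall>a\<in>words B m. \<forall>b\<in>words B l. mc L a (permute_list s b) = permsgn s * koszul (map dg b) s * mc L a b)"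
  if s: "s permutes {..<l}" for s
 proof -
  have "mc (%t. L (tperm g l s t)) a b = koszul (map dg b) s * mc L a (permute_list s b)" if "a \<in> words B m" "b \<in> words B l" for a b
  proof -
   have "mc (%t. L (tperm g l s t)) a b = (\<Sum>c\<in>words B l. if c = permute_list s b then koszul (map dg b) s * mc L a c else 0)"
    unfolding tl_comp(2)[OF tperm_tl(1)[OF s] True that(2)]
    by (intro sum.cong refl) (simp add: mc_tperm[OF s _ that(2)])
   then show ?thesis using perm_words[OF s that(2)] finite_B by simp
  qed
  moreover have "koszul (map dg b) s * x = permsgn s * y \<longleftrightarrow> x = permsgn s * koszul (map dg b) s * (y :: 'k)" for x y b
  proof
   assume "koszul (map dg b) s * x = permsgn s * y"
   then have "koszul (map dg b) s * (koszul (map dg b) s * x) = koszul (map dg b) s * (permsgn s * y)" by (rule arg_cong)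
   then show "x = permsgn s * koszul (map dg b) s * y" unfolding ks by (simp only: mult_ac)
  next
   assume x: "x = permsgn s * koszul (map dg b) s * y"
   have "koszul (map dg b) s * x = koszul (map dg b) s * (koszul (map dg b) s * (permsgn s * y))" unfolding x by (simp only: mult_ac)
   then show "koszul (map dg b) s * x = permsgn s * y" unfolding ks .
  qed
  ultimately show ?thesis
   by (subst restrict[OF tl_comp(1)[OF tperm_tl(1)[OF s] True] tl_scale[OF True]]) (simp add: mc_scale)
 qed
 have 2: "(\<forall>t\<in>tpow g l. tperm g m r (L t) = tscale (permsgn_shift 2 r) (L t)) \<longleftrightarrow>
   (\<forall>a\<in>words B m. \<forall>b\<in>words B l. mc L (permute_list r a) b = koszul (map dg a) r * mc L a b)"
  if r: "r permutes {..<m}" for r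
 proof -
  have c: "mc (%t. tperm g m r (L t)) (permute_list r a) b = koszul (map dg a) r * mc L a b" if a: "a \<in> words B m" and b: "b \<in> words B l" for a b
  proof -
   have "c = a" if "c \<in> words B m" "permute_list r a = permute_list r c" for c
   proof -
    have "permute_list (inv_into UNIV r) (permute_list r x) = x" if "x \<in> words B m" for x
     using permute_list_compose[of "inv_into UNIV r" x r] permutes_inv[OF r] r that
     by (simp add: words_def permutes_inv_o(1))
    then show ?thesis using that a by metis
   qed
   then have "mc (%t. tperm g m r (L t)) (permute_list r a) b = (\<Sum>c\<in>words B m. if c = a then koszul (map dg a) r * mc L a b else 0)"
    unfolding tl_comp(2)[OF True tperm_tl(1)[OF r] b]
    by (intro sum.cong refl) (auto simp: mc_tperm[OF r perm_words[OF r a]])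
   then show ?thesis using a finite_B by simp
  qed
  have surj: "\<exists>a\<in>words B m. a' = permute_list r a" if "a' \<in> words B m" for a'
  proof -
   have "permute_list r (permute_list (inv_into UNIV r) a') = a'"
    using permute_list_compose[of r a' "inv_into UNIV r"] r that by (simp add: words_def permutes_inv_o(2))
   then show ?thesis using perm_words[OF permutes_inv[OF r] that] by metis
  qed
  have "(\<forall>t\<in>tpow g l. tperm g m r (L t) = L t) \<longleftrightarrow> (\<forall>a\<in>words B m. \<forall>b\<in>words B l. mc (%t. tperm g m r (L t)) a b = mc L a b)"
   by (rule restrict[OF tl_comp(1)[OF True tperm_tl(1)[OF r]] True])
  also have "\<dots> \<longleftrightarrow> (\<forall>a\<in>words B m. \<forall>b\<in>words B l. mc (%t. tperm g m r (L t)) (permute_list r a) b = mc L (permute_list r a) b)"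
   using surj perm_words[OF r] by metis
  also have "\<dots> \<longleftrightarrow> (\<forall>a\<in>words B m. \<forall>b\<in>words B l. mc L (permute_list r a) b = koszul (map dg a) r * mc L a b)"
   by (simp add: c eq_commute[of "mc L _ _"])
  finally show ?thesis by (simp add: permsgn_shift_def tscale_def)
 qed
 have "L \<in> sym_hom g 2 (m, l) e \<longleftrightarrow> L \<in> hom_part g (m, l) e &
   (\<forall>s. s permutes {..<l} --> (\<forall>t\<in>tpow g l. L (tperm g l s t) = tscale (permsgn s) (L t))) &
   (\<forall>r. r permutes {..<m} --> (\<forall>t\<in>tpow g l. tperm g m r (L t) = tscale (permsgn_shift 2 r) (L t)))"
  by (auto simp: sym_hom_def)
 then show ?thesis unfolding hom_part_iff using 1 2 by blast
next
 case False
 then show ?thesis by (auto simp: sym_hom_def hom_part_iff)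
qed

end

context two_term_basis
begin

section \<open>Graded symmetric functions as families of maps\<close>

text \<open>The sign exponent that arises when the shifts are moved out of \<open>s\<theta>\<^sub>1 \<dots> s\<theta>\<^sub>l\<close> and the order of the inputs is reversed.\<close>
fun Xs :: "'v list => int"
 where
  "Xs [] = 0"
 | "Xs (e # b) = dg e * (int (length b) + sdg b) + Xs b"

definition E :: "'v list => 'v list => 'k"
 where "E a b = ksgn (int (length b) * sdg a) * ksgn (Xs b)"

definition W :: "'v list => 'v list => (int \<times> bool \<times> 'v) list"
 where "W a b = map Pe a @ map Qe b"

text \<open>The image under \<open>\<Phi>\<close> of the polyvector represented by f: up to the sign \<open>E\<close>, the matrix coefficients are the values of f on sorted words.\<close>
definition phi :: "('v, 'k) pqfun => nat => nat => ('k, 'v) tmap"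
 where "phi f m l = mkT m l (%a b. E a b * co f (W a b))"

lemma E_square [simp]: "E a b * E a b = 1" "E a b * (E a b * x) = x" "E a b ~= 0"
 by (simp_all add: E_def mult_ac)

lemma tl_phi [simp]: "tl l m (phi f m l)"
 by (simp add: phi_def tl_mkT)

lemma mc_phi: "a \<in> words B m ==> b \<in> words B l ==> mc (phi f m l) a b = E a b * co f (W a b)"
 by (simp add: phi_def mc_mkT)

lemma co_phi: "a \<in> words B m ==> b \<in> words B l ==> co f (W a b) = E a b * mc (phi f m l) a b"
 by (simp add: mc_phi)

lemma mkT_cong:
 assumes "\<And>a b. a \<in> words B m ==> b \<in> words B l ==> c a b = c' a b" shows "mkT m l c = mkT m l c'"
 using assms by (intro tl_eqI[of l m] tl_mkT) (simp add: mc_mkT)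

lemma phi_add: "phi (f + h) m l = phi f m l + phi h m l"
 by (rule ext, rule ext) (simp add: phi_def mkT_def fun_sum_apply sum.distrib sum_distrib_right distrib_left distrib_right)

lemma phi_scale: "phi (cst c * f) m l = (%t. tscale c (phi f m l t))"
 by (rule ext, rule ext) (simp add: phi_def mkT_def fun_sum_apply sum_distrib_left sum_distrib_right mult_ac)

lemma phi_0 [simp]: "phi 0 m l = 0"
 by (rule ext, rule ext) (simp add: phi_def mkT_def fun_sum_apply)

lemma Xs_insert: "Xs (u @ e # v) = Xs (u @ v) + dg e * (int (length v) + sdg v) + sdg u * (1 + dg e)"
 by (induction u) (simp_all add: algebra_simps)

lemma Xs_append: "Xs (u @ v) = Xs u + Xs v + sdg u * (int (length v) + sdg v)"
 by (induction u) (simp_all add: algebra_simps)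

text \<open>Modulo 2, the exponents \<open>(1 - x) (1 - y)\<close> and \<open>1 + x y\<close> of the symmetric and the exterior sign differ by \<open>x + y\<close>; the sum of these differences over the inversions is the variation of \<open>Xs\<close>.\<close>
lemma Xs_permute:
 assumes "s permutes {..<length b}"
 shows "even (kap (%x y. dg x + dg y) b s + Xs b + Xs (permute_list s b))"
 using assms
proof (induction b s rule: permutes_induct_ins)
 case Nil
 then show ?case by simp
next
 case (ins x xs p s)
 define c where "c = permute_list s xs"
 define u v where "u = take p c" and "v = drop p c"
 have c: "c = u @ v" and pc: "permute_list (ins p s) (x # xs) = u @ x # v" and lu: "length u = p"
  using ins by (simp_all add: u_def v_def c_def permute_list_ins)
 have "mset c = mset xs" using ins by (simp add: c_def)
 then have "length c = length xs" "sdg c = sdg xs" by (metis mset_eq_length, metis mset_map sum_mset_sum_list)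
 then have len: "length xs = length u + length v" and sd: "sdg xs = sdg u + sdg v" by (simp_all add: c)
 have k: "kap (%x y. dg x + dg y) (x # xs) (ins p s) = sdg u + int (length u) * dg x + kap (%x y. dg x + dg y) xs s"
  using ins by (simp add: kap_ins u_def c_def sum_list_addf sum_list_triv)
 have IH: "even (kap (%x y. dg x + dg y) xs s + Xs xs + Xs (u @ v))" using ins.IH by (simp add: c_def[symmetric] c)
 have eq: "kap (%x y. dg x + dg y) (x # xs) (ins p s) + Xs (x # xs) + Xs (u @ x # v) =
   kap (%x y. dg x + dg y) xs s + Xs xs + Xs (u @ v) +
   2 * (sdg u + int (length u) * dg x + dg x * (int (length v) + sdg v) + sdg u * dg x)"
  unfolding k Xs_insert by (simp add: len sd algebra_simps)
 show ?case unfolding pc eq by (rule dvd_add[OF IH dvd_triv_left])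
qed

lemma decalage_sign:
 assumes "s permutes {..<length b}"
 shows "ksgn (Xs (permute_list s b)) * ksgn (kap (%x y. fst (Qe x) * fst (Qe y)) b s) =
  permsgn s * koszul (map dg b) s * (ksgn (Xs b) :: 'k)"
proof -
 let ?k = "%q. kap q b s"
 have "(%x y. fst (Qe x) * fst (Qe y)) = (%x y. (1 + dg x * dg y) + - (dg x + dg y))" by (auto simp: fun_eq_iff algebra_simps)
 moreover have neg: "?k (%x y. - (dg x + dg y)) = - ?k (%x y. dg x + dg y)"
  by (simp add: kap_def sum_negf[symmetric] case_prod_unfold)
 ultimately have q: "?k (%x y. fst (Qe x) * fst (Qe y)) = ?k (%_ _. 1) + ?k (%x y. dg x * dg y) + - ?k (%x y. dg x + dg y)"
  by (simp only: kap_add)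
 have r: "permsgn s * koszul (map dg b) s * (ksgn (Xs b) :: 'k) = ksgn (?k (%_ _. 1) + ?k (%x y. dg x * dg y) + Xs b)"
  unfolding permsgn_kap[OF assms] koszul_kap ksgn_add using assms by (simp only: kap_map length_map)
 have parity: "even (k3 + x + x') ==> even (x' + (k1 + k2 + - k3) + (k1 + k2 + x))" for k1 k2 k3 x x' :: int by presburger
 show ?thesis unfolding r q ksgn_add[symmetric] by (rule ksgn_cong, rule parity, rule Xs_permute[OF assms])
qed

lemma symf_permute_within:
 fixes f :: "('x, 'a::field_char_0) sfun"
 assumes f: "symf f" and s: "s permutes {..<length w}"
 shows "co f (x @ permute_list s w @ y) = ksgn (kap (%x y. fst x * fst y) w s) * co f (x @ w @ y)"
proof -
 let ?h = "Sfun (%w. co f (x @ w @ y))"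
 have co: "co ?h w = co f (x @ w @ y)" for w by (simp add: Sfun_inverse)
 have "symf ?h"
  unfolding symf_def co
 proof (intro allI)
  fix u a b v
  show "co f (x @ (u @ a # b # v) @ y) = ksgn (fst a * fst b) * co f (x @ (u @ b # a # v) @ y)"
   using symf_swap[OF f, of "x @ u" a b "v @ y"] by (simp only: append_assoc append_Cons)
 qed
 from symf_permute[OF this s] show ?thesis unfolding co .
qed

lemma phi_permute:
 assumes f: "symf f" and a: "a \<in> words B m" and b: "b \<in> words B l"
 shows "s permutes {..<l} ==> mc (phi f m l) a (permute_list s b) = permsgn s * koszul (map dg b) s * mc (phi f m l) a b"
  and "r permutes {..<m} ==> mc (phi f m l) (permute_list r a) b = koszul (map dg a) r * mc (phi f m l) a b"
proof -
 assume "s permutes {..<l}"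
 moreover have lb: "length b = l" using b by (simp add: words_def)
 ultimately have s: "s permutes {..<length b}" "s permutes {..<length (map Qe b)}" "s permutes {..<l}" by simp_all
 have "co f (W a (permute_list s b)) = ksgn (kap (%x y. fst (Qe x) * fst (Qe y)) b s) * co f (W a b)"
  using symf_permute_within[OF f s(2), of "map Pe a" "[]"] s by (simp add: W_def permute_list_map kap_map)
 then have "mc (phi f m l) a (permute_list s b) =
   (ksgn (Xs (permute_list s b)) * ksgn (kap (%x y. fst (Qe x) * fst (Qe y)) b s)) * (ksgn (int l * sdg a) * co f (W a b))"
  using mc_phi[OF a perm_words[OF s(3) b], of f] by (simp add: E_def lb mult_ac)
 then show "mc (phi f m l) a (permute_list s b) = permsgn s * koszul (map dg b) s * mc (phi f m l) a b"
  unfolding decalage_sign[OF s(1)] mc_phi[OF a b] by (simp add: E_def lb mult_ac)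
next
 assume "r permutes {..<m}"
 moreover have la: "length a = m" using a by (simp add: words_def)
 ultimately have r: "r permutes {..<length a}" "r permutes {..<length (map Pe a)}" "r permutes {..<m}" by simp_all
 have sd: "sdg (permute_list r a) = sdg a"
  using r(1) by (simp add: sum_mset_sum_list[symmetric] permute_list_map[symmetric] del: mset_map)
 have "(%x y. fst (Pe x) * fst (Pe y)) = (%x y. dg x * dg y + (2 * (dg x + dg y + 2)))" by (auto simp: fun_eq_iff algebra_simps)
 moreover have "kap (%x y. 2 * (dg x + dg y + 2)) a r = 2 * kap (%x y. dg x + dg y + 2) a r"
  by (simp add: kap_def sum_distrib_left case_prod_unfold)
 ultimately have "kap (%x y. fst (Pe x) * fst (Pe y)) a r = kap (%x y. dg x * dg y) a r + 2 * kap (%x y. dg x + dg y + 2) a r"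
  by (simp only: kap_add)
 then have k: "ksgn (kap (%x y. fst (Pe x) * fst (Pe y)) a r) = (koszul (map dg a) r :: 'k)"
  using r by (simp add: koszul_kap kap_map) (rule ksgn_cong, simp)
 have "co f (W (permute_list r a) b) = koszul (map dg a) r * co f (W a b)"
  using symf_permute_within[OF f r(2), of "[]" "map Qe b"] r by (simp add: W_def permute_list_map kap_map k del: PQ_simps)
 then show "mc (phi f m l) (permute_list r a) b = koszul (map dg a) r * mc (phi f m l) a b"
  using mc_phi[OF perm_words[OF r(3) a] b, of f] mc_phi[OF a b, of f] by (simp add: E_def sd mult_ac)
qed

lemma sum_degrees: "wd (W a b) = sdg a + 2 * int (length a) + int (length b) - sdg b"
 by (induction a) (simp_all add: W_def, induction b, simp_all)

lemma phi_sym_hom: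
 assumes f: "symf f" and h: "hom 4 f"
 shows "phi f m l \<in> sym_hom g 2 (m, l) (pdeg 2 (m, l))"
 unfolding sym_hom_iff
proof (intro conjI allI impI)
 show "homdeg m l (pdeg 2 (m, l)) (mc (phi f m l))"
  unfolding homdeg_def
 proof (intro ballI impI)
  fix a b assume ab: "a \<in> words B m" "b \<in> words B l" "mc (phi f m l) a b ~= 0"
  then have "co f (W a b) ~= 0" by (simp add: mc_phi)
  then have "wd (W a b) = 4" using h by (simp add: homg_def)
  then show "sdg a = sdg b + pdeg 2 (m, l)" using ab by (simp add: sum_degrees words_def pdeg_def)
 qed
qed (simp_all add: phi_permute[OF f])

text \<open>Graded symmetry sorts every word, at the price of a sign, into a word in which the letters \<open>Pe\<close> precede the letters \<open>Qe\<close>.\<close>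

lemma normal_word:
 assumes "set w \<subseteq> LPQ"
 shows "\<exists>a b K. set a \<subseteq> B & set b \<subseteq> B & mset (W a b) = mset w & (\<forall>f :: ('v, 'k) pqfun. symf f --> co f w = ksgn K * co f (W a b))"
 using assms
proof (induction w)
 case Nil
 show ?case by (rule exI[of _ "[]"], rule exI[of _ "[]"], rule exI[of _ 0]) (simp add: W_def)
next
 case (Cons x w)
 then obtain a b K where IH: "set a \<subseteq> B" "set b \<subseteq> B" "mset (W a b) = mset w" "\<And>f :: ('v, 'k) pqfun. symf f ==> co f w = ksgn K * co f (W a b)"
  by auto
 have x: "co f (x # w) = ksgn K * co f (x # W a b)" if "symf f" for f :: "('v, 'k) pqfun"
  using IH(4)[OF symf_Dl[OF that, of x]] by simp
 from Cons.prems consider e where "e \<in> B" "x = Pe e" | e where "e \<in> B" "x = Qe e" by (auto simp: LPQ_def)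
 then show ?case
 proof cases
  case 1
  then show ?thesis using IH x by (intro exI[of _ "e # a"] exI[of _ b] exI[of _ K]) (auto simp: W_def)
 next
  case 2
  have "co f (W a (e # b)) = ksgn (fst x * wd (map Pe a)) * co f (x # W a b)" if "symf f" for f :: "('v, 'k) pqfun"
   using symf_front[OF that, of "map Pe a" x "map Qe b"] 2 by (simp add: W_def)
  then have "co f (x # w) = ksgn (K + fst x * wd (map Pe a)) * co f (W a (e # b))" if "symf f" for f :: "('v, 'k) pqfun"
   using x[OF that] that by (simp add: ksgn_add mult.assoc)
  then show ?thesis using IH(1-3) 2
   by (intro exI[of _ a] exI[of _ "e # b"] exI[of _ "K + fst x * wd (map Pe a)"]) (auto simp: W_def)
 qed
qed

lemma words_W: "set a \<subseteq> B ==> a \<in> words B (length a)" by (simp add: words_def)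

lemma symset_eqI:
 fixes f h :: "('v, 'k) pqfun"
 assumes "f \<in> symset LPQ" "h \<in> symset LPQ" "\<And>m l a b. a \<in> words B m ==> b \<in> words B l ==> co f (W a b) = co h (W a b)"
 shows "f = h"
proof (rule sfun_eqI)
 fix w
 show "co f w = co h w"
 proof (cases "set w \<subseteq> LPQ")
  case True
  then obtain a b K where *: "set a \<subseteq> B" "set b \<subseteq> B" "\<And>f :: ('v, 'k) pqfun. symf f ==> co f w = ksgn K * co f (W a b)"
   using normal_word[of w] by metis
  show ?thesis using *(3)[of f] *(3)[of h] assms(3)[OF words_W[OF *(1)] words_W[OF *(2)]] assms(1,2) by (simp add: symset_symf)
 next
  case False
  then show ?thesis using symset_supp[OF assms(1)] symset_supp[OF assms(2)] by metis
 qed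
qed

lemma phi_inject:
 assumes "f \<in> symset LPQ" "h \<in> symset LPQ" "\<And>m l. phi f m l = phi h m l" shows "f = h"
 using assms by (intro symset_eqI) (simp_all add: co_phi)

lemma phi_weight:
 assumes f: "homg wt k f" and "int m ~= k" shows "phi f m l = 0"
proof -
 have "co f (W a b) = 0" if "a \<in> words B m" for a b
 proof -
  have "sum_list (map wt (W a b)) = int m"
   using that by (auto simp: W_def words_def o_def sum_list_triv)
  then show ?thesis using assms by (auto simp: homg_def)
 qed
 then have "phi f m l = mkT m l (%a b. E a b * co 0 (W a b))" unfolding phi_def by (intro mkT_cong) simp
 then show ?thesis using phi_0 by (simp only: phi_def)
qed

text \<open>All letters have degree 1 or 2, so that a function of degree 4 lives on words of length 2, 3 and 4. This is why only six components occur.\<close>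
lemma phi_zero_outside:
 assumes f: "hom 4 f" and "m + l > 4 \<or> m + l < 2" shows "phi f m l = 0"
proof -
 have "co f (W a b) = 0" if "a \<in> words B m" "b \<in> words B l" for a b
 proof (rule ccontr)
  assume "co f (W a b) ~= 0"
  then have "wd (W a b) = 4" using f by (simp add: homg_def)
  then have w: "sdg a + 2 * int m + int l - sdg b = 4" using that by (simp add: sum_degrees words_def)
  have rg: "- int (length c) \<le> sdg c & sdg c \<le> 0" if "set c \<subseteq> B" for c
   using that
  proof (induction c)
   case (Cons x c)
   then show ?case using dg_range[of x] by auto
  qed simp
  have "- int m \<le> sdg a & sdg a \<le> 0" "- int l \<le> sdg b & sdg b \<le> 0" using rg[of a] rg[of b] that by (auto simp: words_def)
  then show False using w assms(2) by linarith
 qed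
 then have "phi f m l = mkT m l (%a b. E a b * co 0 (W a b))" unfolding phi_def by (intro mkT_cong) simp
 then show ?thesis using phi_0 by (simp only: phi_def)
qed

text \<open>For the converse direction, the value of a graded symmetric function on an arbitrary word is read off from the subwords of letters of the two kinds; \<open>Nq\<close> is the sign exponent of the sorting.\<close>

fun Nq :: "(int \<times> bool \<times> 'v) list => int"
 where
  "Nq [] = 0"
 | "Nq (x # w) = (if fst (snd x) then 0 else fst x * wd (filter (%z. fst (snd z)) w)) + Nq w"

abbreviation "Pw w \<equiv> map (%z. snd (snd z)) (filter (%z. fst (snd z)) w)"
abbreviation "Qw w \<equiv> map (%z. snd (snd z)) (filter (%z. \<not> fst (snd z)) w)"

text \<open>Graded symmetry of functions is a condition on adjacent letters, whereas symmetry of maps is a condition on permutations; adjacent transpositions connect the two.\<close>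
lemma transpose_adjacent:
 defines "s \<equiv> %i j. if j = i then Suc i else if j = Suc i then i else j"
 shows "s (length u) permutes {..<length (u @ y # z # v)}"
  "permute_list (s (length u)) (u @ y # z # v) = u @ z # y # v"
  "kap q (u @ y # z # v) (s (length u)) = q z y"
proof -
 let ?s = "s (length u)" and ?n = "length (u @ y # z # v)"
 have inv: "?s (?s j) = j" for j by (simp add: s_def)
 have out: "?s j = j" if "j \<notin> {..<?n}" for j using that by (auto simp: s_def)
 show perm: "?s permutes {..<?n}"
  unfolding permutes_def using inv out by metis
 show "permute_list ?s (u @ y # z # v) = u @ z # y # v"
 proof (rule nth_equalityI)
  fix i assume "i < length (permute_list ?s (u @ y # z # v))"
  then have i: "i < ?n" by simp
  consider "i < length u" | "i = length u" | "i = Suc (length u)" | k where "i = length u + Suc (Suc k)"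
   by (metis add_Suc_right less_iff_Suc_add less_antisym linorder_less_linear not_less_eq)
  then show "permute_list ?s (u @ y # z # v) ! i = (u @ z # y # v) ! i"
   unfolding permute_list_nth[OF perm i] by cases (simp_all add: s_def nth_append)
 qed simp
 have "Inv ?n ?s = {(length u, Suc (length u))}"
  by (auto simp: Inv_def s_def split: if_splits)
 then show "kap q (u @ y # z # v) ?s = q z y" by (simp add: kap_def s_def nth_append)
qed

definition mkf :: "nat => (nat => nat => ('k, 'v) tmap) => ('v, 'k) pqfun"
 where "mkf N p = Sfun (%w. if set w \<subseteq> LPQ & length w \<le> N
  then ksgn (Nq w) * (E (Pw w) (Qw w) * mc (p (length (Pw w)) (length (Qw w))) (Pw w) (Qw w)) else 0)"

lemma co_mkf: "co (mkf N p) w = (if set w \<subseteq> LPQ & length w \<le> N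
  then ksgn (Nq w) * (E (Pw w) (Qw w) * mc (p (length (Pw w)) (length (Qw w))) (Pw w) (Qw w)) else 0)"
 by (simp add: mkf_def Sfun_inverse)

lemma Nq_append: "Nq (u @ v) = Nq u + Nq v + wd (filter (%z. \<not> fst (snd z)) u) * wd (filter (%z. fst (snd z)) v)"
 by (induction u) (simp_all add: algebra_simps)

lemma Pw_words: "set w \<subseteq> LPQ ==> set (Pw w) \<subseteq> B" and Qw_words: "set w \<subseteq> LPQ ==> set (Qw w) \<subseteq> B"
 by (auto simp: LPQ_def)

lemma mkf_symset:
 assumes p: "\<And>m l. p m l \<in> sym_hom g 2 (m, l) (pdeg 2 (m, l))"
 shows "mkf N p \<in> symset LPQ"
proof -
 have "symf (mkf N p)"
  unfolding symf_def
 proof (intro allI)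
  fix u v :: "(int \<times> bool \<times> 'v) list" and y z :: "int \<times> bool \<times> 'v"
  let ?w = "u @ y # z # v" and ?w' = "u @ z # y # v"
  show "co (mkf N p) ?w = ksgn (fst y * fst z) * co (mkf N p) ?w'"
  proof (cases "set ?w \<subseteq> LPQ & length ?w \<le> N")
   case False
   then show ?thesis by (auto simp: co_mkf)
  next
   case True
   then have w: "set ?w \<subseteq> LPQ" and w': "set ?w' \<subseteq> LPQ" by auto
   have B: "set (Pw ?w) \<subseteq> B" "set (Qw ?w) \<subseteq> B" "set (Pw ?w') \<subseteq> B" "set (Qw ?w') \<subseteq> B"
    using Pw_words Qw_words w w' by blast+
   have yz: "y \<in> LPQ" "z \<in> LPQ" using w by auto
   let ?c = "%w. E (Pw w) (Qw w) * mc (p (length (Pw w)) (length (Qw w))) (Pw w) (Qw w)"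
   have "ksgn (Nq ?w) * ?c ?w = ksgn (fst y * fst z) * (ksgn (Nq ?w') * ?c ?w')"
   proof (cases "fst (snd y) = fst (snd z)")
    case False
    then have c: "Pw ?w = Pw ?w'" "Qw ?w = Qw ?w'" by auto
    have "Nq (y # z # v) = Nq (z # y # v) + fst y * fst z \<or> Nq (y # z # v) = Nq (z # y # v) - fst y * fst z"
     using False by (cases "fst (snd y)") (simp_all add: algebra_simps)
    moreover have "wd (filter (%z. fst (snd z)) (y # z # v)) = wd (filter (%z. fst (snd z)) (z # y # v))" by simp
    ultimately have N: "Nq ?w = Nq ?w' + fst y * fst z \<or> Nq ?w = Nq ?w' - fst y * fst z"
     unfolding Nq_append[of u "y # z # v"] Nq_append[of u "z # y # v"] by presburger
    have "ksgn (Nq ?w) = (ksgn (fst y * fst z + Nq ?w') :: 'k)"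
     by (rule ksgn_cong) (use N in \<open>elim disjE; simp\<close>)
    then show ?thesis unfolding c by (simp only: ksgn_add mult.assoc)
   next
    case same: True
    have N: "Nq ?w = Nq ?w'" using same by (auto simp: Nq_append algebra_simps)
    show ?thesis
    proof (cases "fst (snd y)")
     case True
     then obtain e e' where e: "y = Pe e" "z = Pe e'" using yz same by (auto simp: LPQ_def)
     define u' v' where "u' = Pw u" and "v' = Pw v"
     have P: "Pw ?w = u' @ e # e' # v'" "Pw ?w' = u' @ e' # e # v'" "Qw ?w' = Qw ?w" using e by (simp_all add: u'_def v'_def)
     obtain s where s: "s permutes {..<length (u' @ e # e' # v')}" "permute_list s (u' @ e # e' # v') = u' @ e' # e # v'"
      "\<And>q. kap q (u' @ e # e' # v') s = q e' e" using transpose_adjacent[where u = u' and y = e and z = e' and v = v'] by blast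
     have "mc (p (length (Pw ?w)) (length (Qw ?w))) (permute_list s (Pw ?w)) (Qw ?w) =
       koszul (map dg (Pw ?w)) s * mc (p (length (Pw ?w)) (length (Qw ?w))) (Pw ?w) (Qw ?w)"
      using p[unfolded sym_hom_iff] s(1) words_W[OF B(1)] words_W[OF B(2)] unfolding P(1) by blast
     moreover have "koszul (map dg (Pw ?w)) s = (ksgn (fst y * fst z) :: 'k)"
      unfolding P(1) koszul_kap kap_map[OF s(1)] s(3) by (rule ksgn_cong) (auto simp: e)
     moreover have "E (Pw ?w') (Qw ?w') = E (Pw ?w) (Qw ?w)" unfolding P E_def by (simp add: algebra_simps)
     ultimately show ?thesis unfolding N P s(2) by (simp add: mult_ac)
    next
     case False
     then obtain e e' where e: "y = Qe e" "z = Qe e'" using yz same by (auto simp: LPQ_def)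
     define u' v' where "u' = Qw u" and "v' = Qw v"
     have P: "Qw ?w = u' @ e # e' # v'" "Qw ?w' = u' @ e' # e # v'" "Pw ?w' = Pw ?w" using e by (simp_all add: u'_def v'_def)
     obtain s where s: "s permutes {..<length (u' @ e # e' # v')}" "permute_list s (u' @ e # e' # v') = u' @ e' # e # v'"
      "\<And>q. kap q (u' @ e # e' # v') s = q e' e" using transpose_adjacent[where u = u' and y = e and z = e' and v = v'] by blast
     let ?M = "mc (p (length (Pw ?w)) (length (u' @ e # e' # v')))  (Pw ?w)"
     have "?M (permute_list s (u' @ e # e' # v')) =
       permsgn s * koszul (map dg (u' @ e # e' # v')) s * ?M (u' @ e # e' # v')"
      using p[unfolded sym_hom_iff] s(1) words_W[OF B(1)] words_W[OF B(2)] unfolding P(1) by blast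
     then have M: "?M (u' @ e' # e # v') = permsgn s * koszul (map dg (u' @ e # e' # v')) s * ?M (u' @ e # e' # v')"
      unfolding s(2) .
     have X: "ksgn (Xs (u' @ e' # e # v')) * ksgn (fst y * fst z) = permsgn s * koszul (map dg (u' @ e # e' # v')) s * (ksgn (Xs (u' @ e # e' # v')) :: 'k)"
      using decalage_sign[OF s(1)] unfolding s(2,3) by (simp add: e mult_ac)
     let ?pk = "permsgn s * koszul (map dg (u' @ e # e' # v')) s :: 'k"
     have pk: "?pk * ?pk = 1" by (cases s rule: sign_cases) (simp_all add: permsgn_def koszul_def mult_ac)
     have "ksgn (fst y * fst z) * (ksgn (Xs (u' @ e' # e # v')) * ?M (u' @ e' # e # v')) =
       (?pk * ?pk) * (ksgn (Xs (u' @ e # e' # v')) * ?M (u' @ e # e' # v'))"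
     proof -
      have arr: "q * (x' * (pk * M)) = pk * pk * (x * M)" if h: "x' * q = pk * x" for q x' pk x M :: 'k
      proof -
       have "q * (x' * (pk * M)) = (x' * q) * (pk * M)" by (simp only: mult_ac)
       then show ?thesis unfolding h by (simp only: mult_ac)
      qed
      show ?thesis unfolding M by (rule arr[OF X])
     qed
     then have "ksgn (fst y * fst z) * (ksgn (Xs (u' @ e' # e # v')) * ?M (u' @ e' # e # v')) =
       ksgn (Xs (u' @ e # e' # v')) * ?M (u' @ e # e' # v')" unfolding pk by simp
     then show ?thesis unfolding N P E_def by (simp add: mult_ac)
    qed
   qed
   then show ?thesis using True w' by (simp add: co_mkf)
  qed
 qed
 then show ?thesis unfolding symset_def by (auto simp: co_mkf split: if_splits)
qed

lemma mkf_degrees: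
 assumes p: "\<And>m l. p m l \<in> sym_hom g 2 (m, l) (pdeg 2 (m, l))"
 shows "hom 4 (mkf N p)" and "(\<And>m l. m ~= k ==> p m l = 0) ==> homg wt (int k) (mkf N p)"
proof -
 have wd: "wd w = sdg (Pw w) + 2 * int (length (Pw w)) + int (length (Qw w)) - sdg (Qw w)" if "set w \<subseteq> LPQ" for w
  using that by (induction w) (auto simp: LPQ_def)
 have wtw: "sum_list (map wt w) = int (length (Pw w))" for w :: "(int \<times> bool \<times> 'v) list"
  by (induction w) auto
 show "hom 4 (mkf N p)"
  unfolding homg_def
 proof (intro allI impI)
  fix w assume "co (mkf N p) w ~= 0"
  then have w: "set w \<subseteq> LPQ" and nz: "mc (p (length (Pw w)) (length (Qw w))) (Pw w) (Qw w) ~= 0" by (auto simp: co_mkf split: if_splits)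
  have "sdg (Pw w) = sdg (Qw w) + pdeg 2 (length (Pw w), length (Qw w))"
   using p[of "length (Pw w)" "length (Qw w)", unfolded sym_hom_iff homdeg_def] nz words_W[OF Pw_words[OF w]] words_W[OF Qw_words[OF w]]
   by blast
  then show "wd w = 4" unfolding wd[OF w] by (simp add: pdeg_def)
 qed
 assume z: "\<And>m l. m ~= k ==> p m l = 0"
 show "homg wt (int k) (mkf N p)"
  unfolding homg_def
 proof (intro allI impI)
  fix w assume "co (mkf N p) w ~= 0"
  then have "mc (p (length (Pw w)) (length (Qw w))) (Pw w) (Qw w) ~= 0" by (auto simp: co_mkf split: if_splits)
  moreover have "mc 0 c d = 0" for c d by (simp add: mc_def)
  ultimately have "length (Pw w) = k" using z[of "length (Pw w)" "length (Qw w)"] by metis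
  then show "sum_list (map wt w) = int k" unfolding wtw by simp
 qed
qed

lemma phi_mkf:
 assumes p: "\<And>m l. p m l \<in> sym_hom g 2 (m, l) (pdeg 2 (m, l))" and ml: "m + l \<le> N"
 shows "phi (mkf N p) m l = p m l"
proof (rule tl_eqI[of l m])
 show "tl l m (p m l)" using p by (simp add: sym_hom_iff)
 fix a b assume a: "a \<in> words B m" and b: "b \<in> words B l"
 have N: "Nq (map Qe b) = 0" by (induction b) (simp_all add: filter_map o_def)
 have N2: "Nq (W a b) = 0" unfolding W_def Nq_append N by (induction a) (simp_all add: filter_map o_def)
 have PQ: "Pw (W a b) = a" "Qw (W a b) = b" by (simp_all add: W_def filter_map o_def)
 have "set (W a b) \<subseteq> LPQ" "length (W a b) \<le> N" using a b ml by (auto simp: W_def LPQ_def words_def)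
 then have "co (mkf N p) (W a b) = E a b * mc (p m l) a b"
  unfolding co_mkf N2 PQ using a b by (simp add: words_def)
 then show "mc (phi (mkf N p) m l) a b = mc (p m l) a b" by (simp add: mc_phi[OF a b])
qed simp

end

context two_term_basis
begin

section \<open>The isomorphism Phi\<close>

lemma sum_rotate: "(\<Sum>s\<in>S. \<Sum>r\<in>R. \<Sum>b\<in>K. h s r b) = (\<Sum>b\<in>K. \<Sum>s\<in>S. \<Sum>r\<in>R. h s r b)" for h :: "_ => _ => _ => 'k"
proof -
 have "(\<Sum>s\<in>S. \<Sum>r\<in>R. \<Sum>b\<in>K. h s r b) = (\<Sum>s\<in>S. \<Sum>b\<in>K. \<Sum>r\<in>R. h s r b)"
  by (intro sum.cong refl sum.swap)
 then show ?thesis by (simp only: sum.swap[of "%s b. \<Sum>r\<in>R. h s r b" K S])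
qed

definition lP :: "'v => ('v, 'k) pqfun"
 where "lP x = lin (%z. if z \<in> Pe ` B then crd (snd (snd z)) x else 0)"

lemma lP_sum: "(\<Sum>e\<in>B. cst (crd e x) * gen (Pe e)) = lP x"
proof (rule sfun_eqI)
 fix w
 show "co (\<Sum>e\<in>B. cst (crd e x) * gen (Pe e)) w = co (lP x) w"
 proof (cases "length w = 1")
  case True
  then obtain z where w: "w = [z]" by (cases w) auto
  have "(\<Sum>e\<in>B. crd e x * (if z = Pe e then 1 else 0)) = (if z \<in> Pe ` B then crd (snd (snd z)) x else 0)"
  proof (cases "z \<in> Pe ` B")
   case True
   then obtain e0 where "e0 \<in> B" "z = Pe e0" by auto
   then show ?thesis using finite_B by (simp add: if_distrib cong: if_cong)
  next
   case False
   then show ?thesis by (auto intro!: sum.neutral)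
  qed
  then show ?thesis by (simp add: w lP_def)
 next
  case False
  then show ?thesis by (simp add: lP_def co_lin)
 qed
qed

lemma lP_emb: assumes x: "x \<in> part g i" shows "emb (i + 2) (svec g i x) = lP x"
proof -
 have "emb (i + 2) (svec g i x) = (\<Sum>e\<in>B. cst (crd e x) * gen (Pe e))"
  unfolding emb_def
 proof (intro sum.cong refl)
  fix e assume e: "e \<in> B"
  have "ksgn (i + 2 + dg e) * crd e x = crd e x"
   using crd_part[OF x e] by (cases "crd e x = 0") (simp_all add: ksgn_def)
  then show "cst (ksgn (i + 2 + dg e)) * (cof (svec g i x) e * gen (Pe e)) = cst (crd e x) * gen (Pe e)"
   by (simp only: svec_model(3)[OF x e] mult.assoc[symmetric] cst_mult[symmetric])
 qed
 then show ?thesis unfolding lP_sum .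
qed

lemma lP_basis: assumes e: "e \<in> B" shows "lP e = gen (Pe e)"
proof -
 have "(%z. if z \<in> Pe ` B then crd (snd (snd z)) e else 0) = (%z. if z = Pe e then 1 else 0)"
 proof (rule ext)
  fix z
  show "(if z \<in> Pe ` B then crd (snd (snd z)) e else 0) = (if z = Pe e then 1 else 0)"
  proof (cases "z \<in> Pe ` B")
   case True
   then obtain x where "x \<in> B" "z = Pe x" by blast
   then show ?thesis using e by (simp add: crd_basis)
  next
   case False
   then show ?thesis using e by auto
  qed
 qed
 then show ?thesis by (simp add: lP_def)
qed

lemma pol_monomial_model:
 assumes xs: "homog g ds xs" and \<theta>s: "list_all2 (%j \<theta>. \<theta> \<in> mpart (dual g) j) es \<theta>s"
 shows "pol_monomial g 2 ds xs es \<theta>s \<in> carrier DP"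
  "Ps (pol_monomial g 2 ds xs es \<theta>s) = prod_list (map lP xs) * prod_list (map lQ \<theta>s)"
proof -
 have fold: "foldr (monoid.mult DP) Ys \<one>\<^bsub>DP\<^esub> \<in> carrier DP & Ps (foldr (monoid.mult DP) Ys \<one>\<^bsub>DP\<^esub>) = prod_list (map Ps Ys)"
  if "set Ys \<subseteq> carrier DP" for Ys using that by (induction Ys) auto
 let ?X = "map2 (%i x. sym_gen DA PM (i + 2) (svec g i x)) ds xs"
 let ?T = "map2 (%j \<theta>. sym_coef DA PM (j + 1) (sdual g j \<theta>)) es \<theta>s"
 have X: "set ?X \<subseteq> carrier DP & map Ps ?X = map lP xs"
  using xs unfolding homog_def
 proof (induction ds xs rule: list_all2_induct)
  case (Cons i ds x xs)
  have "svec g i x \<in> der DA (i + 2 - 3)" using svec_model(2)[OF Cons(1)] by (simp add: algebra_simps)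
  then show ?case using Cons gen_carrier[of "svec g i x" "i + 2"] by (simp add: Ps_gen lP_emb)
 qed simp
 have T: "set ?T \<subseteq> carrier DP & map Ps ?T = map lQ \<theta>s"
  using \<theta>s
 proof (induction es \<theta>s rule: list_all2_induct)
  case (Cons j es \<theta> \<theta>s)
  then show ?case using sdual_model[OF Cons(1)] coef_carrier[of "sdual g j \<theta>" "j + 1"] by (simp add: Ps_coef)
 qed simp
 have "set (?X @ ?T) \<subseteq> carrier DP" using X T by simp
 from fold[OF this] show "pol_monomial g 2 ds xs es \<theta>s \<in> carrier DP"
  "Ps (pol_monomial g 2 ds xs es \<theta>s) = prod_list (map lP xs) * prod_list (map lQ \<theta>s)"
  using X T by (simp_all add: pol_monomial_def Let_def)
qed

text \<open>A letter can only be absorbed by the factor that depends on letters of its kind, so one decomposition of the word contributes.\<close>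
lemma co_mult_PQ:
 assumes "F \<in> symset (Pe ` B)" "H \<in> symset LQ"
 shows "co (F * H) (W a b) = co F (map Pe a) * co H (map Qe b)"
proof -
 have DF: "Dl (Qe e) F = 0" if F: "F \<in> symset (Pe ` B)" for e F
 proof (rule sfun_eqI)
  fix w
  have "\<not> set (Qe e # w) \<subseteq> Pe ` B" by auto
  then show "co (Dl (Qe e) F) w = co 0 w" using symset_supp[OF F, of "Qe e # w"] by auto
 qed
 have base: "co (F * H) (map Qe b) = co F [] * co H (map Qe b)" if "F \<in> symset (Pe ` B)" "H \<in> symset LQ" for F H
  using that
 proof (induction b arbitrary: F H)
  case (Cons e b)
  have "co (F * H) (map Qe (e # b)) = co (Dl (Qe e) (F * H)) (map Qe b)" by simp
  also have "\<dots> = co (tw (fst (Qe e)) F * Dl (Qe e) H) (map Qe b)" unfolding Dl_mult DF[OF Cons.prems(1)] by simp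
  also have "\<dots> = co F [] * co H (map Qe (e # b))"
   unfolding Cons.IH[OF symset_tw[OF Cons.prems(1)] symset_Dl[OF Cons.prems(2)]] by simp
  finally show ?case .
 qed simp
 show ?thesis
  using assms
 proof (induction a arbitrary: F)
  case Nil
  then show ?case using base by (simp add: W_def)
 next
  case (Cons e a)
  have "co (F * H) (W (e # a) b) = co (Dl (Pe e) (F * H)) (W a b)" by (simp add: W_def)
  also have "\<dots> = co (Dl (Pe e) F * H) (W a b)" unfolding Dl_mult Dl_Pe_LQ[OF Cons.prems(2)] by simp
  also have "\<dots> = co F (map Pe (e # a)) * co H (map Qe b)"
   unfolding Cons.IH[OF symset_Dl[OF Cons.prems(1)] Cons.prems(2)] by simp
  finally show ?case .
 qed
qed

lemma prod_symset: "(\<And>f. f \<in> set fs ==> f \<in> symset L) ==> prod_list fs \<in> symset L"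
 by (induction fs) (auto intro: symset_mult)

subsection \<open>The signs\<close>

fun Ys :: "'v list => int"
 where "Ys [] = 0" | "Ys (e # b) = dg e * sdg b + Ys b"

lemma Ys_mset: assumes "mset b = mset c" shows "Ys b = Ys c"
proof -
 have Y: "2 * Ys d = (sdg d)\<^sup>2 - (\<Sum>e\<leftarrow>d. (dg e)\<^sup>2)" for d
  by (induction d) (simp_all add: power2_eq_square algebra_simps)
 have sums: "(\<Sum>e\<leftarrow>b. f e) = (\<Sum>e\<leftarrow>c. f e)" for f :: "'v => int"
 proof -
  have "sum_mset (image_mset f (mset b)) = sum_mset (image_mset f (mset c))" using assms by simp
  then show ?thesis unfolding mset_map[symmetric] sum_mset_sum_list .
 qed
 have "sdg b = sdg c" "(\<Sum>e\<leftarrow>b. (dg e)\<^sup>2) = (\<Sum>e\<leftarrow>c. (dg e)\<^sup>2)"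
  by (rule sums)+
 then show ?thesis using Y[of b] Y[of c] by simp
qed

lemma koszul_rev: "koszul (map dg b) (%i. length b - 1 - i) = ksgn (Ys b)"
proof -
 define rv where "rv k i = (if i < k then k - 1 - i else i)" for k i :: nat
 have rv_Suc: "rv (Suc k) = ins k (rv k)" for k by (auto simp: rv_def ins_def fun_eq_iff)
 have perm: "rv k permutes {..<k}" for k
 proof (induction k)
  case 0
  then show ?case by (simp add: rv_def permutes_def)
 next
  case (Suc k)
  then show ?case unfolding rv_Suc by (intro ins_permutes) simp_all
 qed
 have "kap (*) (map dg b) (%i. length b - 1 - i) = kap (*) (map dg b) (rv (length b))"
  unfolding kap_def by (intro sum.cong) (auto simp: Inv_def rv_def)
 also have "kap (*) (map dg b) (rv (length b)) = Ys b"
 proof (induction b)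
  case (Cons e b)
  have p: "rv (length b) permutes {..<length (map dg b)}" using perm by simp
  have "sum_list (permute_list (rv (length b)) (map dg b)) = sdg b"
   by (metis mset_permute_list p sum_mset_sum_list)
  moreover have "(\<Sum>y\<leftarrow>c. y * dg e) = dg e * sum_list c" for c by (induction c) (simp_all add: algebra_simps)
  ultimately show ?case using Cons kap_ins[OF p, of "length b" "(*)" "dg e"]
   by (simp add: rv_Suc)
 qed simp
 finally show ?thesis by (simp add: koszul_kap)
qed

lemma Xs_Ys: "Xs c = (\<Sum>j<length c. dg (c ! j) * (int (length c) - (int j + 1))) + Ys c"
proof (induction c)
 case (Cons e c)
 show ?case unfolding length_Cons sum.lessThan_Suc_shift using Cons by (simp add: algebra_simps)
qed simp

text \<open>The signs in the definition of \<open>\<Phi>\<close> on monomials combine to \<open>E\<close> and the Koszul sign of the shifted forms.\<close>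
lemma monomial_sign:
 assumes s: "s permutes {..<length es}" and lb: "length b = length es"
  and dg: "\<And>j. j < length es ==> dg (b ! j) = - (es ! s j)"
 shows "ksgn (\<Sum>j<length es. es ! j * (int (length es) - (int j + 1))) * (koszul es s * permsgn s) *
  koszul (map dg b) (%i. length es - 1 - i) = (ksgn (Xs b) * ksgn (kap (*) (map (%j. j + 1) es) s) :: 'k)"
proof -
 define c where "c = permute_list (inv_into UNIV s) b"
 have lc: "length c = length es" by (simp add: c_def lb)
 have sc: "s permutes {..<length c}" using s lc by simp
 have b: "permute_list s c = b"
  using permute_list_compose[of s b "inv_into UNIV s"] s lb by (simp add: c_def permutes_inv_o(2))
 have es: "es = map (%e. - dg e) c"
 proof (rule nth_equalityI)
  fix i assume i: "i < length es"
  have j: "inv_into UNIV s i < length es" using permutes_inv[OF s] i by (simp add: permutes_lt)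
  have "c ! i = b ! inv_into UNIV s i" using i lb permutes_inv[OF s] by (simp add: c_def permute_list_nth)
  then show "es ! i = map (%e. - dg e) c ! i" using dg[OF j] i lc by (simp add: permutes_inverses(1)[OF s])
 qed (simp add: lc)
 have k: "koszul es s = (koszul (map dg c) s :: 'k)" using sc by (simp add: es koszul_kap kap_map)
 have k': "kap (*) (map (%j. j + 1) es) s = kap (%x y. fst (Qe x) * fst (Qe y)) c s"
  using sc by (simp add: es kap_map o_def)
 have "mset b = mset c" using b sc by (metis mset_permute_list)
 then have Y: "Ys b = Ys c" by (rule Ys_mset)
 have Z: "(\<Sum>j<length es. es ! j * (int (length es) - (int j + 1))) = - (Xs c - Ys c)"
  unfolding Xs_Ys by (simp add: es sum_negf[symmetric])
 have X: "ksgn (- (Xs c - Ys c)) * ksgn (Ys c) = (ksgn (Xs c) :: 'k)"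
  unfolding ksgn_add[symmetric] by (rule ksgn_cong) simp
 have "ksgn (\<Sum>j<length es. es ! j * (int (length es) - (int j + 1))) * (koszul es s * permsgn s) *
   koszul (map dg b) (%i. length es - 1 - i) = permsgn s * koszul (map dg c) s * (ksgn (- (Xs c - Ys c)) * ksgn (Ys c) :: 'k)"
  unfolding Z k unfolding lb[symmetric] koszul_rev Y by (simp only: mult_ac)
 also have "\<dots> = ksgn (Xs b) * ksgn (kap (*) (map (%j. j + 1) es) s)"
  unfolding X k' decalage_sign[OF sc, symmetric] b ..
 finally show ?thesis .
qed

lemma monomial_map_mc:
 assumes xs: "homog g ds xs" and \<theta>s: "list_all2 (%j \<theta>. \<theta> \<in> mpart (dual g) j) es \<theta>s"
 shows "tl (length \<theta>s) (length xs) (monomial_map g 2 ds xs es \<theta>s)"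
  "a \<in> words B (length xs) ==> b \<in> words B (length \<theta>s) ==> mc (monomial_map g 2 ds xs es \<theta>s) a b =
   (\<Sum>s | s permutes {..<length \<theta>s}. \<Sum>r | r permutes {..<length xs}. koszul ds r * (koszul es s * permsgn s) *
    koszul (map dg b) (%i. length \<theta>s - 1 - i) * (\<Prod>j<length \<theta>s. (\<theta>s ! s j) (b ! j)) * (\<Prod>i<length xs. crd (a ! i) (xs ! r i)))"
proof -
 let ?l = "length \<theta>s" and ?m = "length xs"
 define F where "F = (%fs ys. \<Sum>s | s permutes {..<?l}. \<Sum>r | r permutes {..<?m}.
   tscale (koszul ds r * permsgn_shift 2 r * (koszul es s * permsgn s) * koszul fs (%i. ?l - 1 - i) *
     (\<Prod>j<?l. (\<theta>s ! s j) (ys ! j))) (tp (permute_list r xs)))"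
 have lin: "lin_form \<theta>" if "\<theta> \<in> set \<theta>s" for \<theta>
 proof -
  from that obtain i where i: "i < length \<theta>s & \<theta>s ! i = \<theta>" unfolding in_set_conv_nth ..
  have "\<theta>s ! i \<in> mpart (dual g) (es ! i)" by (rule list_all2_nthD2[OF \<theta>s conjunct1[OF i]])
  then have "\<theta> \<in> mpart (dual g) (es ! i)" unfolding conjunct2[OF i] .
  then show ?thesis unfolding dual_part by (rule conjunct1)
 qed
 have mm: "monomial_map g 2 ds xs es \<theta>s = tlift g ?l F" by (simp add: monomial_map_def F_def Let_def)
 have exp: "F fs ys = (\<Sum>b\<in>words B ?l. tscale (pairing (crds b) ys) (F fs b))" if ys: "length ys = ?l" for fs ys
 proof -
  have pr: "(\<Prod>j<?l. (\<theta>s ! s j) (ys ! j)) = (\<Sum>b\<in>words B ?l. pairing (crds b) ys * (\<Prod>j<?l. (\<theta>s ! s j) (b ! j)))"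
   if s: "s permutes {..<?l}" for s
  proof -
   have nth: "permute_list s \<theta>s ! j = \<theta>s ! s j" if "j < ?l" for j using s that by (simp add: permute_list_nth)
   have "pairing (permute_list s \<theta>s) ys = (\<Sum>b\<in>words B ?l. pairing (crds b) ys * pairing (permute_list s \<theta>s) b)"
    using pairing_expand[of "permute_list s \<theta>s" ys] ys lin s by simp
   moreover have "pairing (permute_list s \<theta>s) zs = (\<Prod>j<?l. (\<theta>s ! s j) (zs ! j))" if "length zs = ?l" for zs
    unfolding that by (intro prod.cong refl) (simp add: nth)
   ultimately show ?thesis using ys by (simp add: words_def)
  qed
  show ?thesis
  proof (rule ext)
   fix \<eta>s
   have "F fs ys \<eta>s = (\<Sum>s | s permutes {..<?l}. \<Sum>r | r permutes {..<?m}. \<Sum>b\<in>words B ?l. pairing (crds b) ys *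
     (koszul ds r * permsgn_shift 2 r * (koszul es s * permsgn s) * koszul fs (%i. ?l - 1 - i) *
     (\<Prod>j<?l. (\<theta>s ! s j) (b ! j)) * tp (permute_list r xs) \<eta>s))"
    unfolding F_def fun_sum_apply tscale_apply
    by (intro sum.cong refl) (simp only: pr mem_Collect_eq sum_distrib_left sum_distrib_right mult_ac)
   also have "\<dots> = (\<Sum>b\<in>words B ?l. \<Sum>s | s permutes {..<?l}. \<Sum>r | r permutes {..<?m}. pairing (crds b) ys *
     (koszul ds r * permsgn_shift 2 r * (koszul es s * permsgn s) * koszul fs (%i. ?l - 1 - i) *
     (\<Prod>j<?l. (\<theta>s ! s j) (b ! j)) * tp (permute_list r xs) \<eta>s))"
    by (rule sum_rotate)
   also have "\<dots> = (\<Sum>b\<in>words B ?l. tscale (pairing (crds b) ys) (F fs b)) \<eta>s"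
    unfolding F_def fun_sum_apply tscale_apply sum_distrib_left ..
   finally show "F fs ys \<eta>s = (\<Sum>b\<in>words B ?l. tscale (pairing (crds b) ys) (F fs b)) \<eta>s" .
  qed
 qed
 have pow: "F fs b \<in> tpow g ?m" for fs b
  unfolding F_def by (intro tpow_sum tpow_closed(3) tpow_tp) simp
 have T: "tl ?l ?m (tlift g ?l F)" by (rule tlift_tl(1)) (simp_all add: exp pow)
 have Tb: "tlift g ?l F (tp b) = F (map dg b) b" if "b \<in> words B ?l" for b
  by (rule tlift_tl(2)[where m = ?m, OF _ _ that]) (simp_all add: exp pow)
 show "tl ?l ?m (monomial_map g 2 ds xs es \<theta>s)" unfolding mm by (rule T)
 assume a: "a \<in> words B ?m" and b: "b \<in> words B ?l"
 have pa: "tp (permute_list r xs) (crds a) = (\<Prod>i<?m. crd (a ! i) (xs ! r i))" if r: "r permutes {..<?m}" for r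
 proof -
  have "tp (permute_list r xs) (crds a) = pairing (crds a) (permute_list r xs)"
   using a crd_linear by (intro tp_apply) (auto simp: words_def)
  also have "\<dots> = (\<Prod>i<?m. crd (a ! i) (xs ! r i))"
   unfolding length_permute_list using a r by (intro prod.cong refl) (simp add: permute_list_nth words_def)
  finally show ?thesis .
 qed
 have ps: "permsgn_shift 2 r = (1 :: 'k)" for r by (simp add: permsgn_shift_def)
 show "mc (monomial_map g 2 ds xs es \<theta>s) a b =
   (\<Sum>s | s permutes {..<length \<theta>s}. \<Sum>r | r permutes {..<length xs}. koszul ds r * (koszul es s * permsgn s) *
    koszul (map dg b) (%i. length \<theta>s - 1 - i) * (\<Prod>j<length \<theta>s. (\<theta>s ! s j) (b ! j)) * (\<Prod>i<length xs. crd (a ! i) (xs ! r i)))"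
  unfolding mc_def mm Tb[OF b] unfolding F_def fun_sum_apply tscale_apply
  by (intro sum.cong refl) (simp only: pa ps mem_Collect_eq mult_1_right)
qed

lemma phi_monomial:
 assumes xs: "homog g ds xs" and \<theta>s: "list_all2 (%j \<theta>. \<theta> \<in> mpart (dual g) j) es \<theta>s"
 shows "phi (prod_list (map lP xs) * prod_list (map lQ \<theta>s)) m l t =
  (if m = length xs & l = length \<theta>s then tscale (monomial_sgn 2 ds es) (monomial_map g 2 ds xs es \<theta>s t) else 0)"
proof -
 define cP where "cP x = (%z :: int \<times> bool \<times> 'v. if z \<in> Pe ` B then crd (snd (snd z)) x else 0)" for x
 define cQ where "cQ \<theta> = (%z :: int \<times> bool \<times> 'v. if z \<in> LQ then (\<theta> (snd (snd z)) :: 'k) else 0)" for \<theta>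
 let ?F = "prod_list (map lP xs)" and ?H = "prod_list (map lQ \<theta>s)"
 have lds: "length ds = length xs" and les: "length es = length \<theta>s"
  using xs \<theta>s by (simp_all add: homog_def list_all2_lengthD)
 have "lP = (%x. lin (cP x))" "lQ = (%\<theta>. lin (cQ \<theta>))" by (simp_all add: lP_def cP_def lQ_def cQ_def fun_eq_iff)
 then have FH: "?F = prod_list (map lin (map cP xs))" "?H = prod_list (map lin (map cQ \<theta>s))" by (simp_all add: o_def)
 have dcP: "fst z = i + 2" if x: "x \<in> part g i" and z: "cP x z ~= 0" for i x z
 proof -
  have "z \<in> Pe ` B" "crd (snd (snd z)) x ~= 0" using z by (simp_all add: cP_def split: if_splits)
  then obtain e where "e \<in> B" "z = Pe e" "crd e x ~= 0" by auto
  then show ?thesis using crd_part[OF x] by simp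
 qed
 have dP: "list_all2 (%d c. \<forall>z. c z ~= 0 --> fst z = d) (map (%i. i + 2) ds) (map cP xs)"
  using xs unfolding homog_def list_all2_map1 list_all2_map2
  by (rule list_all2_mono) (use dcP in blast)
 have dcQ: "fst z = j + 1" if t: "\<theta> \<in> mpart (dual g) j" and z: "cQ \<theta> z ~= 0" for j \<theta> z
 proof -
  have "z \<in> Qe ` B" "\<theta> (snd (snd z)) ~= 0" using z by (simp_all add: cQ_def LQ_def split: if_splits)
  then obtain e where "e \<in> B" "z = Qe e" "\<theta> e ~= 0" by auto
  then show ?thesis using dual_degree[OF t] by simp
 qed
 have dQ: "list_all2 (%d c. \<forall>z. c z ~= 0 --> fst z = d) (map (%j. j + 1) es) (map cQ \<theta>s)"
  using \<theta>s unfolding list_all2_map1 list_all2_map2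
  by (rule list_all2_mono) (use dcQ in blast)
 have sets: "?F \<in> symset (Pe ` B)" "?H \<in> symset LQ"
  by (auto intro!: prod_symset symset_lin lQ_symset simp: lP_def split: if_splits)
 have cF: "co ?F (map Pe a) = (if m = length xs then \<Sum>r | r permutes {..<m}. koszul ds r * (\<Prod>i<m. crd (a ! i) (xs ! r i)) else 0)"
  if a: "a \<in> words B m" for a m
 proof -
  have "ksgn (kap (*) (map (%i. i + 2) ds) r) = (koszul ds r :: 'k)" if r: "r permutes {..<length xs}" for r
  proof -
   have "(%x y. (x + 2) * (y + 2)) = (%x y :: int. x * y + 2 * (x + y + 2))" by (auto simp: fun_eq_iff algebra_simps)
   moreover have "kap (%x y. 2 * (x + y + 2)) ds r = 2 * kap (%x y. x + y + 2) ds r"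
    by (simp add: kap_def sum_distrib_left case_prod_unfold)
   ultimately have "kap (*) (map (%i. i + 2) ds) r = kap (*) ds r + 2 * kap (%x y. x + y + 2) ds r"
    using r lds by (simp add: kap_map kap_add)
   then show ?thesis unfolding koszul_kap by (intro ksgn_cong) simp
  qed
  moreover have "(\<Prod>j<length xs. (map cP xs ! r j) (map Pe a ! j)) = (\<Prod>i<length xs. crd (a ! i) (xs ! r i))"
   if "r permutes {..<length xs}" "m = length xs" for r
  proof (intro prod.cong refl)
   fix i assume "i \<in> {..<length xs}"
   then have "i < length a" "r i < length xs" "a ! i \<in> B" using that a by (auto simp: words_def permutes_lt)
   then show "(map cP xs ! r i) (map Pe a ! i) = crd (a ! i) (xs ! r i)" by (simp add: cP_def)
  qed
  ultimately show ?thesis unfolding FH co_prod_lin[OF dP] using a by (auto simp: words_def intro!: sum.cong)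
 qed
 have cH: "co ?H (map Qe b) = (if l = length \<theta>s then \<Sum>s | s permutes {..<l}. ksgn (kap (*) (map (%j. j + 1) es) s) * (\<Prod>j<l. (\<theta>s ! s j) (b ! j)) else 0)"
  if b: "b \<in> words B l" for b l
 proof -
  have "(\<Prod>j<length \<theta>s. (map cQ \<theta>s ! s j) (map Qe b ! j)) = (\<Prod>j<length \<theta>s. (\<theta>s ! s j) (b ! j))"
   if "s permutes {..<length \<theta>s}" "l = length \<theta>s" for s
  proof (intro prod.cong refl)
   fix i assume "i \<in> {..<length \<theta>s}"
   then have "i < length b" "s i < length \<theta>s" "b ! i \<in> B" using that b by (auto simp: words_def permutes_lt)
   then show "(map cQ \<theta>s ! s i) (map Qe b ! i) = (\<theta>s ! s i) (b ! i)" by (simp add: cQ_def LQ_def)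
  qed
  then show ?thesis unfolding FH co_prod_lin[OF dQ] using b by (auto simp: words_def intro!: sum.cong)
 qed
 show ?thesis
 proof (cases "m = length xs & l = length \<theta>s")
  case False
  have "phi (?F * ?H) m l = mkT m l (%a b. E a b * co 0 (W a b))"
   unfolding phi_def using False by (intro mkT_cong) (auto simp: co_mult_PQ[OF sets] cF cH)
  then have "phi (?F * ?H) m l = 0" using phi_0 by (simp only: phi_def)
  then show ?thesis using False by auto
 next
  case True
  then have ml: "m = length xs" "l = length \<theta>s" by simp_all
  note mm = monomial_map_mc[OF xs \<theta>s, folded ml]
  have "phi (?F * ?H) m l = (%t. tscale (monomial_sgn 2 ds es) (monomial_map g 2 ds xs es \<theta>s t))"
  proof (rule tl_eqI[of l m, OF tl_phi tl_scale[OF mm(1)]])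
   fix a b assume a: "a \<in> words B m" and b: "b \<in> words B l"
   have "E a b * (koszul ds r * (\<Prod>i<m. crd (a ! i) (xs ! r i)) * (ksgn (kap (*) (map (%j. j + 1) es) s) * (\<Prod>j<l. (\<theta>s ! s j) (b ! j)))) =
     monomial_sgn 2 ds es * (koszul ds r * (koszul es s * permsgn s) * koszul (map dg b) (%i. l - 1 - i) *
      (\<Prod>j<l. (\<theta>s ! s j) (b ! j)) * (\<Prod>i<m. crd (a ! i) (xs ! r i)))"
    if s: "s permutes {..<l}" and r: "r permutes {..<m}" for s r
   proof (cases "(\<Prod>j<l. (\<theta>s ! s j) (b ! j)) = 0 \<or> (\<Prod>i<m. crd (a ! i) (xs ! r i)) = 0")
    case True
    then show ?thesis by auto
   next
    case False
    then have nz: "\<And>j. j < l ==> (\<theta>s ! s j) (b ! j) ~= 0" "\<And>i. i < m ==> crd (a ! i) (xs ! r i) ~= 0"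
     by (auto simp: prod_zero_iff)
    have db: "dg (b ! j) = - (es ! s j)" if j: "j < length es" for j
    proof (rule dual_degree)
     show "\<theta>s ! s j \<in> mpart (dual g) (es ! s j)" using list_all2_nthD2[OF \<theta>s, of "s j"] permutes_lt[OF s] j les ml by simp
     show "b ! j \<in> B" using b j les ml by (auto simp: words_def)
     show "(\<theta>s ! s j) (b ! j) ~= 0" using nz(1) j les ml by simp
    qed
    have da: "map dg a = permute_list r ds"
    proof (rule nth_equalityI)
     show "length (map dg a) = length (permute_list r ds)" using a lds ml by (simp add: words_def)
     fix i assume "i < length (map dg a)"
     then have i: "i < m" using a by (simp add: words_def)
     have "xs ! r i \<in> part g (ds ! r i)" using xs permutes_lt[OF r i] ml lds by (simp add: homog_def list_all2_conv_all_nth)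
     moreover have "a ! i \<in> B" using a i by (auto simp: words_def)
     ultimately have "dg (a ! i) = ds ! r i" using nz(2)[OF i] by (rule crd_part)
     then show "map dg a ! i = permute_list r ds ! i" using a i r lds ml by (simp add: permute_list_nth words_def)
    qed
    have sa: "sdg a = sum_list ds"
     unfolding da using r lds ml by (metis mset_permute_list sum_mset_sum_list)
    have "(\<Sum>k<length ds. ds ! k * ((int (length ds) - (int k + 1)) * 2 + int (length es))) + int l * sum_list ds =
      2 * ((\<Sum>k<length ds. ds ! k * (int (length ds) - (int k + 1))) + int l * sum_list ds)"
     unfolding sum_list_sum_nth atLeast0LessThan using les ml
     by (simp add: sum_distrib_left sum.distrib[symmetric] algebra_simps)
    then have k: "ksgn (\<Sum>k<length ds. ds ! k * ((int (length ds) - (int k + 1)) * 2 + int (length es))) = (ksgn (int l * sdg a) :: 'k)"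
     unfolding sa by (intro ksgn_cong) simp
    have sgn: "ksgn (\<Sum>j<length es. es ! j * (int (length es) - (int j + 1))) * (koszul es s * permsgn s) *
      koszul (map dg b) (%i. l - 1 - i) = (ksgn (Xs b) * ksgn (kap (*) (map (%j. j + 1) es) s) :: 'k)"
     using monomial_sign[of s es b] s b db les ml by (simp add: words_def)
    have lb: "length b = l" using b by (simp add: words_def)
    have "monomial_sgn 2 ds es * ((koszul es s * permsgn s) * koszul (map dg b) (%i. l - 1 - i)) =
      (E a b * ksgn (kap (*) (map (%j. j + 1) es) s) :: 'k)"
     unfolding monomial_sgn_def Let_def k E_def lb using sgn by (simp only: mult.assoc)
    from arg_cong[OF this, of "%x. x * (koszul ds r * (\<Prod>i<m. crd (a ! i) (xs ! r i)) * (\<Prod>j<l. (\<theta>s ! s j) (b ! j)))"]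
    show ?thesis by (simp only: mult_ac)
   qed
   note terms = this
   have "mc (phi (?F * ?H) m l) a b = (\<Sum>r | r permutes {..<m}. \<Sum>s | s permutes {..<l}.
     E a b * (koszul ds r * (\<Prod>i<m. crd (a ! i) (xs ! r i)) * (ksgn (kap (*) (map (%j. j + 1) es) s) * (\<Prod>j<l. (\<theta>s ! s j) (b ! j)))))"
    unfolding mc_phi[OF a b] co_mult_PQ[OF sets] cF[OF a] cH[OF b] if_P[OF ml(1)] if_P[OF ml(2)]
    unfolding sum_product unfolding sum_distrib_left ..
   also have "\<dots> = (\<Sum>s | s permutes {..<l}. \<Sum>r | r permutes {..<m}.
     E a b * (koszul ds r * (\<Prod>i<m. crd (a ! i) (xs ! r i)) * (ksgn (kap (*) (map (%j. j + 1) es) s) * (\<Prod>j<l. (\<theta>s ! s j) (b ! j)))))"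
    by (rule sum.swap)
   also have "\<dots> = (\<Sum>s | s permutes {..<l}. \<Sum>r | r permutes {..<m}. monomial_sgn 2 ds es *
     (koszul ds r * (koszul es s * permsgn s) * koszul (map dg b) (%i. l - 1 - i) *
      (\<Prod>j<l. (\<theta>s ! s j) (b ! j)) * (\<Prod>i<m. crd (a ! i) (xs ! r i))))"
    by (intro sum.cong refl terms) simp_all
   also have "\<dots> = mc (%t. tscale (monomial_sgn 2 ds es) (monomial_map g 2 ds xs es \<theta>s t)) a b"
    unfolding mc_scale mm(2)[OF a b] by (simp only: sum_distrib_left)
   finally show "mc (phi (?F * ?H) m l) a b = mc (%t. tscale (monomial_sgn 2 ds es) (monomial_map g 2 ds xs es \<theta>s t)) a b" .
  qed
  then show ?thesis using ml by simp
 qed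
qed

lemma is_Phi_phi: "is_Phi g 2 (%X. phi (Ps X))"
 unfolding is_Phi_def Let_def
proof (intro conjI ballI allI impI)
 fix X Y assume "X \<in> carrier DP" "Y \<in> carrier DP"
 then show "phi (Ps (X \<oplus>\<^bsub>DP\<^esub> Y)) = phi (Ps X) + phi (Ps Y)" by (simp add: fun_eq_iff phi_add)
next
 fix c X assume "X \<in> carrier DP"
 then show "phi (Ps (csmult DP c X)) = (%m l t. tscale c (phi (Ps X) m l t))" by (simp add: fun_eq_iff phi_scale)
next
 fix ds xs es \<theta>s assume *: "homog g ds xs & list_all2 (%j \<theta>. \<theta> \<in> mpart (dual g) j) es \<theta>s"
 show "phi (Ps (pol_monomial g 2 ds xs es \<theta>s)) = (%m l t. if m = length xs & l = length \<theta>s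
   then tscale (monomial_sgn 2 ds es) (monomial_map g 2 ds xs es \<theta>s t) else 0)"
  unfolding pol_monomial_model(2)[OF conjunct1[OF *] conjunct2[OF *]] by (intro ext phi_monomial *[THEN conjunct1] *[THEN conjunct2])
qed

lemma lw_normal:
 assumes "set w \<subseteq> LPQ"
 shows "\<exists>a b c. set a \<subseteq> B & set b \<subseteq> B & (lw w :: ('v, 'k) pqfun) = cst c * (lw (map Pe a) * lw (map Qe b))"
 using assms
proof (induction w)
 case Nil
 show ?case by (rule exI[of _ "[]"], rule exI[of _ "[]"], rule exI[of _ 1]) simp
next
 case (Cons x w)
 then obtain a b c where IH: "set a \<subseteq> B" "set b \<subseteq> B" "(lw w :: ('v, 'k) pqfun) = cst c * (lw (map Pe a) * lw (map Qe b))"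
  by auto
 from Cons.prems consider e where "e \<in> B" "x = Pe e" | e where "e \<in> B" "x = Qe e" by (auto simp: LPQ_def)
 then show ?case
 proof cases
  case 1
  have "(lw (x # w) :: ('v, 'k) pqfun) = cst c * (lw (map Pe (e # a)) * lw (map Qe b))"
   unfolding list.map prod_list.Cons IH(3) 1 cst_left[of "gen (Pe e)"] by (simp only: mult.assoc)
  then show ?thesis using IH 1 by (intro exI[of _ "e # a"] exI[of _ b] exI[of _ c]) auto
 next
  case 2
  have comm: "gen (Qe e) * lw (map Pe a) = cst (ksgn (fst (Qe e) * wd (map Pe a))) * ((lw (map Pe a) :: ('v, 'k) pqfun) * gen (Qe e))"
   by (rule hom_commute[OF homg_gen homg_lw])
  have "(lw (x # w) :: ('v, 'k) pqfun) = cst c * (gen (Qe e) * lw (map Pe a) * lw (map Qe b))"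
   unfolding list.map prod_list.Cons IH(3) 2 cst_left[of "gen (Qe e)"] by (simp only: mult.assoc)
  also have "\<dots> = cst (c * ksgn (fst (Qe e) * wd (map Pe a))) * (lw (map Pe a) * lw (map Qe (e # b)))"
   unfolding comm list.map prod_list.Cons cst_mult by (simp only: mult.assoc)
  finally show ?thesis using IH 2 by (intro exI[of _ a] exI[of _ "e # b"] exI[of _ "c * ksgn (fst (Qe e) * wd (map Pe a))"]) auto
 qed
qed

text \<open>Monomials span, so that the conditions on \<open>\<Phi>\<close> determine it on polyvectors.\<close>
lemma Phi_eq: assumes X: "X \<in> carrier DP" shows "Phi g 2 X = phi (Ps X)"
proof -
 define F where "F = Phi g 2"
 have F: "is_Phi g 2 F" unfolding F_def Phi_def by (rule someI[of "is_Phi g 2", OF is_Phi_phi])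
 have add: "F (X \<oplus>\<^bsub>DP\<^esub> Y) = F X + F Y" if "X \<in> carrier DP" "Y \<in> carrier DP" for X Y
  using F that by (simp add: is_Phi_def Let_def)
 have scale: "F (csmult DP c X) = (%m l t. tscale c (F X m l t))" if "X \<in> carrier DP" for c X
  using F that by (simp add: is_Phi_def Let_def)
 have mono: "F (pol_monomial g 2 ds xs es \<theta>s) = phi (Ps (pol_monomial g 2 ds xs es \<theta>s))"
  if "homog g ds xs" "list_all2 (%j \<theta>. \<theta> \<in> mpart (dual g) j) es \<theta>s" for ds xs es \<theta>s
  using F is_Phi_phi that by (simp add: is_Phi_def Let_def)
 have sc: "F (iP (cst c * f)) = phi (cst c * f)" if f: "f \<in> symset LPQ" "F (iP f) = phi f" for c f
 proof -
  have "iP (cst c * f) = csmult DP c (iP f)"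
   using f by (intro Ps_inj) (simp_all add: iP symset_scale)
  then show ?thesis using scale[of "iP f" c] f by (simp add: iP fun_eq_iff phi_scale)
 qed
 have "Ps X \<in> symset LPQ & F (iP (Ps X)) = phi (Ps X)"
 proof (rule symset_induct[of LPQ "Ps X"])
  show "finite LPQ" "Ps X \<in> symset LPQ" using X by simp_all
  have "(0 :: ('v, 'k) pqfun) \<in> symset LPQ" by simp
  have z: "iP 0 = csmult DP 0 (iP 0)"
   by (intro Ps_inj) (simp_all add: iP symset_scale)
  have "F (iP 0) = (%m l t. tscale 0 (F (iP 0) m l t))"
   using scale[of "iP 0" 0] z by (simp add: iP)
  then have "F (iP 0) m l t \<eta> = 0" for m l t \<eta> by (metis tscale_apply mult_zero_left)
  then show "0 \<in> symset LPQ & F (iP 0) = phi 0" by (simp add: fun_eq_iff)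
 next
  fix f h assume *: "f \<in> symset LPQ & F (iP f) = phi f" "h \<in> symset LPQ & F (iP h) = phi h"
  then have "iP (f + h) = iP f \<oplus>\<^bsub>DP\<^esub> iP h" by (intro Ps_inj) (simp_all add: iP symset_add)
  then show "f + h \<in> symset LPQ & F (iP (f + h)) = phi (f + h)"
   using * add[of "iP f" "iP h"] by (simp add: iP symset_add fun_eq_iff phi_add)
 next
  fix c f assume "f \<in> symset LPQ & F (iP f) = phi f"
  then show "cst c * f \<in> symset LPQ & F (iP (cst c * f)) = phi (cst c * f)" by (simp add: sc symset_scale)
 next
  fix w assume w: "set w \<subseteq> LPQ"
  then obtain a b c where ab: "set a \<subseteq> B" "set b \<subseteq> B" "(lw w :: ('v, 'k) pqfun) = cst c * (lw (map Pe a) * lw (map Qe b))"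
   using lw_normal by blast
  let ?f = "lw (map Pe a) * lw (map Qe b) :: ('v, 'k) pqfun"
  have h: "homog g (map dg a) a" using homog_basis[of a "length a"] ab(1) by (simp add: words_def)
  have d: "list_all2 (%j \<theta>. \<theta> \<in> mpart (dual g) j) (map (%e. - dg e) b) (map crd b)"
   using ab(2) by (induction b) (auto simp: crd_dual)
  have la: "map lP a = map gen (map Pe a)" and lb: "map lQ (map crd b) = map gen (map Qe b)"
   using ab by (auto simp: lP_basis lQ_crd)
  have P: "Ps (pol_monomial g 2 (map dg a) a (map (%e. - dg e) b) (map crd b)) = ?f"
   unfolding pol_monomial_model(2)[OF h d] la lb ..
  have fs: "?f \<in> symset LPQ" using ab by (intro symset_mult symset_lw) (auto simp: LPQ_def)
  then have "iP ?f = pol_monomial g 2 (map dg a) a (map (%e. - dg e) b) (map crd b)"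
   using P pol_monomial_model(1)[OF h d] by (intro Ps_inj) (simp_all add: iP)
  then have "F (iP ?f) = phi ?f" using mono[OF h d] P by simp
  then show "(lw w :: ('v, 'k) pqfun) \<in> symset LPQ & F (iP (lw w)) = phi (lw w)" unfolding ab(3) using sc[OF fs] fs by (simp add: symset_scale)
 qed
 moreover have "iP (Ps X) = X" using X by (intro Ps_inj) (simp_all add: iP)
 ultimately show ?thesis unfolding F_def by simp
qed

end

context two_term_basis
begin

section \<open>The bracket in terms of the operation star\<close>

text \<open>The change from Koszul signs of shifted inputs to exterior signs is, on each decomposition, the variation of \<open>Xs\<close>.\<close>
lemma ssum_decalage:
 "ssum (%x y. dg x * dg y + 1) b G =
  ssum (%x y. fst (Qe x) * fst (Qe y)) b (%b1 b2. ksgn (Xs b + Xs (b1 @ b2)) * (G b1 b2 :: 'k))"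
proof (induction b arbitrary: G)
 case Nil
 then show ?case by simp
next
 case (Cons x b)
 have ms: "length b = length u + length v & sdg b = sdg u + sdg v" if "mset u + mset v = mset b" for u v
 proof -
  have m: "mset (u @ v) = mset b" using that by simp
  have "length (u @ v) = length b" "sdg (u @ v) = sdg b" using m by (metis mset_eq_length, metis mset_map sum_mset_sum_list)
  then show ?thesis by simp
 qed
 have 1: "ssum (%x y. fst (Qe x) * fst (Qe y)) b (%u v. ksgn (Xs b + Xs (u @ v)) * G (x # u) v) =
   ssum (%x y. fst (Qe x) * fst (Qe y)) b (%u v. ksgn (Xs (x # b) + Xs ((x # u) @ v)) * G (x # u) v)"
 proof (rule ssum_cong)
  fix u v assume "mset u + mset v = mset b"
  then have "ksgn (Xs b + Xs (u @ v)) = (ksgn (Xs (x # b) + Xs ((x # u) @ v)) :: 'k)"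
   using ms[of u v] by (intro ksgn_cong) simp
  then show "ksgn (Xs b + Xs (u @ v)) * G (x # u) v = ksgn (Xs (x # b) + Xs ((x # u) @ v)) * G (x # u) v" by simp
 qed
 have 2: "ssum (%x y. fst (Qe x) * fst (Qe y)) b (%u v. ksgn (Xs b + Xs (u @ v)) * (ksgn (\<Sum>y\<leftarrow>u. dg y * dg x + 1) * G u (x # v))) =
   ssum (%x y. fst (Qe x) * fst (Qe y)) b (%u v. ksgn (\<Sum>y\<leftarrow>u. fst (Qe y) * fst (Qe x)) * (ksgn (Xs (x # b) + Xs (u @ x # v)) * G u (x # v)))"
 proof (rule ssum_cong)
  fix u v assume "mset u + mset v = mset b"
  note ms = ms[OF this]
  have q: "(\<Sum>y\<leftarrow>u. dg y * dg x + 1) = sdg u * dg x + int (length u)" by (induction u) (simp_all add: algebra_simps)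
  have q': "(\<Sum>y\<leftarrow>u. fst (Qe y) * fst (Qe x)) = (int (length u) - sdg u) * (1 - dg x)" by (induction u) (simp_all add: algebra_simps)
  have "Xs b + Xs (u @ v) + (sdg u * dg x + int (length u)) + ((int (length u) - sdg u) * (1 - dg x) + (Xs (x # b) + Xs (u @ x # v))) =
   2 * (Xs b + Xs (u @ v) + int (length u) + sdg u * dg x + dg x * (int (length v) + sdg v) + sdg u * dg x)"
   unfolding Xs_insert by (simp add: ms algebra_simps)
  then have "ksgn (Xs b + Xs (u @ v) + (\<Sum>y\<leftarrow>u. dg y * dg x + 1)) =
    (ksgn ((\<Sum>y\<leftarrow>u. fst (Qe y) * fst (Qe x)) + (Xs (x # b) + Xs (u @ x # v))) :: 'k)"
   unfolding q q' by (intro ksgn_cong) simp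
  then show "ksgn (Xs b + Xs (u @ v)) * (ksgn (\<Sum>y\<leftarrow>u. dg y * dg x + 1) * G u (x # v)) =
    ksgn (\<Sum>y\<leftarrow>u. fst (Qe y) * fst (Qe x)) * (ksgn (Xs (x # b) + Xs (u @ x # v)) * G u (x # v))"
   by (simp only: ksgn_add mult.assoc[symmetric])
 qed
 show ?case
  unfolding ssum.simps(2) Cons.IH 1 2 ..
qed

text \<open>The comparison of all signs in \<open>co_hM\<close>. The two hypotheses express that both arguments have even degree.\<close>
lemma parity_star:
 fixes A1 A2 B1 B2 b1 l2 d x :: int
 assumes "even (A1 + b1 + 1 + B1 + d)" "even (d + A2 + l2 + B2)"
 shows "even ((b1 + l2) * (A1 + A2) + (b1 + B1) * A2 + (1 + d) * (A1 + b1 + B1) + (b1 + 1) * A1 + B1 * (1 + d) + l2 * (d + A2) +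
  ((b1 + 1) * (l2 + 1) + l2 * B1 + B1 * (l2 + B2) + 1))"
 using assms by (auto simp: even_add even_mult_iff)

text \<open>A half bracket on a sorted word: the word is decomposed by the shuffle product, the conjugate letters \<open>Qe e\<close> and \<open>Pe e\<close> are inserted, and the sum over e contracts an output of the second map with an input of the first.\<close>
lemma co_hM:
 assumes f: "symf f" "hom 4 f" and h: "symf h" "hom 4 h" and a: "a \<in> words B m" and b: "b \<in> words B l"
 shows "- (E a b * co (hM f h) (W a b)) =
  ssum (%x y. dg x * dg y) a (%a1 a2. ssum (%x y. dg x * dg y + 1) b (%b1 b2.
   ksgn (int (Suc (length b1)) * (int (length b2) + 1)) * (ksgn (int (length b2) * sdg b1) *
   (\<Sum>e\<in>B. mc (phi f (length a1) (Suc (length b1))) a1 (b1 @ [e]) * mc (phi h (Suc (length a2)) (length b2)) (e # a2) b2))))"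
proof -
 let ?qa = "%x y. dg x * dg y" and ?qb = "%x y. fst (Qe x) * fst (Qe y)"
 let ?S = "%a2 b1. \<Sum>x\<leftarrow>map Pe a2. \<Sum>y\<leftarrow>map Qe b1. fst y * fst x"
 let ?F = "%e a1 b1. co f (Qe e # map Pe a1 @ map Qe b1)" and ?H = "%e a2 b2. co h (Pe e # map Pe a2 @ map Qe b2)"
 have "co (hM f h) (W a b) = (\<Sum>e\<in>B. ssum (%x y. fst x * fst y) (map Pe a @ map Qe b) (%u v. co f (Qe e # u) * co h (Pe e # v)))"
  by (simp add: hM_def co_mult_ssum W_def)
 also have "\<dots> = (\<Sum>e\<in>B. ssum ?qa a (%a1 a2. ssum ?qb b (%b1 b2. ksgn (?S a2 b1) * (?F e a1 b1 * ?H e a2 b2))))"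
  unfolding ssum_append ssum_map
  by (intro sum.cong refl, subst ssum_sign_cong[of "%x y. fst (Pe x) * fst (Pe y)" ?qa]) (auto simp: algebra_simps)
 also have "\<dots> = ssum ?qa a (%a1 a2. ssum ?qb b (%b1 b2. \<Sum>e\<in>B. ksgn (?S a2 b1) * (?F e a1 b1 * ?H e a2 b2)))"
  by (simp only: ssum_sum)
 finally have co: "co (hM f h) (W a b) = ssum ?qa a (%a1 a2. ssum ?qb b (%b1 b2. \<Sum>e\<in>B. ksgn (?S a2 b1) * (?F e a1 b1 * ?H e a2 b2)))" .
 have L: "- (E a b * co (hM f h) (W a b)) =
   ssum ?qa a (%a1 a2. ssum ?qb b (%b1 b2. - E a b * (\<Sum>e\<in>B. ksgn (?S a2 b1) * (?F e a1 b1 * ?H e a2 b2))))"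
  unfolding co ssum_scale by simp
 have main: "- E a b * (\<Sum>e\<in>B. ksgn (?S a2 b1) * (?F e a1 b1 * ?H e a2 b2)) =
   ksgn (Xs b + Xs (b1 @ b2)) * (ksgn (int (Suc (length b1)) * (int (length b2) + 1)) * (ksgn (int (length b2) * sdg b1) *
   (\<Sum>e\<in>B. mc (phi f (length a1) (Suc (length b1))) a1 (b1 @ [e]) * mc (phi h (Suc (length a2)) (length b2)) (e # a2) b2)))"
  if ma: "mset a1 + mset a2 = mset a" and mb: "mset b1 + mset b2 = mset b" for a1 a2 b1 b2
 proof -
  have m1: "mset (a1 @ a2) = mset a" "mset (b1 @ b2) = mset b" using ma mb by simp_all
  have "sdg (a1 @ a2) = sdg a" "length (b1 @ b2) = length b" using m1 by (metis mset_map sum_mset_sum_list, metis mset_eq_length)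
  then have sd: "sdg a = sdg a1 + sdg a2" "length b = length b1 + length b2" by simp_all
  have "set (a1 @ a2) = set a" "set (b1 @ b2) = set b" using m1 by (metis set_mset_mset)+
  then have sets: "set a1 \<subseteq> B" "set a2 \<subseteq> B" "set b1 \<subseteq> B" "set b2 \<subseteq> B" using a b by (auto simp: words_def)
  have S: "?S a2 b1 = (int (length b1) - sdg b1) * (sdg a2 + 2 * int (length a2))"
  proof (induction a2)
   case (Cons x a2)
   have "(\<Sum>y\<leftarrow>map Qe b1. fst y * fst (Pe x)) = (int (length b1) - sdg b1) * (dg x + 2)"
    by (induction b1) (simp_all add: algebra_simps)
   then show ?case using Cons by (simp add: algebra_simps del: map_map)
  qed simp
  have "- E a b * (ksgn (?S a2 b1) * (?F e a1 b1 * ?H e a2 b2)) =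
    ksgn (Xs b + Xs (b1 @ b2)) * (ksgn (int (Suc (length b1)) * (int (length b2) + 1)) * (ksgn (int (length b2) * sdg b1) *
    (mc (phi f (length a1) (Suc (length b1))) a1 (b1 @ [e]) * mc (phi h (Suc (length a2)) (length b2)) (e # a2) b2)))"
   if e: "e \<in> B" for e
  proof -
   have wf: "a1 \<in> words B (length a1)" "b1 @ [e] \<in> words B (Suc (length b1))" "e # a2 \<in> words B (Suc (length a2))" "b2 \<in> words B (length b2)"
    using sets e by (auto simp: words_def)
   have cf: "co f (W a1 (b1 @ [e])) = ksgn (fst (Qe e) * wd (W a1 b1)) * ?F e a1 b1"
    using symf_front[OF f(1), of "W a1 b1" "Qe e" "[]"] by (simp add: W_def)
   have ch: "co h (W (e # a2) b2) = ?H e a2 b2" by (simp add: W_def)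
   show ?thesis
   proof (cases "?F e a1 b1 = 0 \<or> ?H e a2 b2 = 0")
    case True
    then have "mc (phi f (length a1) (Suc (length b1))) a1 (b1 @ [e]) = 0 \<or> mc (phi h (Suc (length a2)) (length b2)) (e # a2) b2 = 0"
     using cf ch mc_phi[OF wf(1,2), of f] mc_phi[OF wf(3,4), of h] by auto
    then show ?thesis using True by auto
   next
    case False
    then have nz: "co f (W a1 (b1 @ [e])) ~= 0" "co h (W (e # a2) b2) ~= 0" by (simp_all add: cf ch)
    have d1: "wd (W a1 (b1 @ [e])) = 4" "wd (W (e # a2) b2) = 4" using nz f(2) h(2) by (simp_all add: homg_def)
    let ?A1 = "sdg a1" and ?A2 = "sdg a2" and ?B1 = "sdg b1" and ?B2 = "sdg b2" and ?d = "dg e" and ?b = "int (length b1)" and ?l = "int (length b2)"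
    have e1: "?A1 + ?b + 1 + ?B1 + ?d = 2 * (2 - int (length a1) + ?B1 + ?d)" and e2: "?d + ?A2 + ?l + ?B2 = 2 * (1 - int (length a2) + ?B2)"
     using d1 unfolding sum_degrees by simp_all
    have par: "even (?A1 + ?b + 1 + ?B1 + ?d)" "even (?d + ?A2 + ?l + ?B2)" unfolding e1 e2 by (rule dvd_triv_left)+
    have X1: "Xs (b1 @ [e]) = Xs b1 + ?B1 * (1 + ?d)" by (simp add: Xs_append)
    have X2: "Xs (b1 @ b2) = Xs b1 + Xs b2 + ?B1 * (?l + ?B2)" by (simp add: Xs_append)
    have F: "?F e a1 b1 = ksgn (fst (Qe e) * wd (W a1 b1)) * (E a1 (b1 @ [e]) * mc (phi f (length a1) (Suc (length b1))) a1 (b1 @ [e]))"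
     using cf co_phi[OF wf(1,2), of f] by (metis ksgn_square_left)
    have H: "?H e a2 b2 = E (e # a2) b2 * mc (phi h (Suc (length a2)) (length b2)) (e # a2) b2"
     using ch co_phi[OF wf(3,4), of h] by simp
    have "- E a b * (ksgn (?S a2 b1) * (ksgn (fst (Qe e) * wd (W a1 b1)) * (E a1 (b1 @ [e]) * E (e # a2) b2))) =
      (ksgn (1 + (int (length b) * sdg a + Xs b + ?S a2 b1 + fst (Qe e) * wd (W a1 b1) +
       (int (length (b1 @ [e])) * ?A1 + Xs (b1 @ [e])) + (?l * sdg (e # a2) + Xs b2))) :: 'k)"
     by (simp add: E_def ksgn_add mult_ac) (simp add: ksgn_def)
    also have "\<dots> = ksgn (Xs b + Xs (b1 @ b2) + (int (Suc (length b1)) * (?l + 1) + ?l * ?B1))"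
    proof (rule ksgn_cong)
     have "1 + (int (length b) * sdg a + Xs b + ?S a2 b1 + fst (Qe e) * wd (W a1 b1) +
       (int (length (b1 @ [e])) * ?A1 + Xs (b1 @ [e])) + (?l * sdg (e # a2) + Xs b2)) +
       (Xs b + Xs (b1 @ b2) + (int (Suc (length b1)) * (?l + 1) + ?l * ?B1)) =
      ((?b + ?l) * (?A1 + ?A2) + (?b + ?B1) * ?A2 + (1 + ?d) * (?A1 + ?b + ?B1) + (?b + 1) * ?A1 + ?B1 * (1 + ?d) + ?l * (?d + ?A2) +
      ((?b + 1) * (?l + 1) + ?l * ?B1 + ?B1 * (?l + ?B2) + 1)) +
      2 * (Xs b + Xs b1 + Xs b2 - ?B1 * ?A2 + (?b - ?B1) * int (length a2) + (1 - ?d) * (int (length a1) - ?B1) - ?d * (?A1 + ?b + ?B1))"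
      unfolding S X1 X2 sum_degrees sd by (simp add: algebra_simps)
     then show "even (1 + (int (length b) * sdg a + Xs b + ?S a2 b1 + fst (Qe e) * wd (W a1 b1) +
       (int (length (b1 @ [e])) * ?A1 + Xs (b1 @ [e])) + (?l * sdg (e # a2) + Xs b2)) +
       (Xs b + Xs (b1 @ b2) + (int (Suc (length b1)) * (?l + 1) + ?l * ?B1)))"
      using parity_star[OF par] by (simp only: even_add even_mult_iff even_numeral simp_thms)
    qed
    finally have fin: "- E a b * (ksgn (?S a2 b1) * (ksgn (fst (Qe e) * wd (W a1 b1)) * (E a1 (b1 @ [e]) * E (e # a2) b2))) =
      (ksgn (Xs b + Xs (b1 @ b2)) * (ksgn (int (Suc (length b1)) * (?l + 1)) * ksgn (?l * ?B1)) :: 'k)"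
     by (simp only: ksgn_add)
    have arr: "x * (s * ((w * (E1 * M)) * (E2 * N))) = X * (K * (L * (M * N)))"
     if arr_eq: "x * (s * (w * (E1 * E2))) = X * (K * L)" for x s w E1 E2 X K L M N :: 'k
    proof -
     have "x * (s * ((w * (E1 * M)) * (E2 * N))) = (x * (s * (w * (E1 * E2)))) * (M * N)" by (simp only: mult_ac)
     then show ?thesis unfolding arr_eq by (simp only: mult_ac)
    qed
    show ?thesis unfolding F H by (rule arr[OF fin])
   qed
  qed
  then show ?thesis by (simp add: sum_distrib_left)
 qed
 have bd: "mset u + mset v = mset b ==> mset u + mset v = mset b" for u v by simp
 show ?thesis unfolding L ssum_decalage by (intro ssum_cong) (rule main)
qed

text \<open>Collecting the decompositions of the two words by their lengths gives the shuffle sums in the operation star.\<close>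

lemma hM_star:
 assumes f: "symf f" "hom 4 f" and h: "symf h" "hom 4 h" and a: "a \<in> words B m" and b: "b \<in> words B l"
 shows "- (E a b * co (hM f h) (W a b)) =
  (\<Sum>m1\<le>m. \<Sum>p\<le>l. ksgn (int (Suc p) * (int (l - p) + 1)) *
   mc (star g 2 (m1, Suc p) (phi f m1 (Suc p)) (Suc (m - m1), l - p) (phi h (Suc (m - m1)) (l - p))) a b)"
proof -
 let ?qa = "%x y. dg x * dg y" and ?qb = "%x y. dg x * dg y + 1"
 let ?G = "%m1 p a1 a2 b1 b2. ksgn (int (l - p) * sdg b1) *
   (\<Sum>e\<in>B. mc (phi f m1 (Suc p)) a1 (b1 @ [e]) * mc (phi h (Suc (m - m1)) (l - p)) (e # a2) b2)"
 have star: "ksgn (int (Suc p) * (int (l - p) + 1)) * mc (star g 2 (m1, Suc p) (phi f m1 (Suc p)) (Suc (m - m1), l - p) (phi h (Suc (m - m1)) (l - p))) a b =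
  ssum ?qa a (%a1 a2. ssum ?qb b (%b1 b2. if length a1 = m1 then if length b1 = p then
   ksgn (int (Suc p) * (int (l - p) + 1)) * ?G m1 p a1 a2 b1 b2 else 0 else 0))"
  if "m1 \<le> m" "p \<le> l" for m1 p
 proof -
  have e': "ksgn (pdeg 2 (Suc (m - m1), l - p) * s) = (ksgn (int (l - p) * s) :: 'k)" for s
   by (rule ksgn_cong) (simp add: pdeg_def)
  have ab: "a \<in> words B (m1 + (m - m1))" "b \<in> words B (p + (l - p))" using a b that by simp_all
  show ?thesis
   unfolding star_def star_mc(2)[OF tl_phi tl_phi ab] e' ssum_scale[symmetric]
  proof (rule ssum_cong)
   fix a1 a2
   let ?K = "ksgn (int (Suc p) * (int (l - p) + 1)) :: 'k"
   show "?K * (if length a1 = m1 then ssum ?qb b (%b1 b2. if length b1 = p then ?G m1 p a1 a2 b1 b2 else 0) else 0) =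
     ssum ?qb b (%b1 b2. if length a1 = m1 then if length b1 = p then ?K * ?G m1 p a1 a2 b1 b2 else 0 else 0)"
   proof (cases "length a1 = m1")
    case True
    show ?thesis unfolding if_P[OF True] ssum_scale[symmetric] by (rule ssum_cong) simp
   next
    case False
    then show ?thesis by simp
   qed
  qed
 qed
 have "(\<Sum>m1\<le>m. \<Sum>p\<le>l. ksgn (int (Suc p) * (int (l - p) + 1)) *
   mc (star g 2 (m1, Suc p) (phi f m1 (Suc p)) (Suc (m - m1), l - p) (phi h (Suc (m - m1)) (l - p))) a b) =
  ssum ?qa a (%a1 a2. ssum ?qb b (%b1 b2. \<Sum>m1\<le>m. \<Sum>p\<le>l. if length a1 = m1 then if length b1 = p then
   ksgn (int (Suc p) * (int (l - p) + 1)) * ?G m1 p a1 a2 b1 b2 else 0 else 0))"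
  unfolding ssum_sum by (intro sum.cong refl star) simp_all
 also have "\<dots> = ssum ?qa a (%a1 a2. ssum ?qb b (%b1 b2.
   ksgn (int (Suc (length b1)) * (int (length b2) + 1)) * (ksgn (int (length b2) * sdg b1) *
   (\<Sum>e\<in>B. mc (phi f (length a1) (Suc (length b1))) a1 (b1 @ [e]) * mc (phi h (Suc (length a2)) (length b2)) (e # a2) b2))))"
 proof (intro ssum_cong)
  fix a1 a2 b1 b2 assume "mset a1 + mset a2 = mset a" "mset b1 + mset b2 = mset b"
  then have "mset (a1 @ a2) = mset a" "mset (b1 @ b2) = mset b" by simp_all
  then have "length (a1 @ a2) = length a" "length (b1 @ b2) = length b" by (metis mset_eq_length)+
  then have l: "length a1 \<le> m" "length b1 \<le> l" "m - length a1 = length a2" "l - length b1 = length b2" using a b by (auto simp: words_def)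
  have "(\<Sum>m1\<le>m. \<Sum>p\<le>l. if length a1 = m1 then if length b1 = p then
    ksgn (int (Suc p) * (int (l - p) + 1)) * ?G m1 p a1 a2 b1 b2 else 0 else 0) =
   (\<Sum>m1\<le>m. if length a1 = m1 then \<Sum>p\<le>l. if length b1 = p then
    ksgn (int (Suc p) * (int (l - p) + 1)) * ?G m1 p a1 a2 b1 b2 else 0 else 0)"
   by (intro sum.cong refl) simp
  also have "\<dots> = ksgn (int (Suc (length b1)) * (int (l - length b1) + 1)) * ?G (length a1) (length b1) a1 a2 b1 b2"
   using l by (simp only: sum.delta' finite_atMost atMost_iff if_True)
  finally show "(\<Sum>m1\<le>m. \<Sum>p\<le>l. if length a1 = m1 then if length b1 = p then
    ksgn (int (Suc p) * (int (l - p) + 1)) * ?G m1 p a1 a2 b1 b2 else 0 else 0) =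
   ksgn (int (Suc (length b1)) * (int (length b2) + 1)) * (ksgn (int (length b2) * sdg b1) *
   (\<Sum>e\<in>B. mc (phi f (length a1) (Suc (length b1))) a1 (b1 @ [e]) * mc (phi h (Suc (length a2)) (length b2)) (e # a2) b2))"
   using l by simp
 qed
 finally show ?thesis using co_hM[OF f h a b] by simp
qed

end

context two_term_basis
begin

section \<open>The differential of the complex\<close>

definition Dd :: "('v, 'k) pqfun"
 where "Dd = emb 4 (mkder cd)"

lemma Dd_der: "mkder cd \<in> der DA 1" by (rule mkder_der[OF cd_coeffs])

lemma Dl_Qe_Dd: assumes "e \<in> B" shows "Dl (Qe e) Dd = lP (dif g e)"
proof -
 have "Dl (Qe e) Dd = (\<Sum>f\<in>B. cst (crd f (dif g e)) * gen (Pe f))"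
  unfolding Dd_def DlQ_emb
 proof (intro sum.cong refl)
  fix f assume f: "f \<in> B"
  have "Dl (Qe e) (cof (mkder cd) f) = cst (ksgn (dg f) * crd f (dif g e))"
   unfolding cof_mkder[OF cd_coeffs f] cd_def by (rule Dl_lQ[OF assms])
  moreover have "ksgn (4 + dg f) * (ksgn (dg f) * x) = (x :: 'k)" for x by (simp add: ksgn_def)
  ultimately show "cst (ksgn (4 + dg f)) * (Dl (Qe e) (cof (mkder cd) f) * gen (Pe f)) = cst (crd f (dif g e)) * gen (Pe f)"
   by (simp only: mult.assoc[symmetric] cst_mult[symmetric])
 qed
 then show ?thesis unfolding lP_sum .
qed

lemma tw_4: "hom 4 f ==> tw a f = f"
 using tw_hom[of 4 f a] by (simp add: ksgn_def)

lemma Dl_Pe_emb: assumes D: "D \<in> der DA 1" and e: "e \<in> B" shows "Dl (Pe e) (emb 4 D) = cof D e"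
proof -
 have h: "hom 4 (emb 4 D)" by (rule emb_hom) (use D in simp)
 have "Dl (Pe e) (tw (dg e + 2) (emb (1 + 3) D)) = - (cst (ksgn 1) * cof D e)" by (rule DlP_emb[OF D e])
 then show ?thesis using tw_4[OF h] by (simp add: ksgn_def cst_uminus)
qed

lemma co_replace:
 assumes f: "symf f" and p: "p < length w"
 shows "co f (x # take p w @ drop (Suc p) w) = ksgn (fst x * wd (take p w)) * co f (w[p := x])"
 using symf_front[OF f, of "take p w" x "drop (Suc p) w"] p by (simp add: upd_conv_take_nth_drop)

lemma sum_lessThan_add: "(\<Sum>i<m + l. h i) = (\<Sum>i<m. h i) + (\<Sum>i<l. h (m + i))" for h :: "nat => 'k"
 by (induction l) (simp_all add: add.assoc)

lemma sum_first: "(\<And>p. p < m ==> h p = k p) ==> (\<And>q. q < l ==> h (m + q) = 0) ==> (\<Sum>p<m + l. h p) = (\<Sum>p<m. k p)"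
 and sum_second: "(\<And>p. p < m ==> h p = 0) ==> (\<And>q. q < l ==> h (m + q) = k q) ==> (\<Sum>p<m + l. h p) = (\<Sum>q<l. k q)"
 for h k :: "nat => 'k"
 by (simp_all add: sum_lessThan_add)

lemma take_W: "p \<le> length a ==> wd (take p (W a b)) = sdg (take p a) + 2 * int p"
 "q \<le> length b ==> wd (take (length a + q) (W a b)) = sdg a + 2 * int (length a) + int q - sdg (take q b)"
proof -
 assume p: "p \<le> length a"
 have "take p (W a b) = W (take p a) []" using p by (simp add: W_def take_map)
 then show "wd (take p (W a b)) = sdg (take p a) + 2 * int p" using p by (simp add: sum_degrees)
next
 assume q: "q \<le> length b"
 have "take (length a + q) (W a b) = W a (take q b)" using q by (simp add: W_def take_map)
 then show "wd (take (length a + q) (W a b)) = sdg a + 2 * int (length a) + int q - sdg (take q b)" using q by (simp add: sum_degrees)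
qed

lemma W_update: "p < length a ==> (W a b)[p := Pe e] = W (a[p := e]) b"
 "(W a b)[length a + q := Qe e] = W a (b[q := e])"
 "p < length a ==> W a b ! p = Pe (a ! p)" "q < length b ==> W a b ! (length a + q) = Qe (b ! q)" "length (W a b) = length a + length b"
 by (simp_all add: W_def list_update_append map_update nth_append)

abbreviation "Mm e e' \<equiv> crd e (dif g e')"

lemma Mm_degree: "e \<in> B ==> e' \<in> B ==> Mm e e' ~= 0 ==> dg e = dg e' + 1"
 using crd_part[OF dif_part[OF B_part]] by blast

lemma co_hM_left:
 assumes f: "symf f" and a: "a \<in> words B m" and b: "b \<in> words B l"
 shows "co (hM Dd f) (W a b) = (\<Sum>p<m. \<Sum>e\<in>B. ksgn (sdg (take p a)) * (Mm (a ! p) e * co f (W (a[p := e]) b)))"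
proof -
 have la: "length a = m" "length b = l" and aB: "set a \<subseteq> B" using a b by (auto simp: words_def)
 have tm: "co (lP (dif g e) * Dl (Pe e) f) (W a b) = (\<Sum>p<m. ksgn (sdg (take p a)) * (Mm (a ! p) e * co f (W (a[p := e]) b)))"
  if e: "e \<in> B" for e
 proof -
  have dc: "fst z = dg e + 3" if z: "(if z \<in> Pe ` B then crd (snd (snd z)) (dif g e) else 0) ~= 0" for z :: "int \<times> bool \<times> 'v"
  proof -
   obtain x where "x \<in> B" "z = Pe x" "Mm x e ~= 0" using z by (auto split: if_splits)
   then show ?thesis using Mm_degree[OF _ e, of x] by simp
  qed
  have "co (lP (dif g e) * Dl (Pe e) f) (W a b) = (\<Sum>p<m + l. ksgn ((dg e + 3) * wd (take p (W a b))) *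
    (if W a b ! p \<in> Pe ` B then crd (snd (snd (W a b ! p))) (dif g e) else 0) *
    co (Dl (Pe e) f) (take p (W a b) @ drop (Suc p) (W a b)))"
   unfolding lP_def la(1)[symmetric] la(2)[symmetric] W_update(5)[symmetric] by (rule co_lin_mult, rule dc)
  also have "\<dots> = (\<Sum>p<m. ksgn (sdg (take p a)) * (Mm (a ! p) e * co f (W (a[p := e]) b)))"
  proof -
   have 1: "ksgn ((dg e + 3) * wd (take p (W a b))) *
     (if W a b ! p \<in> Pe ` B then crd (snd (snd (W a b ! p))) (dif g e) else 0) *
     co (Dl (Pe e) f) (take p (W a b) @ drop (Suc p) (W a b)) =
     ksgn (sdg (take p a)) * (Mm (a ! p) e * co f (W (a[p := e]) b))" if p: "p < m" for p
   proof -
    have pW: "p < length (W a b)" "p \<le> length a" "p < length a" and ap: "a ! p \<in> B" using p la aB by (auto simp: W_update)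
    have c: "co (Dl (Pe e) f) (take p (W a b) @ drop (Suc p) (W a b)) = ksgn (fst (Pe e) * wd (take p (W a b))) * co f (W (a[p := e]) b)"
     unfolding co_Dl co_replace[OF f pW(1)] W_update(1)[OF pW(3)] ..
    have "ksgn ((dg e + 3) * wd (take p (W a b))) * ksgn (fst (Pe e) * wd (take p (W a b))) = (ksgn (sdg (take p a)) :: 'k)"
     unfolding ksgn_add[symmetric] take_W(1)[OF pW(2)] by (rule ksgn_cong) (simp add: algebra_simps)
    then show ?thesis unfolding c using ap by (simp add: W_update pW mult_ac)
   qed
   have 2: "ksgn ((dg e + 3) * wd (take (m + q) (W a b))) *
     (if W a b ! (m + q) \<in> Pe ` B then crd (snd (snd (W a b ! (m + q)))) (dif g e) else 0) *
     co (Dl (Pe e) f) (take (m + q) (W a b) @ drop (Suc (m + q)) (W a b)) = 0" if q: "q < l" for q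
   proof -
    have "W a b ! (m + q) \<notin> Pe ` B" using W_update(4)[of q b a] q la by auto
    then show ?thesis by simp
   qed
   show ?thesis by (rule sum_first, erule 1, erule 2)
  qed
  finally show ?thesis .
 qed
 have "co (hM Dd f) (W a b) = (\<Sum>e\<in>B. co (lP (dif g e) * Dl (Pe e) f) (W a b))"
  unfolding hM_def co_sum by (intro sum.cong refl) (simp only: Dl_Qe_Dd)
 also have "\<dots> = (\<Sum>e\<in>B. \<Sum>p<m. ksgn (sdg (take p a)) * (Mm (a ! p) e * co f (W (a[p := e]) b)))"
  by (intro sum.cong refl tm)
 also have "\<dots> = (\<Sum>p<m. \<Sum>e\<in>B. ksgn (sdg (take p a)) * (Mm (a ! p) e * co f (W (a[p := e]) b)))"
  by (rule sum.swap)
 finally show ?thesis .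
qed

lemma co_hM_right:
 assumes f: "symf f" "hom 4 f" and a: "a \<in> words B m" and b: "b \<in> words B l"
 shows "co (hM f Dd) (W a b) = (\<Sum>q<l. \<Sum>e\<in>B. ksgn (sdg a + int q + sdg (take q b) + dg e) * (Mm e (b ! q) * co f (W a (b[q := e]))))"
proof -
 have la: "length a = m" "length b = l" and bB: "set b \<subseteq> B" using a b by (auto simp: words_def)
 have tm: "co (Dl (Qe e) f * cd e) (W a b) = (\<Sum>q<l. ksgn (sdg a + int q + sdg (take q b) + dg e) * (Mm e (b ! q) * co f (W a (b[q := e]))))"
  if e: "e \<in> B" for e
 proof -
  have hcd: "hom (2 - dg e) (cd e)" using cd_coeffs e by (auto simp: der_coeffs_def)
  have "ksgn ((4 - fst (Qe e)) * (2 - dg e)) = (1 :: 'k)" by (simp add: ksgn_def)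
  then have comm: "Dl (Qe e) f * cd e = cd e * Dl (Qe e) f" using hom_commute[OF homg_Dl[OF f(2), of "Qe e"] hcd] by simp
  define c where "c z = (if z \<in> LQ then ksgn (dg e) * crd e (dif g (snd (snd z))) else (0 :: 'k))" for z :: "int \<times> bool \<times> 'v"
  have dc: "fst z = 2 - dg e" if z: "c z ~= 0" for z
  proof -
   have "z \<in> LQ" "crd e (dif g (snd (snd z))) ~= 0" using z by (auto simp: c_def split: if_splits)
   then obtain x where "x \<in> B" "z = Qe x" "Mm e x ~= 0" by (auto simp: LQ_def)
   then show ?thesis using Mm_degree[OF e, of x] by simp
  qed
  have "co (cd e * Dl (Qe e) f) (W a b) = (\<Sum>p<m + l. ksgn ((2 - dg e) * wd (take p (W a b))) * c (W a b ! p) *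
    co (Dl (Qe e) f) (take p (W a b) @ drop (Suc p) (W a b)))"
   unfolding cd_def lQ_def c_def[symmetric] la(1)[symmetric] la(2)[symmetric] W_update(5)[symmetric] by (rule co_lin_mult, rule dc)
  also have "\<dots> = (\<Sum>q<l. ksgn (sdg a + int q + sdg (take q b) + dg e) * (Mm e (b ! q) * co f (W a (b[q := e]))))"
  proof -
   have 1: "ksgn ((2 - dg e) * wd (take p (W a b))) * c (W a b ! p) * co (Dl (Qe e) f) (take p (W a b) @ drop (Suc p) (W a b)) = 0"
    if p: "p < m" for p
   proof -
    have "W a b ! p \<notin> LQ" using W_update(3)[of p a b] p la by (auto simp: LQ_def)
    then show ?thesis by (simp add: c_def)
   qed
   have 2: "ksgn ((2 - dg e) * wd (take (m + q) (W a b))) * c (W a b ! (m + q)) *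
     co (Dl (Qe e) f) (take (m + q) (W a b) @ drop (Suc (m + q)) (W a b)) =
     ksgn (sdg a + int q + sdg (take q b) + dg e) * (Mm e (b ! q) * co f (W a (b[q := e])))" if q: "q < l" for q
   proof -
    have pW: "m + q < length (W a b)" and qb: "q < length b" "q \<le> length b" and bq: "b ! q \<in> B" using q la bB by (auto simp: W_update)
    have cW: "c (W a b ! (m + q)) = ksgn (dg e) * Mm e (b ! q)" using W_update(4)[OF qb(1), of a] bq la by (simp add: c_def LQ_def)
    have c: "co (Dl (Qe e) f) (take (m + q) (W a b) @ drop (Suc (m + q)) (W a b)) =
      ksgn (fst (Qe e) * wd (take (m + q) (W a b))) * co f (W a (b[q := e]))"
     unfolding co_Dl co_replace[OF f(1) pW] W_update(2)[of a b q e, unfolded la] ..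
    have "ksgn ((2 - dg e) * wd (take (m + q) (W a b))) * ksgn (fst (Qe e) * wd (take (m + q) (W a b))) * ksgn (dg e) =
      (ksgn (sdg a + int q + sdg (take q b) + dg e) :: 'k)"
     unfolding ksgn_add[symmetric] take_W(2)[OF qb(2), of a, unfolded la] by (rule ksgn_cong) (simp add: algebra_simps)
    then have sg: "ksgn (sdg a + int q + sdg (take q b) + dg e) =
      ksgn ((2 - dg e) * wd (take (m + q) (W a b))) * ksgn (fst (Qe e) * wd (take (m + q) (W a b))) * (ksgn (dg e) :: 'k)" by (rule sym)
    show ?thesis unfolding cW c sg by (simp only: mult_ac)
   qed
   show ?thesis by (rule sum_second, erule 1, erule 2)
  qed
  finally show ?thesis unfolding comm .
 qed
 have "co (hM f Dd) (W a b) = (\<Sum>e\<in>B. co (Dl (Qe e) f * cd e) (W a b))"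
  unfolding hM_def co_sum Dd_def by (intro sum.cong refl) (simp only: Dl_Pe_emb[OF Dd_der] cof_mkder[OF cd_coeffs])
 also have "\<dots> = (\<Sum>e\<in>B. \<Sum>q<l. ksgn (sdg a + int q + sdg (take q b) + dg e) * (Mm e (b ! q) * co f (W a (b[q := e]))))"
  by (intro sum.cong refl tm)
 also have "\<dots> = (\<Sum>q<l. \<Sum>e\<in>B. ksgn (sdg a + int q + sdg (take q b) + dg e) * (Mm e (b ! q) * co f (W a (b[q := e]))))"
  by (rule sum.swap)
 finally show ?thesis .
qed

text \<open>Basis elements pair to 0 or 1, so only one entry of the word may differ.\<close>
lemma pairing_update:
 assumes c: "c \<in> words B k" and b: "b \<in> words B k" and p: "p < k"
 shows "pairing (crds c) (b[p := x]) = (if c = b[p := c ! p] then crd (c ! p) x else 0)"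
proof -
 have l: "length c = k" "length b = k" using c b by (auto simp: words_def)
 have B: "c ! i \<in> B" "b ! i \<in> B" if "i < k" for i using c b that by (auto simp: words_def)
 have "pairing (crds c) (b[p := x]) = crd (c ! p) x * (\<Prod>i\<in>{..<k} - {p}. crd (c ! i) (b ! i))"
  using p l by (simp add: prod.remove[of "{..<k}" p])
 also have "(\<Prod>i\<in>{..<k} - {p}. crd (c ! i) (b ! i)) = (\<Prod>i\<in>{..<k} - {p}. if c ! i = b ! i then 1 else 0)"
  using B by (intro prod.cong refl) (simp add: crd_basis)
 also have "\<dots> = (if c = b[p := c ! p] then 1 else (0 :: 'k))"
 proof (cases "c = b[p := c ! p]")
  case True
  then have "c ! i = b ! i" if "i ~= p" for i using that by (metis nth_list_update_neq)
  then show ?thesis using True by (auto intro!: prod.neutral)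
 next
  case False
  then obtain i where "i < k" "c ! i ~= b[p := c ! p] ! i" using l by (metis length_list_update nth_equalityI)
  moreover from this have "i ~= p" using l by auto
  ultimately have "i \<in> {..<k} - {p}" "c ! i ~= b ! i" by simp_all
  then have "(\<Prod>i\<in>{..<k} - {p}. if c ! i = b ! i then 1 else (0 :: 'k)) = 0" by (intro prod_zero) auto
  then show ?thesis using False by simp
 qed
 finally show ?thesis by simp
qed

lemma mc_tdiff:
 assumes c: "c \<in> words B k" and b: "b \<in> words B k"
 shows "mc (tdiff g k) c b = (\<Sum>q<k. if c = b[q := c ! q] then ksgn (sdg (take q b)) * Mm (c ! q) (b ! q) else 0)"
proof -
 have "mc (tdiff g k) c b = (\<Sum>q<k. ksgn (sdg (take q b)) * tp (b[q := dif g (b ! q)]) (crds c))"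
  unfolding mc_def tdiff_tl(2)[OF b] fun_sum_apply by (simp add: take_map)
 also have "\<dots> = (\<Sum>q<k. if c = b[q := c ! q] then ksgn (sdg (take q b)) * Mm (c ! q) (b ! q) else 0)"
 proof (intro sum.cong refl)
  fix q assume q: "q \<in> {..<k}"
  have "tp (b[q := dif g (b ! q)]) (crds c) = pairing (crds c) (b[q := dif g (b ! q)])"
   using c b crd_linear by (intro tp_apply) (auto simp: words_def)
  then show "ksgn (sdg (take q b)) * tp (b[q := dif g (b ! q)]) (crds c) =
    (if c = b[q := c ! q] then ksgn (sdg (take q b)) * Mm (c ! q) (b ! q) else 0)"
   using q pairing_update[OF c b, of q "dif g (b ! q)"] by simp
 qed
 finally show ?thesis .
qed

lemma sum_updates:
 assumes b: "b \<in> words B k" and q: "q < k"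
 shows "(\<Sum>c\<in>words B k. if c = b[q := c ! q] then G c else 0) = (\<Sum>e\<in>B. G (b[q := e]) :: 'k)"
proof -
 have lb: "length b = k" using b by (simp add: words_def)
 have inj: "inj_on (%e. b[q := e]) B" using q lb by (intro inj_onI) (metis nth_list_update_eq)
 have sub: "(%e. b[q := e]) ` B \<subseteq> words B k"
  using b set_update_subset_insert[of b q] by (fastforce simp: words_def)
 have fin: "finite (words B k)" using finite_B by simp
 have "(\<Sum>c\<in>words B k. if c = b[q := c ! q] then G c else 0) = (\<Sum>c\<in>(%e. b[q := e]) ` B. if c = b[q := c ! q] then G c else 0)"
 proof (rule sum.mono_neutral_right[OF fin sub], intro ballI)
  fix c assume c: "c \<in> words B k - (%e. b[q := e]) ` B"
  then have "c ! q \<in> B" using q by (auto simp: words_def)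
  then have "c ~= b[q := c ! q]" using c by blast
  then show "(if c = b[q := c ! q] then G c else 0) = 0" by simp
 qed
 also have "\<dots> = (\<Sum>e\<in>B. G (b[q := e]))" unfolding sum.reindex[OF inj] using q lb by simp
 finally show ?thesis .
qed

lemma mc_pdiff:
 assumes L: "tl l m L" and a: "a \<in> words B m" and b: "b \<in> words B l"
 shows "mc (pdiff g 2 (m, l) L) a b =
  (\<Sum>p<m. \<Sum>e\<in>B. ksgn (sdg (take p a)) * (Mm (a ! p) e * mc L (a[p := e]) b)) -
  ksgn (int l) * (\<Sum>q<l. \<Sum>e\<in>B. ksgn (sdg (take q b)) * (Mm e (b ! q) * mc L a (b[q := e])))"
proof -
 have la: "length a = m" "length b = l" using a b by (auto simp: words_def)
 have flip: "a = c[p := a ! p] \<longleftrightarrow> c = a[p := c ! p]" for c p by (metis list_update_id list_update_overwrite)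
 have "mc (%t. tdiff g m (L t)) a b = (\<Sum>c\<in>words B m. mc L c b * mc (tdiff g m) a c)"
  by (rule tl_comp(2)[OF L tdiff_tl(1) b])
 also have "\<dots> = (\<Sum>c\<in>words B m. \<Sum>p<m. if c = a[p := c ! p] then mc L c b * (ksgn (sdg (take p c)) * Mm (a ! p) (c ! p)) else 0)"
  by (intro sum.cong refl) (simp add: mc_tdiff[OF a] flip sum_distrib_left if_distrib[of "%x. mc L _ b * x"] cong: if_cong)
 also have "\<dots> = (\<Sum>p<m. \<Sum>c\<in>words B m. if c = a[p := c ! p] then mc L c b * (ksgn (sdg (take p c)) * Mm (a ! p) (c ! p)) else 0)"
  by (rule sum.swap)
 also have "\<dots> = (\<Sum>p<m. \<Sum>e\<in>B. ksgn (sdg (take p a)) * (Mm (a ! p) e * mc L (a[p := e]) b))"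
  by (intro sum.cong refl, subst sum_updates[OF a]) (simp_all add: la mult_ac)
 finally have 1: "mc (%t. tdiff g m (L t)) a b = (\<Sum>p<m. \<Sum>e\<in>B. ksgn (sdg (take p a)) * (Mm (a ! p) e * mc L (a[p := e]) b))" .
 have "mc (%t. L (tdiff g l t)) a b = (\<Sum>c\<in>words B l. mc (tdiff g l) c b * mc L a c)"
  by (rule tl_comp(2)[OF tdiff_tl(1) L b])
 also have "\<dots> = (\<Sum>c\<in>words B l. \<Sum>q<l. if c = b[q := c ! q] then ksgn (sdg (take q b)) * Mm (c ! q) (b ! q) * mc L a c else 0)"
  by (intro sum.cong refl) (simp add: mc_tdiff[OF _ b] sum_distrib_right if_distrib[of "%x. x * mc L a _"] cong: if_cong)
 also have "\<dots> = (\<Sum>q<l. \<Sum>c\<in>words B l. if c = b[q := c ! q] then ksgn (sdg (take q b)) * Mm (c ! q) (b ! q) * mc L a c else 0)"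
  by (rule sum.swap)
 also have "\<dots> = (\<Sum>q<l. \<Sum>e\<in>B. ksgn (sdg (take q b)) * (Mm e (b ! q) * mc L a (b[q := e])))"
  by (intro sum.cong refl, subst sum_updates[OF b]) (simp_all add: la mult_ac)
 finally have 2: "mc (%t. L (tdiff g l t)) a b = (\<Sum>q<l. \<Sum>e\<in>B. ksgn (sdg (take q b)) * (Mm e (b ! q) * mc L a (b[q := e])))" .
 have s: "ksgn (pdeg 2 (m, l)) = (ksgn (int l) :: 'k)" by (rule ksgn_cong) (simp add: pdeg_def)
 have "mc (pdiff g 2 (m, l) L) a b = mc (%t. tdiff g m (L t)) a b - ksgn (int l) * mc (%t. L (tdiff g l t)) a b"
  unfolding mc_def by (simp add: pdiff_def hom_diff_def s)
 then show ?thesis unfolding 1 2 .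
qed

lemma sdg_update: "q < length b ==> sdg (b[q := e]) = sdg b - dg (b ! q) + dg e"
proof -
 assume q: "q < length b"
 have "sdg b = sdg (take q b) + dg (b ! q) + sdg (drop (Suc q) b)"
  by (subst id_take_nth_drop[OF q]) simp
 then show ?thesis using q by (simp add: upd_conv_take_nth_drop)
qed

lemma Xs_update:
 assumes q: "q < length b"
 shows "Xs (b[q := e]) = Xs b + (dg e - dg (b ! q)) * (int (length b) - 1 - int q + sdg b - dg (b ! q))"
proof -
 let ?u = "take q b" and ?v = "drop (Suc q) b"
 have b: "b = ?u @ b ! q # ?v" by (rule id_take_nth_drop[OF q])
 have lv: "int (length ?v) = int (length b) - 1 - int q" using q by simp
 have sb: "sdg b = sdg ?u + dg (b ! q) + sdg ?v" by (subst b) simp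
 have Xb: "Xs b = Xs (?u @ ?v) + dg (b ! q) * (int (length ?v) + sdg ?v) + sdg ?u * (1 + dg (b ! q))"
  by (subst b) (rule Xs_insert)
 have "b[q := e] = ?u @ e # ?v" by (rule upd_conv_take_nth_drop[OF q])
 then have "Xs (b[q := e]) = Xs (?u @ ?v) + dg e * (int (length ?v) + sdg ?v) + sdg ?u * (1 + dg e)" by (simp only: Xs_insert)
 then show ?thesis unfolding Xb lv sb by (simp add: algebra_simps)
qed

text \<open>The bracket with the differential replaces one letter of a word at a time, exactly as the differential of multilinear maps changes one input or one output at a time.\<close>
lemma hM_differential:
 assumes f: "symf f" "hom 4 f" and a: "a \<in> words B m" and b: "b \<in> words B l"
 shows "- (E a b * co (hM Dd f + hM f Dd) (W a b)) = ksgn (int l + 1) * mc (pdiff g 2 (m, l) (phi f m l)) a b"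
proof -
 have la: "length a = m" "length b = l" and B: "set a \<subseteq> B" "set b \<subseteq> B" using a b by (auto simp: words_def)
 have upd: "c[p := e] \<in> words B k" if "c \<in> words B k" "e \<in> B" for c p e k
  using that set_update_subset_insert[of c p e] by (auto simp: words_def)
 have 1: "- (E a b * (ksgn s * (Mm (a ! p) e * co f (W (a[p := e]) b)))) =
   ksgn (int l + 1) * (ksgn s * (Mm (a ! p) e * mc (phi f m l) (a[p := e]) b))" if p: "p < m" and e: "e \<in> B" for p e s
 proof (cases "Mm (a ! p) e = 0")
  case False
  have "a ! p \<in> B" using B p la by auto
  then have "dg (a ! p) = dg e + 1" using Mm_degree[OF _ e False] by simp
  then have sa: "sdg (a[p := e]) = sdg a - 1" using sdg_update[of p a e] p la by simp
  have "E (a[p := e]) b = ksgn (int l) * E a b"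
  proof -
   have "ksgn (int l * (sdg a - 1)) = (ksgn (int l + int l * sdg a) :: 'k)" by (rule ksgn_cong) (simp add: algebra_simps)
   then show ?thesis unfolding E_def sa la by (simp add: ksgn_add)
  qed
  moreover have "ksgn (int l + 1) * (ksgn (int l) * x) = - (x :: 'k)" for x by (simp add: ksgn_def)
  ultimately show ?thesis unfolding mc_phi[OF upd[OF a e] b] by (simp add: ksgn_def)
 qed simp
 have 2: "- (E a b * (ksgn (sdg a + int q + s + dg e) * (Mm e (b ! q) * co f (W a (b[q := e]))))) =
   - (ksgn (int l + 1) * (ksgn (int l) * (ksgn s * (Mm e (b ! q) * mc (phi f m l) a (b[q := e])))))" if q: "q < l" and e: "e \<in> B" for q e s
 proof (cases "Mm e (b ! q) = 0 \<or> co f (W a (b[q := e])) = 0")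
  case True
  then show ?thesis unfolding mc_phi[OF a upd[OF b e]] by auto
 next
  case False
  have bq: "b ! q \<in> B" using B q la by auto
  have d: "dg e = dg (b ! q) + 1" using Mm_degree[OF e bq] False by simp
  have wd: "wd (W a (b[q := e])) = 4" using f(2) False by (simp add: homg_def)
  have sb: "sdg (b[q := e]) = sdg b + 1" using sdg_update[of q b e] q la d by simp
  have deg: "sdg a + 2 * int m + int l - sdg b - 1 = 4" using wd unfolding sum_degrees sb by (simp add: la)
  have X: "Xs (b[q := e]) = Xs b + (int l - 1 - int q + sdg b - dg (b ! q))" using Xs_update[of q b e] q la d by simp
  have "E a b * ksgn (sdg a + int q + s + dg e) = (ksgn (int l * sdg a + Xs b + (sdg a + int q + s + dg e)) :: 'k)"
   by (simp add: E_def la ksgn_add)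
  also have "\<dots> = ksgn (1 + (s + (int l * sdg a + Xs (b[q := e]))))"
  proof (rule ksgn_cong)
   have eq: "int l * sdg a + Xs b + (sdg a + int q + s + dg e) + (1 + (s + (int l * sdg a + Xs (b[q := e])))) =
     2 * (int l * sdg a + Xs b + s + 3 - int m + sdg b)"
    unfolding X using d deg by (simp add: algebra_simps)
   show "even (int l * sdg a + Xs b + (sdg a + int q + s + dg e) + (1 + (s + (int l * sdg a + Xs (b[q := e])))))"
    unfolding eq by (rule dvd_triv_left)
  qed
  also have "\<dots> = - (ksgn s * E a (b[q := e]))"
  proof -
   have "ksgn 1 = (- 1 :: 'k)" by (simp add: ksgn_def)
   then show ?thesis by (simp only: ksgn_add E_def length_list_update la) (simp add: mult_ac)
  qed
  finally have sg: "E a b * ksgn (sdg a + int q + s + dg e) = - (ksgn s * E a (b[q := e]))" .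
  have ll: "ksgn (int l + 1) * (ksgn (int l) * x) = - (x :: 'k)" for x by (simp add: ksgn_def)
  have "E a b * (ksgn (sdg a + int q + s + dg e) * (Mm e (b ! q) * co f (W a (b[q := e])))) =
    (E a b * ksgn (sdg a + int q + s + dg e)) * (Mm e (b ! q) * co f (W a (b[q := e])))" by (simp only: mult.assoc)
  then show ?thesis unfolding sg ll mc_phi[OF a upd[OF b e]] by (simp add: mult_ac)
 qed
 have "- (E a b * co (hM Dd f + hM f Dd) (W a b)) =
   (\<Sum>p<m. \<Sum>e\<in>B. - (E a b * (ksgn (sdg (take p a)) * (Mm (a ! p) e * co f (W (a[p := e]) b))))) +
   (\<Sum>q<l. \<Sum>e\<in>B. - (E a b * (ksgn (sdg a + int q + sdg (take q b) + dg e) * (Mm e (b ! q) * co f (W a (b[q := e]))))))"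
  by (simp add: co_hM_left[OF f(1) a b] co_hM_right[OF f a b] sum_distrib_left sum_negf distrib_left)
 also have "\<dots> = (\<Sum>p<m. \<Sum>e\<in>B. ksgn (int l + 1) * (ksgn (sdg (take p a)) * (Mm (a ! p) e * mc (phi f m l) (a[p := e]) b))) +
   (\<Sum>q<l. \<Sum>e\<in>B. - (ksgn (int l + 1) * (ksgn (int l) * (ksgn (sdg (take q b)) * (Mm e (b ! q) * mc (phi f m l) a (b[q := e]))))))"
  using 1 2 by (intro arg_cong2[of _ _ _ _ "(+)"] sum.cong refl) simp_all
 also have "\<dots> = ksgn (int l + 1) * mc (pdiff g 2 (m, l) (phi f m l)) a b"
  unfolding mc_pdiff[OF tl_phi a b] by (simp only: sum_distrib_left sum_negf right_diff_distrib add_uminus_conv_diff)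
 finally show ?thesis .
qed

end

context two_term_basis
begin

section \<open>The Maurer-Cartan equation in coordinates\<close>

lemma mc_ops: "mc (L + K) a b = mc L a b + mc K a b" "mc (L - K) a b = mc L a b - mc K a b" "mc (- L) a b = - mc L a b" "mc 0 a b = 0"
 by (simp_all add: mc_def)

lemma tl_ops: "tl l m 0" "tl l m L ==> tl l m (- L)" "tl l m L ==> tl l m K ==> tl l m (L + K)" "tl l m L ==> tl l m K ==> tl l m (L - K)"
proof -
 show "tl l m 0" using tl_phi[of l m 0] by simp
 have neg: "tl l m (- L)" if "tl l m L" for L
 proof -
  have "- L = (%t. tscale (- 1) (L t))" by (simp add: fun_eq_iff)
  then show ?thesis using tl_scale[OF that, of "- 1"] by simp
 qed
 have add: "tl l m (L + K)" if "tl l m L" "tl l m K" for L K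
 proof -
  have "L + K = (%t. \<Sum>i\<in>{True, False}. (if i then L else K) t)" by (simp add: fun_eq_iff)
  then show ?thesis using tl_sum[of "{True, False}" l m "%i. if i then L else K"] that by simp
 qed
 show "tl l m L ==> tl l m (- L)" by (rule neg)
 show "tl l m L ==> tl l m K ==> tl l m (L + K)" by (rule add)
 show "tl l m L ==> tl l m K ==> tl l m (L - K)" using add[OF _ neg[of K]] by simp
qed

lemma star_tl:
 assumes "tl l m L" "tl l' m' L'" "1 \<le> l" "1 \<le> m'" "k = l - 1 + l'" "n = m + m' - 1"
 shows "tl k n (star g 2 (m, l) L (m', l') L')"
proof -
 obtain p q where "l = Suc p" "m' = Suc q" using assms(3,4) by (metis Suc_le_D One_nat_def)
 then show ?thesis using star_mc(1)[of p m L l' q L' "pdeg 2 (m', l')"] assms by (simp add: star_def)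
qed

lemma star_zero:
 assumes "tl l m L" "tl l' m' L'" "1 \<le> l" "1 \<le> m'" "a \<in> words B (m + m' - 1)" "b \<in> words B (l - 1 + l')" "L = 0 \<or> L' = 0"
 shows "mc (star g 2 (m, l) L (m', l') L') a b = 0"
proof -
 obtain p q where pq: "l = Suc p" "m' = Suc q" using assms(3,4) by (metis Suc_le_D One_nat_def)
 have z: "(\<Sum>e\<in>B. mc L a1 (b1 @ [e]) * mc L' (e # a2) b2) = 0" for a1 a2 b1 b2
  using assms(7) by (auto simp: mc_ops)
 have t: "tl (Suc p) m L" "tl l' (Suc q) L'" "a \<in> words B (m + q)" "b \<in> words B (p + l')" using assms pq by simp_all
 show ?thesis unfolding pq star_def star_mc(2)[OF t] z by (simp cong: if_cong)
qed

lemma pdiff_tl: "tl l m L ==> tl l m (pdiff g 2 (m, l) L)"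
proof -
 assume L: "tl l m L"
 have "pdiff g 2 (m, l) L = (%t. tdiff g m (L t)) - (%t. tscale (ksgn (pdeg 2 (m, l))) (L (tdiff g l t)))"
  by (simp add: fun_eq_iff pdiff_def hom_diff_def)
 then show ?thesis using tl_ops(4)[OF tl_comp(1)[OF L tdiff_tl(1)] tl_scale[OF tl_comp(1)[OF tdiff_tl(1) L]]] by simp
qed

lemma coord_iff:
 assumes "tl l m X" "tl l m Y"
  and "\<And>a b. a \<in> words B m ==> b \<in> words B l ==> mc X a b - mc Y a b = r a b \<or> mc X a b - mc Y a b = - r a b"
 shows "X = Y \<longleftrightarrow> (\<forall>a\<in>words B m. \<forall>b\<in>words B l. r a b = (0 :: 'k))"
proof
 assume "X = Y"
 then show "\<forall>a\<in>words B m. \<forall>b\<in>words B l. r a b = 0" using assms(3) by fastforce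
next
 assume "\<forall>a\<in>words B m. \<forall>b\<in>words B l. r a b = 0"
 then show "X = Y" using assms(3) by (intro tl_eqI[OF assms(1,2)]) fastforce
qed

lemma hM_zero [simp]: "hM 0 h = 0" "hM f 0 = 0"
 by (simp_all add: hM_def)

lemma hM_add: "hM (f + f') h = hM f h + hM f' h" "hM f (h + h') = hM f h + hM f h'"
 by (simp_all add: hM_def distrib_left distrib_right sum.distrib)

lemma hM_symset: "f \<in> symset LPQ ==> h \<in> symset LPQ ==> hM f h \<in> symset LPQ"
 unfolding hM_def by (intro symset_sum symset_mult symset_Dl)

lemma hM_hom: assumes "hom 4 f" "hom 4 h" shows "hom 5 (hM f h)"
 unfolding hM_def
proof (rule homg_sum)
 fix e
 show "hom 5 (Dl (Qe e) f * Dl (Pe e) h)"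
  using homg_mult[OF homg_Dl[OF assms(1), of "Qe e"] homg_Dl[OF assms(2), of "Pe e"]] by simp
qed

lemma hM_wt: assumes "homg wt i f" "homg wt j h" shows "homg wt (i + j - 1) (hM f h)"
 unfolding hM_def
proof (rule homg_sum)
 fix e
 show "homg wt (i + j - 1) (Dl (Qe e) f * Dl (Pe e) h)"
  using homg_mult[OF homg_Dl[OF assms(1), of "Qe e"] homg_Dl[OF assms(2), of "Pe e"]] by (simp add: algebra_simps)
qed

lemma emb_wt: assumes D: "D \<in> der DA i" shows "homg wt 1 (emb j D)"
 unfolding emb_def
proof (rule homg_sum)
 fix e assume e: "e \<in> B"
 have "cof D e \<in> symset LQ" using der_coeffs_cof[OF D] e by (simp add: der_coeffs_def)
 then have "homg wt (0 + wt (Pe e)) (cof D e * gen (Pe e))" by (intro homg_mult homg_wt_LQ homg_gen)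
 then show "homg wt 1 (cst (ksgn (j + dg e)) * (cof D e * gen (Pe e)))" by simp
qed

lemma co_weight:
 fixes f :: "('v, 'k) pqfun"
 assumes "homg wt k f" "a \<in> words B m" "b \<in> words B l" "int m ~= k" shows "co f (W a b) = 0"
 using co_phi[OF assms(2,3), of f] phi_weight[OF assms(1,4), of l] by (simp add: mc_ops)

lemma weight1_eqI:
 fixes f h :: "('v, 'k) pqfun"
 assumes "f \<in> symset LPQ" "h \<in> symset LPQ" "homg wt 1 f" "homg wt 1 h" "\<And>e. e \<in> B ==> Dl (Pe e) f = Dl (Pe e) h"
 shows "f = h"
proof (rule symset_eqI[OF assms(1,2)])
 fix m l a b assume ab: "a \<in> words B m" "b \<in> words B l"
 show "co f (W a b) = co h (W a b)"
 proof (cases "m = 1")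
  case True
  then obtain e where e: "a = [e]" "e \<in> B" using ab(1) by (auto simp: words_def length_Suc_conv)
  have "co (Dl (Pe e) f) (map Qe b) = co (Dl (Pe e) h) (map Qe b)" using assms(5)[OF e(2)] by simp
  then show ?thesis by (simp add: W_def e)
 next
  case False
  then have "int m ~= 1" by simp
  then show ?thesis using co_weight[OF assms(3) ab] co_weight[OF assms(4) ab] by simp
 qed
qed

lemma sym_hom_zero: "0 \<in> sym_hom g 2 (m, l) e"
 by (simp add: sym_hom_iff tl_ops homdeg_def mc_ops)

lemma Dl_Pe_weight1:
 assumes f: "f \<in> symset LPQ" "homg wt 1 f" shows "Dl (Pe e) f \<in> symset LQ"
proof -
 let ?h = "Dl (Pe e) f"
 have h: "?h \<in> symset LPQ" "homg wt 0 ?h" using symset_Dl[OF f(1)] homg_Dl[OF f(2), of "Pe e"] by simp_all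
 obtain N where N: "\<And>w. co ?h w ~= 0 ==> set w \<subseteq> LPQ & length w \<le> N" using h(1) unfolding symset_def by blast
 have noP: "\<not> fst (snd z)" if "sum_list (map wt w) = 0" "z \<in> set w" for z and w :: "(int \<times> bool \<times> 'v) list"
  using that
 proof (induction w)
  case (Cons x w)
  have "0 \<le> sum_list (map wt w)" by (rule sum_list_nonneg) auto
  then show ?case using Cons by (auto split: if_splits)
 qed simp
 have "set w \<subseteq> LQ" if "co ?h w ~= 0" for w
 proof
  fix z assume z: "z \<in> set w"
  have "sum_list (map wt w) = 0" using h(2) that by (simp add: homg_def)
  then have "\<not> fst (snd z)" using z by (rule noP)
  moreover have "z \<in> LPQ" using N[OF that] z by blast
  ultimately show "z \<in> LQ" by (auto simp: LPQ_def LQ_def)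
 qed
 then show ?thesis using N symset_symf[OF h(1)] unfolding symset_def by blast
qed

text \<open>The brackets form a family of weight 1 and degree 4, hence come from a graded symmetric function; functions of weight 1 are the images of derivations.\<close>
lemma ce_derivation_spec:
 assumes p12: "p12 \<in> sym_hom g 2 (1, 2) 0" and p13: "p13 \<in> sym_hom g 2 (1, 3) (- 1)"
 shows "ce_derivation g p12 p13 2 \<in> der DA 1"
  and "phi (emb 4 (ce_derivation g p12 p13 2)) = (%m l. if m = 1 & l = 2 then p12 else if m = 1 & l = 3 then p13 else 0)"
proof -
 define P where "P = (%m l :: nat. if m = (1 :: nat) & l = 2 then p12 else if m = 1 & l = 3 then p13 else 0)"
 have P: "P m l \<in> sym_hom g 2 (m, l) (pdeg 2 (m, l))" for m l
  using p12 p13 sym_hom_zero by (simp add: P_def pdeg_def)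
 define f where "f = mkf 4 P"
 have f: "f \<in> symset LPQ" "hom 4 f" unfolding f_def by (rule mkf_symset[OF P], rule mkf_degrees(1)[OF P])
 have "homg wt (int 1) f" unfolding f_def by (rule mkf_degrees(2)[OF P]) (simp add: P_def)
 then have fw: "homg wt 1 f" by simp
 have phif: "phi f = P"
 proof (rule ext, rule ext)
  fix m l
  show "phi f m l = P m l"
  proof (cases "m + l \<le> 4")
   case True
   then show ?thesis unfolding f_def by (simp add: phi_mkf[OF P])
  next
   case False
   then show ?thesis using phi_zero_outside[OF f(2), of m l] by (auto simp: P_def)
  qed
 qed
 let ?c = "%e. Dl (Pe e) f" and ?a = "mkder (%e. Dl (Pe e) f)"
 have c: "der_coeffs 1 ?c"
  unfolding der_coeffs_def
 proof (intro ballI conjI)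
  fix e
  show "?c e \<in> symset LQ" by (rule Dl_Pe_weight1[OF f(1) fw])
  show "hom (1 + 1 - dg e) (?c e)" using homg_Dl[OF f(2), of "Pe e"] by simp
 qed
 have a: "?a \<in> der DA 1" by (rule mkder_der[OF c])
 have emb: "emb 4 ?a = f"
  by (rule weight1_eqI[OF emb_symset[OF a] f(1) emb_wt[OF a] fw]) (simp only: Dl_Pe_emb[OF a] cof_mkder[OF c])
 have Phi: "Phi g 2 (sym_gen DA PM (2 + 2) D) = phi (emb 4 D)" if "D \<in> der DA 1" for D
  using Phi_eq[OF gen_carrier[of D 4]] that by (simp add: Ps_gen)
 have "\<exists>!D. D \<in> der DA 1 & Phi g 2 (sym_gen DA PM (2 + 2) D) = P"
 proof (rule ex1I[of _ ?a])
  show "?a \<in> der DA 1 & Phi g 2 (sym_gen DA PM (2 + 2) ?a) = P" using a Phi[OF a] emb phif by simp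
  fix D assume D: "D \<in> der DA 1 & Phi g 2 (sym_gen DA PM (2 + 2) D) = P"
  then have D1: "D \<in> der DA 1" and "phi (emb 4 D) = phi f" using Phi phif by auto
  then have "emb 4 D = f" by (intro phi_inject[OF emb_symset[OF D1] f(1)]) simp
  then have "cof D e = cof ?a e" if "e \<in> B" for e using Dl_Pe_emb[OF D1 that] Dl_Pe_emb[OF a that] emb by simp
  then show "D = ?a" by (rule der_eqI[OF D1 a])
 qed
 from theI'[OF this] have "ce_derivation g p12 p13 2 \<in> der DA 1 & Phi g 2 (sym_gen DA PM (2 + 2) (ce_derivation g p12 p13 2)) = P"
  unfolding ce_derivation_def Let_def P_def by simp
 then show "ce_derivation g p12 p13 2 \<in> der DA 1"
  "phi (emb 4 (ce_derivation g p12 p13 2)) = (%m l. if m = 1 & l = 2 then p12 else if m = 1 & l = 3 then p13 else 0)"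
  using Phi unfolding P_def by auto
qed

text \<open>For homogeneous weights, the number of outputs of each map in the composition is prescribed.\<close>
lemma hM_star_weight:
 assumes f: "symf f" "hom 4 f" "homg wt (int i) f" and h: "symf h" "hom 4 h" and ij: "i + j = Suc w" "1 \<le> j"
  and a: "a \<in> words B w" and b: "b \<in> words B l"
 shows "- (E a b * co (hM f h) (W a b)) = (\<Sum>p\<le>l. ksgn (int (Suc p) * (int (l - p) + 1)) *
   mc (star g 2 (i, Suc p) (phi f i (Suc p)) (j, l - p) (phi h j (l - p))) a b)"
proof -
 let ?t = "%k p. ksgn (int (Suc p) * (int (l - p) + 1)) *
   mc (star g 2 (k, Suc p) (phi f k (Suc p)) (Suc (w - k), l - p) (phi h (Suc (w - k)) (l - p))) a b"
 have z: "?t k p = 0" if "k \<le> w" "p \<le> l" "k ~= i" for k p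
 proof -
  have "phi f k (Suc p) = 0" by (rule phi_weight[OF f(3)]) (use that in simp)
  moreover have "mc (star g 2 (k, Suc p) (phi f k (Suc p)) (Suc (w - k), l - p) (phi h (Suc (w - k)) (l - p))) a b = 0"
   by (rule star_zero) (use that a b calculation in \<open>simp_all add: tl_ops\<close>)
  ultimately show ?thesis by simp
 qed
 have "- (E a b * co (hM f h) (W a b)) = (\<Sum>k\<le>w. \<Sum>p\<le>l. ?t k p)" by (rule hM_star[OF f(1,2) h a b])
 also have "\<dots> = (\<Sum>k\<in>{i}. \<Sum>p\<le>l. ?t k p)"
  by (rule sum.mono_neutral_right) (use ij z in \<open>auto intro!: sum.neutral\<close>)
 also have "\<dots> = (\<Sum>p\<le>l. ?t i p)" by simp
 finally have sum: "- (E a b * co (hM f h) (W a b)) = (\<Sum>p\<le>l. ?t i p)" .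
 have j: "Suc (w - i) = j" using ij by simp
 show ?thesis using sum unfolding j .
qed

end

context ce_algebra
begin

lemma Poisson_bijection:
 assumes phiA: "phi (emb 4 \<alpha>) = (%m l. if m = 1 & l = 2 then p12 else if m = 1 & l = 3 then p13 else 0)"
 shows "bij_betw (poisson_maps g 2) (shifted_poisson CA 2)
  {p.
   p 2 0 \<in> sym_hom g 2 (2, 0) 0 &
   p 2 1 \<in> sym_hom g 2 (2, 1) (- 1) &
   p 2 2 \<in> sym_hom g 2 (2, 2) (- 2) &
   p 3 0 \<in> sym_hom g 2 (3, 0) (- 2) &
   p 3 1 \<in> sym_hom g 2 (3, 1) (- 3) &
   p 4 0 \<in> sym_hom g 2 (4, 0) (- 4) &
   (\<forall>m l. (m, l) \<notin> {(2, 0), (2, 1), (2, 2), (3, 0), (3, 1), (4, 0)} --> p m l = 0) &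
   - pdiff g 2 (2, 1) (p 2 1) = star g 2 (1, 2) p12 (2, 0) (p 2 0) &
   - pdiff g 2 (2, 2) (p 2 2) =
     star g 2 (2, 1) (p 2 1) (1, 2) p12
    - star g 2 (1, 2) p12 (2, 1) (p 2 1)
    + star g 2 (1, 3) p13 (2, 0) (p 2 0) &
   0 = star g 2 (2, 1) (p 2 1) (1, 3) p13
    + star g 2 (1, 2) p12 (2, 2) (p 2 2)
    + star g 2 (2, 2) (p 2 2) (1, 2) p12
    + star g 2 (1, 3) p13 (2, 1) (p 2 1) &
   - pdiff g 2 (3, 0) (p 3 0) = star g 2 (2, 1) (p 2 1) (2, 0) (p 2 0) &
   - pdiff g 2 (3, 1) (p 3 1) =
     star g 2 (2, 1) (p 2 1) (2, 1) (p 2 1)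
    + star g 2 (1, 2) p12 (3, 0) (p 3 0)
    + star g 2 (2, 2) (p 2 2) (2, 0) (p 2 0) &
   0 = star g 2 (3, 1) (p 3 1) (1, 2) p12
    + star g 2 (2, 1) (p 2 1) (2, 2) (p 2 2)
    - star g 2 (1, 2) p12 (3, 1) (p 3 1)
    - star g 2 (2, 2) (p 2 2) (2, 1) (p 2 1)
    + star g 2 (1, 3) p13 (3, 0) (p 3 0) &
   - pdiff g 2 (4, 0) (p 4 0) =
     star g 2 (3, 1) (p 3 1) (2, 0) (p 2 0)
    + star g 2 (2, 1) (p 2 1) (3, 0) (p 3 0) &
   0 = star g 2 (3, 1) (p 3 1) (2, 1) (p 2 1)
    + star g 2 (2, 1) (p 2 1) (3, 1) (p 3 1)
    + star g 2 (1, 2) p12 (4, 0) (p 4 0)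
    + star g 2 (2, 2) (p 2 2) (3, 0) (p 3 0) &
   0 = star g 2 (3, 1) (p 3 1) (3, 0) (p 3 0)
    + star g 2 (2, 1) (p 2 1) (4, 0) (p 4 0)}"
  (is "bij_betw _ _ ?T")
proof -
 define A where "A = emb 4 \<alpha>"
 have A: "A \<in> symset LPQ" "hom 4 A" "homg wt (int 1) A"
  unfolding A_def using emb_symset[OF ce_der] emb_wt[OF ce_der] emb_hom[of \<alpha> 4] ce_der by simp_all
 have \<Delta>: "\<Delta> = Dd + A" by (simp add: \<Delta>_def Dd_def A_def)
 define T where "T f w = hM \<Delta> (f w) + hM (f w) \<Delta> + (\<Sum>m\<le>Suc w. hM (f m) (f (Suc w - m)))" for f :: "nat => ('v, 'k) pqfun" and w
 define good where "good f \<longleftrightarrow> (\<forall>m. f m \<in> symset LPQ & hom 4 (f m) & homg wt (int m) (f m)) & (\<forall>m<2. f m = 0)"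
  for f :: "nat => ('v, 'k) pqfun"
 have main: "(\<forall>w. T f w = 0) \<longleftrightarrow>
   (- pdiff g 2 (2, 1) (PP 2 1) = star g 2 (1, 2) (PP 1 2) (2, 0) (PP 2 0)) &
   (- pdiff g 2 (2, 2) (PP 2 2) = star g 2 (2, 1) (PP 2 1) (1, 2) (PP 1 2) - star g 2 (1, 2) (PP 1 2) (2, 1) (PP 2 1) + star g 2 (1, 3) (PP 1 3) (2, 0) (PP 2 0)) &
   (0 = star g 2 (2, 1) (PP 2 1) (1, 3) (PP 1 3) + star g 2 (1, 2) (PP 1 2) (2, 2) (PP 2 2) + star g 2 (2, 2) (PP 2 2) (1, 2) (PP 1 2) + star g 2 (1, 3) (PP 1 3) (2, 1) (PP 2 1)) &
   (- pdiff g 2 (3, 0) (PP 3 0) = star g 2 (2, 1) (PP 2 1) (2, 0) (PP 2 0)) &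
   (- pdiff g 2 (3, 1) (PP 3 1) = star g 2 (2, 1) (PP 2 1) (2, 1) (PP 2 1) + star g 2 (1, 2) (PP 1 2) (3, 0) (PP 3 0) + star g 2 (2, 2) (PP 2 2) (2, 0) (PP 2 0)) &
   (0 = star g 2 (3, 1) (PP 3 1) (1, 2) (PP 1 2) + star g 2 (2, 1) (PP 2 1) (2, 2) (PP 2 2) - star g 2 (1, 2) (PP 1 2) (3, 1) (PP 3 1) - star g 2 (2, 2) (PP 2 2) (2, 1) (PP 2 1) + star g 2 (1, 3) (PP 1 3) (3, 0) (PP 3 0)) &
   (- pdiff g 2 (4, 0) (PP 4 0) = star g 2 (3, 1) (PP 3 1) (2, 0) (PP 2 0) + star g 2 (2, 1) (PP 2 1) (3, 0) (PP 3 0)) &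
   (0 = star g 2 (3, 1) (PP 3 1) (2, 1) (PP 2 1) + star g 2 (2, 1) (PP 2 1) (3, 1) (PP 3 1) + star g 2 (1, 2) (PP 1 2) (4, 0) (PP 4 0) + star g 2 (2, 2) (PP 2 2) (3, 0) (PP 3 0)) &
   (0 = star g 2 (3, 1) (PP 3 1) (3, 0) (PP 3 0) + star g 2 (2, 1) (PP 2 1) (4, 0) (PP 4 0))"
  if good: "good f" and PP_def: "PP = (%m. if m = 1 then phi A 1 else phi (f m) m)" for f PP
 proof -
  have f: "f m \<in> symset LPQ" "symf (f m)" "hom 4 (f m)" "homg wt (int m) (f m)" and f0: "m < 2 ==> f m = 0" for m
   using good symset_symf[of "f m" LPQ] by (auto simp: good_def)
  have tl_PP: "tl l m (PP m l)" for m l by (simp add: PP_def)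
  define C where "C m1 l1 m2 l2 a b = (if PP m1 l1 = 0 \<or> PP m2 l2 = 0 then 0
   else mc (star g 2 (m1, l1) (PP m1 l1) (m2, l2) (PP m2 l2)) a b)" for m1 l1 m2 l2 a b
  define D where "D m l a b = (if PP m l = 0 then 0 else mc (pdiff g 2 (m, l) (PP m l)) a b)" for m l a b
  define R where "R w l a b = ksgn (int l + 1) * D w l a b + (\<Sum>p\<le>l. ksgn (int (Suc p) * (int (l - p) + 1)) *
   (C 1 (Suc p) w (l - p) a b + C w (Suc p) 1 (l - p) a b + (\<Sum>k\<in>{2..<w}. C k (Suc p) (Suc w - k) (l - p) a b)))" for w l a b
  have PP_bad: "PP m l = 0" if "\<not> (m = 1 & (l = 2 \<or> l = 3) \<or> 2 \<le> m & m + l \<le> 4)" for m l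
  proof -
   have "m = 0 \<or> m = 1 & l ~= 2 & l ~= 3 \<or> 2 \<le> m & 4 < m + l" using that by presburger
   then consider "m = 0" | "m = 1" "l ~= 2" "l ~= 3" | "2 \<le> m" "4 < m + l" by blast
   then show ?thesis
   proof cases
    case 1
    then show ?thesis using f0[of 0] by (simp add: PP_def)
   next
    case 2
    then show ?thesis by (simp add: PP_def A_def phiA)
   next
    case 3
    then show ?thesis using phi_zero_outside[OF f(3), of m l] by (simp add: PP_def)
   qed
  qed
  (* By degree reasons, a composition is nonzero only if both maps are brackets or among the six components. *)
  have C_bad: "C m1 l1 m2 l2 a b = 0" if "\<not> (m1 = 1 & (l1 = 2 \<or> l1 = 3) \<or> 2 \<le> m1 & m1 + l1 \<le> 4) \<or>
    \<not> (m2 = 1 & (l2 = 2 \<or> l2 = 3) \<or> 2 \<le> m2 & m2 + l2 \<le> 4)" for m1 l1 m2 l2 a b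
   using that PP_bad unfolding C_def by metis
  have D_bad: "D m l a b = 0" if "4 < m + l" "2 \<le> m" for m l a b
   using PP_bad[of m l] that by (simp add: D_def)
  have C_star: "mc (star g 2 (m1, l1) (PP m1 l1) (m2, l2) (PP m2 l2)) a b = C m1 l1 m2 l2 a b"
   if "1 \<le> l1" "1 \<le> m2" "a \<in> words B (m1 + m2 - 1)" "b \<in> words B (l1 - 1 + l2)" for m1 l1 m2 l2 a b
   using star_zero[OF tl_PP tl_PP that] by (auto simp: C_def)
  have D_pdiff: "mc (pdiff g 2 (m, l) (PP m l)) a b = D m l a b" if "a \<in> words B m" "b \<in> words B l" for m l a b
   using mc_pdiff[OF tl_ops(1) that] by (simp add: D_def mc_ops)
  have T: "T f w \<in> symset LPQ" "hom 5 (T f w)" "homg wt (int w) (T f w)" for w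
  proof -
   have s: "\<Delta> \<in> symset LPQ" "hom 4 \<Delta>" "homg wt 1 \<Delta>"
    using \<Delta>_symset \<Delta>_hom A(3) emb_wt[OF Dd_der, of 4] by (simp_all add: \<Delta> Dd_def)
   show "T f w \<in> symset LPQ" unfolding T_def by (intro symset_add symset_sum hM_symset s f)
   show "hom 5 (T f w)" unfolding T_def by (intro homg_add homg_sum hM_hom s f)
   have "homg wt (int w) (hM \<Delta> (f w))" "homg wt (int w) (hM (f w) \<Delta>)"
    using hM_wt[OF s(3) f(4)[of w]] hM_wt[OF f(4)[of w] s(3)] by simp_all
   moreover have "homg wt (int w) (hM (f m) (f (Suc w - m)))" if "m \<in> {..Suc w}" for m
    using hM_wt[OF f(4)[of m] f(4)[of "Suc w - m"]] that by (simp add: of_nat_diff)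
   ultimately show "homg wt (int w) (T f w)" unfolding T_def by (intro homg_add homg_sum)
  qed
  have low: "T f w = 0" if "w < 2" for w
  proof -
   have "hM (f m) (f (Suc w - m)) = 0" if "m \<le> Suc w" for m
    using f0[of m] f0[of "Suc w - m"] \<open>w < 2\<close> by (cases "m < 2") simp_all
   then show ?thesis using f0[OF that] by (simp add: T_def)
  qed
  have coT: "- (E a b * co (T f w) (W a b)) = R w l a b" if w: "2 \<le> w" and a: "a \<in> words B w" and b: "b \<in> words B l" for w l a b
  proof -
   have PPw: "phi (f m) m = PP m" if "2 \<le> m" for m using that by (simp add: PP_def)
   have PP1: "phi A 1 = PP 1" by (simp add: PP_def)
   have AS: "symf A" using A(1) by (rule symset_symf)
   have d: "- (E a b * co (hM Dd (f w) + hM (f w) Dd) (W a b)) = ksgn (int l + 1) * D w l a b"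
    unfolding hM_differential[OF f(2,3) a b] D_pdiff[OF a b, symmetric] PPw[OF w] ..
   have 1: "- (E a b * co (hM A (f w)) (W a b)) = (\<Sum>p\<le>l. ksgn (int (Suc p) * (int (l - p) + 1)) * C 1 (Suc p) w (l - p) a b)"
    unfolding hM_star_weight[OF AS A(2,3) f(2,3) _ _ a b, of w, simplified plus_1_eq_Suc, OF refl order.trans[OF one_le_numeral w]] PPw[OF w] PP1
    by (intro sum.cong refl arg_cong2[of _ _ _ _ "(*)"] C_star) (use a b w in auto)
   have 2: "- (E a b * co (hM (f w) A) (W a b)) = (\<Sum>p\<le>l. ksgn (int (Suc p) * (int (l - p) + 1)) * C w (Suc p) 1 (l - p) a b)"
    unfolding hM_star_weight[OF f(2,3,4) AS A(2) _ order.refl a b, of w, simplified Suc_eq_plus1, OF refl] PPw[OF w] PP1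
    by (intro sum.cong refl arg_cong2[of _ _ _ _ "(*)"] C_star) (use a b w in \<open>auto intro!: C_star\<close>)
   have 3: "- (E a b * co (hM (f k) (f (Suc w - k))) (W a b)) =
     (\<Sum>p\<le>l. ksgn (int (Suc p) * (int (l - p) + 1)) * C k (Suc p) (Suc w - k) (l - p) a b)" if k: "k \<in> {2..<w}" for k
   proof -
    have k': "2 \<le> k" "2 \<le> Suc w - k" "k + (Suc w - k) = Suc w" "1 \<le> Suc w - k" "k + (Suc w - k) - 1 = w" using k by auto
    show ?thesis
     unfolding hM_star_weight[OF f(2,3,4) f(2,3) k'(3,4) a b] PPw[OF k'(1)] PPw[OF k'(2)]
     by (intro sum.cong refl arg_cong2[of _ _ _ _ "(*)"] C_star) (use a b k' in auto)
   qed
   have "(\<Sum>m\<le>Suc w. hM (f m) (f (Suc w - m))) = (\<Sum>k\<in>{2..<w}. hM (f k) (f (Suc w - k)))"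
   proof (rule sum.mono_neutral_right)
    show "\<forall>m\<in>{..Suc w} - {2..<w}. hM (f m) (f (Suc w - m)) = 0"
    proof
     fix m assume "m \<in> {..Suc w} - {2..<w}"
     then have "m < 2 \<or> Suc w - m < 2" by auto
     then show "hM (f m) (f (Suc w - m)) = 0" using f0 by auto
    qed
   qed auto
   then have "- (E a b * co (T f w) (W a b)) = - (E a b * co (hM Dd (f w) + hM (f w) Dd) (W a b)) +
     - (E a b * co (hM A (f w)) (W a b)) + - (E a b * co (hM (f w) A) (W a b)) +
     (\<Sum>k\<in>{2..<w}. - (E a b * co (hM (f k) (f (Suc w - k))) (W a b)))"
    unfolding T_def \<Delta> hM_add by (simp add: distrib_left sum_distrib_left sum_negf)
   also have "\<dots> = R w l a b"
    unfolding d 1 2 R_def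
    by (subst sum.cong[OF refl 3], assumption, subst sum.swap)
     (simp add: distrib_left sum.distrib sum_distrib_left add.assoc)
   finally show ?thesis .
  qed
  have T_iff: "(\<forall>w. T f w = 0) \<longleftrightarrow> (\<forall>w l. 2 \<le> w & 3 \<le> w + l & w + l \<le> 5 --> (\<forall>a\<in>words B w. \<forall>b\<in>words B l. R w l a b = 0))"
  proof (intro iffI allI impI ballI)
   fix w l a b assume "\<forall>w. T f w = 0" "2 \<le> w & 3 \<le> w + l & w + l \<le> 5" "a \<in> words B w" "b \<in> words B l"
   then show "R w l a b = 0" using coT[of w a b l] by simp
  next
   fix w assume R: "\<forall>w l. 2 \<le> w & 3 \<le> w + l & w + l \<le> 5 --> (\<forall>a\<in>words B w. \<forall>b\<in>words B l. R w l a b = 0)"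
   show "T f w = 0"
   proof (rule symset_eqI[OF T(1)])
    fix m l a b assume a: "a \<in> words B m" and b: "b \<in> words B l"
    show "co (T f w) (W a b) = co 0 (W a b)"
    proof (rule ccontr)
     assume "co (T f w) (W a b) ~= co 0 (W a b)"
     then have nz: "co (T f w) (W a b) ~= 0" by simp
     have m: "m = w" using co_weight[OF T(3) a b] nz by auto
     have w: "2 \<le> w" using low[of w] nz by (cases "w < 2") auto
     have wd: "wd (W a b) = 5" using T(2) nz by (simp add: homg_def)
     have rg: "- int (length c) \<le> sdg c & sdg c \<le> 0" if "set c \<subseteq> B" for c
      using that
     proof (induction c)
      case (Cons x c)
      then show ?case using dg_range[of x] by auto
     qed simp
     have r: "- int w \<le> sdg a" "sdg a \<le> 0" "- int l \<le> sdg b" "sdg b \<le> 0" using rg[of a] rg[of b] a b m by (auto simp: words_def)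
     have "sdg a + 2 * int w + int l - sdg b = 5" using wd a b m by (simp add: sum_degrees words_def)
     then have "3 \<le> w + l & w + l \<le> 5" using r by linarith
     then have "R w l a b = 0" using R w a b m by blast
     then show False using coT[OF w, of a b l] a b m nz by simp
    qed
   qed simp
  qed
  have eq21: "- pdiff g 2 (2, 1) (PP 2 1) = star g 2 (1, 2) (PP 1 2) (2, 0) (PP 2 0) \<longleftrightarrow> (\<forall>a\<in>words B 2. \<forall>b\<in>words B 1. R 2 1 a b = 0)"
  proof (rule coord_iff)
   show "tl 1 2 (- pdiff g 2 (2, 1) (PP 2 1))" by (intro tl_ops pdiff_tl tl_PP)
   show "tl 1 2 (star g 2 (1, 2) (PP 1 2) (2, 0) (PP 2 0))"
    by (intro tl_ops star_tl tl_PP) simp_all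
   fix a b assume ab: "a \<in> words B 2" "b \<in> words B 1"
   have s0: "mc (star g 2 (1, 2) (PP 1 2) (2, 0) (PP 2 0)) a b = C 1 2 2 0 a b" by (rule C_star) (use ab in \<open>simp_all add: eval_nat_numeral\<close>)
   have d: "mc (pdiff g 2 (2, 1) (PP 2 1)) a b = D 2 1 a b" by (rule D_pdiff) (use ab in simp_all)
   have l: "mc (- pdiff g 2 (2, 1) (PP 2 1)) a b = - D 2 1 a b" by (simp only: mc_ops d)
   have r: "mc (star g 2 (1, 2) (PP 1 2) (2, 0) (PP 2 0)) a b = C 1 2 2 0 a b" by (simp only: mc_ops s0)
   have R: "R 2 1 a b = D 2 1 a b + C 1 2 2 0 a b"
    by (simp add: R_def C_bad D_bad eval_nat_numeral ksgn_def atLeastLessThanSuc)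
   show "mc (- pdiff g 2 (2, 1) (PP 2 1)) a b - mc (star g 2 (1, 2) (PP 1 2) (2, 0) (PP 2 0)) a b = R 2 1 a b \<or> mc (- pdiff g 2 (2, 1) (PP 2 1)) a b - mc (star g 2 (1, 2) (PP 1 2) (2, 0) (PP 2 0)) a b = - R 2 1 a b"
    unfolding l r R by (simp add: algebra_simps)
  qed
  have eq22: "- pdiff g 2 (2, 2) (PP 2 2) = star g 2 (2, 1) (PP 2 1) (1, 2) (PP 1 2) - star g 2 (1, 2) (PP 1 2) (2, 1) (PP 2 1) + star g 2 (1, 3) (PP 1 3) (2, 0) (PP 2 0) \<longleftrightarrow> (\<forall>a\<in>words B 2. \<forall>b\<in>words B 2. R 2 2 a b = 0)"
  proof (rule coord_iff)
   show "tl 2 2 (- pdiff g 2 (2, 2) (PP 2 2))" by (intro tl_ops pdiff_tl tl_PP)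
   show "tl 2 2 (star g 2 (2, 1) (PP 2 1) (1, 2) (PP 1 2) - star g 2 (1, 2) (PP 1 2) (2, 1) (PP 2 1) + star g 2 (1, 3) (PP 1 3) (2, 0) (PP 2 0))"
    by (intro tl_ops star_tl tl_PP) simp_all
   fix a b assume ab: "a \<in> words B 2" "b \<in> words B 2"
   have s0: "mc (star g 2 (2, 1) (PP 2 1) (1, 2) (PP 1 2)) a b = C 2 1 1 2 a b" by (rule C_star) (use ab in \<open>simp_all add: eval_nat_numeral\<close>)
   have s1: "mc (star g 2 (1, 2) (PP 1 2) (2, 1) (PP 2 1)) a b = C 1 2 2 1 a b" by (rule C_star) (use ab in \<open>simp_all add: eval_nat_numeral\<close>)
   have s2: "mc (star g 2 (1, 3) (PP 1 3) (2, 0) (PP 2 0)) a b = C 1 3 2 0 a b" by (rule C_star) (use ab in \<open>simp_all add: eval_nat_numeral\<close>)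
   have d: "mc (pdiff g 2 (2, 2) (PP 2 2)) a b = D 2 2 a b" by (rule D_pdiff) (use ab in simp_all)
   have l: "mc (- pdiff g 2 (2, 2) (PP 2 2)) a b = - D 2 2 a b" by (simp only: mc_ops d)
   have r: "mc (star g 2 (2, 1) (PP 2 1) (1, 2) (PP 1 2) - star g 2 (1, 2) (PP 1 2) (2, 1) (PP 2 1) + star g 2 (1, 3) (PP 1 3) (2, 0) (PP 2 0)) a b = C 2 1 1 2 a b - C 1 2 2 1 a b + C 1 3 2 0 a b" by (simp only: mc_ops s0 s1 s2)
   have R: "R 2 2 a b = - D 2 2 a b - C 2 1 1 2 a b + C 1 2 2 1 a b - C 1 3 2 0 a b"
    by (simp add: R_def C_bad D_bad eval_nat_numeral ksgn_def atLeastLessThanSuc)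
   show "mc (- pdiff g 2 (2, 2) (PP 2 2)) a b - mc (star g 2 (2, 1) (PP 2 1) (1, 2) (PP 1 2) - star g 2 (1, 2) (PP 1 2) (2, 1) (PP 2 1) + star g 2 (1, 3) (PP 1 3) (2, 0) (PP 2 0)) a b = R 2 2 a b \<or> mc (- pdiff g 2 (2, 2) (PP 2 2)) a b - mc (star g 2 (2, 1) (PP 2 1) (1, 2) (PP 1 2) - star g 2 (1, 2) (PP 1 2) (2, 1) (PP 2 1) + star g 2 (1, 3) (PP 1 3) (2, 0) (PP 2 0)) a b = - R 2 2 a b"
    unfolding l r R by (simp add: algebra_simps)
  qed
  have eq23: "0 = star g 2 (2, 1) (PP 2 1) (1, 3) (PP 1 3) + star g 2 (1, 2) (PP 1 2) (2, 2) (PP 2 2) + star g 2 (2, 2) (PP 2 2) (1, 2) (PP 1 2) + star g 2 (1, 3) (PP 1 3) (2, 1) (PP 2 1) \<longleftrightarrow> (\<forall>a\<in>words B 2. \<forall>b\<in>words B 3. R 2 3 a b = 0)"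
  proof (rule coord_iff)
   show "tl 3 2 0" by (rule tl_ops)
   show "tl 3 2 (star g 2 (2, 1) (PP 2 1) (1, 3) (PP 1 3) + star g 2 (1, 2) (PP 1 2) (2, 2) (PP 2 2) + star g 2 (2, 2) (PP 2 2) (1, 2) (PP 1 2) + star g 2 (1, 3) (PP 1 3) (2, 1) (PP 2 1))"
    by (intro tl_ops star_tl tl_PP) simp_all
   fix a b assume ab: "a \<in> words B 2" "b \<in> words B 3"
   have s0: "mc (star g 2 (2, 1) (PP 2 1) (1, 3) (PP 1 3)) a b = C 2 1 1 3 a b" by (rule C_star) (use ab in \<open>simp_all add: eval_nat_numeral\<close>)
   have s1: "mc (star g 2 (1, 2) (PP 1 2) (2, 2) (PP 2 2)) a b = C 1 2 2 2 a b" by (rule C_star) (use ab in \<open>simp_all add: eval_nat_numeral\<close>)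
   have s2: "mc (star g 2 (2, 2) (PP 2 2) (1, 2) (PP 1 2)) a b = C 2 2 1 2 a b" by (rule C_star) (use ab in \<open>simp_all add: eval_nat_numeral\<close>)
   have s3: "mc (star g 2 (1, 3) (PP 1 3) (2, 1) (PP 2 1)) a b = C 1 3 2 1 a b" by (rule C_star) (use ab in \<open>simp_all add: eval_nat_numeral\<close>)
   have l: "mc 0 a b = 0" by (rule mc_ops)
   have r: "mc (star g 2 (2, 1) (PP 2 1) (1, 3) (PP 1 3) + star g 2 (1, 2) (PP 1 2) (2, 2) (PP 2 2) + star g 2 (2, 2) (PP 2 2) (1, 2) (PP 1 2) + star g 2 (1, 3) (PP 1 3) (2, 1) (PP 2 1)) a b = C 2 1 1 3 a b + C 1 2 2 2 a b + C 2 2 1 2 a b + C 1 3 2 1 a b" by (simp only: mc_ops s0 s1 s2 s3)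
   have R: "R 2 3 a b = C 2 1 1 3 a b + C 1 2 2 2 a b + C 2 2 1 2 a b + C 1 3 2 1 a b"
    by (simp add: R_def C_bad D_bad eval_nat_numeral ksgn_def atLeastLessThanSuc)
   show "mc (0) a b - mc (star g 2 (2, 1) (PP 2 1) (1, 3) (PP 1 3) + star g 2 (1, 2) (PP 1 2) (2, 2) (PP 2 2) + star g 2 (2, 2) (PP 2 2) (1, 2) (PP 1 2) + star g 2 (1, 3) (PP 1 3) (2, 1) (PP 2 1)) a b = R 2 3 a b \<or> mc (0) a b - mc (star g 2 (2, 1) (PP 2 1) (1, 3) (PP 1 3) + star g 2 (1, 2) (PP 1 2) (2, 2) (PP 2 2) + star g 2 (2, 2) (PP 2 2) (1, 2) (PP 1 2) + star g 2 (1, 3) (PP 1 3) (2, 1) (PP 2 1)) a b = - R 2 3 a b"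
    unfolding l r R by (simp add: algebra_simps)
  qed
  have eq30: "- pdiff g 2 (3, 0) (PP 3 0) = star g 2 (2, 1) (PP 2 1) (2, 0) (PP 2 0) \<longleftrightarrow> (\<forall>a\<in>words B 3. \<forall>b\<in>words B 0. R 3 0 a b = 0)"
  proof (rule coord_iff)
   show "tl 0 3 (- pdiff g 2 (3, 0) (PP 3 0))" by (intro tl_ops pdiff_tl tl_PP)
   show "tl 0 3 (star g 2 (2, 1) (PP 2 1) (2, 0) (PP 2 0))"
    by (intro tl_ops star_tl tl_PP) simp_all
   fix a b assume ab: "a \<in> words B 3" "b \<in> words B 0"
   have s0: "mc (star g 2 (2, 1) (PP 2 1) (2, 0) (PP 2 0)) a b = C 2 1 2 0 a b" by (rule C_star) (use ab in \<open>simp_all add: eval_nat_numeral\<close>)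
   have d: "mc (pdiff g 2 (3, 0) (PP 3 0)) a b = D 3 0 a b" by (rule D_pdiff) (use ab in simp_all)
   have l: "mc (- pdiff g 2 (3, 0) (PP 3 0)) a b = - D 3 0 a b" by (simp only: mc_ops d)
   have r: "mc (star g 2 (2, 1) (PP 2 1) (2, 0) (PP 2 0)) a b = C 2 1 2 0 a b" by (simp only: mc_ops s0)
   have R: "R 3 0 a b = - D 3 0 a b - C 2 1 2 0 a b"
    by (simp add: R_def C_bad D_bad eval_nat_numeral ksgn_def atLeastLessThanSuc)
   show "mc (- pdiff g 2 (3, 0) (PP 3 0)) a b - mc (star g 2 (2, 1) (PP 2 1) (2, 0) (PP 2 0)) a b = R 3 0 a b \<or> mc (- pdiff g 2 (3, 0) (PP 3 0)) a b - mc (star g 2 (2, 1) (PP 2 1) (2, 0) (PP 2 0)) a b = - R 3 0 a b"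
    unfolding l r R by (simp add: algebra_simps)
  qed
  have eq31: "- pdiff g 2 (3, 1) (PP 3 1) = star g 2 (2, 1) (PP 2 1) (2, 1) (PP 2 1) + star g 2 (1, 2) (PP 1 2) (3, 0) (PP 3 0) + star g 2 (2, 2) (PP 2 2) (2, 0) (PP 2 0) \<longleftrightarrow> (\<forall>a\<in>words B 3. \<forall>b\<in>words B 1. R 3 1 a b = 0)"
  proof (rule coord_iff)
   show "tl 1 3 (- pdiff g 2 (3, 1) (PP 3 1))" by (intro tl_ops pdiff_tl tl_PP)
   show "tl 1 3 (star g 2 (2, 1) (PP 2 1) (2, 1) (PP 2 1) + star g 2 (1, 2) (PP 1 2) (3, 0) (PP 3 0) + star g 2 (2, 2) (PP 2 2) (2, 0) (PP 2 0))"
    by (intro tl_ops star_tl tl_PP) simp_all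
   fix a b assume ab: "a \<in> words B 3" "b \<in> words B 1"
   have s0: "mc (star g 2 (2, 1) (PP 2 1) (2, 1) (PP 2 1)) a b = C 2 1 2 1 a b" by (rule C_star) (use ab in \<open>simp_all add: eval_nat_numeral\<close>)
   have s1: "mc (star g 2 (1, 2) (PP 1 2) (3, 0) (PP 3 0)) a b = C 1 2 3 0 a b" by (rule C_star) (use ab in \<open>simp_all add: eval_nat_numeral\<close>)
   have s2: "mc (star g 2 (2, 2) (PP 2 2) (2, 0) (PP 2 0)) a b = C 2 2 2 0 a b" by (rule C_star) (use ab in \<open>simp_all add: eval_nat_numeral\<close>)
   have d: "mc (pdiff g 2 (3, 1) (PP 3 1)) a b = D 3 1 a b" by (rule D_pdiff) (use ab in simp_all)
   have l: "mc (- pdiff g 2 (3, 1) (PP 3 1)) a b = - D 3 1 a b" by (simp only: mc_ops d)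
   have r: "mc (star g 2 (2, 1) (PP 2 1) (2, 1) (PP 2 1) + star g 2 (1, 2) (PP 1 2) (3, 0) (PP 3 0) + star g 2 (2, 2) (PP 2 2) (2, 0) (PP 2 0)) a b = C 2 1 2 1 a b + C 1 2 3 0 a b + C 2 2 2 0 a b" by (simp only: mc_ops s0 s1 s2)
   have R: "R 3 1 a b = D 3 1 a b + C 2 1 2 1 a b + C 1 2 3 0 a b + C 2 2 2 0 a b"
    by (simp add: R_def C_bad D_bad eval_nat_numeral ksgn_def atLeastLessThanSuc)
   show "mc (- pdiff g 2 (3, 1) (PP 3 1)) a b - mc (star g 2 (2, 1) (PP 2 1) (2, 1) (PP 2 1) + star g 2 (1, 2) (PP 1 2) (3, 0) (PP 3 0) + star g 2 (2, 2) (PP 2 2) (2, 0) (PP 2 0)) a b = R 3 1 a b \<or> mc (- pdiff g 2 (3, 1) (PP 3 1)) a b - mc (star g 2 (2, 1) (PP 2 1) (2, 1) (PP 2 1) + star g 2 (1, 2) (PP 1 2) (3, 0) (PP 3 0) + star g 2 (2, 2) (PP 2 2) (2, 0) (PP 2 0)) a b = - R 3 1 a b"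
    unfolding l r R by (simp add: algebra_simps)
  qed
  have eq32: "0 = star g 2 (3, 1) (PP 3 1) (1, 2) (PP 1 2) + star g 2 (2, 1) (PP 2 1) (2, 2) (PP 2 2) - star g 2 (1, 2) (PP 1 2) (3, 1) (PP 3 1) - star g 2 (2, 2) (PP 2 2) (2, 1) (PP 2 1) + star g 2 (1, 3) (PP 1 3) (3, 0) (PP 3 0) \<longleftrightarrow> (\<forall>a\<in>words B 3. \<forall>b\<in>words B 2. R 3 2 a b = 0)"
  proof (rule coord_iff)
   show "tl 2 3 0" by (rule tl_ops)
   show "tl 2 3 (star g 2 (3, 1) (PP 3 1) (1, 2) (PP 1 2) + star g 2 (2, 1) (PP 2 1) (2, 2) (PP 2 2) - star g 2 (1, 2) (PP 1 2) (3, 1) (PP 3 1) - star g 2 (2, 2) (PP 2 2) (2, 1) (PP 2 1) + star g 2 (1, 3) (PP 1 3) (3, 0) (PP 3 0))"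
    by (intro tl_ops star_tl tl_PP) simp_all
   fix a b assume ab: "a \<in> words B 3" "b \<in> words B 2"
   have s0: "mc (star g 2 (3, 1) (PP 3 1) (1, 2) (PP 1 2)) a b = C 3 1 1 2 a b" by (rule C_star) (use ab in \<open>simp_all add: eval_nat_numeral\<close>)
   have s1: "mc (star g 2 (2, 1) (PP 2 1) (2, 2) (PP 2 2)) a b = C 2 1 2 2 a b" by (rule C_star) (use ab in \<open>simp_all add: eval_nat_numeral\<close>)
   have s2: "mc (star g 2 (1, 2) (PP 1 2) (3, 1) (PP 3 1)) a b = C 1 2 3 1 a b" by (rule C_star) (use ab in \<open>simp_all add: eval_nat_numeral\<close>)
   have s3: "mc (star g 2 (2, 2) (PP 2 2) (2, 1) (PP 2 1)) a b = C 2 2 2 1 a b" by (rule C_star) (use ab in \<open>simp_all add: eval_nat_numeral\<close>)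
   have s4: "mc (star g 2 (1, 3) (PP 1 3) (3, 0) (PP 3 0)) a b = C 1 3 3 0 a b" by (rule C_star) (use ab in \<open>simp_all add: eval_nat_numeral\<close>)
   have l: "mc 0 a b = 0" by (rule mc_ops)
   have r: "mc (star g 2 (3, 1) (PP 3 1) (1, 2) (PP 1 2) + star g 2 (2, 1) (PP 2 1) (2, 2) (PP 2 2) - star g 2 (1, 2) (PP 1 2) (3, 1) (PP 3 1) - star g 2 (2, 2) (PP 2 2) (2, 1) (PP 2 1) + star g 2 (1, 3) (PP 1 3) (3, 0) (PP 3 0)) a b = C 3 1 1 2 a b + C 2 1 2 2 a b - C 1 2 3 1 a b - C 2 2 2 1 a b + C 1 3 3 0 a b" by (simp only: mc_ops s0 s1 s2 s3 s4)
   have R: "R 3 2 a b = - C 3 1 1 2 a b - C 2 1 2 2 a b + C 1 2 3 1 a b + C 2 2 2 1 a b - C 1 3 3 0 a b"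
    by (simp add: R_def C_bad D_bad eval_nat_numeral ksgn_def atLeastLessThanSuc)
   show "mc (0) a b - mc (star g 2 (3, 1) (PP 3 1) (1, 2) (PP 1 2) + star g 2 (2, 1) (PP 2 1) (2, 2) (PP 2 2) - star g 2 (1, 2) (PP 1 2) (3, 1) (PP 3 1) - star g 2 (2, 2) (PP 2 2) (2, 1) (PP 2 1) + star g 2 (1, 3) (PP 1 3) (3, 0) (PP 3 0)) a b = R 3 2 a b \<or> mc (0) a b - mc (star g 2 (3, 1) (PP 3 1) (1, 2) (PP 1 2) + star g 2 (2, 1) (PP 2 1) (2, 2) (PP 2 2) - star g 2 (1, 2) (PP 1 2) (3, 1) (PP 3 1) - star g 2 (2, 2) (PP 2 2) (2, 1) (PP 2 1) + star g 2 (1, 3) (PP 1 3) (3, 0) (PP 3 0)) a b = - R 3 2 a b"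
    unfolding l r R by (simp add: algebra_simps)
  qed
  have eq40: "- pdiff g 2 (4, 0) (PP 4 0) = star g 2 (3, 1) (PP 3 1) (2, 0) (PP 2 0) + star g 2 (2, 1) (PP 2 1) (3, 0) (PP 3 0) \<longleftrightarrow> (\<forall>a\<in>words B 4. \<forall>b\<in>words B 0. R 4 0 a b = 0)"
  proof (rule coord_iff)
   show "tl 0 4 (- pdiff g 2 (4, 0) (PP 4 0))" by (intro tl_ops pdiff_tl tl_PP)
   show "tl 0 4 (star g 2 (3, 1) (PP 3 1) (2, 0) (PP 2 0) + star g 2 (2, 1) (PP 2 1) (3, 0) (PP 3 0))"
    by (intro tl_ops star_tl tl_PP) simp_all
   fix a b assume ab: "a \<in> words B 4" "b \<in> words B 0"
   have s0: "mc (star g 2 (3, 1) (PP 3 1) (2, 0) (PP 2 0)) a b = C 3 1 2 0 a b" by (rule C_star) (use ab in \<open>simp_all add: eval_nat_numeral\<close>)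
   have s1: "mc (star g 2 (2, 1) (PP 2 1) (3, 0) (PP 3 0)) a b = C 2 1 3 0 a b" by (rule C_star) (use ab in \<open>simp_all add: eval_nat_numeral\<close>)
   have d: "mc (pdiff g 2 (4, 0) (PP 4 0)) a b = D 4 0 a b" by (rule D_pdiff) (use ab in simp_all)
   have l: "mc (- pdiff g 2 (4, 0) (PP 4 0)) a b = - D 4 0 a b" by (simp only: mc_ops d)
   have r: "mc (star g 2 (3, 1) (PP 3 1) (2, 0) (PP 2 0) + star g 2 (2, 1) (PP 2 1) (3, 0) (PP 3 0)) a b = C 3 1 2 0 a b + C 2 1 3 0 a b" by (simp only: mc_ops s0 s1)
   have R: "R 4 0 a b = - D 4 0 a b - C 3 1 2 0 a b - C 2 1 3 0 a b"
    by (simp add: R_def C_bad D_bad eval_nat_numeral ksgn_def atLeastLessThanSuc)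
   show "mc (- pdiff g 2 (4, 0) (PP 4 0)) a b - mc (star g 2 (3, 1) (PP 3 1) (2, 0) (PP 2 0) + star g 2 (2, 1) (PP 2 1) (3, 0) (PP 3 0)) a b = R 4 0 a b \<or> mc (- pdiff g 2 (4, 0) (PP 4 0)) a b - mc (star g 2 (3, 1) (PP 3 1) (2, 0) (PP 2 0) + star g 2 (2, 1) (PP 2 1) (3, 0) (PP 3 0)) a b = - R 4 0 a b"
    unfolding l r R by (simp add: algebra_simps)
  qed
  have eq41: "0 = star g 2 (3, 1) (PP 3 1) (2, 1) (PP 2 1) + star g 2 (2, 1) (PP 2 1) (3, 1) (PP 3 1) + star g 2 (1, 2) (PP 1 2) (4, 0) (PP 4 0) + star g 2 (2, 2) (PP 2 2) (3, 0) (PP 3 0) \<longleftrightarrow> (\<forall>a\<in>words B 4. \<forall>b\<in>words B 1. R 4 1 a b = 0)"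
  proof (rule coord_iff)
   show "tl 1 4 0" by (rule tl_ops)
   show "tl 1 4 (star g 2 (3, 1) (PP 3 1) (2, 1) (PP 2 1) + star g 2 (2, 1) (PP 2 1) (3, 1) (PP 3 1) + star g 2 (1, 2) (PP 1 2) (4, 0) (PP 4 0) + star g 2 (2, 2) (PP 2 2) (3, 0) (PP 3 0))"
    by (intro tl_ops star_tl tl_PP) simp_all
   fix a b assume ab: "a \<in> words B 4" "b \<in> words B 1"
   have s0: "mc (star g 2 (3, 1) (PP 3 1) (2, 1) (PP 2 1)) a b = C 3 1 2 1 a b" by (rule C_star) (use ab in \<open>simp_all add: eval_nat_numeral\<close>)
   have s1: "mc (star g 2 (2, 1) (PP 2 1) (3, 1) (PP 3 1)) a b = C 2 1 3 1 a b" by (rule C_star) (use ab in \<open>simp_all add: eval_nat_numeral\<close>)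
   have s2: "mc (star g 2 (1, 2) (PP 1 2) (4, 0) (PP 4 0)) a b = C 1 2 4 0 a b" by (rule C_star) (use ab in \<open>simp_all add: eval_nat_numeral\<close>)
   have s3: "mc (star g 2 (2, 2) (PP 2 2) (3, 0) (PP 3 0)) a b = C 2 2 3 0 a b" by (rule C_star) (use ab in \<open>simp_all add: eval_nat_numeral\<close>)
   have l: "mc 0 a b = 0" by (rule mc_ops)
   have r: "mc (star g 2 (3, 1) (PP 3 1) (2, 1) (PP 2 1) + star g 2 (2, 1) (PP 2 1) (3, 1) (PP 3 1) + star g 2 (1, 2) (PP 1 2) (4, 0) (PP 4 0) + star g 2 (2, 2) (PP 2 2) (3, 0) (PP 3 0)) a b = C 3 1 2 1 a b + C 2 1 3 1 a b + C 1 2 4 0 a b + C 2 2 3 0 a b" by (simp only: mc_ops s0 s1 s2 s3)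
   have R: "R 4 1 a b = C 3 1 2 1 a b + C 2 1 3 1 a b + C 1 2 4 0 a b + C 2 2 3 0 a b"
    by (simp add: R_def C_bad D_bad eval_nat_numeral ksgn_def atLeastLessThanSuc)
   show "mc (0) a b - mc (star g 2 (3, 1) (PP 3 1) (2, 1) (PP 2 1) + star g 2 (2, 1) (PP 2 1) (3, 1) (PP 3 1) + star g 2 (1, 2) (PP 1 2) (4, 0) (PP 4 0) + star g 2 (2, 2) (PP 2 2) (3, 0) (PP 3 0)) a b = R 4 1 a b \<or> mc (0) a b - mc (star g 2 (3, 1) (PP 3 1) (2, 1) (PP 2 1) + star g 2 (2, 1) (PP 2 1) (3, 1) (PP 3 1) + star g 2 (1, 2) (PP 1 2) (4, 0) (PP 4 0) + star g 2 (2, 2) (PP 2 2) (3, 0) (PP 3 0)) a b = - R 4 1 a b"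
    unfolding l r R by (simp add: algebra_simps)
  qed
  have eq50: "0 = star g 2 (3, 1) (PP 3 1) (3, 0) (PP 3 0) + star g 2 (2, 1) (PP 2 1) (4, 0) (PP 4 0) \<longleftrightarrow> (\<forall>a\<in>words B 5. \<forall>b\<in>words B 0. R 5 0 a b = 0)"
  proof (rule coord_iff)
   show "tl 0 5 0" by (rule tl_ops)
   show "tl 0 5 (star g 2 (3, 1) (PP 3 1) (3, 0) (PP 3 0) + star g 2 (2, 1) (PP 2 1) (4, 0) (PP 4 0))"
    by (intro tl_ops star_tl tl_PP) simp_all
   fix a b assume ab: "a \<in> words B 5" "b \<in> words B 0"
   have s0: "mc (star g 2 (3, 1) (PP 3 1) (3, 0) (PP 3 0)) a b = C 3 1 3 0 a b" by (rule C_star) (use ab in \<open>simp_all add: eval_nat_numeral\<close>)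
   have s1: "mc (star g 2 (2, 1) (PP 2 1) (4, 0) (PP 4 0)) a b = C 2 1 4 0 a b" by (rule C_star) (use ab in \<open>simp_all add: eval_nat_numeral\<close>)
   have l: "mc 0 a b = 0" by (rule mc_ops)
   have r: "mc (star g 2 (3, 1) (PP 3 1) (3, 0) (PP 3 0) + star g 2 (2, 1) (PP 2 1) (4, 0) (PP 4 0)) a b = C 3 1 3 0 a b + C 2 1 4 0 a b" by (simp only: mc_ops s0 s1)
   have R: "R 5 0 a b = - C 3 1 3 0 a b - C 2 1 4 0 a b"
    by (simp add: R_def C_bad D_bad eval_nat_numeral ksgn_def atLeastLessThanSuc)
   show "mc (0) a b - mc (star g 2 (3, 1) (PP 3 1) (3, 0) (PP 3 0) + star g 2 (2, 1) (PP 2 1) (4, 0) (PP 4 0)) a b = R 5 0 a b \<or> mc (0) a b - mc (star g 2 (3, 1) (PP 3 1) (3, 0) (PP 3 0) + star g 2 (2, 1) (PP 2 1) (4, 0) (PP 4 0)) a b = - R 5 0 a b"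
    unfolding l r R by (simp add: algebra_simps)
  qed
  (* Weight at least 2 and word length between 3 and 5, which is forced by degree 5, leave nine bidegrees. *)
  have nine: "(\<forall>w l. 2 \<le> w & 3 \<le> w + l & w + l \<le> 5 --> Q w l) \<longleftrightarrow>
    Q 2 1 & Q 2 2 & Q 2 3 & Q 3 0 & Q 3 1 & Q 3 2 & Q 4 0 & Q 4 1 & Q 5 0" for Q :: "nat => nat => bool"
  proof (intro iffI allI impI)
   assume "\<forall>w l. 2 \<le> w & 3 \<le> w + l & w + l \<le> 5 --> Q w l"
   then show "Q 2 1 & Q 2 2 & Q 2 3 & Q 3 0 & Q 3 1 & Q 3 2 & Q 4 0 & Q 4 1 & Q 5 0" by simp
  next
   fix w l :: nat assume Q: "Q 2 1 & Q 2 2 & Q 2 3 & Q 3 0 & Q 3 1 & Q 3 2 & Q 4 0 & Q 4 1 & Q 5 0"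
    and wl: "2 \<le> w & 3 \<le> w + l & w + l \<le> 5"
   have "w = 2 & (l = 1 \<or> l = 2 \<or> l = 3) \<or> w = 3 & (l = 0 \<or> l = 1 \<or> l = 2) \<or> w = 4 & (l = 0 \<or> l = 1) \<or> w = 5 & l = 0"
    using wl by presburger
   then show "Q w l" using Q by blast
  qed
  show ?thesis
   unfolding T_iff nine eq21 eq22 eq23 eq30 eq31 eq32 eq40 eq41 eq50 ..
 qed
 have P12: "phi A 1 2 = p12" "phi A 1 3 = p13" by (simp_all add: A_def phiA)
 have PPf: "good f ==> (\<forall>w. T f w = 0) \<longleftrightarrow> (- pdiff g 2 (2, 1) (phi (f 2) 2 1) = star g 2 (1, 2) p12 (2, 0) (phi (f 2) 2 0)) & (- pdiff g 2 (2, 2) (phi (f 2) 2 2) = star g 2 (2, 1) (phi (f 2) 2 1) (1, 2) p12 - star g 2 (1, 2) p12 (2, 1) (phi (f 2) 2 1) + star g 2 (1, 3) p13 (2, 0) (phi (f 2) 2 0)) & (0 = star g 2 (2, 1) (phi (f 2) 2 1) (1, 3) p13 + star g 2 (1, 2) p12 (2, 2) (phi (f 2) 2 2) + star g 2 (2, 2) (phi (f 2) 2 2) (1, 2) p12 + star g 2 (1, 3) p13 (2, 1) (phi (f 2) 2 1)) & (- pdiff g 2 (3, 0) (phi (f 3) 3 0) = star g 2 (2, 1) (phi (f 2) 2 1) (2, 0) (phi (f 2) 2 0)) & (- pdiff g 2 (3, 1) (phi (f 3) 3 1) = star g 2 (2, 1) (phi (f 2) 2 1) (2, 1) (phi (f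 2) 2 1) + star g 2 (1, 2) p12 (3, 0) (phi (f 3) 3 0) + star g 2 (2, 2) (phi (f 2) 2 2) (2, 0) (phi (f 2) 2 0)) & (0 = star g 2 (3, 1) (phi (f 3) 3 1) (1, 2) p12 + star g 2 (2, 1) (phi (f 2) 2 1) (2, 2) (phi (f 2) 2 2) - star g 2 (1, 2) p12 (3, 1) (phi (f 3) 3 1) - star g 2 (2, 2) (phi (f 2) 2 2) (2, 1) (phi (f 2) 2 1) + star g 2 (1, 3) p13 (3, 0) (phi (f 3) 3 0)) & (- pdiff g 2 (4, 0) (phi (f 4) 4 0) = star g 2 (3, 1) (phi (f 3) 3 1) (2, 0) (phi (f 2) 2 0) + star g 2 (2, 1) (phi (f 2) 2 1) (3, 0) (phi (f 3) 3 0)) & (0 = star g 2 (3, 1) (phi (f 3) 3 1) (2, 1) (phi (f 2) 2 1) + star g 2 (2, 1) (phi (f 2) 2 1) (3, 1) (phi (f 3) 3 1) + star g 2 (1, 2) p12 (4, 0) (phi (f 4) 4 0) + star g 2 (2, 2) (phi (f 2) 2 2) (3, 0) (phi (f 3) 3 0)) & (0 = star g 2 (3, 1) (phi (f 3) 3 1) (3, 0) (phi (f 3) 3 0) + star g 2 (2, 1) (phi (f 2) 2 1) (4, 0) (phi (f 4) 4 0))" for f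
  using main[of f, OF _ refl] by (simp only: P12 if_True if_False one_eq_numeral_iff num.simps numeral_eq_iff numeral_eq_one_iff simp_thms)
 have model: "\<pi> \<in> shifted_poisson CA 2 \<longleftrightarrow> (\<forall>m. \<pi> m \<in> carrier DP) & good (%m. Ps (\<pi> m)) & (\<forall>w. T (%m. Ps (\<pi> m)) w = 0)" for \<pi>
 proof -
  have z: "\<pi> m = \<zero>\<^bsub>DP\<^esub> \<longleftrightarrow> Ps (\<pi> m) = 0" if "\<pi> m \<in> carrier DP" for m
  proof
   assume "\<pi> m = \<zero>\<^bsub>DP\<^esub>"
   then show "Ps (\<pi> m) = 0" by (simp only: Ps_ops(4))
  next
   assume "Ps (\<pi> m) = 0"
   then have eq: "Ps (\<pi> m) = Ps \<zero>\<^bsub>DP\<^esub>" by (simp only: Ps_ops(4))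
   have "\<zero>\<^bsub>DP\<^esub> \<in> carrier DP" by simp
   from Ps_inj[OF that this eq] show "\<pi> m = \<zero>\<^bsub>DP\<^esub>" .
  qed
  have logic: "((\<forall>m. C m & H m & V m) & Z & Q) = ((\<forall>m. C m) & ((\<forall>m. S m & H m & V m) & Z) & Q)"
   if c: "\<forall>m. C m" and s: "\<forall>m. S m" for C S H V :: "nat => bool" and Z Q :: bool
   using c s by (simp only: simp_thms conj_assoc)
  have logic': "((\<forall>m. C m & H m) & Q) = ((\<forall>m. C m) & Q')" if n: "\<not> (\<forall>m. C m)" for C H :: "nat => bool" and Q Q' :: bool
   using n by (simp only: all_conj_distrib simp_thms)
  show ?thesis
  proof (cases "\<forall>m. \<pi> m \<in> carrier DP")
   case True
   have z': "(\<pi> m = \<zero>\<^bsub>DP\<^esub>) = (Ps (\<pi> m) = 0)" for m by (rule z) (rule True[rule_format])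
   have s: "\<forall>m. Ps (\<pi> m) \<in> symset LPQ" using True by simp
   show ?thesis unfolding shifted_poisson_model good_def T_def z' by (rule logic[OF True s])
  next
   case False
   show ?thesis unfolding shifted_poisson_model by (rule logic'[OF False])
  qed
 qed
 have maps: "poisson_maps g 2 \<pi> = (%m l. phi (Ps (\<pi> m)) m l)" if "\<pi> \<in> shifted_poisson CA 2" for \<pi>
  using that unfolding model by (simp add: poisson_maps_def fun_eq_iff Phi_eq)
 have outside: "phi (f m) m l = 0" if "good f" "(m, l) \<notin> {(2, 0), (2, 1), (2, 2), (3, 0), (3, 1), (4, 0)}" for f m l
 proof (cases "m < 2")
  case True
  then show ?thesis using that(1) by (simp add: good_def)
 next
  case False
  have "4 < m + l"
  proof (rule ccontr)
   assume "\<not> 4 < m + l"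
   then have "m = 2 & (l = 0 \<or> l = 1 \<or> l = 2) \<or> m = 3 & (l = 0 \<or> l = 1) \<or> m = 4 & l = 0" using False by presburger
   then show False using that(2) by auto
  qed
  then show ?thesis using that(1) phi_zero_outside[of "f m" m l] by (simp add: good_def)
 qed
 have sym: "phi (f m) m l \<in> sym_hom g 2 (m, l) (pdeg 2 (m, l))" if "good f" for f m l
  by (rule phi_sym_hom) (use that symset_symf[of "f m" LPQ] in \<open>simp_all add: good_def\<close>)
 have pd: "pdeg 2 (2, 0) = 0" "pdeg 2 (2, 1) = - 1" "pdeg 2 (2, 2) = - 2" "pdeg 2 (3, 0) = - 2" "pdeg 2 (3, 1) = - 3" "pdeg 2 (4, 0) = - 4"
  by (simp_all add: pdeg_def)
 show ?thesis
 proof (rule bij_betw_imageI)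
  show "inj_on (poisson_maps g 2) (shifted_poisson CA 2)"
  proof (rule inj_onI)
   fix \<pi> \<pi>' assume p: "\<pi> \<in> shifted_poisson CA 2" "\<pi>' \<in> shifted_poisson CA 2" and eq: "poisson_maps g 2 \<pi> = poisson_maps g 2 \<pi>'"
   show "\<pi> = \<pi>'"
   proof
    fix m
    have g: "good (%m. Ps (\<pi> m))" "good (%m. Ps (\<pi>' m))" "\<pi> m \<in> carrier DP" "\<pi>' m \<in> carrier DP" using p unfolding model by blast+
    have "Ps (\<pi> m) = Ps (\<pi>' m)"
    proof (rule phi_inject)
     fix k l
     show "phi (Ps (\<pi> m)) k l = phi (Ps (\<pi>' m)) k l"
     proof (cases "k = m")
      case True
      then show ?thesis using eq unfolding maps[OF p(1)] maps[OF p(2)] by (simp add: fun_eq_iff)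
     next
      case False
      then show ?thesis using g(1,2) phi_weight[of "int m" "Ps (\<pi> m)" k l] phi_weight[of "int m" "Ps (\<pi>' m)" k l] by (simp add: good_def)
     qed
    qed (use g in simp_all)
    then show "\<pi> m = \<pi>' m" using g Ps_inj by blast
   qed
  qed
 next
  show "poisson_maps g 2 ` shifted_poisson CA 2 = ?T"
  proof (intro equalityI subsetI)
   fix p assume "p \<in> poisson_maps g 2 ` shifted_poisson CA 2"
   then obtain \<pi> where \<pi>: "\<pi> \<in> shifted_poisson CA 2" and p: "p = (%m l. phi (Ps (\<pi> m)) m l)" using maps by auto
   have g: "good (%m. Ps (\<pi> m))" and T: "\<forall>w. T (%m. Ps (\<pi> m)) w = 0" using \<pi> unfolding model by blast+
   show "p \<in> ?T"
    unfolding mem_Collect_eq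
    using sym[OF g, of 2 0] sym[OF g, of 2 1] sym[OF g, of 2 2] sym[OF g, of 3 0] sym[OF g, of 3 1] sym[OF g, of 4 0]
     PPf[OF g, THEN iffD1, OF T] unfolding pd p
    by (elim conjE) (intro conjI; (assumption | (intro allI impI; erule outside[OF g])))
  next
   fix p assume "p \<in> ?T"
   note p = this[unfolded mem_Collect_eq]
   have z0: "\<forall>m l. (m, l) \<notin> {(2, 0), (2, 1), (2, 2), (3, 0), (3, 1), (4, 0)} --> p m l = 0" using p by (elim conjE)
   have zero: "p m l = 0" if "(m, l) \<notin> {(2, 0), (2, 1), (2, 2), (3, 0), (3, 1), (4, 0)}" for m l using z0 that by blast
   have p20: "p 2 0 \<in> sym_hom g 2 (2, 0) (pdeg 2 (2, 0))" unfolding pd using p by (elim conjE)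
   have p21: "p 2 1 \<in> sym_hom g 2 (2, 1) (pdeg 2 (2, 1))" unfolding pd using p by (elim conjE)
   have p22: "p 2 2 \<in> sym_hom g 2 (2, 2) (pdeg 2 (2, 2))" unfolding pd using p by (elim conjE)
   have p30: "p 3 0 \<in> sym_hom g 2 (3, 0) (pdeg 2 (3, 0))" unfolding pd using p by (elim conjE)
   have p31: "p 3 1 \<in> sym_hom g 2 (3, 1) (pdeg 2 (3, 1))" unfolding pd using p by (elim conjE)
   have p40: "p 4 0 \<in> sym_hom g 2 (4, 0) (pdeg 2 (4, 0))" unfolding pd using p by (elim conjE)
   note ps = p20 p21 p22 p30 p31 p40
   have psym: "p m l \<in> sym_hom g 2 (m, l) (pdeg 2 (m, l))" for m l
   proof (cases "(m, l) \<in> {(2, 0), (2, 1), (2, 2), (3, 0), (3, 1), (4, 0)}")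
    case True
    then consider "(m, l) = (2, 0)" | "(m, l) = (2, 1)" | "(m, l) = (2, 2)" | "(m, l) = (3, 0)" | "(m, l) = (3, 1)" | "(m, l) = (4, 0)" by blast
    then show ?thesis by cases (auto simp only: prod.inject ps)
   next
    case False
    then show ?thesis using zero sym_hom_zero by simp
   qed
   define q where "q k = (%m l. if m = k then p m l else 0)" for k
   have q: "q k m l \<in> sym_hom g 2 (m, l) (pdeg 2 (m, l))" for k m l using psym sym_hom_zero by (simp add: q_def)
   define f where "f k = mkf 4 (q k)" for k
   have f: "f k \<in> symset LPQ" "hom 4 (f k)" "homg wt (int k) (f k)" for k
    unfolding f_def by (rule mkf_symset[OF q], rule mkf_degrees(1)[OF q], rule mkf_degrees(2)[OF q], simp add: q_def)
   have phif: "phi (f k) m l = q k m l" for k m l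
   proof (cases "m + l \<le> 4")
    case True
    then show ?thesis unfolding f_def by (rule phi_mkf[OF q])
   next
    case False
    then have "p m l = 0" by (intro zero) auto
    then show ?thesis using False phi_zero_outside[OF f(2), of m l k] by (auto simp: q_def)
   qed
   have "f k = 0" if "k < 2" for k
   proof (rule phi_inject[OF f(1)])
    fix m l
    have "p k l = 0" using that by (intro zero) auto
    then show "phi (f k) m l = phi 0 m l" by (simp add: phif q_def)
   qed simp
   then have g: "good f" using f by (simp add: good_def)
   have fp: "phi (f m) m l = p m l" for m l by (simp add: phif q_def)
   have T0: "\<forall>w. T f w = 0" unfolding PPf[OF g] fp using p by (elim conjE) (intro conjI; assumption)
   have "(%m. Ps (iP (f m))) = f" using f by (simp add: Ps_iP)
   then have "(%m. iP (f m)) \<in> shifted_poisson CA 2" unfolding model using g T0 f by (simp add: iP_carrier)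
   moreover have "poisson_maps g 2 (%m. iP (f m)) = p" using maps[OF calculation] f fp by (simp add: Ps_iP fun_eq_iff)
   ultimately show "p \<in> poisson_maps g 2 ` shifted_poisson CA 2" by (metis imageI)
  qed
 qed
qed

end

theorem proposition4p10:
  fixes g :: "('k::field_char_0, 'v::ab_group_add) gvs"
    and p12 p13 :: "('k, 'v) tmap"
  assumes "lie_2_algebra g p12 p13"
  shows "bij_betw (poisson_maps g 2) (shifted_poisson (CE g p12 p13 2) 2)
    {p.
      p 2 0 \<in> sym_hom g 2 (2, 0) 0 \<and>
      p 2 1 \<in> sym_hom g 2 (2, 1) (- 1) \<and>
      p 2 2 \<in> sym_hom g 2 (2, 2) (- 2) \<and>
      p 3 0 \<in> sym_hom g 2 (3, 0) (- 2) \<and>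
      p 3 1 \<in> sym_hom g 2 (3, 1) (- 3) \<and>
      p 4 0 \<in> sym_hom g 2 (4, 0) (- 4) \<and>
      (\<forall>m l. (m, l) \<notin> {(2, 0), (2, 1), (2, 2), (3, 0), (3, 1), (4, 0)} \<longrightarrow> p m l = 0) \<and>
      - pdiff g 2 (2, 1) (p 2 1) = star g 2 (1, 2) p12 (2, 0) (p 2 0) \<and>
      - pdiff g 2 (2, 2) (p 2 2) =
          star g 2 (2, 1) (p 2 1) (1, 2) p12
        - star g 2 (1, 2) p12 (2, 1) (p 2 1)
        + star g 2 (1, 3) p13 (2, 0) (p 2 0) \<and>
      0 = star g 2 (2, 1) (p 2 1) (1, 3) p13
        + star g 2 (1, 2) p12 (2, 2) (p 2 2)
        + star g 2 (2, 2) (p 2 2) (1, 2) p12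
        + star g 2 (1, 3) p13 (2, 1) (p 2 1) \<and>
      - pdiff g 2 (3, 0) (p 3 0) = star g 2 (2, 1) (p 2 1) (2, 0) (p 2 0) \<and>
      - pdiff g 2 (3, 1) (p 3 1) =
          star g 2 (2, 1) (p 2 1) (2, 1) (p 2 1)
        + star g 2 (1, 2) p12 (3, 0) (p 3 0)
        + star g 2 (2, 2) (p 2 2) (2, 0) (p 2 0) \<and>
      0 = star g 2 (3, 1) (p 3 1) (1, 2) p12
        + star g 2 (2, 1) (p 2 1) (2, 2) (p 2 2)
        - star g 2 (1, 2) p12 (3, 1) (p 3 1)
        - star g 2 (2, 2) (p 2 2) (2, 1) (p 2 1)
        + star g 2 (1, 3) p13 (3, 0) (p 3 0) \<and>
      - pdiff g 2 (4, 0) (p 4 0) =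
          star g 2 (3, 1) (p 3 1) (2, 0) (p 2 0)
        + star g 2 (2, 1) (p 2 1) (3, 0) (p 3 0) \<and>
      0 = star g 2 (3, 1) (p 3 1) (2, 1) (p 2 1)
        + star g 2 (2, 1) (p 2 1) (3, 1) (p 3 1)
        + star g 2 (1, 2) p12 (4, 0) (p 4 0)
        + star g 2 (2, 2) (p 2 2) (3, 0) (p 3 0) \<and>
      0 = star g 2 (3, 1) (p 3 1) (3, 0) (p 3 0)
        + star g 2 (2, 1) (p 2 1) (4, 0) (p 4 0)}"
proof -
 have two: "two_term_complex g" and p: "p12 \<in> sym_hom g 0 (1, 2) 0" "p13 \<in> sym_hom g 0 (1, 3) (- 1)"
  using assms by (simp_all add: lie_2_algebra_def)
 have shift: "sym_hom g 0 = sym_hom g 2" by (simp add: sym_hom_def permsgn_shift_def)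
 obtain B dg crd where B: "two_term_basis g B dg crd" using two_term_basis_exists[OF two] by blast
 interpret two_term_basis g B dg crd by (rule B)
 note spec = ce_derivation_spec[OF p[unfolded shift]]
 interpret ce_algebra g B dg crd p12 p13 by unfold_locales (rule spec(1))
 show ?thesis by (rule Poisson_bijection[OF spec(2)])
qed

end
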